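(* Let $G$ be a complex classical group, i.e. one of $GL_n(\mathbb C)$, $SL_n(\mathbb C)$, $O_n(\mathbb C)$, $SO_n(\mathbb C)$, $Sp_n(\mathbb C)$. Then every nilpotent $G$-orbit $\mathcal O$ is uniquely determined by $\overline{\mathcal O}\cap\Psi$; that is, if $\mathcal O,\mathcal O'$ are nilpotent coadjoint $G$-orbits with $\overline{\mathcal O}\cap\Psi=\overline{\mathcal O'}\cap\Psi$, then $\mathcal O=\mathcal O'$.
   Context: Let $\mathfrak q$ be the complex Lie algebra of $G$, with Borel subalgebra $\mathfrak b=\mathfrak h+\mathfrak n$ (Cartan subalgebra $\mathfrak h$, nilradical $\mathfrak n$) and opposite Borel subalgebra $\overline{\mathfrak b}\supset\mathfrak h$. $\Psi=(\mathfrak n/[\mathfrak n,\mathfrak n])^*$ is the space of characters of $\mathfrak n$, regarded as a subspace of $\mathfrak q^*$ consisting of functionals vanishing on $\overline{\mathfrak b}$ and on $[\mathfrak n,\mathfrak n]$. Under the identification $\mathfrak q\cong\mathfrak q^*$ by a non-degenerate invariant form, $\Psi$ corresponds to the direct sum of the root spaces of the negatives of the simple roots. A nilpotent orbit is a $G$-orbit of nilpotent elements of $\mathfrak q^*\cong\mathfrak q$; $\overline{\mathcal O}$ is the closure of $\mathcal O$. *)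

theory Defs
  imports "HOL-Analysis.Analysis"
begin

section \<open>Complex scalar multiplication of matrices\<close>

text \<open>
  The library provides only real scalar multiplication on \<open>complex^'n^'n\<close> (and \<open>(*s)\<close> with
  scalars in \<open>complex^'n\<close>), so the complex vector space structure is introduced here.
\<close>

definition cscale :: "complex \<Rightarrow> complex^'n^'n \<Rightarrow> complex^'n^'n"
  where "cscale c = map_matrix ((*) c)"

interpretation cmat: vector_space "cscale :: complex \<Rightarrow> complex^'n^'n \<Rightarrow> complex^'n^'n"
  by unfold_locales (simp_all add: cscale_def vec_eq_iff algebra_simps)

section \<open>Complex classical groups and their Lie algebras\<close>

definition GL :: "(complex^'n^'n) set"
  where "GL = {A. invertible A}"

definition SL :: "(complex^'n^'n) set"
  where "SL = {A. det A = 1}"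

definition OC :: "(complex^'n^'n) set"
  where "OC = {A. orthogonal_matrix A}"

definition SOC :: "(complex^'n^'n) set"
  where "SOC = {A. orthogonal_matrix A \<and> det A = 1}"

text \<open>
  A finite index type carries no preferred symplectic form, so the symplectic group is taken
  with respect to the Gram matrix \<open>J\<close> of an arbitrary one. Such a \<open>J\<close> exists only if
  \<open>CARD('n)\<close> is even.
\<close>

definition symplectic_form :: "complex^'n^'n \<Rightarrow> bool"
  where "symplectic_form J \<longleftrightarrow> transpose J = - J \<and> invertible J"

definition Sp :: "complex^'n^'n \<Rightarrow> (complex^'n^'n) set"
  where "Sp J = {A. transpose A ** J ** A = J}"

definition classical_group :: "(complex^'n^'n) set \<Rightarrow> bool"
  where "classical_group G \<longleftrightarrow>
    G = GL \<or> G = SL \<or> G = OC \<or> G = SOC \<or> (\<exists>J. symplectic_form J \<and> G = Sp J)"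

text \<open>
  The tangent space at the identity. Differentiability of the curve at \<open>0\<close> suffices,
  because a matrix Lie group is an embedded submanifold.
\<close>

definition lie_algebra :: "(complex^'n^'n) set \<Rightarrow> (complex^'n^'n) set"
  where "lie_algebra G = {X. \<exists>\<gamma> :: real \<Rightarrow> complex^'n^'n.
    (\<forall>t. \<gamma> t \<in> G) \<and> \<gamma> 0 = mat 1 \<and> (\<gamma> has_vector_derivative X) (at 0)}"

section \<open>Subalgebras of matrix Lie algebras\<close>

definition bracket :: "complex^'n^'n \<Rightarrow> complex^'n^'n \<Rightarrow> complex^'n^'n"
  where "bracket X Y = X ** Y - Y ** X"

definition bracket_span :: "(complex^'n^'n) set \<Rightarrow> (complex^'n^'n) set \<Rightarrow> (complex^'n^'n) set"
  where "bracket_span S T = cmat.span {bracket X Y | X Y. X \<in> S \<and> Y \<in> T}"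

definition lie_subalgebra :: "(complex^'n^'n) set \<Rightarrow> (complex^'n^'n) set \<Rightarrow> bool"
  where "lie_subalgebra s q \<longleftrightarrow>
    s \<subseteq> q \<and> cmat.subspace s \<and> (\<forall>X\<in>s. \<forall>Y\<in>s. bracket X Y \<in> s)"

definition lie_ideal :: "(complex^'n^'n) set \<Rightarrow> (complex^'n^'n) set \<Rightarrow> bool"
  where "lie_ideal I q \<longleftrightarrow>
    I \<subseteq> q \<and> cmat.subspace I \<and> (\<forall>X\<in>q. \<forall>Y\<in>I. bracket X Y \<in> I)"

definition lie_solvable :: "(complex^'n^'n) set \<Rightarrow> bool"
  where "lie_solvable s \<longleftrightarrow> (\<exists>k. ((\<lambda>d. bracket_span d d) ^^ k) s = {0})"

definition lie_nilpotent :: "(complex^'n^'n) set \<Rightarrow> bool"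
  where "lie_nilpotent s \<longleftrightarrow> (\<exists>k. ((\<lambda>d. bracket_span s d) ^^ k) s = {0})"

definition cartan_subalgebra :: "(complex^'n^'n) set \<Rightarrow> (complex^'n^'n) set \<Rightarrow> bool"
  where "cartan_subalgebra h q \<longleftrightarrow>
    lie_subalgebra h q \<and> lie_nilpotent h \<and> {X \<in> q. \<forall>Y\<in>h. bracket X Y \<in> h} = h"

definition borel_subalgebra :: "(complex^'n^'n) set \<Rightarrow> (complex^'n^'n) set \<Rightarrow> bool"
  where "borel_subalgebra b q \<longleftrightarrow>
    lie_subalgebra b q \<and> lie_solvable b \<and>
    (\<forall>s. lie_subalgebra s q \<and> lie_solvable s \<and> b \<subseteq> s \<longrightarrow> s = b)"

definition opposite_borels ::
    "(complex^'n^'n) set \<Rightarrow> (complex^'n^'n) set \<Rightarrow> (complex^'n^'n) set \<Rightarrow> (complex^'n^'n) set \<Rightarrow> bool"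
  where "opposite_borels q h b b' \<longleftrightarrow>
    cartan_subalgebra h q \<and> borel_subalgebra b q \<and> borel_subalgebra b' q \<and> b \<inter> b' = h"

definition nilpotent_matrix :: "complex^'n^'n \<Rightarrow> bool"
  where "nilpotent_matrix X \<longleftrightarrow> (\<exists>k. (((**) X) ^^ k) (mat 1) = 0)"

text \<open>
  The sum of all ideals consisting of nilpotent elements. For a Borel subalgebra \<open>b\<close> this is the
  \<open>n\<close> with \<open>b = h \<oplus> n\<close>; the largest ideal that is nilpotent as a Lie algebra
  would also contain the centre of \<open>q\<close> (the scalar matrices in type \<open>GL\<close>).
\<close>

definition nilradical :: "(complex^'n^'n) set \<Rightarrow> (complex^'n^'n) set"
  where "nilradical b = cmat.span (\<Union>{I. lie_ideal I b \<and> (\<forall>X\<in>I. nilpotent_matrix X)})"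

section \<open>The dual space and coadjoint orbits\<close>

text \<open>
  A functional on \<open>q\<close> is a function on all matrices that is \<open>undefined\<close> outside \<open>q\<close>.
  The topology is that of pointwise convergence, in which \<open>dual q\<close> is closed and which induces
  the usual topology on this finite-dimensional space.
\<close>

definition dual :: "(complex^'n^'n) set \<Rightarrow> (complex^'n^'n \<Rightarrow> complex) set"
  where "dual q = {\<phi> \<in> extensional q.
    (\<forall>X\<in>q. \<forall>Y\<in>q. \<phi> (X + Y) = \<phi> X + \<phi> Y) \<and>
    (\<forall>c. \<forall>X\<in>q. \<phi> (cscale c X) = c * \<phi> X)}"

text \<open>
  The identification of \<open>q\<close> with its dual by the trace form, which is invariant, and
  non-degenerate on the Lie algebra of each of the classical groups.
\<close>

definition trace_dual :: "(complex^'n^'n) set \<Rightarrow> complex^'n^'n \<Rightarrow> (complex^'n^'n \<Rightarrow> complex)"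
  where "trace_dual q X = (\<lambda>Y\<in>q. trace (X ** Y))"

definition nilpotent_functional ::
    "(complex^'n^'n) set \<Rightarrow> (complex^'n^'n \<Rightarrow> complex) \<Rightarrow> bool"
  where "nilpotent_functional q \<phi> \<longleftrightarrow> (\<exists>X\<in>q. nilpotent_matrix X \<and> \<phi> = trace_dual q X)"

definition coadjoint ::
    "(complex^'n^'n) set \<Rightarrow> complex^'n^'n \<Rightarrow> (complex^'n^'n \<Rightarrow> complex) \<Rightarrow> (complex^'n^'n \<Rightarrow> complex)"
  where "coadjoint q g \<phi> = (\<lambda>Y\<in>q. \<phi> (matrix_inv g ** Y ** g))"

definition nilpotent_coadjoint_orbit ::
    "(complex^'n^'n) set \<Rightarrow> (complex^'n^'n \<Rightarrow> complex) set \<Rightarrow> bool"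
  where "nilpotent_coadjoint_orbit G Orb \<longleftrightarrow>
    (\<exists>\<phi> \<in> dual (lie_algebra G). nilpotent_functional (lie_algebra G) \<phi> \<and>
       Orb = (\<lambda>g. coadjoint (lie_algebra G) g \<phi>) ` G)"

text \<open>
  Characters of \<open>n = nilradical b\<close>, extended by zero along \<open>q = n \<oplus> b'\<close>.
\<close>

definition Psi ::
    "(complex^'n^'n) set \<Rightarrow> (complex^'n^'n) set \<Rightarrow> (complex^'n^'n) set \<Rightarrow> (complex^'n^'n \<Rightarrow> complex) set"
  where "Psi q b b' = {\<phi> \<in> dual q.
    (\<forall>X\<in>b'. \<phi> X = 0) \<and> (\<forall>X\<in>bracket_span (nilradical b) (nilradical b). \<phi> X = 0)}"

end

theory Submission
  imports Defs "HOL-Computational_Algebra.Fundamental_Theorem_Algebra"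
begin

text \<open>
  The ranks of the powers of a nilpotent \<open>X\<close> determine its orbit under the general linear, the
  orthogonal and the symplectic group, and they do not increase when passing to limits. So it suffices
  to find, for every nilpotent \<open>X\<close> and every \<open>k\<close>, an element \<open>Z \<in> \<Psi>\<close> of the closure of the orbit
  of \<open>X\<close> such that the rank of \<open>Z\<^sup>k\<close> is at least that of \<open>X\<^sup>k\<close>.

  For the general linear group, \<open>Z\<close> is the Jordan form of \<open>X\<close> in a basis defining the flags of the
  two Borel subalgebras. In the presence of a form \<open>B\<close>, \<open>X\<close> is brought into a position relative to
  such a basis (with antidiagonal Gram matrix) in which it lowers the degrees of the principal grading
  and the part of \<open>X\<^sup>k\<close> of degree \<open>-k\<close> has the same rank as \<open>X\<^sup>k\<close>. This is achieved by splitting the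
  space into \<open>X\<close>-stable summands with a cyclic Lagrangian subspace and at most one remaining Jordan
  block of size greater than \<open>k\<close>. Since the orbit is a cone, the principal one-parameter subgroup
  contracts \<open>X\<close> to its part \<open>Z\<close> of degree \<open>-1\<close>, which lies in \<open>\<Psi>\<close>.

  The special orthogonal orbit of \<open>X\<close> is the orthogonal one if a nondegenerate odd Jordan block splits
  off, because reflecting in it commutes with \<open>X\<close>. Otherwise the same \<open>Z\<close> works for all \<open>k\<close>, hence is
  conjugate to \<open>X\<close>; and elements conjugate to \<open>Z\<close> and close to it are conjugate to it by isometries of
  determinant \<open>1\<close>.
\<close>

section \<open>Powers and polynomials of matrices\<close>

text \<open>The dependence of \<open>Z\<close> on \<open>k\<close> is forced. In the presence of a
  form, an element of \<Psi> is up to conjugacy a principal nilpotent of a Levi subalgebra, so its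
  Jordan blocks come in pairs of equal size except for one or two; sizes 4 and 2 in the symplectic
  algebra of dimension 6 do not occur. For two unpaired blocks of sizes c2 \<le> c and k \<le> c2,
  two blocks of the mean size give the k-th power the same rank, because (c - k) + (c2 - k) = 2 ((c
  + c2) / 2 - k). If the k-th power kills everything outside a largest block, that block is kept and
  the rest may be degenerated freely. Even orthogonal groups need care twice. Two opposite Borel
  subalgebras do not distinguish the two middle vectors of a frame, and exchanging these is an
  isometry of determinant -1; this freedom corrects determinants. And when an odd block is inserted
  into a frame of odd length, the two middle vectors receive the same degree, which \<Psi> allows
  because skew elements have no entry between them.\<close>

lemma cscale_mult_vec [simp]: "cscale c A *v x = c *s (A *v x)"
  by (simp add: cscale_def vec_eq_iff matrix_vector_mult_def sum_distrib_left mult.assoc)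

lemma cscale_matrix_mult_left [simp]: "cscale c A ** B = cscale c (A ** B)"
  by (simp add: cscale_def vec_eq_iff matrix_matrix_mult_def sum_distrib_left mult.assoc)

lemma cscale_matrix_mult_right [simp]: "A ** cscale c B = cscale c (A ** B)"
  by (simp add: cscale_def vec_eq_iff matrix_matrix_mult_def sum_distrib_left mult.left_commute)

lemma mult_vec_scale [simp]: "A *v (c *s x) = c *s (A *v x)" for A :: "complex^'n^'n"
  by (simp add: vec.scale)

lemma matrix_add_rdistrib: "(A + B) ** C = A ** C + B ** C" for A B C :: "complex^'n^'n"
  by (simp add: vec_eq_iff matrix_matrix_mult_def sum.distrib algebra_simps)

lemma matrix_diff_distrib:
  fixes A B C :: "complex^'n^'n"
  shows "(A - B) ** C = A ** C - B ** C" "C ** (A - B) = C ** A - C ** B"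
  by (simp_all add: vec_eq_iff matrix_matrix_mult_def sum_subtractf algebra_simps)

lemma matrix_eqI: "(\<And>x. A *v x = B *v x) \<Longrightarrow> A = B" for A B :: "complex^'n^'n"
  by (simp add: matrix_eq)

text \<open>The same iteration as in \<open>nilpotent_matrix\<close>, so that nilpotency unfolds to
  \<open>mpow X k = 0\<close>.\<close>

definition mpow :: "complex^'n^'n \<Rightarrow> nat \<Rightarrow> complex^'n^'n"
  where "mpow X k = (((**) X) ^^ k) (mat 1)"

lemma mpow_0 [simp]: "mpow X 0 = mat 1"
  and mpow_Suc: "mpow X (Suc k) = X ** mpow X k"
  by (simp_all add: mpow_def)

lemma mpow_1 [simp]: "mpow X (Suc 0) = X"
  by (simp add: mpow_Suc)

lemma mpow_add: "mpow X (i + j) = mpow X i ** mpow X j"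
  by (induction i) (simp_all add: mpow_Suc matrix_mul_assoc)

lemma mpow_mult_vec_add: "mpow X i *v (mpow X j *v v) = mpow X (i + j) *v v"
  by (simp add: mpow_add matrix_vector_mul_assoc)

lemma mpow_mult_vec_Suc: "X *v (mpow X j *v v) = mpow X (Suc j) *v v"
  by (simp add: mpow_Suc matrix_vector_mul_assoc)

lemma mpow_Suc_right: "mpow X (Suc k) = mpow X k ** X"
  using mpow_add[of X k 1] by simp

lemma mpow_eq_0_mono:
  assumes "mpow X c *v v = 0" "c \<le> i" shows "mpow X i *v v = 0"
proof -
  have "mpow X i *v v = mpow X (i - c) *v (mpow X c *v v)"
    using assms(2) by (simp add: mpow_mult_vec_add)
  then show ?thesis using assms(1) by simp
qed

lemma nilpotent_matrix_iff: "nilpotent_matrix X \<longleftrightarrow> (\<exists>k. mpow X k = 0)"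
  by (simp add: nilpotent_matrix_def mpow_def)

lemma mpow_conj:
  assumes "T ** X = Y ** T" shows "T ** mpow X k = mpow Y k ** T"
  by (induction k) (simp_all add: mpow_Suc matrix_mul_assoc assms, metis assms matrix_mul_assoc)

lemma mpow_cscale: "mpow (cscale c X) k = cscale (c ^ k) (mpow X k)"
  by (induction k) (simp_all add: mpow_Suc)

lemma mpow_stable:
  assumes "\<And>w. w \<in> W \<Longrightarrow> X *v w \<in> W" "w \<in> W" shows "mpow X k *v w \<in> W"
  by (induction k) (simp_all add: assms mpow_mult_vec_Suc[symmetric])

text \<open>The value of the polynomial at \<open>X\<close> by Horner's scheme, which makes
  recursion over \<open>pCons\<close> immediate.\<close>

definition pm :: "complex poly \<Rightarrow> complex^'n^'n \<Rightarrow> complex^'n^'n"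
  where "pm p X = fold_coeffs (\<lambda>a M. cscale a (mat 1) + X ** M) p 0"

lemma pm_0 [simp]: "pm 0 X = 0"
  by (simp add: pm_def)

lemma pm_pCons [simp]: "pm (pCons a p) X = cscale a (mat 1) + X ** pm p X"
  by (cases "p = 0 \<and> a = 0") (auto simp: pm_def)

lemma pm_1 [simp]: "pm 1 X = mat 1"
  by (simp add: one_pCons)

lemma pm_add: "pm (p + q) X = pm p X + pm q X"
  by (induction p q rule: poly_induct2)
    (simp_all add: cmat.scale_left_distrib matrix_add_ldistrib)

lemma pm_smult: "pm (smult c p) X = cscale c (pm p X)"
  by (induction p) (simp_all add: cmat.scale_right_distrib)

lemma pm_mult: "pm (p * q) X = pm p X ** pm q X"
  by (induction p)
    (simp_all add: pm_add pm_smult matrix_add_rdistrib matrix_mul_assoc)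

lemma pm_monom: "pm (monom c k) X = cscale c (mpow X k)"
  by (induction k) (simp_all add: monom_0 monom_Suc mpow_Suc)

lemma pm_diff: "pm (p - q) X = pm p X - pm q X"
  using pm_add[of "p - q" q X] by simp

lemma pm_commute:
  assumes "A ** X = X ** A" shows "A ** pm p X = pm p X ** A"
proof (induction p)
  case (pCons a p)
  have "A ** (X ** pm p X) = (X ** pm p X) ** A"
    by (metis assms matrix_mul_assoc pCons.IH)
  then show ?case
    by (simp add: matrix_add_ldistrib matrix_add_rdistrib)
qed simp

section \<open>Spans and dimensions\<close>

text \<open>Flags are encoded by sequences: the members of the flag are the spans of the initial
  segments.\<close>

abbreviation fspan :: "(nat \<Rightarrow> complex^'n) \<Rightarrow> nat \<Rightarrow> (complex^'n) set"
  where "fspan f k \<equiv> vec.span (f ` {..<k})"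

lemma in_span_image_iff:
  fixes f :: "'b \<Rightarrow> complex^'n"
  assumes "finite I"
  shows "x \<in> vec.span (f ` I) \<longleftrightarrow> (\<exists>c. x = (\<Sum>i\<in>I. c i *s f i))"
proof
  assume "x \<in> vec.span (f ` I)"
  then show "\<exists>c. x = (\<Sum>i\<in>I. c i *s f i)"
  proof (induction rule: vec.span_induct_alt)
    case base
    show ?case by (rule exI[of _ "\<lambda>_. 0"]) simp
  next
    case (step a y z)
    then obtain i c where i: "i \<in> I" "y = f i" and c: "z = (\<Sum>i\<in>I. c i *s f i)" by auto
    show ?case
    proof (intro exI)
      show "a *s y + z = (\<Sum>j\<in>I. (c j + (if j = i then a else 0)) *s f j)"
        using i assms by (simp add: c vec.scale_left_distrib sum.distrib if_distrib[of "\<lambda>t. t *s _"] sum.delta cong: if_cong)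
    qed
  qed
next
  assume "\<exists>c. x = (\<Sum>i\<in>I. c i *s f i)"
  then show "x \<in> vec.span (f ` I)"
    by (auto intro!: vec.span_sum vec.span_scale intro: vec.span_base)
qed

lemma dim_direct_sum:
  fixes S T W :: "(complex^'n) set"
  assumes "vec.subspace S" "vec.subspace T" "S \<inter> T \<subseteq> {0}"
    and "W = {x + y | x y. x \<in> S \<and> y \<in> T}"
  shows "vec.dim W = vec.dim S + vec.dim T"
proof -
  have "S \<inter> T = {0}"
    using assms vec.subspace_0 by blast
  then show ?thesis
    using vec.dim_sums_Int[OF assms(1,2)] assms(4) by simp
qed

abbreviation rk :: "complex^'n^'n \<Rightarrow> (complex^'n) set \<Rightarrow> nat"
  where "rk A V \<equiv> vec.dim ((*v) A ` V)"

lemma dim_image_matrix_le: "rk A W \<le> vec.dim W" for A :: "complex^'n^'n"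
  by (rule vec.dim_image_le) simp

lemma subspace_image: "vec.subspace W \<Longrightarrow> vec.subspace ((*v) A ` W)" for A :: "complex^'n^'n"
  by (rule vec.subspace_image)

text \<open>The vectors X^i w cannot stay independent in a finite-dimensional space; the first
  dependence is a relation with leading coefficient 1.\<close>

lemma ex_krylov_relation:
  fixes X :: "complex^'n^'n"
  shows "\<exists>p. p \<noteq> 0 \<and> pm p X *v w = 0"
proof -
  let ?f = "\<lambda>i. mpow X i *v w"
  have "\<exists>n. ?f n \<in> fspan ?f n"
  proof (rule ccontr)
    assume "\<not> ?thesis"
    then have H: "?f n \<notin> fspan ?f n" for n by blast
    have "vec.dim (?f ` {..<n}) = n" for n
    proof (induction n)
      case (Suc n)
      then show ?case using H[of n] by (simp add: lessThan_Suc vec.dim_insert)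
    qed simp
    then have "Suc CARD('n) \<le> CARD('n)"
      by (metis vec_dim_card vec.dim_subset subset_UNIV)
    then show False by simp
  qed
  then obtain n c where "?f n = (\<Sum>i<n. c i *s ?f i)"
    by (auto simp: in_span_image_iff)
  moreover define p where "p = monom 1 n - (\<Sum>i<n. monom (c i) i)"
  moreover have "pm (\<Sum>i<n. monom (c i) i) X *v w = (\<Sum>i<n. c i *s ?f i)" for n
    by (induction n) (simp_all add: pm_add pm_monom matrix_vector_mult_add_rdistrib)
  ultimately have "pm p X *v w = 0"
    by (simp add: pm_diff pm_monom matrix_vector_mult_diff_rdistrib)
  moreover have "coeff p n = 1"
    by (simp add: p_def coeff_sum)
  ultimately show ?thesis by (metis coeff_0 zero_neq_one)
qed

text \<open>Replaces an eigenvector in the quotient W/U. A nonzero polynomial of least degree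
  carrying \<open>w\<close> into \<open>U\<close> has a root \<open>c\<close>; after removing the
  factor x - c it no longer carries \<open>w\<close> into \<open>U\<close>, and the resulting vector
  is an eigenvector modulo \<open>U\<close>.\<close>

lemma ex_eigenvector_mod:
  fixes X :: "complex^'n^'n"
  assumes U: "vec.subspace U" and W: "vec.subspace W" and XU: "\<And>u. u \<in> U \<Longrightarrow> X *v u \<in> U"
    and XW: "\<And>u. u \<in> W \<Longrightarrow> X *v u \<in> W" and w: "w \<in> W" "w \<notin> U"
  shows "\<exists>v c. v \<in> W \<and> v \<notin> U \<and> X *v v - c *s v \<in> U"
proof -
  have pW: "pm p X *v u \<in> W" if "u \<in> W" for p u
    using that by (induction p)
      (simp_all add: matrix_vector_mult_add_rdistrib matrix_vector_mul_assoc[symmetric] XW W vec.subspace_add vec.subspace_scale vec.subspace_0)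
  define P where "P p \<longleftrightarrow> p \<noteq> 0 \<and> pm p X *v w \<in> U" for p
  have "\<exists>p. P p" using ex_krylov_relation[of X w] U by (auto simp: P_def vec.subspace_0)
  then obtain p where p: "P p" and min: "\<And>q. P q \<Longrightarrow> degree p \<le> degree q"
    using ex_has_least_nat[of P _ degree] by metis
  have "degree p \<noteq> 0"
  proof
    assume "degree p = 0"
    then obtain a where a: "p = [:a:]" by (meson degree_eq_zeroE)
    then have "a \<noteq> 0" "a *s w \<in> U" using p by (auto simp: P_def)
    then have "inverse a *s (a *s w) \<in> U" using U vec.subspace_scale by blast
    then show False using \<open>a \<noteq> 0\<close> w by simp
  qed
  then obtain c where "poly p c = 0"
    using fundamental_theorem_of_algebra[of p] by (auto simp: constant_degree)
  then obtain q where q: "p = [:- c, 1:] * q" by (metis dvdE poly_eq_0_iff_dvd)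
  have q0: "q \<noteq> 0" using p q by (auto simp: P_def)
  have "degree p = Suc (degree q)"
    unfolding q using q0 by (subst degree_mult_eq) auto
  then have "\<not> P q" using min by fastforce
  then have "pm q X *v w \<notin> U" using q0 by (simp add: P_def)
  moreover have "pm p X *v w = X *v (pm q X *v w) - c *s (pm q X *v w)"
    unfolding q pm_mult by (simp add: matrix_vector_mul_assoc[symmetric] matrix_vector_mult_add_rdistrib
       matrix_vector_mult_diff_rdistrib)
  ultimately show ?thesis using p pW[OF w(1)] by (auto simp: P_def)
qed

section \<open>Matrices whose columns are indexed by natural numbers\<close>

text \<open>The index type has no preferred order. A fixed enumeration allows flags and triangular
  shapes to be described by natural numbers.\<close>

definition idx :: "'n::finite \<Rightarrow> nat"
  where "idx = (SOME h. bij_betw h (UNIV :: 'n set) {..<CARD('n)})"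

lemma bij_idx: "bij_betw idx (UNIV :: 'n::finite set) {..<CARD('n)}"
proof -
  have "\<exists>h. bij_betw h (UNIV :: 'n set) {..<CARD('n)}"
    using ex_bij_betw_finite_nat[of "UNIV :: 'n set"] by (auto simp: atLeast0LessThan)
  then show ?thesis unfolding idx_def by (rule someI_ex)
qed

lemma idx_less [simp]: "idx (i::'n::finite) < CARD('n)"
  using bij_idx by (auto simp: bij_betw_def)

lemma idx_eq_iff [simp]: "idx i = idx j \<longleftrightarrow> i = j" for i j :: "'n::finite"
  using bij_idx[where 'n='n] by (auto simp: bij_betw_def inj_on_def)

lemma ex_idx: "j < CARD('n) \<Longrightarrow> \<exists>i::'n::finite. idx i = j"
  using bij_betw_imp_surj_on[OF bij_idx[where 'n='n]] by (metis imageE lessThan_iff)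

definition fmat :: "(nat \<Rightarrow> complex^'n) \<Rightarrow> complex^'n^'n"
  where "fmat f = (\<chi> r i. f (idx i) $ r)"

lemma fmat_axis: "fmat f *v axis i 1 = f (idx i)"
  by (simp add: fmat_def vec_eq_iff matrix_vector_mult_def axis_def if_distrib cong: if_cong)

lemma fmat_mult_vec: "fmat f *v x = (\<Sum>i\<in>UNIV. x $ i *s f (idx i))"
  by (simp add: fmat_def vec_eq_iff matrix_vector_mult_def mult.commute)

lemma invertible_fmat:
  fixes f :: "nat \<Rightarrow> complex^'n"
  assumes "fspan f CARD('n) = UNIV"
  shows "invertible (fmat f)"
proof -
  have "columns (fmat f) = f ` {..<CARD('n)}"
  proof -
    have "columns (fmat f) = range (\<lambda>i::'n. f (idx i))"
      by (auto simp: columns_def column_def fmat_def)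
    also have "\<dots> = f ` range (idx :: 'n \<Rightarrow> nat)" by (simp add: image_image)
    finally show ?thesis using bij_idx[where 'n='n] by (simp add: bij_betw_def)
  qed
  then show ?thesis
    by (metis assms invertible_right_inverse matrix_right_invertible_span_columns)
qed

lemma matrix_inv_mult:
  fixes A :: "complex^'n^'n"
  assumes "invertible A"
  shows "A ** matrix_inv A = mat 1" "matrix_inv A ** A = mat 1"
    and "A *v (matrix_inv A *v x) = x" "matrix_inv A *v (A *v x) = x"
proof -
  show 1: "A ** matrix_inv A = mat 1" and 2: "matrix_inv A ** A = mat 1"
    using assms unfolding invertible_def matrix_inv_def by (metis (mono_tags, lifting) someI_ex)+
  show "A *v (matrix_inv A *v x) = x" "matrix_inv A *v (A *v x) = x"
    by (simp_all add: matrix_vector_mul_assoc 1 2)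
qed

lemma matrix_inv_conj:
  fixes A :: "complex^'n^'n"
  assumes "invertible A"
  shows "A ** (matrix_inv A ** B) = B" "matrix_inv A ** (A ** B) = B"
    "B ** A ** matrix_inv A = B" "B ** matrix_inv A ** A = B"
  by (simp_all add: matrix_mul_assoc matrix_inv_mult[OF assms])
    (simp_all add: matrix_mul_assoc[symmetric] matrix_inv_mult[OF assms])

abbreviation Ad :: "complex^'n^'n \<Rightarrow> complex^'n^'n \<Rightarrow> complex^'n^'n"
  where "Ad g X \<equiv> g ** X ** matrix_inv g"

lemma invertible_matrix_inv: "invertible A \<Longrightarrow> invertible (matrix_inv A)" for A :: "complex^'n^'n"
  by (meson invertible_def matrix_inv_mult(1,2))

lemma matrix_eq_on_basis:
  fixes A B :: "complex^'n^'n"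
  assumes "fspan f CARD('n) = UNIV" "\<And>j. j < CARD('n) \<Longrightarrow> A *v f j = B *v f j"
  shows "A = B"
proof (rule matrix_eqI)
  fix x
  have "x \<in> fspan f CARD('n)" using assms(1) by simp
  then show "A *v x = B *v x"
    by (induction rule: vec.span_induct_alt)
      (auto simp: matrix_vector_right_distrib assms(2))
qed

lemma ex_basis_map:
  fixes f g :: "nat \<Rightarrow> complex^'n"
  assumes "fspan f CARD('n) = UNIV" "fspan g CARD('n) = UNIV"
  shows "\<exists>T. invertible T \<and> (\<forall>j<CARD('n). T *v f j = g j)"
proof (intro exI conjI allI impI)
  let ?T = "fmat g ** matrix_inv (fmat f)"
  show "invertible ?T"
    using assms by (simp add: invertible_fmat invertible_matrix_inv invertible_mult)
  fix j assume "j < CARD('n)"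
  then obtain i :: 'n where i: "idx i = j" using ex_idx by blast
  show "?T *v f j = g j"
    unfolding i[symmetric] fmat_axis[symmetric]
    by (simp add: matrix_vector_mul_assoc[symmetric] matrix_inv_mult invertible_fmat[OF assms(1)])
qed

section \<open>Nilpotent matrices with the same ranks\<close>

text \<open>The power X^(c - 1 - m) kills all later vectors of the chain but not the m-th, so the
  chain, built up from its last vector, gains a dimension at each step.\<close>

lemma dim_cyclic:
  fixes X :: "complex^'n^'n"
  assumes "mpow X c *v v = 0" "mpow X (c - 1) *v v \<noteq> 0"
  shows "vec.dim (vec.span ((\<lambda>i. mpow X i *v v) ` {m..<c})) = c - m"
proof -
  let ?f = "\<lambda>i. mpow X i *v v"
  have "m + d = c \<Longrightarrow> vec.dim (?f ` {m..<c}) = d" for d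
  proof (induction d arbitrary: m)
    case (Suc d)
    have "mpow X (c - 1 - m) *v y = 0" if "y \<in> vec.span (?f ` {Suc m..<c})" for y
      using that
    proof (induction rule: vec.span_induct_alt)
      case (step a x z)
      then obtain i where i: "x = ?f i" "Suc m \<le> i" by auto
      have "mpow X (c - 1 - m) *v x = 0"
        unfolding i(1) mpow_mult_vec_add using i(2) Suc.prems by (intro mpow_eq_0_mono[OF assms(1)]) auto
      with step show ?case by (simp add: matrix_vector_right_distrib)
    qed simp
    moreover have "mpow X (c - 1 - m) *v ?f m \<noteq> 0"
      using Suc.prems assms(2) by (simp add: mpow_mult_vec_add)
    ultimately have "?f m \<notin> vec.span (?f ` {Suc m..<c})" by blast
    moreover have "{m..<c} = insert m {Suc m..<c}" using Suc.prems by auto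
    ultimately show ?case using Suc.IH[of "Suc m"] Suc.prems by (simp add: vec.dim_insert)
  qed simp
  from this[of "c - m"] show ?thesis
    by (cases "m \<le> c") (simp_all add: vec.dim_span)
qed

lemma image_cyclic:
  fixes X :: "complex^'n^'n"
  assumes "mpow X c *v v = 0"
  shows "(*v) (mpow X k) ` fspan (\<lambda>i. mpow X i *v v) c = vec.span ((\<lambda>i. mpow X i *v v) ` {k..<c})"
proof -
  let ?f = "\<lambda>i. mpow X i *v v"
  have "(*v) (mpow X k) ` fspan ?f c = vec.span ((\<lambda>i. ?f (k + i)) ` {..<c})"
    by (simp add: vec.span_image[symmetric] image_image mpow_mult_vec_add)
  also have "\<dots> = vec.span (?f ` {k..<c})"
  proof (rule vec.span_eq[THEN iffD2], intro conjI subsetI)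
    fix y assume "y \<in> (\<lambda>i. ?f (k + i)) ` {..<c}"
    then obtain i where y: "y = ?f (k + i)" by auto
    show "y \<in> vec.span (?f ` {k..<c})"
    proof (cases "k + i < c")
      case True then show ?thesis unfolding y by (intro vec.span_base) auto
    next
      case False then show ?thesis unfolding y using mpow_eq_0_mono[OF assms, of "k + i"] by (simp add: vec.span_zero)
    qed
  next
    fix y assume "y \<in> ?f ` {k..<c}"
    then obtain i where "y = ?f i" "k \<le> i" "i < c" by auto
    then have "y \<in> (\<lambda>i. ?f (k + i)) ` {..<c}" by (intro image_eqI[of _ _ "i - k"]) auto
    then show "y \<in> vec.span ((\<lambda>i. ?f (k + i)) ` {..<c})" by (rule vec.span_base)
  qed
  finally show ?thesis .
qed

lemma cyclic_stable:
  assumes "mpow X c *v v = 0" "y \<in> fspan (\<lambda>i. mpow X i *v v) c"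
  shows "X *v y \<in> fspan (\<lambda>i. mpow X i *v v) c"
proof -
  have "X *v y \<in> (*v) (mpow X 1) ` fspan (\<lambda>i. mpow X i *v v) c" using assms(2) by simp
  also have "\<dots> \<subseteq> fspan (\<lambda>i. mpow X i *v v) c"
    unfolding image_cyclic[OF assms(1)] by (rule vec.span_mono) auto
  finally show ?thesis .
qed

text \<open>A functional that is nonzero on the last vector of a chain separates the whole chain:
  the matrix of the values \<phi> (X^(i + j) v) vanishes for i + j \<ge> c and has nonzero
  antidiagonal. The vectors with \<phi> (X^j y) = 0 for all j < c therefore form a complement of the
  chain, which is stable wherever X^c vanishes.\<close>

locale cyclic_functional =
  fixes X :: "complex^'n^'n" and v and c and \<phi> :: "complex^'n \<Rightarrow> complex"
  assumes zero: "mpow X c *v v = 0" and nz: "\<phi> (mpow X (c - 1) *v v) \<noteq> 0"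
    and add: "\<And>x y. \<phi> (x + y) = \<phi> x + \<phi> y" and scale: "\<And>a x. \<phi> (a *s x) = a * \<phi> x"
begin

lemma phi_0: "\<phi> 0 = 0"
  using scale[of 0 0] by simp

lemma phi_diff: "\<phi> (x - y) = \<phi> x - \<phi> y"
  using add[of "x - y" y] by simp

lemma c_pos: "c > 0" and top_nz: "mpow X (c - 1) *v v \<noteq> 0"
  using nz phi_0 zero by (auto intro!: Nat.gr0I)

text \<open>Back substitution: the multiple of X^l v corrects the value at j = c - 1 - l, and the
  values already cleared at larger j do not change because X^(j + l) v = 0 there.\<close>

lemma clear: "\<exists>s \<in> fspan (\<lambda>i. mpow X i *v v) c. \<forall>j<c. \<phi> (mpow X j *v (y - s)) = 0"
proof -
  have "\<exists>s \<in> fspan (\<lambda>i. mpow X i *v v) c. \<forall>j. c - l \<le> j \<longrightarrow> j < c \<longrightarrow> \<phi> (mpow X j *v (y - s)) = 0"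
    if "l \<le> c" for l using that
  proof (induction l)
    case 0
    show ?case by (auto intro!: bexI[of _ 0] vec.span_zero)
  next
    case (Suc l)
    then obtain s where s: "s \<in> fspan (\<lambda>i. mpow X i *v v) c"
      and s0: "\<And>j. c - l \<le> j \<Longrightarrow> j < c \<Longrightarrow> \<phi> (mpow X j *v (y - s)) = 0" by auto
    define r where "r = \<phi> (mpow X (c - Suc l) *v (y - s)) / \<phi> (mpow X (c - 1) *v v)"
    let ?s = "s + r *s (mpow X l *v v)"
    have e: "\<phi> (mpow X j *v (y - ?s)) = \<phi> (mpow X j *v (y - s)) - r * \<phi> (mpow X (j + l) *v v)" for j
      by (simp add: matrix_vector_mult_diff_distrib matrix_vector_right_distrib phi_diff add scale mpow_mult_vec_add)
    show ?case
    proof (intro bexI allI impI)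
      show "?s \<in> fspan (\<lambda>i. mpow X i *v v) c"
        using s Suc.prems by (auto intro!: vec.span_add vec.span_scale intro: vec.span_base)
      fix j assume j: "c - Suc l \<le> j" "j < c"
      show "\<phi> (mpow X j *v (y - ?s)) = 0"
      proof (cases "j = c - Suc l")
        case True
        have "j + l = c - 1" using True Suc.prems by simp
        then show ?thesis unfolding e using nz by (simp add: True r_def)
      next
        case False
        then have "c - l \<le> j" "c \<le> j + l" using j Suc.prems by auto
        then show ?thesis unfolding e using s0 j(2) mpow_eq_0_mono[OF zero] phi_0 by simp
      qed
    qed
  qed
  from this[of c] show ?thesis by simp
qed

lemma indep:
  assumes "y \<in> fspan (\<lambda>i. mpow X i *v v) c" "\<And>j. j < c \<Longrightarrow> \<phi> (mpow X j *v y) = 0"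
  shows "y = 0"
proof -
  have "y \<in> vec.span ((\<lambda>i. mpow X i *v v) ` {m..<c})" if "m \<le> c" for m using that
  proof (induction m)
    case 0 then show ?case using assms by (simp add: atLeast0LessThan)
  next
    case (Suc m)
    have "{m..<c} = insert m {Suc m..<c}" using Suc.prems by auto
    then obtain a where a: "y - a *s (mpow X m *v v) \<in> vec.span ((\<lambda>i. mpow X i *v v) ` {Suc m..<c})"
      using Suc.IH Suc.prems by (auto simp: vec.span_insert)
    have "mpow X (c - 1 - m) *v z = 0" if "z \<in> vec.span ((\<lambda>i. mpow X i *v v) ` {Suc m..<c})" for z
      using that
    proof (induction rule: vec.span_induct_alt)
      case (step b x z)
      then obtain i where i: "x = mpow X i *v v" "Suc m \<le> i" by auto
      have "mpow X (c - 1 - m) *v x = 0"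
        unfolding i(1) mpow_mult_vec_add using i(2) Suc.prems by (intro mpow_eq_0_mono[OF zero]) auto
      with step show ?case by (simp add: matrix_vector_right_distrib)
    qed simp
    from this[OF a] have "mpow X (c - 1 - m) *v y = a *s (mpow X (c - 1) *v v)"
      using Suc.prems by (simp add: matrix_vector_mult_diff_distrib mpow_mult_vec_add)
    with assms(2)[of "c - 1 - m"] Suc.prems nz have "a = 0" by (auto simp: scale)
    with a show ?case by simp
  qed
  from this[of c] show ?thesis by simp
qed

end

text \<open>Splits off a Jordan block of maximal size. Some coordinate is nonzero on X^(c - 1) v,
  and it serves as the functional of \<open>cyclic_functional\<close>.\<close>

lemma peel:
  fixes X :: "complex^'n^'n"
  assumes W: "vec.subspace W" and XW: "\<And>w. w \<in> W \<Longrightarrow> X *v w \<in> W"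
    and c: "\<And>w. w \<in> W \<Longrightarrow> mpow X c *v w = 0" and v: "v \<in> W" "mpow X (c - 1) *v v \<noteq> 0"
  obtains W2 where "vec.subspace W2" "W2 \<subseteq> W" "\<And>w. w \<in> W2 \<Longrightarrow> X *v w \<in> W2"
    "\<And>k. rk (mpow X k) W = (c - k) + rk (mpow X k) W2"
    "W = vec.span ((\<lambda>i. mpow X i *v v) ` {..<c} \<union> W2)"
proof -
  obtain i where i: "(mpow X (c - 1) *v v) $ i \<noteq> 0" using v(2) by (auto simp: vec_eq_iff)
  interpret cyclic_functional X v c "\<lambda>x. x $ i"
    by unfold_locales (use c[OF v(1)] i in auto)
  define S where "S = fspan (\<lambda>i. mpow X i *v v) c"
  define W2 where "W2 = {w \<in> W. \<forall>j<c. (mpow X j *v w) $ i = 0}"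
  have sub: "vec.subspace W2"
    using W by (auto simp: W2_def vec.subspace_def matrix_vector_right_distrib)
  have SW: "S \<subseteq> W" unfolding S_def using W v XW mpow_stable[of W X]
    by (intro vec.span_minimal) auto
  have st: "X *v w \<in> W2" if "w \<in> W2" for w
  proof -
    have "(mpow X j *v (X *v w)) $ i = 0" if "j < c" for j
    proof (cases "Suc j < c")
      case True
      then show ?thesis using \<open>w \<in> W2\<close> by (auto simp: W2_def matrix_vector_mul_assoc mpow_Suc_right[symmetric])
    next
      case False
      then show ?thesis using \<open>w \<in> W2\<close> c[of w] that mpow_eq_0_mono[of X c w "Suc j"]
        by (auto simp: W2_def matrix_vector_mul_assoc mpow_Suc_right[symmetric])
    qed
    then show ?thesis using that XW by (auto simp: W2_def)
  qed
  have int: "S \<inter> W2 \<subseteq> {0}"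
    using indep by (auto simp: S_def W2_def)
  have sum: "\<exists>s\<in>S. \<exists>t\<in>W2. y = s + t" if "y \<in> W" for y
  proof -
    obtain s where s: "s \<in> S" "\<forall>j<c. (mpow X j *v (y - s)) $ i = 0" using clear[of y] by (auto simp: S_def)
    then have "y - s \<in> W2" using that SW vec.subspace_diff[OF W, of y s] by (auto simp: W2_def)
    then show ?thesis using s by (metis add.commute diff_add_cancel)
  qed
  have im: "(*v) (mpow X k) ` S = vec.span ((\<lambda>i. mpow X i *v v) ` {k..<c})" for k
    unfolding S_def by (rule image_cyclic[OF zero])
  have XS: "(*v) (mpow X k) ` S \<subseteq> S" for k
    unfolding im unfolding S_def by (rule vec.span_mono) auto
  have "rk (mpow X k) W = rk (mpow X k) S + rk (mpow X k) W2" for k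
  proof (rule dim_direct_sum)
    show "vec.subspace ((*v) (mpow X k) ` S)" "vec.subspace ((*v) (mpow X k) ` W2)"
      using sub by (auto intro!: subspace_image simp: S_def)
    have "(*v) (mpow X k) ` W2 \<subseteq> W2" using mpow_stable[of W2 X] st by auto
    then show "(*v) (mpow X k) ` S \<inter> (*v) (mpow X k) ` W2 \<subseteq> {0}" using XS int by blast
    show "(*v) (mpow X k) ` W = {x + y |x y. x \<in> (*v) (mpow X k) ` S \<and> y \<in> (*v) (mpow X k) ` W2}"
    proof (intro equalityI subsetI)
      fix z assume "z \<in> (*v) (mpow X k) ` W"
      then obtain y where y: "y \<in> W" "z = mpow X k *v y" by auto
      then obtain s t where "s \<in> S" "t \<in> W2" "y = s + t" using sum by blast
      then show "z \<in> {x + y |x y. x \<in> (*v) (mpow X k) ` S \<and> y \<in> (*v) (mpow X k) ` W2}"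
        unfolding y(2) by (auto simp: matrix_vector_right_distrib)
    next
      fix z assume "z \<in> {x + y |x y. x \<in> (*v) (mpow X k) ` S \<and> y \<in> (*v) (mpow X k) ` W2}"
      then obtain s t where "s \<in> S" "t \<in> W2" "z = mpow X k *v (s + t)" by (auto simp: matrix_vector_right_distrib)
      moreover have "s + t \<in> W" using calculation SW W by (auto simp: W2_def vec.subspace_add)
      ultimately show "z \<in> (*v) (mpow X k) ` W" by auto
    qed
  qed
  then have dims: "rk (mpow X k) W = (c - k) + rk (mpow X k) W2" for k
    unfolding im by (simp add: dim_cyclic[OF zero top_nz, unfolded vec.dim_span])
  have span: "W = vec.span ((\<lambda>i. mpow X i *v v) ` {..<c} \<union> W2)"
  proof (intro equalityI subsetI)
    fix y assume "y \<in> W"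
    then obtain s t where "s \<in> S" "t \<in> W2" "y = s + t" using sum by blast
    moreover have "s \<in> vec.span ((\<lambda>i. mpow X i *v v) ` {..<c} \<union> W2)"
      using \<open>s \<in> S\<close> vec.span_mono[of "(\<lambda>i. mpow X i *v v) ` {..<c}" "(\<lambda>i. mpow X i *v v) ` {..<c} \<union> W2"]
      unfolding S_def by blast
    ultimately show "y \<in> vec.span ((\<lambda>i. mpow X i *v v) ` {..<c} \<union> W2)"
      by (simp add: vec.span_add vec.span_base)
  next
    fix y assume y: "y \<in> vec.span ((\<lambda>i. mpow X i *v v) ` {..<c} \<union> W2)"
    have "(\<lambda>i. mpow X i *v v) ` {..<c} \<subseteq> S" unfolding S_def by (rule vec.span_superset)
    moreover have "W2 \<subseteq> W" by (auto simp: W2_def)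
    ultimately have "(\<lambda>i. mpow X i *v v) ` {..<c} \<union> W2 \<subseteq> W" using SW by blast
    then show "y \<in> W" using vec.span_minimal[OF _ W] y by blast
  qed
  have "W2 \<subseteq> W" by (auto simp: W2_def)
  show ?thesis by (rule that[OF sub \<open>W2 \<subseteq> W\<close> st dims span])
qed

lemma nilpotent_order:
  fixes X :: "complex^'n^'n"
  assumes "\<And>w. w \<in> W \<Longrightarrow> mpow X m *v w = 0" "\<not> W \<subseteq> {0}"
  obtains c where "c > 0" "\<And>w. w \<in> W \<Longrightarrow> mpow X c *v w = 0"
    "\<exists>v\<in>W. mpow X (c - 1) *v v \<noteq> 0"
proof -
  define c where "c = (LEAST c. \<forall>w\<in>W. mpow X c *v w = 0)"
  have 1: "\<forall>w\<in>W. mpow X c *v w = 0" unfolding c_def by (rule LeastI[of _ m]) (use assms in blast)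
  have "c \<noteq> 0" using 1 assms(2) by (auto intro!: Nat.gr0I)
  moreover have "\<not> (\<forall>w\<in>W. mpow X (c - 1) *v w = 0)"
    unfolding c_def by (rule not_less_Least) (use \<open>c \<noteq> 0\<close> in \<open>simp add: c_def\<close>)
  ultimately show ?thesis using that[of c] 1 by blast
qed

lemma span_Un_span: "vec.span (A \<union> vec.span B) = vec.span (A \<union> B)" for A B :: "(complex^'n) set"
proof (rule vec.span_eq[THEN iffD2], intro conjI)
  have "A \<subseteq> vec.span (A \<union> B)" using vec.span_superset[of "A \<union> B"] by blast
  moreover have "vec.span B \<subseteq> vec.span (A \<union> B)" by (rule vec.span_mono) blast
  ultimately show "A \<union> vec.span B \<subseteq> vec.span (A \<union> B)" by blast
  have "B \<subseteq> vec.span (A \<union> vec.span B)" using vec.span_superset[of B] vec.span_superset[of "A \<union> vec.span B"] by blast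
  moreover have "A \<subseteq> vec.span (A \<union> vec.span B)" using vec.span_superset[of "A \<union> vec.span B"] by blast
  ultimately show "A \<union> B \<subseteq> vec.span (A \<union> vec.span B)" by blast
qed

text \<open>Both matrices are peeled at the same time. The largest block size \<open>c\<close> can
  be read off the ranks, so blocks of equal size are removed and the ranks on the complements still
  agree. Each chain is listed from the kernel upwards; \<open>\<eta> j\<close> says that the j-th
  vector is not in the kernel. Since \<open>\<eta>\<close> is common to both bases, matching them
  gives an intertwiner.\<close>

lemma same_ranks_bases:
  fixes X X' :: "complex^'n^'n"
  assumes "vec.subspace W" "\<And>w. w \<in> W \<Longrightarrow> X *v w \<in> W" "\<And>w. w \<in> W \<Longrightarrow> mpow X m *v w = 0"
    and "vec.subspace W'" "\<And>w. w \<in> W' \<Longrightarrow> X' *v w \<in> W'" "\<And>w. w \<in> W' \<Longrightarrow> mpow X' m *v w = 0"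
    and "\<And>k. rk (mpow X k) W = rk (mpow X' k) W'"
    and "vec.dim W = d"
  shows "\<exists>f f' \<eta>. W = fspan f d \<and> W' = fspan f' d \<and>
    (\<forall>j<d. X *v f j = (if \<eta> j then f (j - 1) else 0) \<and> X' *v f' j = (if \<eta> j then f' (j - 1) else 0)) \<and>
    (\<forall>j. \<eta> j \<longrightarrow> j > (0::nat))"
  using assms
proof (induction d arbitrary: W W' rule: less_induct)
  case (less d)
  have d': "vec.dim W' = d" using less.prems(7)[of 0] less.prems(8) by (simp add: image_def)
  show ?case
  proof (cases "d = 0")
    case True
    then have "W = {0}" "W' = {0}"
      using less.prems(1,4,8) d' vec.subspace_0 by auto
    then show ?thesis using True by (intro exI[of _ "\<lambda>_. 0"] exI[of _ "\<lambda>_. False"]) simp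
  next
    case False
    then have "\<not> W \<subseteq> {0}" using less.prems(8) by (metis vec.dim_eq_0)
    with less.prems(3) obtain c v where c: "c > 0" "\<And>w. w \<in> W \<Longrightarrow> mpow X c *v w = 0"
      and v: "v \<in> W" "mpow X (c - 1) *v v \<noteq> 0" using nilpotent_order[of W X m] by metis
    have "rk (mpow X c) W = 0" using c(2) by auto
    then have c': "\<And>w. w \<in> W' \<Longrightarrow> mpow X' c *v w = 0" unfolding less.prems(7) by auto
    have "vec.dim ((*v) (mpow X (c - 1)) ` W) \<noteq> 0" using v by auto
    then obtain v' where v': "v' \<in> W'" "mpow X' (c - 1) *v v' \<noteq> 0" unfolding less.prems(7) by auto
    obtain W2 where W2: "vec.subspace W2" "W2 \<subseteq> W" "\<And>w. w \<in> W2 \<Longrightarrow> X *v w \<in> W2"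
      "\<And>k. rk (mpow X k) W = (c - k) + rk (mpow X k) W2"
      "W = vec.span ((\<lambda>i. mpow X i *v v) ` {..<c} \<union> W2)"
      using peel[OF less.prems(1,2) c(2) v] by blast
    obtain W2' where W2': "vec.subspace W2'" "W2' \<subseteq> W'" "\<And>w. w \<in> W2' \<Longrightarrow> X' *v w \<in> W2'"
      "\<And>k. rk (mpow X' k) W' = (c - k) + rk (mpow X' k) W2'"
      "W' = vec.span ((\<lambda>i. mpow X' i *v v') ` {..<c} \<union> W2')"
      using peel[OF less.prems(4,5) c' v'] by blast
    have dd: "vec.dim W2 = d - c" "c \<le> d" using W2(4)[of 0] less.prems(8) by (simp_all add: image_def)
    have r: "rk (mpow X k) W2 = rk (mpow X' k) W2'" for k
      using W2(4)[of k] W2'(4)[of k] less.prems(7)[of k] by simp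
    have ex: "\<exists>f f' \<eta>. W2 = fspan f (d-c) \<and> W2' = fspan f' (d-c) \<and>
      (\<forall>j<d-c. X *v f j = (if \<eta> j then f (j - 1) else 0) \<and> X' *v f' j = (if \<eta> j then f' (j - 1) else 0)) \<and>
      (\<forall>j. \<eta> j \<longrightarrow> j > (0::nat))"
    proof (rule less.IH)
      show "d - c < d" using c(1) False by simp
      show "\<And>w. w \<in> W2 \<Longrightarrow> mpow X m *v w = 0" "\<And>w. w \<in> W2' \<Longrightarrow> mpow X' m *v w = 0"
        using W2(2) W2'(2) less.prems(3,6) by blast+
    qed (use W2 W2' r dd in auto)
    obtain f f' \<eta> where ff: "W2 = fspan f (d-c) \<and> W2' = fspan f' (d-c) \<and>
      (\<forall>j<d-c. X *v f j = (if \<eta> j then f (j - 1) else 0) \<and> X' *v f' j = (if \<eta> j then f' (j - 1) else 0)) \<and>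
      (\<forall>j. \<eta> j \<longrightarrow> j > (0::nat))" using ex by (elim exE)
    note f = ff[THEN conjunct1] ff[THEN conjunct2, THEN conjunct1]
      ff[THEN conjunct2, THEN conjunct2, THEN conjunct1, rule_format, THEN conjunct1]
      ff[THEN conjunct2, THEN conjunct2, THEN conjunct1, rule_format, THEN conjunct2]
      ff[THEN conjunct2, THEN conjunct2, THEN conjunct2, rule_format]
    define F where "F X v f j = (if j < c then mpow X (c - 1 - j) *v v else f (j - c))"
      for X and v :: "complex^'n" and f j
    define H where "H j \<longleftrightarrow> (if j < c then j > 0 else \<eta> (j - c))" for j
    have span: "W = vec.span (F X v f ` {..<d})"
      if W: "W = vec.span ((\<lambda>i. mpow X i *v v) ` {..<c} \<union> W2)" and f: "W2 = fspan f (d-c)"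
      for X and v :: "complex^'n" and f W W2
    proof -
      have "F X v f ` {..<d} = (\<lambda>i. mpow X i *v v) ` {..<c} \<union> f ` {..<d-c}"
      proof (intro equalityI subsetI)
        fix y assume "y \<in> F X v f ` {..<d}"
        then show "y \<in> (\<lambda>i. mpow X i *v v) ` {..<c} \<union> f ` {..<d-c}"
          using dd c(1) by (auto simp: F_def split: if_splits)
      next
        fix y assume "y \<in> (\<lambda>i. mpow X i *v v) ` {..<c} \<union> f ` {..<d-c}"
        then consider i where "i < c" "y = mpow X i *v v" | i where "i < d - c" "y = f i" by auto
        then show "y \<in> F X v f ` {..<d}"
        proof cases
          case 1
          then show ?thesis using dd by (intro image_eqI[of _ _ "c - 1 - i"]) (auto simp: F_def)
        next
          case 2
          then show ?thesis using dd by (intro image_eqI[of _ _ "c + i"]) (auto simp: F_def)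
        qed
      qed
      then show ?thesis by (simp only: W f span_Un_span)
    qed
    have act: "X *v F X v f j = (if H j then F X v f (j - 1) else 0)"
      if "j < d" "mpow X c *v v = 0" "\<And>j. j<d-c \<Longrightarrow> X *v f j = (if \<eta> j then f (j - 1) else 0)"
      for X :: "complex^'n^'n" and v f j
    proof (cases "j < c")
      case True
      show ?thesis
      proof (cases "j = 0")
        case False
        then have "c - Suc (j - Suc 0) = Suc (c - Suc j)" using True by simp
        then show ?thesis using True False by (simp add: F_def H_def mpow_mult_vec_Suc less_imp_diff_less)
      qed (use True that(2) in \<open>auto simp: F_def H_def mpow_mult_vec_Suc\<close>)
    next
      case False
      then show ?thesis using that f(5)[of "j - c"] by (auto simp: F_def H_def)
    qed
    show ?thesis
    proof (rule exI[of _ "F X v f"], rule exI[of _ "F X' v' f'"], rule exI[of _ H], intro conjI allI impI)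
      show "W = vec.span (F X v f ` {..<d})" by (rule span[OF W2(5) f(1)])
      show "W' = vec.span (F X' v' f' ` {..<d})" by (rule span[OF W2'(5) f(2)])
      fix j assume "j < d"
      then show "X *v F X v f j = (if H j then F X v f (j - 1) else 0)"
        "X' *v F X' v' f' j = (if H j then F X' v' f' (j - 1) else 0)"
        using act f(3,4) c(2) c' v(1) v'(1) by blast+
    next
      fix j assume "H j" then show "j > 0" using f(5)[of "j - c"] by (auto simp: H_def split: if_splits)
    qed
  qed
qed

text \<open>The comparison of \<open>X\<close> with itself.\<close>

lemma jordan_basis:
  fixes X :: "complex^'n^'n"
  assumes "nilpotent_matrix X"
  shows "\<exists>f \<eta>. fspan f CARD('n) = UNIV \<and> (\<forall>j. \<eta> j \<longrightarrow> j > (0::nat)) \<and>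
    (\<forall>j<CARD('n). X *v f j = (if \<eta> j then f (j - 1) else 0))"
proof -
  obtain m where m: "mpow X m = 0" using assms by (auto simp: nilpotent_matrix_iff)
  have "\<exists>f f' \<eta>. UNIV = fspan f CARD('n) \<and> UNIV = fspan f' CARD('n) \<and>
    (\<forall>j<CARD('n). X *v f j = (if \<eta> j then f (j - 1) else 0) \<and> X *v f' j = (if \<eta> j then f' (j - 1) else 0)) \<and>
    (\<forall>j. \<eta> j \<longrightarrow> j > (0::nat))"
    by (rule same_ranks_bases[where m = m]) (simp_all add: m card_cart_basis)
  then obtain f f' \<eta> where ff: "UNIV = fspan f CARD('n) \<and> UNIV = fspan f' CARD('n) \<and>
    (\<forall>j<CARD('n). X *v f j = (if \<eta> j then f (j - 1) else 0) \<and> X *v f' j = (if \<eta> j then f' (j - 1) else 0)) \<and>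
    (\<forall>j. \<eta> j \<longrightarrow> j > (0::nat))" by (elim exE)
  show ?thesis
    by (rule exI[of _ f], rule exI[of _ \<eta>], intro conjI allI impI)
      (rule ff[THEN conjunct1, symmetric] ff[THEN conjunct2, THEN conjunct2, THEN conjunct2, rule_format]
        ff[THEN conjunct2, THEN conjunct2, THEN conjunct1, rule_format, THEN conjunct1], assumption?)+
qed

lemma conj_of_same_ranks:
  fixes X X' :: "complex^'n^'n"
  assumes "nilpotent_matrix X" "nilpotent_matrix X'"
    and r: "\<And>k. rk (mpow X k) UNIV = rk (mpow X' k) UNIV"
  shows "\<exists>T. invertible T \<and> T ** X = X' ** T"
proof -
  obtain a b where ab: "mpow X a = 0" "mpow X' b = 0" using assms by (auto simp: nilpotent_matrix_iff)
  have 1: "mpow X (a + b) = 0" "mpow X' (a + b) = 0" by (simp_all add: mpow_add ab)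
  have "\<exists>f f' \<eta>. UNIV = fspan f CARD('n) \<and> UNIV = fspan f' CARD('n) \<and>
    (\<forall>j<CARD('n). X *v f j = (if \<eta> j then f (j - 1) else 0) \<and> X' *v f' j = (if \<eta> j then f' (j - 1) else 0)) \<and>
    (\<forall>j. \<eta> j \<longrightarrow> j > (0::nat))"
    by (rule same_ranks_bases[where m = "a + b"]) (simp_all add: 1 r card_cart_basis)
  then obtain f f' \<eta> where ff: "UNIV = fspan f CARD('n) \<and> UNIV = fspan f' CARD('n) \<and>
    (\<forall>j<CARD('n). X *v f j = (if \<eta> j then f (j - 1) else 0) \<and> X' *v f' j = (if \<eta> j then f' (j - 1) else 0)) \<and>
    (\<forall>j. \<eta> j \<longrightarrow> j > (0::nat))" by (elim exE)
  note f = ff[THEN conjunct1, symmetric] ff[THEN conjunct2, THEN conjunct1, symmetric]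
      ff[THEN conjunct2, THEN conjunct2, THEN conjunct1, rule_format, THEN conjunct1]
      ff[THEN conjunct2, THEN conjunct2, THEN conjunct1, rule_format, THEN conjunct2]
  obtain T where T: "invertible T" "\<And>j. j < CARD('n) \<Longrightarrow> T *v f j = f' j"
    using ex_basis_map[OF f(1,2)] by blast
  have "T ** X = X' ** T"
    by (rule matrix_eq_on_basis[OF f(1)]) (auto simp: matrix_vector_mul_assoc[symmetric] T f)
  with T(1) show ?thesis by blast
qed

section \<open>Square roots of matrices\<close>

text \<open>Induction over the roots of \<open>m\<close>. A square root \<open>p\<close> of the
  indeterminate modulo m' is replaced by p + c m', where \<open>c\<close> has to satisfy a quadratic
  equation at the new root \<open>a\<close>. If m' vanishes at \<open>a\<close>, the equation
  becomes linear with coefficient 2 p(a), which is nonzero because p(a)^2 = a and \<open>a\<close>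
  is not 0.\<close>

lemma poly_sqrt_mod:
  fixes m :: "complex poly"
  assumes "m \<noteq> 0" "poly m 0 \<noteq> 0"
  shows "\<exists>p. m dvd p * p - [:0, 1:]"
  using assms
proof (induction "degree m" arbitrary: m)
  case 0
  then have "is_unit m" by (simp add: is_unit_iff_degree)
  then show ?case using unit_imp_dvd by blast
next
  case (Suc d)
  then obtain a where a: "poly m a = 0"
    using fundamental_theorem_of_algebra[of m] by (auto simp: constant_degree)
  then obtain m' where m': "m = [:- a, 1:] * m'" by (metis dvdE poly_eq_0_iff_dvd)
  have a0: "a \<noteq> 0" using a Suc.prems by auto
  have m'0: "m' \<noteq> 0" "poly m' 0 \<noteq> 0" using Suc.prems by (auto simp: m')
  have "degree m = Suc (degree m')" unfolding m' using m'0 by (subst degree_mult_eq) auto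
  with Suc m'0 obtain p r where p: "p * p - [:0, 1:] = m' * r" by (metis Suc_inject dvdE)
  have "\<exists>c. poly r a + 2 * c * poly p a + c * c * poly m' a = 0"
  proof (cases "poly m' a = 0")
    case True
    have "poly p a * poly p a = a"
      using arg_cong[OF p, of "\<lambda>p. poly p a"] True by simp
    then have "poly p a \<noteq> 0" using a0 by auto
    then show ?thesis using True by (intro exI[of _ "- poly r a / (2 * poly p a)"]) simp
  next
    case False
    then have "\<not> constant (poly [:poly r a, 2 * poly p a, poly m' a:])"
      by (simp add: constant_degree)
    then obtain c where "poly [:poly r a, 2 * poly p a, poly m' a:] c = 0"
      using fundamental_theorem_of_algebra by blast
    then show ?thesis by (intro exI[of _ c]) (simp add: algebra_simps)
  qed
  then obtain c where c: "poly r a + 2 * c * poly p a + c * c * poly m' a = 0" by blast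
  have "poly (r + smult (2 * c) p + smult (c * c) m') a = 0" using c by simp
  then obtain s where s: "r + smult (2 * c) p + smult (c * c) m' = [:- a, 1:] * s"
    by (metis dvdE poly_eq_0_iff_dvd)
  have "(p + smult c m') * (p + smult c m') - [:0, 1:] = (p * p - [:0, 1:]) + m' * (smult (2 * c) p + smult (c * c) m')"
  proof -
    have "(p + C * m') * (p + C * m') - x = (p * p - x) + m' * ((C + C) * p + (C * C) * m')" for C x :: "complex poly"
      by (simp add: algebra_simps)
    from this[of "[:c:]" "[:0, 1:]"] show ?thesis by simp
  qed
  also have "\<dots> = m' * (r + smult (2 * c) p + smult (c * c) m')" unfolding p by (simp add: algebra_simps)
  also have "\<dots> = m * s" unfolding s m' by (simp only: mult_ac)
  finally show ?case by (metis dvd_triv_left)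
qed

text \<open>The product of the relations for the vectors of the standard basis; polynomials in
  \<open>S\<close> commute, so each factor can be applied to its own vector before the
  others.\<close>

lemma ex_annihilating_poly:
  fixes S :: "complex^'n^'n"
  shows "\<exists>p. p \<noteq> 0 \<and> pm p S = 0"
proof -
  have "\<exists>p. p \<noteq> 0 \<and> (\<forall>i\<in>I. pm p S *v axis i 1 = 0)" if "finite I" for I :: "'n set"
    using that
  proof (induction I)
    case empty
    show ?case by (rule exI[of _ 1]) simp
  next
    case (insert i I)
    then obtain p where p: "p \<noteq> 0" "\<And>j. j \<in> I \<Longrightarrow> pm p S *v axis j 1 = 0" by blast
    obtain r where r: "r \<noteq> 0" "pm r S *v axis i 1 = 0" using ex_krylov_relation by blast
    have "pm (r * p) S *v axis j 1 = 0" if "j \<in> insert i I" for j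
    proof (cases "j = i")
      case True
      have "pm (r * p) S *v axis i 1 = pm p S *v (pm r S *v axis i 1)"
        by (subst mult.commute) (simp add: pm_mult matrix_vector_mul_assoc)
      then show ?thesis using r True by simp
    next
      case False
      then show ?thesis using p that by (simp add: pm_mult matrix_vector_mul_assoc[symmetric])
    qed
    then show ?case using p r by (intro exI[of _ "r * p"]) auto
  qed
  from this[of UNIV] obtain p where p: "p \<noteq> 0" "\<And>i. pm p S *v axis i 1 = 0" by auto
  have "pm p S *v x = 0" for x
  proof -
    have "pm p S *v x = (\<Sum>i\<in>UNIV. x $ i *s (pm p S *v axis i 1))"
      by (subst basis_expansion[of x, symmetric]) (simp add: vec.sum)
    then show ?thesis using p by simp
  qed
  then have "pm p S = 0" by (intro matrix_eqI) simp
  then show ?thesis using p by blast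
qed

text \<open>The minimal polynomial of an invertible matrix does not vanish at 0, so the
  indeterminate is a square modulo it. A root that is a polynomial in \<open>S\<close> inherits
  self-adjointness and commutes with everything that commutes with \<open>S\<close>.\<close>

lemma ex_matrix_sqrt:
  fixes S :: "complex^'n^'n"
  assumes "invertible S"
  shows "\<exists>p. pm p S ** pm p S = S"
proof -
  define P where "P p \<longleftrightarrow> p \<noteq> 0 \<and> pm p S = 0" for p
  have "\<exists>p. P p" using ex_annihilating_poly by (auto simp: P_def)
  then obtain m where m: "P m" and min: "\<And>q. P q \<Longrightarrow> degree m \<le> degree q"
    using ex_has_least_nat[of P _ degree] by metis
  have "poly m 0 \<noteq> 0"
  proof
    assume "poly m 0 = 0"
    then obtain q where q: "m = [:0, 1:] * q" by (metis dvdE minus_zero poly_eq_0_iff_dvd)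
    then have q0: "q \<noteq> 0" using m by (auto simp: P_def)
    have "S ** pm q S = 0" using m by (simp add: P_def q)
    then have "pm q S = 0" by (metis assms matrix_inv_conj(2) times0_right)
    then have "degree m \<le> degree q" using min q0 by (simp add: P_def)
    then show False unfolding q using q0 by (simp add: degree_mult_eq)
  qed
  then obtain p where "m dvd p * p - [:0, 1:]" using poly_sqrt_mod m by (auto simp: P_def)
  then obtain r where "p * p - [:0, 1:] = m * r" by (auto elim: dvdE)
  then have "pm (p * p) S - pm [:0, 1:] S = pm m S ** pm r S"
    by (metis pm_diff pm_mult)
  then show ?thesis using m by (intro exI[of _ p]) (simp add: P_def pm_mult)
qed

section \<open>Bilinear forms\<close>

definition bil :: "complex^'n^'n \<Rightarrow> complex^'n \<Rightarrow> complex^'n \<Rightarrow> complex"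
  where "bil M x y = (\<Sum>i\<in>UNIV. x $ i * (M *v y) $ i)"

lemma bil_add_left: "bil M (x + x') y = bil M x y + bil M x' y"
  and bil_scale_left: "bil M (c *s x) y = c * bil M x y"
  and bil_add_right: "bil M x (y + y') = bil M x y + bil M x y'"
  and bil_scale_right: "bil M x (c *s y) = c * bil M x y"
  by (simp_all add: bil_def algebra_simps sum.distrib sum_distrib_left matrix_vector_right_distrib)

lemma bil_0 [simp]: "bil M 0 y = 0" "bil M x 0 = 0"
  by (simp_all add: bil_def)

lemma bil_diff_left: "bil M (x - x') y = bil M x y - bil M x' y"
  and bil_diff_right: "bil M x (y - y') = bil M x y - bil M x y'"
  by (simp_all add: bil_def algebra_simps sum_subtractf matrix_vector_mult_diff_distrib)

lemma bil_minus_left: "bil M (- x) y = - bil M x y"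
  and bil_minus_right: "bil M x (- y) = - bil M x y"
  using bil_diff_left[of M 0 x y] bil_diff_right[of M x 0 y] by simp_all

lemma bil_sum_left: "bil M (sum f I) y = (\<Sum>i\<in>I. bil M (f i) y)"
  by (induction I rule: infinite_finite_induct) (simp_all add: bil_add_left)

lemma bil_sum_right: "bil M x (sum f I) = (\<Sum>i\<in>I. bil M x (f i))"
  by (induction I rule: infinite_finite_induct) (simp_all add: bil_add_right)

lemmas bil_simps = bil_add_left bil_add_right bil_scale_left bil_scale_right bil_diff_left bil_diff_right
  bil_minus_left bil_minus_right

lemma bil_mult_right: "bil M x (A *v y) = bil (M ** A) x y"
  by (simp add: bil_def matrix_vector_mul_assoc)

lemma bil_transpose: "bil (transpose M) x y = bil M y x"
proof -
  have "bil (transpose M) x y = (\<Sum>i\<in>UNIV. \<Sum>j\<in>UNIV. x $ i * (M $ j $ i * y $ j))"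
    by (simp add: bil_def matrix_vector_mult_def transpose_def sum_distrib_left)
  also have "\<dots> = (\<Sum>j\<in>UNIV. \<Sum>i\<in>UNIV. y $ j * (M $ j $ i * x $ i))"
    by (subst sum.swap) (simp add: mult_ac)
  also have "\<dots> = bil M y x"
    by (simp add: bil_def matrix_vector_mult_def sum_distrib_left)
  finally show ?thesis .
qed

lemma bil_mult_left: "bil M (A *v x) y = bil (transpose A ** M) x y"
proof -
  have "bil M (A *v x) y = bil (transpose M) y (A *v x)" by (simp add: bil_transpose)
  also have "\<dots> = bil (transpose (transpose A ** M)) y x"
    by (simp add: bil_mult_right matrix_transpose_mul)
  finally show ?thesis by (simp only: bil_transpose)
qed

lemma bil_axis: "bil M (axis i 1) y = (M *v y) $ i"
  by (simp add: bil_def axis_def if_distrib[of "\<lambda>t. t * _"] cong: if_cong)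

lemma bil_eqI: "(\<And>x y. bil M x y = bil M' x y) \<Longrightarrow> M = M'"
  by (rule matrix_eqI) (metis bil_axis vec_eq_iff)

lemma bil_cscale: "bil (cscale c M) x y = c * bil M x y"
  by (simp add: bil_def sum_distrib_left mult_ac)

lemma bil_matrix_add: "bil (M + M') x y = bil M x y + bil M' x y"
  by (simp add: bil_def matrix_vector_mult_add_rdistrib algebra_simps sum.distrib)

lemma bil_matrix_0 [simp]: "bil 0 x y = 0"
  by (simp add: bil_def)

text \<open>The skew elements with respect to \<open>M\<close>; the orthogonal or the symplectic
  algebra according to the symmetry of \<open>M\<close>.\<close>

definition so :: "complex^'n^'n \<Rightarrow> (complex^'n^'n) set"
  where "so M = {X. \<forall>x y. bil M (X *v x) y = - bil M x (X *v y)}"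

definition Iso :: "complex^'n^'n \<Rightarrow> (complex^'n^'n) set"
  where "Iso M = {g. \<forall>x y. bil M (g *v x) (g *v y) = bil M x y}"

lemma so_iff: "X \<in> so M \<longleftrightarrow> transpose X ** M + M ** X = 0"
proof -
  have "X \<in> so M \<longleftrightarrow> (\<forall>x y. bil (transpose X ** M + M ** X) x y = bil 0 x y)"
    by (simp add: so_def bil_mult_left bil_mult_right bil_matrix_add eq_neg_iff_add_eq_0)
  then show ?thesis using bil_eqI by metis
qed

lemma Iso_iff: "g \<in> Iso M \<longleftrightarrow> transpose g ** M ** g = M"
proof -
  have "g \<in> Iso M \<longleftrightarrow> (\<forall>x y. bil (transpose g ** M ** g) x y = bil M x y)"
    by (simp add: Iso_def bil_mult_left bil_mult_right matrix_mul_assoc)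
  then show ?thesis using bil_eqI by metis
qed

lemma soD: "X \<in> so M \<Longrightarrow> bil M (X *v x) y = - bil M x (X *v y)"
  by (simp add: so_def)

lemma IsoD: "g \<in> Iso M \<Longrightarrow> bil M (g *v x) (g *v y) = bil M x y"
  by (simp add: Iso_def)

lemma mpow_so: "X \<in> so M \<Longrightarrow> bil M (mpow X k *v x) y = (- 1) ^ k * bil M x (mpow X k *v y)"
proof (induction k arbitrary: y)
  case (Suc k)
  have "bil M (mpow X (Suc k) *v x) y = - bil M (mpow X k *v x) (X *v y)"
    using soD[OF Suc.prems] by (simp add: mpow_mult_vec_Suc[symmetric])
  then show ?case using Suc by (simp add: matrix_vector_mul_assoc mpow_Suc_right)
qed simp

text \<open>The sign \<open>\<epsilon>\<close> distinguishes the orthogonal case 1 from the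
  symplectic case -1, and both are treated together as far as possible.\<close>

locale form =
  fixes M :: "complex^'n^'n" and \<epsilon> :: complex
  assumes eps: "\<epsilon> = 1 \<or> \<epsilon> = - 1" and sym: "transpose M = cscale \<epsilon> M" and inv: "invertible M"
begin

abbreviation B where "B \<equiv> bil M"

lemma eps_sq [simp]: "\<epsilon> * \<epsilon> = 1" "\<epsilon> * (\<epsilon> * x) = x" "\<epsilon> \<noteq> 0"
  using eps by auto

lemma B_sym: "B x y = \<epsilon> * B y x"
  using bil_transpose[of M y x] unfolding sym by (simp add: bil_cscale)

lemma B_sym_0: "B x y = 0 \<longleftrightarrow> B y x = 0"
  using B_sym[of x y] eps_sq(3) by simp

lemma nondeg: "(\<And>x. B x y = 0) \<Longrightarrow> y = 0"
proof -
  assume "\<And>x. B x y = 0"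
  then have "M *v y = 0" by (simp add: vec_eq_iff bil_axis[symmetric])
  then show "y = 0" by (metis inv matrix_inv_mult(4) matrix_vector_mult_0_right)
qed

lemma B_eqI: "(\<And>x. B x y = B x z) \<Longrightarrow> y = z"
  using nondeg[of "y - z"] by (simp add: bil_diff_right)

definition adj :: "complex^'n^'n \<Rightarrow> complex^'n^'n"
  where "adj T = matrix_inv M ** (transpose T ** M)"

lemma adj: "B (T *v x) y = B x (adj T *v y)"
  by (simp add: bil_mult_left bil_mult_right adj_def matrix_inv_conj[OF inv])

lemma det_Iso:
  assumes "g \<in> Iso M" shows "det g = 1 \<or> det g = - 1"
proof -
  have "det g * det M * det g = det M"
    using assms by (metis Iso_iff det_mul det_transpose)
  then have "det g * det g = 1" using inv by (auto simp: invertible_det_nz)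
  then show ?thesis by (metis square_eq_1_iff)
qed

lemma invertible_Iso: "g \<in> Iso M \<Longrightarrow> invertible g"
  using det_Iso[of g] by (auto simp: invertible_det_nz)

lemma Iso_mult: "g \<in> Iso M \<Longrightarrow> h \<in> Iso M \<Longrightarrow> g ** h \<in> Iso M"
  by (simp add: Iso_def matrix_vector_mul_assoc[symmetric])

lemma Iso_inv: assumes "g \<in> Iso M" shows "matrix_inv g \<in> Iso M"
  unfolding Iso_def mem_Collect_eq
  by (metis IsoD[OF assms] matrix_inv_mult(3)[OF invertible_Iso[OF assms]])

lemma self_adjoint_pm:
  assumes "\<And>x y. B (S *v x) y = B x (S *v y)"
  shows "B (pm p S *v x) y = B x (pm p S *v y)"
proof (induction p arbitrary: x y)
  case (pCons a p)
  have "pm p S *v (S *v y) = S *v (pm p S *v y)"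
    using pm_commute[of S S p] by (simp add: matrix_vector_mul_assoc)
  then show ?case
    by (simp add: matrix_vector_mult_add_rdistrib matrix_vector_mul_assoc[symmetric] bil_simps assms pCons.IH)
qed simp

text \<open>The matrix \<open>adj T ** T\<close> measures how far an intertwiner is from being an
  isometry. It commutes with \<open>X\<close> because the signs from the skewness of
  \<open>X\<close> and \<open>X'\<close> cancel.\<close>

lemma adj_mult_self:
  assumes "X \<in> so M" "X' \<in> so M" "T ** X = X' ** T"
  shows "B (T *v x) (T *v y) = B x ((adj T ** T) *v y)"
    "B ((adj T ** T) *v x) y = B x ((adj T ** T) *v y)"
    "(adj T ** T) ** X = X ** (adj T ** T)"
proof -
  show 1: "B (T *v x) (T *v y) = B x ((adj T ** T) *v y)" for x y
    by (simp add: adj matrix_vector_mul_assoc)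
  show "B ((adj T ** T) *v x) y = B x ((adj T ** T) *v y)"
    by (subst B_sym, subst 1[symmetric], subst B_sym, simp add: 1)
  show "(adj T ** T) ** X = X ** (adj T ** T)"
  proof (rule matrix_eqI, rule B_eqI)
    fix x y
    have T: "T *v (X *v z) = X' *v (T *v z)" for z using assms(3) by (simp add: matrix_vector_mul_assoc)
    have "B x ((adj T ** T) *v (X *v y)) = B (T *v x) (X' *v (T *v y))" unfolding T[symmetric] 1 ..
    also have "\<dots> = - B (T *v (X *v x)) (T *v y)" unfolding T by (simp add: soD[OF assms(2)])
    also have "\<dots> = B x (X *v ((adj T ** T) *v y))" unfolding 1 by (simp add: soD[OF assms(1)])
    finally show "B x ((adj T ** T ** X) *v y) = B x ((X ** (adj T ** T)) *v y)"
      by (simp add: matrix_vector_mul_assoc[symmetric])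
  qed
qed

lemma matrix_inv_commute:
  assumes "invertible (R :: complex^'n^'n)" "R ** X = X ** R"
  shows "matrix_inv R ** X = X ** matrix_inv R"
  by (metis assms matrix_inv_conj(2,3) matrix_mul_assoc)

text \<open>The isometric factor in the polar decomposition of \<open>T\<close>; it still
  intertwines because \<open>R\<close> commutes with \<open>X\<close>.\<close>

lemma iso_of_sqrt:
  assumes "invertible T" "T ** X = X' ** T" "R ** R = adj T ** T" "R ** X = X ** R"
    and "\<And>x y. B (R *v x) y = B x (R *v y)" and R: "invertible R"
  shows "T ** matrix_inv R \<in> Iso M" "(T ** matrix_inv R) ** X = X' ** (T ** matrix_inv R)"
proof -
  have "B (T *v (matrix_inv R *v x)) (T *v (matrix_inv R *v y)) = B x y" for x y
  proof -
    have "B (T *v (matrix_inv R *v x)) (T *v (matrix_inv R *v y))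
        = B (matrix_inv R *v x) ((R ** R) *v (matrix_inv R *v y))"
      unfolding assms(3) matrix_vector_mul_assoc[symmetric] by (rule adj)
    also have "\<dots> = B x y"
      by (simp add: matrix_vector_mul_assoc[symmetric] matrix_inv_mult[OF R] assms(5)[symmetric])
    finally show ?thesis .
  qed
  then show "T ** matrix_inv R \<in> Iso M" by (simp add: Iso_def matrix_vector_mul_assoc[symmetric])
  have "T ** matrix_inv R ** X = T ** (X ** matrix_inv R)"
    unfolding matrix_inv_commute[OF R assms(4), symmetric] by (simp add: matrix_mul_assoc)
  then show "T ** matrix_inv R ** X = X' ** (T ** matrix_inv R)"
    by (simp add: matrix_mul_assoc assms(2))
qed

text \<open>
  Conjugate elements of the Lie algebra are conjugate by an isometry: an intertwiner \<open>T\<close> is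
  corrected by a square root of \<open>T\<^sup>* T\<close>, which commutes with \<open>X\<close>.
\<close>

lemma iso_conj:
  assumes "X \<in> so M" "X' \<in> so M" "invertible T" "T ** X = X' ** T"
  shows "\<exists>g\<in>Iso M. g ** X = X' ** g"
proof -
  let ?S = "adj T ** T"
  note S = adj_mult_self[OF assms(1,2,4)]
  have "invertible (adj T)"
    unfolding adj_def by (intro invertible_mult invertible_matrix_inv inv) (metis assms(3) invertible_det_nz det_transpose)
  then have "invertible ?S" by (simp add: assms(3) invertible_mult)
  then obtain p where p: "pm p ?S ** pm p ?S = ?S" using ex_matrix_sqrt by blast
  have "invertible (pm p ?S)"
    by (metis \<open>invertible ?S\<close> p det_mul invertible_det_nz mult_eq_0_iff)
  moreover have "pm p ?S ** X = X ** pm p ?S" using pm_commute[of X ?S p] S(3) by simp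
  ultimately show ?thesis
    using iso_of_sqrt[OF assms(3,4) p _ self_adjoint_pm[OF S(2)]] by blast
qed

end

section \<open>Limits of matrices\<close>

lemma scaleR_matrix_mult: "(r *\<^sub>R A) ** B = r *\<^sub>R (A ** B)" "A ** (r *\<^sub>R B) = r *\<^sub>R (A ** B)"
  for A B :: "complex^'n^'n"
  by (simp_all add: vec_eq_iff matrix_matrix_mult_def scaleR_sum_right mult_scaleR_left mult_scaleR_right)

lemma scaleR_eq_cscale: "r *\<^sub>R A = cscale (of_real r) A"
  by (simp add: vec_eq_iff cscale_def scaleR_conv_of_real[where 'a=complex])

lemma bounded_bilinear_matrix_mult: "bounded_bilinear ((**) :: complex^'n^'n \<Rightarrow> complex^'n^'n \<Rightarrow> complex^'n^'n)"
proof -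
  have "bilinear ((**) :: complex^'n^'n \<Rightarrow> complex^'n^'n \<Rightarrow> complex^'n^'n)"
    by (auto simp: bilinear_def intro!: linearI simp: matrix_add_ldistrib matrix_add_rdistrib scaleR_matrix_mult)
  then show ?thesis by (simp add: bilinear_conv_bounded_bilinear)
qed

lemmas tendsto_matrix_mult [tendsto_intros] = bounded_bilinear.tendsto[OF bounded_bilinear_matrix_mult]
lemmas continuous_on_matrix_mult [continuous_intros] = bounded_bilinear.continuous_on[OF bounded_bilinear_matrix_mult]

lemma tendsto_det [tendsto_intros]:
  fixes f :: "'b \<Rightarrow> complex^'n^'n"
  assumes "(f \<longlongrightarrow> A) F" shows "((\<lambda>x. det (f x)) \<longlongrightarrow> det A) F"
  unfolding det_def by (intro tendsto_intros tendsto_vec_nth assms)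

lemma tendsto_transpose [tendsto_intros]:
  fixes f :: "'b \<Rightarrow> complex^'n^'n"
  assumes "(f \<longlongrightarrow> A) F" shows "((\<lambda>x. transpose (f x)) \<longlongrightarrow> transpose A) F"
  unfolding transpose_def by (intro tendsto_vec_lambda tendsto_vec_nth assms)

lemma tendsto_mult_vec [tendsto_intros]:
  fixes f :: "'b \<Rightarrow> complex^'n^'n"
  assumes "(f \<longlongrightarrow> A) F" shows "((\<lambda>x. f x *v v) \<longlongrightarrow> A *v v) F"
  unfolding matrix_vector_mult_def by (intro tendsto_vec_lambda tendsto_intros tendsto_vec_nth assms)

lemma tendsto_bil [tendsto_intros]:
  assumes "(f \<longlongrightarrow> a) F" "(g \<longlongrightarrow> b) F" shows "((\<lambda>x. bil M (f x) (g x)) \<longlongrightarrow> bil M a b) F"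
  unfolding bil_def matrix_vector_mult_def
  by (auto intro!: tendsto_intros tendsto_vec_lambda tendsto_vec_nth[OF assms(1)] tendsto_vec_nth[OF assms(2)])

lemma tendsto_mpow [tendsto_intros]:
  fixes f :: "'b \<Rightarrow> complex^'n^'n"
  assumes "(f \<longlongrightarrow> A) F" shows "((\<lambda>x. mpow (f x) k) \<longlongrightarrow> mpow A k) F"
  by (induction k) (auto simp: mpow_Suc intro!: tendsto_intros assms)

text \<open>The fixed points of \<open>Y \<mapsto> (E - Y\<^sup>2) / 2\<close> are the \<open>Y\<close> with \<open>(1 + Y)\<^sup>2 = 1 + E\<close>.\<close>

lemma small_matrix_sqrt:
  fixes C :: "(complex^'n^'n) set"
  assumes C: "closed C" "0 \<in> C" "\<And>x y. x \<in> C \<Longrightarrow> y \<in> C \<Longrightarrow> x - y \<in> C"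
    "\<And>x r. x \<in> C \<Longrightarrow> r *\<^sub>R x \<in> C" "\<And>x. x \<in> C \<Longrightarrow> x ** x \<in> C" and \<rho>: "\<rho> > 0"
  shows "\<exists>\<eta>>0. \<forall>E\<in>C. norm E < \<eta> \<longrightarrow> (\<exists>Y\<in>C. norm Y \<le> \<rho> \<and> (mat 1 + Y) ** (mat 1 + Y) = mat 1 + E)"
proof -
  obtain K where K: "K > 0" "\<And>(a :: complex^'n^'n) (b :: complex^'n^'n). norm (a ** b) \<le> norm a * norm b * K"
    using bounded_bilinear.pos_bounded[OF bounded_bilinear_matrix_mult[where 'n='n]] by auto
  \<comment> \<open>On the ball of radius \<open>r\<close> the bound K |Y| \<le> 1/2 makes the map a
    contraction with factor 1/2. If also |E| < r, it maps the ball into itself, since (r + r/2) / 2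
    \<le> r.\<close>
  define r where "r = min \<rho> (1 / (2 * K))"
  have r: "r > 0" "r \<le> \<rho>" "K * r \<le> 1 / 2"
    using K(1) \<rho> by (auto simp: r_def min_def field_simps)
  have Kr: "K * norm Y \<le> 1 / 2" if "norm Y \<le> r" for Y :: "complex^'n^'n"
    using mult_left_mono[OF that, of K] K(1) r(3) by linarith
  show ?thesis
  proof (intro exI[of _ r] conjI ballI impI)
    show "r > 0" by fact
    fix E assume E: "E \<in> C" "norm E < r"
    let ?D = "C \<inter> cball 0 r"
    let ?f = "\<lambda>Y. (1 / 2) *\<^sub>R (E - Y ** Y)"
    have "\<exists>!Y\<in>?D. ?f Y = Y"
    proof (rule Banach_fix[of _ "1 / 2"])
      show "complete ?D"
        by (intro compact_imp_complete closed_Int_compact C compact_cball)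
      show "?D \<noteq> {}" using C r by auto
      show "?f ` ?D \<subseteq> ?D"
      proof (intro image_subsetI IntI)
        fix Y assume Y: "Y \<in> ?D"
        show "?f Y \<in> C" using Y E C by auto
        have "norm (Y ** Y) \<le> norm Y * (norm Y * K)" using K(2)[of Y Y] by (simp add: mult_ac)
        also have "\<dots> \<le> r * (1 / 2)"
          using Y r K(1) Kr[of Y] by (intro mult_mono) (auto simp: mult.commute)
        finally have "norm (E - Y ** Y) \<le> r + r / 2" using E norm_triangle_ineq4[of E "Y ** Y"] by simp
        then show "?f Y \<in> cball 0 r" using r by simp
      qed
      fix Y Y' assume Y: "Y \<in> ?D" "Y' \<in> ?D"
      have "dist (?f Y) (?f Y') = norm ((1/2) *\<^sub>R (Y' ** Y' - Y ** Y))"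
        unfolding dist_norm scaleR_diff_right[symmetric] by simp
      also have "\<dots> = (1 / 2) * norm (Y' ** Y' - Y ** Y)" by simp
      also have "Y' ** Y' - Y ** Y = Y' ** (Y' - Y) + (Y' - Y) ** Y" by (simp add: matrix_diff_distrib)
      also have "(1/2) * norm \<dots> \<le> (1/2) * (norm Y' * norm (Y' - Y) * K + norm (Y' - Y) * norm Y * K)"
        by (intro mult_left_mono order_trans[OF norm_triangle_ineq] add_mono K(2)) simp
      also have "\<dots> = (1/2) * ((K * norm Y' + K * norm Y) * norm (Y' - Y))" by (simp add: algebra_simps)
      also have "\<dots> \<le> (1/2) * ((1/2 + 1/2) * norm (Y' - Y))"
      proof (intro mult_left_mono mult_right_mono add_mono)
        show "K * norm Y' \<le> 1 / 2" "K * norm Y \<le> 1 / 2"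
          using Y Kr by auto
      qed auto
      finally show "dist (?f Y) (?f Y') \<le> 1 / 2 * dist Y Y'" by (simp add: dist_norm norm_minus_commute)
    qed auto
    then obtain Y where Y: "Y \<in> C" "norm Y \<le> r" "?f Y = Y" by auto
    have "2 *\<^sub>R ?f Y = 2 *\<^sub>R Y" using Y(3) by simp
    then have "E - Y ** Y = 2 *\<^sub>R Y" by simp
    then have "(mat 1 + Y) ** (mat 1 + Y) = mat 1 + E"
      by (simp add: matrix_add_ldistrib matrix_add_rdistrib scaleR_2 algebra_simps)
    with Y r show "\<exists>Y\<in>C. norm Y \<le> \<rho> \<and> (mat 1 + Y) ** (mat 1 + Y) = mat 1 + E" by force
  qed
qed

text \<open>
  The intertwiners of \<open>Z\<close> and \<open>Z'\<close> form a space of the same dimension as the commutant of \<open>Z\<close>;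
  so it is still complementary to the orthogonal complement of that commutant when \<open>Z'\<close> is close to \<open>Z\<close>.
\<close>

lemma intertwiner_near_one:
  fixes Z :: "complex^'n^'n"
  assumes "\<rho> > 0"
  shows "\<exists>\<eta>>0. \<forall>Z' T0. norm (Z' - Z) < \<eta> \<longrightarrow> invertible T0 \<longrightarrow> T0 ** Z = Z' ** T0 \<longrightarrow>
    (\<exists>T. T ** Z = Z' ** T \<and> norm (T - mat 1) \<le> \<rho>)"
proof -
  define L where "L Z' T = T ** Z - Z' ** T" for Z' T :: "complex^'n^'n"
  have lin: "linear (L Z')" for Z'
    by (auto intro!: linearI simp: L_def matrix_add_ldistrib matrix_add_rdistrib scaleR_matrix_mult algebra_simps)
  have sub: "subspace {T. L Z' T = 0}" for Z'
    using linear_subspace_kernel[OF lin] .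
  define Kr where "Kr = {T. L Z T = 0}"
  define P where "P = {y. \<forall>x\<in>Kr. orthogonal x y}"
  have P: "subspace P" unfolding P_def by (rule subspace_orthogonal_to_vectors)
  have dimP: "dim P + dim Kr = DIM(complex^'n^'n)"
    using dim_subspace_orthogonal_to_vectors[of Kr UNIV] sub by (simp add: P_def Kr_def)
  have "\<forall>x\<in>P. L Z x = 0 \<longrightarrow> x = 0"
    by (auto simp: P_def Kr_def orthogonal_self)
  then obtain e where e: "e > 0" "\<And>x. x \<in> P \<Longrightarrow> norm (L Z x) \<ge> e * norm x"
    using injective_imp_isometric[OF closed_subspace[OF P] P linear_conv_bounded_linear[THEN iffD1, OF lin[of Z]]] by auto
  obtain K where K: "K > 0" "\<And>(a :: complex^'n^'n) (b :: complex^'n^'n). norm (a ** b) \<le> norm a * norm b * K"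
    using bounded_bilinear.pos_bounded[OF bounded_bilinear_matrix_mult[where 'n='n]] by auto
  \<comment> \<open>The first bound keeps \<open>L Z'\<close> bounded below by e/2 on the complement
    \<open>P\<close>; the second makes the \<open>P\<close>-component of the identity matrix at most
    \<open>\<rho>\<close>, because \<open>L Z'\<close> takes this component to Z - Z'.\<close>
  define \<eta> where "\<eta> = min (e / (2 * K)) (\<rho> * e / 2)"
  show ?thesis
  proof (intro exI[of _ \<eta>] conjI allI impI)
    show "\<eta> > 0" using e(1) K(1) assms by (auto simp: \<eta>_def)
    fix Z' T0 assume Z': "norm (Z' - Z) < \<eta>" and T0: "invertible T0" "T0 ** Z = Z' ** T0"
    have kz: "K * norm (Z' - Z) \<le> e / 2"
      using Z' K(1) by (auto simp: \<eta>_def field_simps)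
    have low: "norm (L Z' x) \<ge> (e / 2) * norm x" if "x \<in> P" for x
    proof -
      have "L Z' x = L Z x - (Z' - Z) ** x" by (simp add: L_def matrix_diff_distrib)
      then have "norm (L Z' x) \<ge> norm (L Z x) - norm ((Z' - Z) ** x)" by (metis norm_triangle_ineq2)
      moreover have "norm ((Z' - Z) ** x) \<le> (K * norm (Z' - Z)) * norm x"
        using K(2)[of "Z' - Z" x] by (simp add: mult_ac)
      moreover have "\<dots> \<le> (e / 2) * norm x" using kz by (intro mult_right_mono) auto
      ultimately show ?thesis using e(2)[OF that] by simp
    qed
    define Kr' where "Kr' = {T. L Z' T = 0}"
    have "Kr' \<inter> P \<subseteq> {0}"
    proof
      fix x assume x: "x \<in> Kr' \<inter> P"
      then have "0 \<ge> (e / 2) * norm x" using low[of x] by (simp add: Kr'_def)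
      then show "x \<in> {0}" using e(1) by (simp add: zero_less_mult_iff mult_le_0_iff)
    qed
    moreover have "0 \<in> Kr' \<inter> P" using P linear_0[OF lin] by (simp add: Kr'_def subspace_0)
    ultimately have int: "Kr' \<inter> P = {0}" by auto
    \<comment> \<open>Multiplication by the given invertible intertwiner embeds the commutant of
      \<open>Z\<close> into the space of intertwiners.\<close>
    have "dim Kr \<le> dim Kr'"
    proof -
      have lT: "linear ((**) T0 :: complex^'n^'n \<Rightarrow> complex^'n^'n)"
        by (auto intro!: linearI simp: matrix_add_ldistrib scaleR_matrix_mult)
      have "dim Kr = dim ((**) T0 ` Kr)"
        by (rule dim_image_eq[OF lT, symmetric])
          (rule inj_on_inverseI[where g = "(**) (matrix_inv T0)"], rule matrix_inv_conj(2)[OF T0(1)])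
      also have "\<dots> \<le> dim Kr'"
      proof (rule dim_subset, intro image_subsetI)
        fix T assume "T \<in> Kr"
        then have "T ** Z = Z ** T" by (simp add: Kr_def L_def)
        then have "(T0 ** T) ** Z = Z' ** (T0 ** T)" by (metis T0(2) matrix_mul_assoc)
        then show "T0 ** T \<in> Kr'" by (simp add: Kr'_def L_def)
      qed
      finally show ?thesis .
    qed
    moreover have "dim {x + y |x y. x \<in> Kr' \<and> y \<in> P} + dim (Kr' \<inter> P) = dim Kr' + dim P"
      by (rule dim_sums_Int) (use sub P in \<open>auto simp: Kr'_def\<close>)
    ultimately have "DIM(complex^'n^'n) \<le> dim {x + y |x y. x \<in> Kr' \<and> y \<in> P}"
      using dimP int by simp
    then have "dim {x + y |x y. x \<in> Kr' \<and> y \<in> P} = DIM(complex^'n^'n)"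
      by (intro le_antisym dim_subset_UNIV)
    then have "span {x + y |x y. x \<in> Kr' \<and> y \<in> P} = UNIV"
      by (simp only: dim_eq_full)
    moreover have "subspace {x + y |x y. x \<in> Kr' \<and> y \<in> P}"
      by (rule subspace_sums) (use sub P in \<open>auto simp: Kr'_def\<close>)
    ultimately have "{x + y |x y. x \<in> Kr' \<and> y \<in> P} = UNIV" by (simp only: span_eq_iff[symmetric])
    then have "mat 1 \<in> {x + y |x y. x \<in> Kr' \<and> y \<in> P}" by (simp only: UNIV_I)
    then obtain T x where Tx: "T \<in> Kr'" "x \<in> P" "mat 1 = T + x" by (simp only: mem_Collect_eq) (elim exE conjE, rule that)
    have "L Z' x = L Z' (mat 1)" using Tx linear_add[OF lin] by (simp add: Kr'_def)
    then have "L Z' x = Z - Z'" by (simp add: L_def)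
    then have "(e / 2) * norm x \<le> norm (Z' - Z)" using low[OF Tx(2)] by (simp add: norm_minus_commute)
    also have "\<dots> \<le> \<rho> * e / 2"
      using Z' by (simp add: \<eta>_def)
    finally have "norm x \<le> \<rho>" using e(1) by (simp add: field_simps)
    then show "\<exists>T. T ** Z = Z' ** T \<and> norm (T - mat 1) \<le> \<rho>"
      using Tx by (intro exI[of _ T]) (auto simp: Kr'_def L_def)
  qed
qed

context form
begin

text \<open>Elements of the Lie algebra close to \<open>Z\<close> and conjugate to it are conjugate to it by isometries
  close to \<open>1\<close>, which have determinant \<open>1\<close>.\<close>

lemma iso_conj_near:
  assumes Z: "Z \<in> so M" and Zm: "\<And>m. Zm m \<in> so M" "Zm \<longlonglongrightarrow> Z"
    and conj: "\<And>m. \<exists>T. invertible T \<and> T ** Z = Zm m ** T"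
  shows "\<exists>m. \<exists>g\<in>Iso M. det g = 1 \<and> g ** Z = Zm m ** g"
proof -
  have "\<forall>j. \<exists>N. \<forall>m\<ge>N. \<exists>T. T ** Z = Zm m ** T \<and> norm (T - mat 1) \<le> 1 / Suc j"
  proof
    fix j
    obtain \<eta> where \<eta>: "\<eta> > 0" "\<And>Z' T0. norm (Z' - Z) < \<eta> \<Longrightarrow> invertible T0 \<Longrightarrow> T0 ** Z = Z' ** T0 \<Longrightarrow>
      \<exists>T. T ** Z = Z' ** T \<and> norm (T - mat 1) \<le> 1 / Suc j"
      using intertwiner_near_one[of "1 / Suc j" Z] by auto
    obtain N where "\<And>m. m \<ge> N \<Longrightarrow> norm (Zm m - Z) < \<eta>"
      using LIMSEQ_D[OF Zm(2) \<eta>(1)] by blast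
    then show "\<exists>N. \<forall>m\<ge>N. \<exists>T. T ** Z = Zm m ** T \<and> norm (T - mat 1) \<le> 1 / Suc j"
      using \<eta>(2) conj by blast
  qed
  then obtain \<mu> where "\<And>j. \<exists>T. T ** Z = Zm (\<mu> j) ** T \<and> norm (T - mat 1) \<le> 1 / Suc j"
    by (metis order_refl)
  then obtain T where T: "\<And>j. T j ** Z = Zm (\<mu> j) ** T j" "\<And>j. norm (T j - mat 1) \<le> 1 / Suc j" by metis
  have T1: "T \<longlonglongrightarrow> mat 1"
    by (rule LIM_zero_cancel, rule Lim_null_comparison[OF _ LIMSEQ_inverse_real_of_nat])
      (use T(2) in \<open>auto simp: inverse_eq_divide\<close>)
  define E where "E j = adj (T j) ** T j - mat 1" for j
  have adj1: "adj (mat 1) = mat 1"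
    by (rule matrix_eqI, rule B_eqI) (simp add: adj[symmetric])
  have "E \<longlonglongrightarrow> adj (mat 1) ** mat 1 - mat 1"
    unfolding E_def adj_def by (intro tendsto_intros T1)
  then have E0: "E \<longlonglongrightarrow> 0" by (simp add: adj1)
  \<comment> \<open>The self-adjoint part of the commutant of \<open>Z\<close>. It contains all the
    errors \<open>E j\<close> and is closed under squaring, so the square root of
    \<open>adj (T j) ** T j\<close> near 1 can be taken with the same properties.\<close>
  define C where "C = {Y. Y ** Z = Z ** Y \<and> (\<forall>x y. B (Y *v x) y = B x (Y *v y))}"
  have EC: "E j \<in> C" for j
    using adj_mult_self[OF Z Zm(1) T(1)[of j]]
    by (simp add: C_def E_def matrix_diff_distrib matrix_vector_mult_diff_rdistrib bil_simps)
  have closed: "closed C"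
  proof (rule closed_sequential_limits[THEN iffD2], intro allI impI, elim conjE)
    fix Y l assume Y: "\<forall>n. Y n \<in> C" "Y \<longlonglongrightarrow> l"
    have "(\<lambda>n. Y n ** Z - Z ** Y n) \<longlonglongrightarrow> l ** Z - Z ** l" by (intro tendsto_intros Y)
    moreover have "(\<lambda>n. B (Y n *v x) y - B x (Y n *v y)) \<longlonglongrightarrow> B (l *v x) y - B x (l *v y)" for x y
      by (intro tendsto_intros Y)
    moreover have "Y n ** Z - Z ** Y n = 0" "B (Y n *v x) y - B x (Y n *v y) = 0" for n x y
      using Y(1) by (simp_all add: C_def)
    ultimately show "l \<in> C" by (auto simp: C_def LIMSEQ_const_iff)
  qed
  have sq: "Y ** Y \<in> C" if Y: "Y \<in> C" for Y
  proof -
    have "Y ** Y ** Z = Z ** (Y ** Y)" using Y by (simp add: C_def) (metis matrix_mul_assoc)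
    then show ?thesis using Y by (simp add: C_def matrix_vector_mul_assoc[symmetric])
  qed
  have small: "\<exists>\<eta>>0. \<forall>E\<in>C. norm E < \<eta> \<longrightarrow> (\<exists>Y\<in>C. norm Y \<le> \<rho> \<and> (mat 1 + Y) ** (mat 1 + Y) = mat 1 + E)"
    if "\<rho> > 0" for \<rho>
  proof (rule small_matrix_sqrt[OF closed _ _ _ sq that])
    show "0 \<in> C" by (simp add: C_def)
    show "x - y \<in> C" if "x \<in> C" "y \<in> C" for x y
      using that by (simp add: C_def matrix_diff_distrib matrix_vector_mult_diff_rdistrib bil_simps)
    show "r *\<^sub>R x \<in> C" if "x \<in> C" for x r
      using that by (simp add: C_def scaleR_eq_cscale bil_simps)
  qed
  have "\<exists>j. \<exists>Y\<in>C. norm Y \<le> \<rho> \<and> (mat 1 + Y) ** (mat 1 + Y) = mat 1 + E j \<and> norm (T j - mat 1) \<le> \<rho>"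
    if rho: "\<rho> > 0" for \<rho>
  proof -
    obtain \<eta> where \<eta>: "\<eta> > 0" "\<And>E. E\<in>C \<Longrightarrow> norm E < \<eta> \<Longrightarrow> \<exists>Y\<in>C. norm Y \<le> \<rho> \<and> (mat 1 + Y) ** (mat 1 + Y) = mat 1 + E"
      using small[OF rho] by meson
    have "eventually (\<lambda>j. norm (E j) < \<eta>) sequentially" "eventually (\<lambda>j. norm (T j - mat 1) < \<rho>) sequentially"
      using tendstoD[OF E0 \<eta>(1)] tendstoD[OF T1 rho] by (simp_all add: dist_norm)
    then have "eventually (\<lambda>j. norm (E j) < \<eta> \<and> norm (T j - mat 1) < \<rho>) sequentially"
      by (rule eventually_conj)
    then obtain j where "norm (E j) < \<eta>" "norm (T j - mat 1) < \<rho>"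
      using eventually_happens'[OF sequentially_bot] by blast
    then show ?thesis using \<eta>(2)[OF EC] by (metis less_imp_le)
  qed
  then have "\<forall>n. \<exists>j. \<exists>Y\<in>C. norm Y \<le> 1 / Suc n \<and> (mat 1 + Y) ** (mat 1 + Y) = mat 1 + E j \<and> norm (T j - mat 1) \<le> 1 / Suc n"
    by simp
  then obtain \<nu> Y where Y: "\<And>n. Y n \<in> C" "\<And>n. norm (Y n) \<le> 1 / Suc n"
    "\<And>n. (mat 1 + Y n) ** (mat 1 + Y n) = mat 1 + E (\<nu> n)" "\<And>n. norm (T (\<nu> n) - mat 1) \<le> 1 / Suc n" by metis
  have "Y \<longlonglongrightarrow> 0"
    by (rule Lim_null_comparison[OF _ LIMSEQ_inverse_real_of_nat]) (use Y(2) in \<open>auto simp: inverse_eq_divide\<close>)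
  then have "(\<lambda>n. mat 1 + Y n) \<longlonglongrightarrow> mat 1 + 0" by (intro tendsto_intros)
  then have R1: "(\<lambda>n. det (mat 1 + Y n)) \<longlonglongrightarrow> 1" using tendsto_det by fastforce
  have "(\<lambda>n. T (\<nu> n)) \<longlonglongrightarrow> mat 1"
    by (rule LIM_zero_cancel, rule Lim_null_comparison[OF _ LIMSEQ_inverse_real_of_nat])
      (use Y(4) in \<open>auto simp: inverse_eq_divide\<close>)
  then have T2: "(\<lambda>n. det (T (\<nu> n))) \<longlonglongrightarrow> 1" using tendsto_det by fastforce
  have near: "eventually (\<lambda>n. f n \<noteq> 0) sequentially" if "f \<longlonglongrightarrow> 1" for f :: "nat \<Rightarrow> complex"
    using tendsto_imp_eventually_ne[OF that] by simp
  \<comment> \<open>This quotient is the determinant of the isometric factor. It can only be 1 or -1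
    and converges to 1.\<close>
  have "(\<lambda>n. det (T (\<nu> n)) / det (mat 1 + Y n)) \<longlonglongrightarrow> 1"
    using tendsto_divide[OF T2 R1] by simp
  then have "eventually (\<lambda>n. det (T (\<nu> n)) / det (mat 1 + Y n) \<noteq> - 1) sequentially"
    by (rule tendsto_imp_eventually_ne) simp
  with near[OF R1] near[OF T2] have "eventually (\<lambda>n. det (mat 1 + Y n) \<noteq> 0 \<and> det (T (\<nu> n)) \<noteq> 0 \<and>
    det (T (\<nu> n)) / det (mat 1 + Y n) \<noteq> - 1) sequentially" by eventually_elim simp
  then obtain n where n: "det (mat 1 + Y n) \<noteq> 0" "det (T (\<nu> n)) \<noteq> 0"
    "det (T (\<nu> n)) / det (mat 1 + Y n) \<noteq> - 1" using eventually_happens'[OF sequentially_bot] by blast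
  let ?T = "T (\<nu> n)" and ?R = "mat 1 + Y n"
  have R: "invertible ?R" "invertible ?T" using n by (simp_all add: invertible_det_nz)
  have RR: "?R ** ?R = adj ?T ** ?T" unfolding Y(3) by (simp add: E_def)
  have RZ: "?R ** Z = Z ** ?R" using Y(1)[of n] by (simp add: C_def matrix_add_ldistrib matrix_add_rdistrib)
  have RB: "B (?R *v x) y = B x (?R *v y)" for x y
    using Y(1)[of n] by (simp add: C_def matrix_vector_mult_add_rdistrib bil_simps)
  note g = iso_of_sqrt[OF R(2) T(1) RR RZ RB R(1)]
  have "det (?T ** matrix_inv ?R) * det ?R = det ?T"
    unfolding det_mul[symmetric] by (simp add: matrix_inv_conj[OF R(1)])
  then have "det (?T ** matrix_inv ?R) = det ?T / det ?R" using n(1) by (simp add: field_simps)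
  then have "det (?T ** matrix_inv ?R) = 1" using n(3) det_Iso[OF g(1)] by auto
  with g show ?thesis by blast
qed

end

section \<open>Semicontinuity of the rank\<close>

lemma dim_Un_le: "finite B \<Longrightarrow> vec.dim (A \<union> B) \<le> vec.dim A + card B" for A B :: "(complex^'n) set"
proof (induction B rule: finite_induct)
  case (insert x B)
  then show ?case by (simp add: vec.dim_insert)
qed simp

lemma ex_enumerated_basis:
  fixes S :: "(complex^'n) set"
  assumes "vec.subspace S"
  shows "\<exists>f. fspan f (vec.dim S) = S \<and> fspan f CARD('n) = UNIV"
proof -
  obtain A where A: "A \<subseteq> S" "vec.independent A" "S \<subseteq> vec.span A" "card A = vec.dim S"
    using vec.basis_exists[of S] by blast
  obtain C where C: "A \<subseteq> C" "vec.independent C" "UNIV \<subseteq> vec.span C"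
    using vec.maximal_independent_subset_extend[of A UNIV] A(2) by auto
  have fin: "finite C" using C(2) by (rule vec.finiteI_independent)
  have cC: "card C = CARD('n)"
    using vec.basis_card_eq_dim[of C UNIV] C by (simp add: card_cart_basis)
  have fA: "finite A" using fin C(1) finite_subset by blast
  obtain g where g: "bij_betw g {..<card A} A"
    using ex_bij_betw_nat_finite[OF fA] by (auto simp: atLeast0LessThan)
  have "finite (C - A)" using fin by simp
  then obtain h where h: "bij_betw h {..<card (C - A)} (C - A)"
    using ex_bij_betw_nat_finite[of "C - A"] by (auto simp: atLeast0LessThan)
  have cCA: "card (C - A) = CARD('n) - card A" and le: "card A \<le> CARD('n)"
    using cC C(1) fin fA card_mono[OF fin C(1)] by (simp_all add: card_Diff_subset)
  define f where "f i = (if i < card A then g i else h (i - card A))" for i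
  have fA': "f ` {..<card A} = A"
    using bij_betw_imp_surj_on[OF g] by (simp add: f_def)
  have "f ` {card A..<CARD('n)} = C - A"
  proof -
    have "{card A..<CARD('n)} = (\<lambda>i. i + card A) ` {..<card (C - A)}"
    proof (intro equalityI subsetI)
      fix i assume "i \<in> {card A..<CARD('n)}"
      then show "i \<in> (\<lambda>i. i + card A) ` {..<card (C - A)}"
        by (intro image_eqI[of _ _ "i - card A"]) (auto simp: cCA)
    qed (auto simp: cCA)
    then have "f ` {card A..<CARD('n)} = (\<lambda>i. f (i + card A)) ` {..<card (C - A)}"
      by (simp only: image_image)
    also have "\<dots> = h ` {..<card (C - A)}" by (simp add: f_def)
    finally show ?thesis using bij_betw_imp_surj_on[OF h] by simp
  qed
  moreover have "{..<CARD('n)} = {..<card A} \<union> {card A..<CARD('n)}" using le by auto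
  ultimately have "f ` {..<CARD('n)} = C" using fA' C(1) by (simp add: image_Un Un_absorb1)
  moreover have "vec.span A = S"
    using A(1,3) assms by (intro equalityI vec.span_minimal) auto
  ultimately show ?thesis using fA' A(4) C(3) by (intro exI[of _ f]) auto
qed

lemma dim_span_of_invertible_fmat:
  fixes f :: "nat \<Rightarrow> complex^'n"
  assumes "invertible (fmat f)" "I \<subseteq> {..<CARD('n)}"
  shows "vec.dim (f ` I) = card I"
proof (rule antisym)
  have fI: "finite I" using assms(2) finite_subset by blast
  then show "vec.dim (f ` I) \<le> card I"
    by (metis card_image_le finite_imageI le_trans vec.dim_le_card')
  have "UNIV \<subseteq> fspan f CARD('n)"
  proof
    fix x :: "complex^'n"
    have "x = fmat f *v (matrix_inv (fmat f) *v x)" by (simp add: matrix_inv_mult[OF assms(1)])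
    then show "x \<in> fspan f CARD('n)"
      unfolding fmat_mult_vec by (metis (no_types, lifting) idx_less imageI lessThan_iff vec.span_base vec.span_scale vec.span_sum)
  qed
  then have "CARD('n) = vec.dim (f ` {..<CARD('n)})"
    by (metis vec.dim_UNIV card_cart_basis vec.dim_span subset_antisym subset_UNIV)
  also have "f ` {..<CARD('n)} = f ` I \<union> f ` ({..<CARD('n)} - I)" using assms(2) by auto
  also have "vec.dim \<dots> \<le> vec.dim (f ` I) + card (f ` ({..<CARD('n)} - I))"
    by (rule dim_Un_le) simp
  also have "\<dots> \<le> vec.dim (f ` I) + (CARD('n) - card I)"
    using card_image_le[of "{..<CARD('n)} - I" f] assms(2) fI by (simp add: card_Diff_subset)
  finally show "card I \<le> vec.dim (f ` I)" using card_mono[OF _ assms(2)] by simp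
qed

text \<open>A basis of the range of \<open>Z\<close>, written as Z a_i, is completed to a basis of
  the whole space. Invertibility of the matrix of these columns is an open condition, so the vectors
  Zm a_i are independent for some \<open>m\<close>.\<close>

lemma rank_limit:
  fixes Z :: "complex^'n^'n"
  assumes "Zm \<longlonglongrightarrow> Z" "\<And>m. rk (Zm m) UNIV \<le> r"
  shows "rk Z UNIV \<le> r"
proof -
  have "vec.subspace (range ((*v) Z))" by (rule subspace_image) simp
  from ex_enumerated_basis[OF this] obtain f where
    f: "fspan f (rk Z UNIV) = range ((*v) Z)" "fspan f CARD('n) = UNIV" by blast
  define d where "d = rk Z UNIV"
  have "\<forall>i. \<exists>a. i < d \<longrightarrow> f i = Z *v a"
    using f(1) vec.span_base[of _ "f ` {..<d}"] by (auto simp: d_def)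
  then obtain a where a: "\<And>i. i < d \<Longrightarrow> f i = Z *v a i" by metis
  define F where "F A i = (if i < d then A *v a i else f i)" for A :: "complex^'n^'n" and i
  have F: "F Z = f" using a by (auto simp: F_def)
  have "(\<lambda>m. fmat (F (Zm m))) \<longlonglongrightarrow> fmat (F Z)"
  proof -
    have "(\<lambda>m. F (Zm m) i) \<longlonglongrightarrow> F Z i" for i
      using tendsto_mult_vec[OF assms(1)] by (simp add: F_def)
    then show ?thesis unfolding fmat_def by (intro tendsto_vec_lambda tendsto_vec_nth)
  qed
  then have "(\<lambda>m. det (fmat (F (Zm m)))) \<longlonglongrightarrow> det (fmat (F Z))" by (rule tendsto_det)
  moreover have "det (fmat (F Z)) \<noteq> 0" using invertible_fmat[OF f(2)] by (simp add: F invertible_det_nz)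
  ultimately have "eventually (\<lambda>m. det (fmat (F (Zm m))) \<noteq> 0) sequentially"
    by (rule tendsto_imp_eventually_ne)
  then obtain m where "det (fmat (F (Zm m))) \<noteq> 0" using eventually_happens'[OF sequentially_bot] by blast
  then have m: "invertible (fmat (F (Zm m)))" by (simp add: invertible_det_nz)
  have "d \<le> CARD('n)" unfolding d_def by (metis card_cart_basis vec.dim_UNIV vec.dim_subset subset_UNIV)
  then have "d = vec.dim (F (Zm m) ` {..<d})"
    using dim_span_of_invertible_fmat[OF m, of "{..<d}"] by auto
  also have "\<dots> \<le> rk (Zm m) UNIV"
    by (rule vec.dim_subset) (auto simp: F_def)
  finally show ?thesis using assms(2)[of m] by (simp add: d_def)
qed

section \<open>Lie's theorem\<close>

text \<open>The eigenvalue \<open>\<mu>\<close> of \<open>[Y, X]\<close> enters \<open>Y X\<^sup>i w\<close> with multiplicity \<open>i\<close>, which must vanish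
  when the vectors \<open>X\<^sup>i w\<close> become dependent.\<close>

lemma cyclic_weight_zero:
  fixes X Y Z :: "complex^'n^'n"
  assumes U: "vec.subspace U" "\<And>u. u \<in> U \<Longrightarrow> X *v u \<in> U" "\<And>u. u \<in> U \<Longrightarrow> Y *v u \<in> U"
    and w: "w \<notin> U" "Y *v w - \<alpha> *s w \<in> U"
    and Z: "\<And>i. Z *v (mpow X i *v w) - \<mu> *s (mpow X i *v w) \<in> vec.span ((\<lambda>j. mpow X j *v w) ` {..<i} \<union> U)"
    and YX: "Y ** X = X ** Y + Z"
  shows "\<mu> = 0"
proof (rule ccontr)
  assume \<mu>: "\<mu> \<noteq> 0"
  let ?f = "\<lambda>j. mpow X j *v w"
  define C where "C i = vec.span (?f ` {..<i} \<union> U)" for i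
  have Csub: "vec.subspace (C i)" for i by (simp add: C_def)
  have C_mono: "C i \<subseteq> C j" if "i \<le> j" for i j
    unfolding C_def using that by (intro vec.span_mono) auto
  have fC: "?f i \<in> C j" if "i < j" for i j unfolding C_def using that by (intro vec.span_base) auto
  have UC: "U \<subseteq> C j" for j unfolding C_def using vec.span_superset by blast
  have C0: "C 0 = U" using U(1) by (simp add: C_def vec.span_eq_iff)
  have XC: "X *v y \<in> C (Suc i)" if "y \<in> C i" for y i
    using that unfolding C_def[of i]
  proof (induction rule: vec.span_induct_alt)
    case base then show ?case by (simp add: Csub vec.subspace_0)
  next
    case (step c x y)
    have "X *v x \<in> C (Suc i)" using step(1)
    proof
      assume "x \<in> U" then show ?thesis using U UC by blast
    next
      assume "x \<in> ?f ` {..<i}"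
      then obtain j where "j < i" "x = ?f j" by auto
      then show ?thesis using fC[of "Suc j" "Suc i"] by (simp add: mpow_mult_vec_Suc)
    qed
    then show ?case using step.IH Csub by (simp add: matrix_vector_right_distrib vec.subspace_add vec.subspace_scale)
  qed
  have Yf: "Y *v ?f (Suc i) - \<alpha> *s ?f (Suc i) - (of_nat (Suc i) * \<mu>) *s ?f i \<in> C i" for i
  proof (induction i)
    case 0
    have "Y *v (X *v w) = X *v (Y *v w) + Z *v w"
      using YX by (metis matrix_vector_mul_assoc matrix_vector_mult_add_rdistrib)
    then have "Y *v ?f 1 - \<alpha> *s ?f 1 - \<mu> *s w = X *v (Y *v w - \<alpha> *s w) + (Z *v ?f 0 - \<mu> *s ?f 0)"
      by (simp add: matrix_vector_mult_diff_distrib)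
    moreover have "X *v (Y *v w - \<alpha> *s w) \<in> U" using U w by blast
    moreover have "Z *v ?f 0 - \<mu> *s ?f 0 \<in> U" using Z[of 0] U(1) by (simp add: vec.span_eq_iff[THEN iffD2])
    ultimately have "Y *v ?f 1 - \<alpha> *s ?f 1 - \<mu> *s w \<in> U" using U(1) by (simp only: vec.subspace_add)
    then show ?case by (simp add: C0)
  next
    case (Suc i)
    have "Y *v (X *v ?f (Suc i)) = X *v (Y *v ?f (Suc i)) + Z *v ?f (Suc i)"
      using YX by (metis matrix_vector_mul_assoc matrix_vector_mult_add_rdistrib)
    then have "Y *v ?f (Suc (Suc i)) - \<alpha> *s ?f (Suc (Suc i)) - (of_nat (Suc (Suc i)) * \<mu>) *s ?f (Suc i) =
      X *v (Y *v ?f (Suc i) - \<alpha> *s ?f (Suc i) - (of_nat (Suc i) * \<mu>) *s ?f i) + (Z *v ?f (Suc i) - \<mu> *s ?f (Suc i))"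
      by (simp add: matrix_vector_mult_diff_distrib mpow_mult_vec_Suc[symmetric]) (simp add: vec_eq_iff algebra_simps)
    moreover have "Z *v ?f (Suc i) - \<mu> *s ?f (Suc i) \<in> C (Suc i)" using Z[of "Suc i"] by (simp add: C_def)
    ultimately show ?case using XC[OF Suc] Csub by (simp only: vec.subspace_add)
  qed
  have "\<exists>n. ?f n \<in> C n"
  proof (rule ccontr)
    assume "\<not> ?thesis"
    then have H: "?f n \<notin> vec.span (?f ` {..<n} \<union> U)" for n by (auto simp: C_def)
    have "vec.dim (?f ` {..<n} \<union> U) \<ge> n" for n
    proof (induction n)
      case (Suc n)
      then show ?case using H[of n] by (simp add: lessThan_Suc vec.dim_insert)
    qed simp
    then have "Suc CARD('n) \<le> CARD('n)"
      by (metis card_cart_basis vec.dim_UNIV vec.dim_subset subset_UNIV le_trans)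
    then show False by simp
  qed
  then obtain n where n: "?f n \<in> C n" and min: "\<And>j. j < n \<Longrightarrow> ?f j \<notin> C j"
    using exists_least_iff[of "\<lambda>n. ?f n \<in> C n"] by blast
  have "n \<noteq> 0" using n w(1) C0 by (auto intro!: Nat.gr0I)
  then obtain l where l: "n = Suc l" by (cases n) auto
  have "Y *v y - \<alpha> *s y \<in> C l" if "y \<in> C n" for y
    using that unfolding C_def[of n]
  proof (induction rule: vec.span_induct_alt)
    case base then show ?case by (simp add: Csub vec.subspace_0)
  next
    case (step c x y)
    have "Y *v x - \<alpha> *s x \<in> C l" using step(1)
    proof
      assume "x \<in> U"
      then have "Y *v x - \<alpha> *s x \<in> U" using U by (simp add: vec.subspace_diff vec.subspace_scale)
      then show ?thesis using UC by blast
    next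
      assume "x \<in> ?f ` {..<n}"
      then obtain j where j: "j < n" "x = ?f j" by auto
      show ?thesis
      proof (cases j)
        case 0 then show ?thesis using w(2) UC j by auto
      next
        case (Suc i)
        have "(Y *v x - \<alpha> *s x - (of_nat (Suc i) * \<mu>) *s ?f i) + (of_nat (Suc i) * \<mu>) *s ?f i \<in> C l"
          using Yf[of i] C_mono[of i l] fC[of i l] j Suc l
          by (intro vec.subspace_add[OF Csub] vec.subspace_scale[OF Csub]) auto
        then show ?thesis by (simp only: diff_add_cancel)
      qed
    qed
    then have "c *s (Y *v x - \<alpha> *s x) + (Y *v y - \<alpha> *s y) \<in> C l"
      by (intro vec.subspace_add[OF Csub] vec.subspace_scale[OF Csub] step.IH)
    moreover have "c *s (Y *v x - \<alpha> *s x) + (Y *v y - \<alpha> *s y) = Y *v (c *s x + y) - \<alpha> *s (c *s x + y)"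
      by (simp add: vec_eq_iff matrix_vector_right_distrib algebra_simps)
    ultimately show ?case by (simp only:)
  qed
  from vec.subspace_diff[OF Csub this[OF n] Yf[of l, folded l]] have "(of_nat n * \<mu>) *s ?f l \<in> C l" by simp
  then have "inverse (of_nat n * \<mu>) *s ((of_nat n * \<mu>) *s ?f l) \<in> C l" by (rule vec.subspace_scale[OF Csub])
  moreover have nz: "of_nat n * \<mu> \<noteq> 0" using \<mu> \<open>n \<noteq> 0\<close> by simp
  ultimately have "?f l \<in> C l" by (simp only: vec.scale_scale left_inverse[OF nz] vec.scale_one)
  then show False using min[of l] l by simp
qed

lemma bracket_in_span: "X \<in> S \<Longrightarrow> Y \<in> T \<Longrightarrow> bracket X Y \<in> bracket_span S T"
  unfolding bracket_span_def by (rule cmat.span_base) blast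

lemma subspace_bracket_span: "cmat.subspace (bracket_span S T)"
  unfolding bracket_span_def by (rule cmat.subspace_span)

lemma bracket_span_minimal:
  assumes "cmat.subspace L" "\<And>X Y. X \<in> S \<Longrightarrow> Y \<in> T \<Longrightarrow> bracket X Y \<in> L"
  shows "bracket_span S T \<subseteq> L"
  unfolding bracket_span_def using assms by (intro cmat.span_minimal) auto

lemma weight_space_closed:
  fixes Y :: "complex^'n^'n"
  assumes "vec.subspace U" "Y *v x - a *s x \<in> U"
  shows "Y *v (c *s x) - a *s (c *s x) \<in> U"
    and "Y *v y - a *s y \<in> U \<Longrightarrow> Y *v (x + y) - a *s (x + y) \<in> U"
proof -
  have "Y *v (c *s x) - a *s (c *s x) = c *s (Y *v x - a *s x)"
    by (simp add: vec_eq_iff algebra_simps)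
  then show "Y *v (c *s x) - a *s (c *s x) \<in> U" using assms by (simp only: vec.subspace_scale)
  have "Y *v (x + y) - a *s (x + y) = (Y *v x - a *s x) + (Y *v y - a *s y)"
    by (simp add: vec_eq_iff matrix_vector_right_distrib algebra_simps)
  then show "Y *v (x + y) - a *s (x + y) \<in> U" if "Y *v y - a *s y \<in> U"
    using assms that by (simp only: vec.subspace_add)
qed

text \<open>Lie's theorem for the action on W/U. By induction the derived algebra has a common
  eigenvector modulo \<open>U\<close>; its weight space is stable under \<open>L\<close> by
  \<open>cyclic_weight_zero\<close>. On a minimal stable space brackets then act as 0 modulo
  \<open>U\<close>, so every eigenspace modulo \<open>U\<close> is stable and, by minimality, is
  everything.\<close>

lemma lie_common_eigenvector:
  fixes L :: "(complex^'n^'n) set"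
  assumes "((\<lambda>d. bracket_span d d) ^^ k) L = {0}" "cmat.subspace L"
    and "\<And>X Y. X \<in> L \<Longrightarrow> Y \<in> L \<Longrightarrow> bracket X Y \<in> L"
    and "vec.subspace U" "vec.subspace W" "U \<subseteq> W" "\<not> W \<subseteq> U"
    and "\<And>X u. X \<in> L \<Longrightarrow> u \<in> U \<Longrightarrow> X *v u \<in> U" "\<And>X u. X \<in> L \<Longrightarrow> u \<in> W \<Longrightarrow> X *v u \<in> W"
  shows "\<exists>v\<in>W. v \<notin> U \<and> (\<forall>X\<in>L. \<exists>c. X *v v - c *s v \<in> U)"
  using assms
proof (induction k arbitrary: L W)
  case 0
  then have L: "L = {0}" by simp
  obtain v where "v \<in> W" "v \<notin> U" using 0 by blast
  then show ?case using 0 by (intro bexI[of _ v] conjI) (auto intro!: exI[of _ 0] simp: L vec.subspace_0)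
next
  case (Suc k)
  note U = Suc.prems(4) and LU = Suc.prems(8)
  define D where "D = bracket_span L L"
  have DL: "D \<subseteq> L" unfolding D_def by (rule bracket_span_minimal) (use Suc.prems in auto)
  \<comment> \<open>A space of least dimension with this property takes the role of an irreducible
    subrepresentation of W/U.\<close>
  define P where "P S \<longleftrightarrow> vec.subspace S \<and> U \<subseteq> S \<and> S \<subseteq> W \<and> \<not> S \<subseteq> U \<and> (\<forall>X\<in>L. \<forall>u\<in>S. X *v u \<in> S)" for S
  have "P W" using Suc.prems by (auto simp: P_def)
  then obtain S where S: "P S" and min: "\<And>T. P T \<Longrightarrow> vec.dim S \<le> vec.dim T"
    using ex_has_least_nat[of P W vec.dim] by blast
  have minS: "T = S" if "P T" "T \<subseteq> S" for T
    using vec.subspace_dim_equal[of T S] that min[OF that(1)] S by (auto simp: P_def)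
  have Ssub: "vec.subspace S" and US: "U \<subseteq> S" and LS: "\<And>X u. X \<in> L \<Longrightarrow> u \<in> S \<Longrightarrow> X *v u \<in> S"
    and SU: "\<not> S \<subseteq> U" and SW: "S \<subseteq> W" using S by (auto simp: P_def)
  have "\<exists>v\<in>S. v \<notin> U \<and> (\<forall>X\<in>D. \<exists>c. X *v v - c *s v \<in> U)"
  proof (rule Suc.IH)
    show "((\<lambda>d. bracket_span d d) ^^ k) D = {0}" using Suc.prems(1) by (simp add: D_def funpow_Suc_right del: funpow.simps)
    show "cmat.subspace D" unfolding D_def by (rule subspace_bracket_span)
    show "bracket X Y \<in> D" if "X \<in> D" "Y \<in> D" for X Y
      unfolding D_def using that DL by (intro bracket_in_span) auto
  qed (use U Ssub US SU LU LS DL in auto)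
  then obtain v \<nu> where v: "v \<in> S" "v \<notin> U" "\<And>Y. Y \<in> D \<Longrightarrow> Y *v v - \<nu> Y *s v \<in> U" by metis
  define T where "T = {x \<in> S. \<forall>Y\<in>D. Y *v x - \<nu> Y *s x \<in> U}"
  have br: "Y ** X = X ** Y + bracket Y X" for X Y :: "complex^'n^'n" by (simp add: bracket_def)
  have brv: "Y *v (X *v x) = X *v (Y *v x) + bracket Y X *v x" for X Y :: "complex^'n^'n" and x
    using br[of Y X] by (metis matrix_vector_mul_assoc matrix_vector_mult_add_rdistrib)
  have Tstab: "X *v x \<in> T" if X: "X \<in> L" and x: "x \<in> T" for X x
  proof (cases "x \<in> U")
    case True
    then have "X *v x \<in> U" using LU X by blast
    then show ?thesis using US LU DL U by (auto simp: T_def vec.subspace_diff vec.subspace_scale)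
  next
    case False
    have DX: "bracket Y X \<in> D" if "Y \<in> D" for Y unfolding D_def using that X DL by (intro bracket_in_span) auto
    let ?f = "\<lambda>j. mpow X j *v x"
    let ?C = "\<lambda>i. vec.span (?f ` {..<i} \<union> U)"
    have XC: "X *v y \<in> ?C (Suc i)" if "y \<in> ?C i" for y i
      using that
    proof (induction rule: vec.span_induct_alt)
      case (step c z y)
      have "X *v z \<in> ?C (Suc i)" using step(1)
      proof
        assume "z \<in> U" then show ?thesis using LU X by (intro vec.span_base) auto
      next
        assume "z \<in> ?f ` {..<i}"
        then obtain j where "j < i" "z = ?f j" by auto
        then show ?thesis by (auto simp: mpow_mult_vec_Suc intro!: vec.span_base imageI)
      qed
      then show ?case using step.IH by (simp add: matrix_vector_right_distrib vec.span_add vec.span_scale)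
    qed (simp add: vec.span_zero)
    have weight: "Y *v ?f i - \<nu> Y *s ?f i \<in> ?C i" if "Y \<in> D" for Y i
      using that
    proof (induction i arbitrary: Y)
      case 0 then show ?case using x by (auto simp: T_def intro: vec.span_base)
    next
      case (Suc i)
      have "Y *v ?f (Suc i) - \<nu> Y *s ?f (Suc i) =
        X *v (Y *v ?f i - \<nu> Y *s ?f i) + ((bracket Y X *v ?f i - \<nu> (bracket Y X) *s ?f i) + \<nu> (bracket Y X) *s ?f i)"
        unfolding mpow_mult_vec_Suc[symmetric] brv[of Y X] matrix_vector_mult_diff_distrib by simp
      moreover have "X *v (Y *v ?f i - \<nu> Y *s ?f i) \<in> ?C (Suc i)" using XC Suc by blast
      moreover have "bracket Y X *v ?f i - \<nu> (bracket Y X) *s ?f i \<in> ?C (Suc i)"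
        using Suc.IH[OF DX[OF Suc.prems]]
        by (rule subsetD[rotated]) (intro vec.span_mono Un_mono image_mono order_refl, simp)
      moreover have "?f i \<in> ?C (Suc i)" by (intro vec.span_base) auto
      ultimately show ?case by (simp only: vec.span_add vec.span_scale)
    qed
    have "\<nu> (bracket Y X) = 0" if "Y \<in> D" for Y
      using that DL X x weight[OF DX[OF that]]
      by (intro cyclic_weight_zero[OF U LU LU False _ _ br, of X Y "\<nu> Y"]) (auto simp: T_def)
    then have "bracket Y X *v x \<in> U" if "Y \<in> D" for Y
      using x DX[OF that] that by (force simp: T_def)
    then have "Y *v (X *v x) - \<nu> Y *s (X *v x) \<in> U" if "Y \<in> D" for Y
    proof -
      have "Y *v (X *v x) - \<nu> Y *s (X *v x) = X *v (Y *v x - \<nu> Y *s x) + bracket Y X *v x"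
        unfolding brv[of Y X] matrix_vector_mult_diff_distrib by simp
      then show ?thesis using x that LU X U \<open>\<And>Y. Y \<in> D \<Longrightarrow> bracket Y X *v x \<in> U\<close>
        by (auto simp: T_def intro!: vec.subspace_add)
    qed
    then show ?thesis using x X LS by (simp add: T_def)
  qed
  have Tsub: "vec.subspace T"
  proof (rule vec.subspaceI)
    show "0 \<in> T" using Ssub U by (simp add: T_def vec.subspace_0)
    fix x y c assume xy: "x \<in> T"
    show "c *s x \<in> T" using xy Ssub weight_space_closed(1)[OF U] by (simp only: T_def mem_Collect_eq vec.subspace_scale simp_thms ball_simps) blast
    assume y: "y \<in> T"
    show "x + y \<in> T" using xy y Ssub weight_space_closed(2)[OF U] by (simp only: T_def mem_Collect_eq vec.subspace_add simp_thms) blast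
  qed
  have UT: "U \<subseteq> T" using US LU DL U by (auto simp: T_def vec.subspace_diff vec.subspace_scale)
  have "T = S"
    by (rule minS) (use Tsub UT Tstab v SW in \<open>auto simp: P_def T_def\<close>)
  then have ST: "\<And>x Y. x \<in> S \<Longrightarrow> Y \<in> D \<Longrightarrow> Y *v x - \<nu> Y *s x \<in> U" by (auto simp: T_def)
  \<comment> \<open>The bracket acts on \<open>S\<close> modulo \<open>U\<close> by a scalar. That
    scalar vanishes by \<open>cyclic_weight_zero\<close>, applied to the chain of \<open>X\<close>
    starting at an eigenvector of \<open>Y\<close>.\<close>
  have "bracket Y X *v x \<in> U" if X: "X \<in> L" and Y: "Y \<in> L" and x: "x \<in> S" for X Y x
  proof -
    have Z: "bracket Y X \<in> D" unfolding D_def by (rule bracket_in_span[OF Y X])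
    obtain w a where w: "w \<in> S" "w \<notin> U" "Y *v w - a *s w \<in> U"
      using ex_eigenvector_mod[OF U Ssub, of Y] LU LS Y SU by blast
    have "\<nu> (bracket Y X) = 0"
    proof (rule cyclic_weight_zero[OF U LU[OF X] LU[OF Y] w(2,3) _ br])
      fix i
      have "mpow X i *v w \<in> S" using mpow_stable[of S X w i] LS[OF X] w(1) by blast
      then show "bracket Y X *v (mpow X i *v w) - \<nu> (bracket Y X) *s (mpow X i *v w)
          \<in> vec.span ((\<lambda>j. mpow X j *v w) ` {..<i} \<union> U)"
        using ST[OF _ Z] by (intro vec.span_base) auto
    qed auto
    then show ?thesis using ST[OF x Z] by simp
  qed
  note comm = this
  have "\<exists>c. \<forall>x\<in>S. X *v x - c *s x \<in> U" if X: "X \<in> L" for X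
  proof -
    obtain w a where w: "w \<in> S" "w \<notin> U" "X *v w - a *s w \<in> U"
      using ex_eigenvector_mod[OF U Ssub, of X] LU LS X SU by blast
    define E where "E = {x \<in> S. X *v x - a *s x \<in> U}"
    have "vec.subspace E"
    proof (rule vec.subspaceI)
      show "0 \<in> E" using Ssub U by (simp add: E_def vec.subspace_0)
      fix x y c assume xy: "x \<in> E"
      show "c *s x \<in> E" using xy Ssub weight_space_closed(1)[OF U] by (simp only: E_def mem_Collect_eq vec.subspace_scale simp_thms)
      assume y: "y \<in> E"
      show "x + y \<in> E" using xy y Ssub weight_space_closed(2)[OF U] by (simp only: E_def mem_Collect_eq vec.subspace_add simp_thms)
    qed
    moreover have "U \<subseteq> E" using US LU X U by (auto simp: E_def vec.subspace_diff vec.subspace_scale)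
    moreover have "X' *v x \<in> E" if "X' \<in> L" "x \<in> E" for X' x
    proof -
      have "X *v (X' *v x) - a *s (X' *v x) = X' *v (X *v x - a *s x) + bracket X X' *v x"
        unfolding brv[of X X'] matrix_vector_mult_diff_distrib by simp
      then show ?thesis using that comm[of X' X x] X LU LS U by (auto simp: E_def intro!: vec.subspace_add)
    qed
    ultimately have "P E" using w SW by (auto simp: P_def E_def)
    then have "E = S" by (rule minS) (auto simp: E_def)
    then show ?thesis by (auto simp: E_def)
  qed
  then show ?case using v(1,2) SW by blast
qed

section \<open>Independent sequences\<close>

definition indep_seq :: "(nat \<Rightarrow> complex^'n) \<Rightarrow> nat \<Rightarrow> bool"
  where "indep_seq u p \<longleftrightarrow> (\<forall>i<p. u i \<notin> fspan u i)"

lemma dim_indep_seq: "indep_seq u p \<Longrightarrow> vec.dim (u ` {..<p}) = p"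
proof (induction p)
  case (Suc p)
  then show ?case by (simp add: indep_seq_def lessThan_Suc vec.dim_insert)
qed simp

lemma dim_le_CARD: "vec.dim (S :: (complex^'n) set) \<le> CARD('n)"
  by (metis card_cart_basis vec.dim_UNIV vec.dim_subset subset_UNIV)

lemma indep_seq_le: "indep_seq (u :: nat \<Rightarrow> complex^'n) p \<Longrightarrow> p \<le> CARD('n)"
  by (metis dim_indep_seq dim_le_CARD)

lemma span_eq_UNIV_of_dim:
  fixes S :: "(complex^'n) set"
  assumes "vec.dim S = CARD('n)" shows "vec.span S = UNIV"
  using assms vec.dim_eq_full[of S] by (simp add: vec.dimension_def card_cart_basis)

lemma span_indep_seq: "indep_seq (u :: nat \<Rightarrow> complex^'n) CARD('n) \<Longrightarrow> fspan u CARD('n) = UNIV"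
  by (intro span_eq_UNIV_of_dim dim_indep_seq)

lemma indep_seq_cong: "(\<And>i. i < p \<Longrightarrow> u i = v i) \<Longrightarrow> indep_seq u p \<longleftrightarrow> indep_seq v p"
proof -
  assume uv: "\<And>i. i < p \<Longrightarrow> u i = v i"
  then have "u ` {..<i} = v ` {..<i}" if "i < p" for i using that by (intro image_cong) auto
  then show ?thesis by (simp add: indep_seq_def uv)
qed

lemma indep_seq_Suc: "indep_seq u (Suc p) \<longleftrightarrow> indep_seq u p \<and> u p \<notin> fspan u p"
  by (auto simp: indep_seq_def less_Suc_eq)

lemma indep_seq_upd:
  assumes "indep_seq u p" "v \<notin> fspan u p" shows "indep_seq (u(p := v)) (Suc p)"
proof -
  have "(u(p := v)) ` {..<p} = u ` {..<p}" by (intro image_cong) auto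
  moreover have "indep_seq (u(p := v)) p" using assms(1) by (subst indep_seq_cong[of p _ u]) auto
  ultimately show ?thesis using assms(2) by (simp only: indep_seq_Suc fun_upd_same simp_thms)
qed

lemma indep_seq_extend:
  fixes u :: "nat \<Rightarrow> complex^'n"
  assumes "indep_seq u p"
  shows "\<exists>g. (\<forall>i<p. g i = u i) \<and> indep_seq g CARD('n)"
proof -
  have "p + d \<le> CARD('n) \<Longrightarrow> \<exists>g. (\<forall>i<p. g i = u i) \<and> indep_seq g (p + d)" for d
  proof (induction d)
    case 0 then show ?case using assms by auto
  next
    case (Suc d)
    then obtain g where g: "\<And>i. i < p \<Longrightarrow> g i = u i" "indep_seq g (p + d)" by auto
    have "fspan g (p + d) \<noteq> UNIV"
    proof
      assume "fspan g (p + d) = UNIV"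
      then have "vec.dim (g ` {..<p + d}) = CARD('n)" by (metis card_cart_basis vec.dim_UNIV vec.dim_span)
      then show False using dim_indep_seq[OF g(2)] Suc.prems by simp
    qed
    then obtain v where "v \<notin> fspan g (p + d)" by blast
    from indep_seq_upd[OF g(2) this] g(1) show ?case by (intro exI[of _ "g(p + d := v)"]) (simp del: fun_upd_apply, simp)
  qed
  from this[of "CARD('n) - p"] indep_seq_le[OF assms] show ?thesis by simp
qed

lemma hyperplane_dim:
  fixes W :: "(complex^'n) set" and \<phi> :: "complex^'n \<Rightarrow> complex"
  assumes W: "vec.subspace W" and add: "\<And>x y. \<phi> (x + y) = \<phi> x + \<phi> y" and scale: "\<And>a x. \<phi> (a *s x) = a * \<phi> x"
  shows "vec.dim W \<le> Suc (vec.dim {w \<in> W. \<phi> w = 0})"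
proof (cases "\<forall>w\<in>W. \<phi> w = 0")
  case True
  then have "{w \<in> W. \<phi> w = 0} = W" by auto
  then show ?thesis by simp
next
  case False
  then obtain w where w: "w \<in> W" "\<phi> w \<noteq> 0" by blast
  have "W \<subseteq> vec.span (insert w {w \<in> W. \<phi> w = 0})"
  proof
    fix x assume x: "x \<in> W"
    define c where "c = \<phi> x / \<phi> w"
    have "\<phi> (x + (- c) *s w) = 0" unfolding add scale using w by (simp add: c_def)
    moreover have "x + (- c) *s w \<in> W" using x w W by (intro vec.subspace_add vec.subspace_scale)
    ultimately have "x + (- c) *s w \<in> {w \<in> W. \<phi> w = 0}" by simp
    moreover have "x - c *s w = x + (- c) *s w" by (simp add: vec_eq_iff)
    ultimately show "x \<in> vec.span (insert w {w \<in> W. \<phi> w = 0})"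
      unfolding vec.span_insert by (metis (mono_tags, lifting) mem_Collect_eq vec.span_base)
  qed
  then have "vec.dim W \<le> vec.dim (insert w {w \<in> W. \<phi> w = 0})" by (rule vec.dim_mono)
  also have "\<dots> \<le> Suc (vec.dim {w \<in> W. \<phi> w = 0})" by (simp add: vec.dim_insert)
  finally show ?thesis .
qed

lemma dim_psubset_subspace:
  fixes S T :: "(complex^'n) set"
  assumes "vec.subspace S" "vec.subspace T" "S \<subseteq> T" "vec.dim T \<le> vec.dim S" shows "S = T"
  using vec.subspace_dim_equal[OF assms] .

section \<open>Frames of a bilinear form\<close>

text \<open>The position paired with \<open>i\<close> by an antidiagonal Gram matrix.\<close>

definition dual_idx :: "complex^'n^'n \<Rightarrow> nat \<Rightarrow> nat"
  where "dual_idx M i = CARD('n) - 1 - i"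

text \<open>The Witt index, except for even orthogonal groups, where it is one less. The form is an argument
  only because it determines the dimension.\<close>

definition flag_length :: "complex^'n^'n \<Rightarrow> complex \<Rightarrow> nat"
  where "flag_length M \<epsilon> = (if \<epsilon> = 1 then (CARD('n) - 1) div 2 else CARD('n) div 2)"

context form
begin

definition perp :: "(complex^'n) set \<Rightarrow> (complex^'n) set"
  where "perp S = {y. \<forall>x\<in>S. B x y = 0}"

lemma subspace_perp: "vec.subspace (perp S)"
  by (auto simp: vec.subspace_def perp_def bil_simps)

lemma perp_span: "perp (vec.span S) = perp S"
proof (intro equalityI subsetI)
  fix y assume "y \<in> perp S"
  have "B x y = 0" if "x \<in> vec.span S" for x
    using that \<open>y \<in> perp S\<close> by (induction rule: vec.span_induct_alt) (auto simp: perp_def bil_simps)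
  then show "y \<in> perp (vec.span S)" by (simp add: perp_def)
qed (auto simp: perp_def vec.span_base)

lemma perp_mono: "S \<subseteq> T \<Longrightarrow> perp T \<subseteq> perp S"
  by (auto simp: perp_def)

lemma perp_stable:
  assumes "X \<in> so M" "\<And>u. u \<in> U \<Longrightarrow> X *v u \<in> U" "y \<in> perp U" shows "X *v y \<in> perp U"
proof -
  have "B u (X *v y) = 0" if "u \<in> U" for u
    using soD[OF assms(1), of u y] assms(2)[OF that] assms(3) by (simp add: perp_def)
  then show ?thesis by (simp add: perp_def)
qed

lemma ex_dual_vector:
  assumes "indep_seq u p" shows "\<exists>y. \<forall>i<p. B (u i) y = c i"
proof -
  obtain g where g: "\<And>i. i < p \<Longrightarrow> g i = u i" "indep_seq g CARD('n)" using indep_seq_extend[OF assms] by blast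
  let ?P = "fmat g"
  have "invertible (transpose ?P)"
    by (metis det_transpose invertible_det_nz invertible_fmat span_indep_seq[OF g(2)])
  then have P: "invertible (transpose ?P ** M)" using inv by (rule invertible_mult)
  define y where "y = matrix_inv (transpose ?P ** M) *v (\<chi> i. c (idx i))"
  have "B (g (idx i)) y = c (idx i)" for i :: 'n
  proof -
    have "B (g (idx i)) y = bil (transpose ?P ** M) (axis i 1) y"
      unfolding fmat_axis[symmetric] by (rule bil_mult_left)
    also have "\<dots> = c (idx i)" by (simp add: bil_axis y_def matrix_inv_mult[OF P])
    finally show ?thesis .
  qed
  then show ?thesis using g(1) ex_idx[where 'n='n] indep_seq_le[OF assms]
    by (metis order.strict_trans2)
qed

lemma dim_perp_ge: "vec.subspace W \<Longrightarrow> vec.dim W \<le> p + vec.dim (W \<inter> perp (u ` {..<p}))"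
proof (induction p)
  case 0 then show ?case by (simp add: perp_def)
next
  case (Suc p)
  let ?W = "W \<inter> perp (u ` {..<p})"
  have "vec.dim ?W \<le> Suc (vec.dim {w \<in> ?W. B (u p) w = 0})"
    by (rule hyperplane_dim) (use Suc.prems in \<open>auto simp: bil_simps vec.subspace_inter subspace_perp\<close>)
  moreover have "{w \<in> ?W. B (u p) w = 0} = W \<inter> perp (u ` {..<Suc p})"
    by (auto simp: perp_def less_Suc_eq)
  ultimately show ?case using Suc by simp
qed

text \<open>Counting conditions bounds the dimension from below. For the upper bound, a dual system
  spans a \<open>p\<close>-dimensional space that meets the orthogonal complement only in 0.\<close>

lemma dim_perp:
  assumes "indep_seq u p" shows "vec.dim (perp (u ` {..<p})) = CARD('n) - p"
proof (rule antisym)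
  have "CARD('n) \<le> p + vec.dim (perp (u ` {..<p}))"
    using dim_perp_ge[of UNIV p u] by (simp add: card_cart_basis)
  then show "CARD('n) - p \<le> vec.dim (perp (u ` {..<p}))" by simp
  have "\<forall>j. \<exists>y. \<forall>i<p. B (u i) y = (if i = j then 1 else 0)"
    by (intro allI ex_dual_vector[OF assms])
  from choice[OF this] obtain y where y0: "\<forall>j. \<forall>i<p. B (u i) (y j) = (if i = j then 1 else 0)" ..
  then have y: "B (u i) (y j) = (if i = j then 1 else 0)" if "i < p" for i j using that by simp
  let ?Y = "fspan y p" and ?U = "perp (u ` {..<p})"
  have "?U \<inter> ?Y \<subseteq> {0}"
  proof
    fix x assume x: "x \<in> ?U \<inter> ?Y"
    then obtain c where c: "x = (\<Sum>j<p. c j *s y j)" by (auto simp: in_span_image_iff)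
    have "c i = 0" if "i < p" for i
    proof -
      have "B (u i) x = (\<Sum>j<p. if i = j then c j else 0)"
        unfolding c bil_sum_right bil_scale_right by (intro sum.cong) (auto simp: y[OF that])
      then have "B (u i) x = c i" using that by simp
      then show ?thesis using x that by (auto simp: perp_def)
    qed
    then show "x \<in> {0}" by (simp add: c)
  qed
  then have "vec.dim {a + b | a b. a \<in> ?U \<and> b \<in> ?Y} = vec.dim ?U + vec.dim ?Y"
    by (intro dim_direct_sum subspace_perp) auto
  moreover have "vec.dim (y ` {..<p}) = p"
  proof (rule dim_indep_seq)
    show "indep_seq y p" unfolding indep_seq_def
    proof (intro allI impI notI)
      fix i assume i: "i < p" "y i \<in> fspan y i"
      have "B (u i) x = 0" if "x \<in> fspan y i" for x
        using that by (induction rule: vec.span_induct_alt) (use i(1) in \<open>auto simp: bil_simps y\<close>)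
      from this[OF i(2)] show False using i(1) by (simp add: y)
    qed
  qed
  ultimately show "vec.dim (perp (u ` {..<p})) \<le> CARD('n) - p"
    using dim_le_CARD[of "{a + b | a b. a \<in> ?U \<and> b \<in> ?Y}"] by simp
qed

lemma isotropic_le:
  assumes "indep_seq u p" "\<And>i j. i < p \<Longrightarrow> j < p \<Longrightarrow> B (u i) (u j) = 0"
  shows "2 * p \<le> CARD('n)"
proof -
  have "vec.dim (u ` {..<p}) \<le> vec.dim (perp (u ` {..<p}))"
    using assms(2) by (intro vec.dim_subset) (auto simp: perp_def)
  then show ?thesis using dim_perp[OF assms(1)] dim_indep_seq[OF assms(1)] indep_seq_le[OF assms(1)] by simp
qed

section \<open>Frames with antidiagonal Gram matrix\<close>

abbreviation dl where "dl \<equiv> dual_idx M"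
abbreviation wi where "wi \<equiv> flag_length M \<epsilon>"

lemma dl_def: "dl i = CARD('n) - 1 - i"
  by (simp add: dual_idx_def)

lemma wi_def: "wi = (if \<epsilon> = 1 then (CARD('n) - 1) div 2 else CARD('n) div 2)"
  by (simp add: flag_length_def)

text \<open>For such a basis the orthogonal complement of an initial segment is again spanned by an
  initial segment, and the reversed sequence describes the opposite flag.\<close>

definition frame :: "(nat \<Rightarrow> complex^'n) \<Rightarrow> bool"
  where "frame f \<longleftrightarrow> (\<forall>i<CARD('n). \<forall>j<CARD('n). B (f i) (f j) =
    (if i + j = CARD('n) - 1 then (if i \<le> j then 1 else \<epsilon>) else 0))"

lemma frameD: "frame f \<Longrightarrow> i < CARD('n) \<Longrightarrow> j < CARD('n) \<Longrightarrow>
    B (f i) (f j) = (if i + j = CARD('n) - 1 then (if i \<le> j then 1 else \<epsilon>) else 0)"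
  by (simp add: frame_def)

lemma frame_dual_nz: "frame f \<Longrightarrow> i < CARD('n) \<Longrightarrow> B (f (dl i)) (f i) \<noteq> 0"
  by (simp add: frameD dl_def)

lemma frame_dual_0: "frame f \<Longrightarrow> i < CARD('n) \<Longrightarrow> j < CARD('n) \<Longrightarrow> i \<noteq> j \<Longrightarrow> B (f (dl i)) (f j) = 0"
  by (auto simp add: frameD dl_def)

lemma frame_indep: assumes "frame f" shows "indep_seq f CARD('n)"
  unfolding indep_seq_def
proof (intro allI impI notI)
  fix i assume i: "i < CARD('n)" "f i \<in> fspan f i"
  have "B (f (dl i)) x = 0" if "x \<in> fspan f i" for x
    using that by (induction rule: vec.span_induct_alt) (use i(1) in \<open>auto simp: bil_simps frame_dual_0[OF assms]\<close>)
  from this[OF i(2)] show False using frame_dual_nz[OF assms i(1)] by simp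
qed

lemma frame_span: "frame f \<Longrightarrow> fspan f CARD('n) = UNIV"
  by (intro span_indep_seq frame_indep)

text \<open>Pairing with \<open>f (dl i)\<close> reads off the i-th coordinate up to a nonzero
  factor, so coordinate subspaces are described by the form alone.\<close>

lemma frame_span_iff:
  assumes f: "frame f" and I: "I \<subseteq> {..<CARD('n)}"
  shows "x \<in> vec.span (f ` I) \<longleftrightarrow> (\<forall>i<CARD('n). i \<notin> I \<longrightarrow> B (f (dl i)) x = 0)"
proof
  assume "x \<in> vec.span (f ` I)"
  then show "\<forall>i<CARD('n). i \<notin> I \<longrightarrow> B (f (dl i)) x = 0"
  proof (induction rule: vec.span_induct_alt)
    case (step c y z)
    then obtain j where "j \<in> I" "y = f j" by auto
    then have "B (f (dl i)) y = 0" if "i < CARD('n)" "i \<notin> I" for i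
      using that I by (auto intro!: frame_dual_0[OF f])
    then show ?case using step by (auto simp: bil_simps)
  qed simp
next
  assume R: "\<forall>i<CARD('n). i \<notin> I \<longrightarrow> B (f (dl i)) x = 0"
  have "x \<in> fspan f CARD('n)" using frame_span[OF f] by simp
  then obtain c where c: "x = (\<Sum>j<CARD('n). c j *s f j)" by (auto simp: in_span_image_iff)
  have "c i = 0" if "i < CARD('n)" "i \<notin> I" for i
  proof -
    have "B (f (dl i)) x = (\<Sum>j<CARD('n). c j * B (f (dl i)) (f j))"
      by (simp add: c bil_sum_right bil_scale_right)
    also have "\<dots> = (\<Sum>j<CARD('n). if j = i then c i * B (f (dl i)) (f i) else 0)"
      using that by (intro sum.cong) (auto simp: frame_dual_0[OF f])
    also have "\<dots> = c i * B (f (dl i)) (f i)" using that by simp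
    finally show ?thesis using R that frame_dual_nz[OF f that(1)] by simp
  qed
  then have "c j *s f j \<in> vec.span (f ` I)" if "j < CARD('n)" for j
    using that by (cases "j \<in> I") (auto intro: vec.span_scale vec.span_base vec.span_zero)
  then show "x \<in> vec.span (f ` I)" unfolding c by (intro vec.span_sum) auto
qed

lemma frame_iso:
  assumes "frame f" "frame e"
  shows "\<exists>g\<in>Iso M. \<forall>j<CARD('n). g *v f j = e j"
proof -
  obtain g where g: "invertible g" "\<And>j. j < CARD('n) \<Longrightarrow> g *v f j = e j"
    using ex_basis_map[OF frame_span frame_span, OF assms] by blast
  have "B (g *v x) (g *v y) = B x y" for x y
  proof -
    have "x \<in> fspan f CARD('n)" "y \<in> fspan f CARD('n)"
      using frame_span[OF assms(1)] by simp_all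
    then obtain c d where x: "x = (\<Sum>j<CARD('n). c j *s f j)" and y: "y = (\<Sum>j<CARD('n). d j *s f j)"
      by (auto simp: in_span_image_iff)
    show ?thesis
      unfolding x y by (simp add: vec.sum bil_sum_left bil_sum_right bil_simps g(2) frameD[OF assms(1)] frameD[OF assms(2)])
  qed
  then show ?thesis using g(2) by (intro bexI[of _ g]) (auto simp: Iso_def)
qed

section \<open>Completing hyperbolic pairs to a frame\<close>

lemma middle_indices:
  fixes N p :: nat
  assumes "0 < N" "p = (N - 1) div 2"
  shows "p < N \<and> p \<le> N - 1 - p \<and> N - 1 - (N - 1 - p) = p \<and> p + (N - 1 - p) = N - 1 \<and>
    (p + p = N - 1 \<longleftrightarrow> p = N - 1 - p) \<and> ((N - 1 - p) + (N - 1 - p) = N - 1 \<longleftrightarrow> p = N - 1 - p)"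
proof -
  have "2 * p \<le> N - 1" using assms(2) by simp
  then show ?thesis using assms(1) by auto
qed

lemma middle_index:
  fixes N p i :: nat
  assumes "p = (N - 1) div 2" "i < N" "\<not> i < p" "\<not> N - 1 - i < p"
  shows "i = p \<or> i = N - 1 - p"
proof -
  have "2 * p \<le> N - 1" "N - 1 \<le> 2 * p + 1" using assms(1) by simp_all
  then show ?thesis using assms(2-4) by linarith
qed

text \<open>Supplies the one or two middle vectors of an orthogonal frame. In the first case a
  vector with B m m nonzero, which exists by polarization, is normalized by a square root. In the
  second a quadratic equation gives an isotropic vector, and a vector paired with it is made
  isotropic by subtracting half of its square.\<close>

lemma middle_extend:
  assumes e1: "\<epsilon> = 1" and p: "p = (CARD('n) - 1) div 2"
    and W: "vec.subspace W" "vec.dim W \<ge> CARD('n) - 2 * p"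
    and nd: "\<And>m. m \<in> W \<Longrightarrow> (\<And>w. w \<in> W \<Longrightarrow> B m w = 0) \<Longrightarrow> m = 0"
  shows "\<exists>g. g p \<in> W \<and> g (dl p) \<in> W \<and> B (g p) (g (dl p)) = 1 \<and>
    (p \<noteq> dl p \<longrightarrow> B (g p) (g p) = 0 \<and> B (g (dl p)) (g (dl p)) = 0)"
proof -
  have s: "B x y = B y x" for x y using B_sym[of x y] e1 by simp
  have N: "CARD('n) > 0" by simp
  have "vec.dim W \<noteq> 0" using W(2) p N by linarith
  then obtain w where w: "w \<in> W" "w \<noteq> 0" using vec.dim_eq_0[of W] by auto
  have polar: "\<exists>m\<in>W. B m m \<noteq> 0"
  proof (rule ccontr)
    assume "\<not> ?thesis"
    then have z: "B m m = 0" if "m \<in> W" for m using that by blast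
    have "B m m' = 0" if "m \<in> W" "m' \<in> W" for m m'
    proof -
      have "B (m + m') (m + m') = 0" using that W(1) by (intro z vec.subspace_add)
      then show ?thesis using z that s[of m' m] by (simp add: bil_simps)
    qed
    then show False using nd w by blast
  qed
  show ?thesis
  proof (cases "p = dl p")
    case True
    obtain m where m: "m \<in> W" "B m m \<noteq> 0" using polar by blast
    define c where "c = csqrt (inverse (B m m))"
    have "c * c = inverse (B m m)" by (metis c_def power2_csqrt power2_eq_square)
    then have "B (c *s m) (c *s m) = 1" using m by (simp add: bil_simps mult.assoc[symmetric])
    then show ?thesis using True m W(1) by (intro exI[of _ "\<lambda>_. c *s m"]) (auto simp: vec.subspace_scale)
  next
    case False
    then have d2: "vec.dim W \<ge> 2" using W(2) p unfolding dl_def by presburger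
    obtain m1 where m1: "m1 \<in> W" "B m1 m1 \<noteq> 0" using polar by blast
    have "\<not> W \<subseteq> vec.span {m1}"
    proof
      assume "W \<subseteq> vec.span {m1}"
      then have "vec.dim W \<le> card {m1}" by (intro vec.dim_le_card) auto
      then show False using d2 by simp
    qed
    then obtain m2 where m2: "m2 \<in> W" "m2 \<notin> vec.span {m1}" by blast
    have "\<not> constant (poly [:B m2 m2, 2 * B m1 m2, B m1 m1:])" using m1 by (simp add: constant_degree)
    then obtain t where "poly [:B m2 m2, 2 * B m1 m2, B m1 m1:] t = 0" using fundamental_theorem_of_algebra by blast
    then have t: "B (m2 + t *s m1) (m2 + t *s m1) = 0"
      by (simp add: bil_simps s[of m2 m1] algebra_simps)
    let ?m = "m2 + t *s m1"
    have mW: "?m \<in> W" using m1 m2 W by (intro vec.subspace_add vec.subspace_scale)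
    have "?m \<noteq> 0"
    proof
      assume "?m = 0"
      then have m2': "m2 = (- t) *s m1" by (simp add: vec_eq_iff eq_neg_iff_add_eq_0)
      have "m2 \<in> vec.span {m1}" by (subst m2') (intro vec.span_scale vec.span_base, simp)
      then show False using m2(2) by blast
    qed
    then obtain w where w: "w \<in> W" "B ?m w \<noteq> 0" using nd[OF mW] by blast
    define w1 where "w1 = inverse (B ?m w) *s w"
    have w1: "w1 \<in> W" "B ?m w1 = 1" using w W by (auto simp: w1_def bil_scale_right vec.subspace_scale)
    define w2 where "w2 = w1 - (B w1 w1 / 2) *s ?m"
    have w2: "w2 \<in> W" unfolding w2_def by (intro vec.subspace_diff vec.subspace_scale W(1) w1(1) mW)
    have "B ?m w2 = 1" unfolding w2_def bil_diff_right bil_scale_right t w1 by simp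
    moreover have "B w2 w2 = 0"
      unfolding w2_def bil_diff_left bil_diff_right bil_scale_left bil_scale_right t s[of w1 ?m] w1(2) by simp
    ultimately show ?thesis using t mW w2 False
      by (intro exI[of _ "\<lambda>i. if i = p then ?m else w2"]) auto
  qed
qed

text \<open>In the symplectic case the given pairs are a frame. In the orthogonal case a space
  \<open>W\<close> of small dimension remains orthogonal to them; it is nondegenerate because every
  vector can be projected to it along the pairs, and \<open>middle_extend\<close> applies.\<close>

lemma hyperbolic_frame:
  assumes uu: "\<And>i j. i < wi \<Longrightarrow> j < wi \<Longrightarrow> B (u i) (u j) = 0"
    and vv: "\<And>i j. i < wi \<Longrightarrow> j < wi \<Longrightarrow> B (v i) (v j) = 0"
    and uv: "\<And>i j. i < wi \<Longrightarrow> j < wi \<Longrightarrow> B (u i) (v j) = (if i = j then 1 else 0)"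
    and p2: "2 * wi \<le> CARD('n)" and ev: "\<epsilon> = - 1 \<Longrightarrow> CARD('n) = 2 * wi"
  shows "\<exists>f. frame f \<and> (\<forall>i<wi. f i = u i \<and> f (dl i) = v i)"
proof -
  let ?p = wi and ?N = "CARD('n)"
  have vu: "B (v j) (u i) = (if i = j then \<epsilon> else 0)" if "i < ?p" "j < ?p" for i j
    using B_sym[of "v j" "u i"] uv[OF that] by simp
  define h where "h i = (if i < ?p then u i else v (dl i))" for i
  define I where "I = {i. i < ?N \<and> (i < ?p \<or> dl i < ?p)}"
  have h: "B (h i) (h j) = (if i + j = ?N - 1 then (if i \<le> j then 1 else \<epsilon>) else 0)" if "i \<in> I" "j \<in> I" for i j
  proof -
    have ij: "i < ?N" "j < ?N" "i < ?p \<or> dl i < ?p" "j < ?p \<or> dl j < ?p" using that by (auto simp: I_def dl_def)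
    consider "i < ?p" "j < ?p" | "i < ?p" "\<not> j < ?p" | "\<not> i < ?p" "j < ?p" | "\<not> i < ?p" "\<not> j < ?p" by blast
    then show ?thesis
    proof cases
      case 1 then show ?thesis using uu p2 by (simp add: h_def)
    next
      case 2
      have "(i = dl j) = (i + j = ?N - 1)" "i \<le> j" using 2 ij by (auto simp: dl_def)
      then show ?thesis using 2 ij by (simp add: h_def uv)
    next
      case 3
      have "(j = dl i) = (i + j = ?N - 1)" "\<not> i \<le> j" using 3 ij by (auto simp: dl_def)
      then show ?thesis using 3 ij by (simp add: h_def vu)
    next
      case 4
      then have "i + j \<noteq> ?N - 1" using ij p2 by (auto simp: dl_def)
      then show ?thesis using 4 ij by (simp add: h_def vv)
    qed
  qed
  have dI: "dl i \<in> I" if "i \<in> I" for i using that by (auto simp: I_def dl_def)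
  show ?thesis
  proof (cases "\<epsilon> = 1")
    case False
    then have N: "?N = 2 * ?p" using ev eps by blast
    then have "I = {..<?N}" by (auto simp: I_def dl_def)
    then have "frame h" using h by (simp add: frame_def)
    then show ?thesis using p2 by (intro exI[of _ h]) (auto simp: h_def dl_def)
  next
    case True
    then have p: "?p = (?N - 1) div 2" by (subst wi_def) simp
    define W where "W = {w. \<forall>i\<in>I. B (h i) w = 0}"
    have Wsub: "vec.subspace W" by (auto simp: W_def vec.subspace_def bil_simps)
    \<comment> \<open>The same vectors as \<open>h\<close> on \<open>I\<close>, listed without the
      gap in the middle, so that \<open>dim_perp_ge\<close> can count them.\<close>
    define hh where "hh i = (if i < ?p then u i else v (i - ?p))" for i
    have hW: "W = perp (hh ` {..<2 * ?p})"
    proof -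
      have "h ` I = hh ` {..<2 * ?p}"
      proof (intro equalityI subsetI)
        fix x assume "x \<in> h ` I"
        then obtain i where i: "i \<in> I" "x = h i" by auto
        show "x \<in> hh ` {..<2 * ?p}"
        proof (cases "i < ?p")
          case True then show ?thesis using i by (intro image_eqI[of _ _ i]) (auto simp: h_def hh_def dl_def)
        next
          case False
          then show ?thesis using i by (intro image_eqI[of _ _ "?p + dl i"]) (auto simp: h_def hh_def I_def dl_def)
        qed
      next
        fix x assume "x \<in> hh ` {..<2 * ?p}"
        then obtain i where i: "i < 2 * ?p" "x = hh i" by auto
        show "x \<in> h ` I"
        proof (cases "i < ?p")
          case True then show ?thesis using i p2 by (intro image_eqI[of _ _ i]) (auto simp: h_def hh_def I_def dl_def)
        next
          case False
          then have "i - ?p < ?p" using i by simp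
          then show ?thesis using i False p2
            by (intro image_eqI[of _ _ "dl (i - ?p)"]) (auto simp: h_def hh_def I_def dl_def)
        qed
      qed
      moreover have "W = perp (h ` I)" by (auto simp: W_def perp_def)
      ultimately show ?thesis by (simp only:)
    qed
    have dW: "vec.dim W \<ge> ?N - 2 * ?p"
      using dim_perp_ge[of UNIV "2 * ?p" hh] by (simp add: hW card_cart_basis)
    have nd: "m = 0" if m: "m \<in> W" "\<And>w. w \<in> W \<Longrightarrow> B m w = 0" for m
    proof (rule nondeg)
      fix x
      define s where "s = (\<Sum>i\<in>I. (B (h (dl i)) x / B (h (dl i)) (h i)) *s h i)"
      have fI: "finite I" by (simp add: I_def)
      have "x - s \<in> W" unfolding W_def
      proof (intro CollectI ballI)
        fix i assume i: "i \<in> I"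
        have "B (h i) s = (\<Sum>j\<in>I. (B (h (dl j)) x / B (h (dl j)) (h j)) * B (h i) (h j))"
          by (simp add: s_def bil_sum_right bil_scale_right)
        also have "\<dots> = (\<Sum>j\<in>I. if j = dl i then B (h i) x else 0)"
        proof (intro sum.cong refl)
          fix j assume j: "j \<in> I"
          have ij: "i < ?N" "j < ?N" using i j by (auto simp: I_def dl_def)
          show "(B (h (dl j)) x / B (h (dl j)) (h j)) * B (h i) (h j) = (if j = dl i then B (h i) x else 0)"
          proof (cases "j = dl i")
            case True
            then have "dl j = i" using ij by (simp add: dl_def)
            moreover have "B (h i) (h j) \<noteq> 0" using h[OF i j] ij True by (simp add: dl_def)
            ultimately show ?thesis using True by simp
          next
            case False
            then have "B (h i) (h j) = 0" using h[OF i j] ij by (auto simp: dl_def)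
            then show ?thesis using False by simp
          qed
        qed
        also have "\<dots> = B (h i) x" using fI dI[OF i] by simp
        finally show "B (h i) (x - s) = 0" by (simp add: bil_simps)
      qed
      then have "B m (x - s) = 0" by (rule m(2))
      moreover have "B m s = 0"
      proof -
        have "B m (h i) = 0" if "i \<in> I" for i using m(1) that B_sym_0 by (auto simp: W_def)
        then show ?thesis by (simp add: s_def bil_sum_right bil_scale_right)
      qed
      ultimately have "B m x = 0" by (simp add: bil_simps)
      then show "B x m = 0" using B_sym_0 by blast
    qed
    obtain g where g: "g ?p \<in> W" "g (dl ?p) \<in> W" "B (g ?p) (g (dl ?p)) = 1"
      "?p \<noteq> dl ?p \<Longrightarrow> B (g ?p) (g ?p) = 0 \<and> B (g (dl ?p)) (g (dl ?p)) = 0"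
      using middle_extend[OF True p Wsub dW nd] by blast
    define f where "f i = (if i \<in> I then h i else g i)" for i
    have mid: "i = ?p \<or> i = dl ?p" if "i < ?N" "i \<notin> I" for i
      using middle_index[OF p that(1)] that by (auto simp: I_def dl_def)
    have s: "B x y = B y x" for x y using B_sym[of x y] True by simp
    have gh: "B (h i) (g j) = 0" "B (g j) (h i) = 0" if "i \<in> I" "j < ?N" "j \<notin> I" for i j
      using mid[OF that(2,3)] g(1,2) that(1) s by (auto simp: W_def)
    have pN: "?p < ?N" "?p \<le> dl ?p" "dl (dl ?p) = ?p" "?p + dl ?p = ?N - 1"
      "?p + ?p = ?N - 1 \<longleftrightarrow> ?p = dl ?p" "dl ?p + dl ?p = ?N - 1 \<longleftrightarrow> ?p = dl ?p"
      using middle_indices[OF zero_less_card_finite p] unfolding dl_def by - (elim conjE, assumption)+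
    have gg: "B (g i) (g j) = (if i + j = ?N - 1 then 1 else 0)"
      if "i < ?N" "i \<notin> I" "j < ?N" "j \<notin> I" for i j
    proof (cases "?p = dl ?p")
      case True
      then have "i = ?p" "j = ?p" using mid[OF that(1,2)] mid[OF that(3,4)] by metis+
      then show ?thesis using g(3) pN(5) True by simp
    next
      case False
      then show ?thesis
        using mid[OF that(1,2)] mid[OF that(3,4)] g(3) g(4)[OF False] s[of "g (dl ?p)" "g ?p"] pN(4-6)
        by (elim disjE) (simp_all add: add.commute)
    qed
    have "frame f" unfolding frame_def
    proof (intro allI impI)
      fix i j assume ij: "i < ?N" "j < ?N"
      have x: "i + j \<noteq> ?N - 1" if "(i \<in> I) \<noteq> (j \<in> I)" using ij that by (auto simp: I_def dl_def)
      consider "i \<in> I" "j \<in> I" | "i \<in> I" "j \<notin> I" | "i \<notin> I" "j \<in> I" | "i \<notin> I" "j \<notin> I" by blast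
      then show "B (f i) (f j) = (if i + j = ?N - 1 then (if i \<le> j then 1 else \<epsilon>) else 0)"
      proof cases
        case 1 then show ?thesis using h[OF 1] by (simp add: f_def)
      next
        case 2 then show ?thesis using gh(1)[OF 2(1) ij(2) 2(2)] x by (simp add: f_def)
      next
        case 3 then show ?thesis using gh(2)[OF 3(2) ij(1) 3(1)] x by (simp add: f_def)
      next
        case 4 then show ?thesis using gg[OF ij(1) 4(1) ij(2) 4(2)] by (simp add: f_def True)
      qed
    qed
    moreover have "\<forall>i<?p. f i = u i \<and> f (dl i) = v i" using p2 by (auto simp: f_def h_def I_def dl_def)
    ultimately show ?thesis by blast
  qed
qed

section \<open>Nondegenerate subspaces and isotropic dual systems\<close>

definition nd :: "(complex^'n) set \<Rightarrow> bool"
  where "nd V \<longleftrightarrow> vec.subspace V \<and> (\<forall>x\<in>V. (\<forall>y\<in>V. B x y = 0) \<longrightarrow> x = 0)"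

lemma nd_UNIV: "nd UNIV"
  unfolding nd_def using nondeg B_sym_0 vec.subspace_UNIV by blast

text \<open>A nondegenerate subspace meets its orthogonal complement only in 0, and their dimensions
  add up to that of the whole space.\<close>

lemma nd_project:
  assumes "nd V" shows "\<exists>y\<in>V. x - y \<in> perp V"
proof -
  have V: "vec.subspace V" using assms by (simp add: nd_def)
  obtain u where u: "indep_seq u (vec.dim V)" "fspan u (vec.dim V) = V"
  proof -
    obtain f where f: "fspan f (vec.dim V) = V" "fspan f CARD('n) = UNIV"
      using ex_enumerated_basis[OF V] by blast
    have "indep_seq f (vec.dim V)" unfolding indep_seq_def
    proof (intro allI impI notI)
      fix i assume i: "i < vec.dim V" "f i \<in> fspan f i"
      then have "i < CARD('n)" using dim_le_CARD[of V] by simp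
      have "vec.dim (f ` {..<Suc i}) = vec.dim (f ` {..<i})" using i by (simp add: lessThan_Suc vec.dim_insert)
      then show False using dim_span_of_invertible_fmat[OF invertible_fmat[OF f(2)], of "{..<i}"]
        dim_span_of_invertible_fmat[OF invertible_fmat[OF f(2)], of "{..<Suc i}"] \<open>i < CARD('n)\<close> by simp
    qed
    then show thesis using f(1) that by blast
  qed
  have "perp V = perp (u ` {..<vec.dim V})" using perp_span[of "u ` {..<vec.dim V}"] u(2) by simp
  then have dp: "vec.dim (perp V) = CARD('n) - vec.dim V" using dim_perp[OF u(1)] by simp
  have "V \<inter> perp V \<subseteq> {0}" using assms B_sym_0 by (auto simp: nd_def perp_def)
  then have "vec.dim {a + b | a b. a \<in> V \<and> b \<in> perp V} = vec.dim V + vec.dim (perp V)"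
    by (intro dim_direct_sum V subspace_perp) auto
  then have "vec.dim {a + b | a b. a \<in> V \<and> b \<in> perp V} = CARD('n)" using dp dim_le_CARD[of V] by simp
  then have "vec.span {a + b | a b. a \<in> V \<and> b \<in> perp V} = UNIV" by (rule span_eq_UNIV_of_dim)
  then have "{a + b | a b. a \<in> V \<and> b \<in> perp V} = UNIV"
    by (simp only: vec.span_eq_iff[THEN iffD2, OF vec.subspace_sums[OF V subspace_perp[of V]]])
  then have "x \<in> {a + b | a b. a \<in> V \<and> b \<in> perp V}" by (simp only: UNIV_I)
  then obtain a b where "a \<in> V" "b \<in> perp V" "x = a + b" by blast
  then show ?thesis by (intro bexI[of _ a]) auto
qed

text \<open>Any dual system is first projected into \<open>V\<close>, which does not change its
  pairings with vectors of \<open>V\<close>, and then made isotropic by adding vectors of the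
  isotropic system.\<close>

lemma isotropic_duals:
  assumes V: "nd V" "\<And>i. i < p \<Longrightarrow> u i \<in> V"
    and u: "indep_seq u p" "\<And>i j. i < p \<Longrightarrow> j < p \<Longrightarrow> B (u i) (u j) = 0"
  shows "\<exists>v. (\<forall>j<p. v j \<in> V) \<and> (\<forall>i<p. \<forall>j<p. B (u i) (v j) = (if i = j then 1 else 0)) \<and>
    (\<forall>i<p. \<forall>j<p. B (v i) (v j) = 0)"
proof -
  have Vs: "vec.subspace V" using V by (simp add: nd_def)
  have "\<forall>j. \<exists>y. y \<in> V \<and> (\<forall>i<p. B (u i) y = (if i = j then 1 else 0))"
  proof
    fix j
    have "\<exists>x. \<forall>i<p. B (u i) x = (if i = j then 1 else 0)" by (rule ex_dual_vector[OF u(1)])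
    then obtain x where x: "\<forall>i<p. B (u i) x = (if i = j then 1 else 0)" ..
    obtain y where y: "y \<in> V" "x - y \<in> perp V" using nd_project[OF V(1)] by blast
    have "B (u i) y = B (u i) x" if "i < p" for i
    proof -
      have "B (u i) (x - y) = 0" using y(2) V(2)[OF that] by (simp add: perp_def)
      then show ?thesis by (simp add: bil_simps)
    qed
    then show "\<exists>y. y \<in> V \<and> (\<forall>i<p. B (u i) y = (if i = j then 1 else 0))" using x y(1) by (intro exI[of _ y]) simp
  qed
  from choice[OF this] obtain y where y0: "\<forall>j. y j \<in> V \<and> (\<forall>i<p. B (u i) (y j) = (if i = j then 1 else 0))" ..
  then have y: "B (u i) (y j) = (if i = j then 1 else 0)" if "i < p" for i j using that by simp
  have y': "B (y j) (u i) = (if i = j then \<epsilon> else 0)" if "i < p" for i j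
    using B_sym[of "y j" "u i"] y[OF that, of j] by simp
  \<comment> \<open>The correction enters B (v i) (v j) once from each argument, and each time
    removes half of B (y i) (y j).\<close>
  define v where "v j = y j - (\<Sum>i<p. (\<epsilon> * B (y i) (y j) / 2) *s u i)" for j
  have vV: "v j \<in> V" for j
    unfolding v_def using y0 V(2) by (intro vec.subspace_diff[OF Vs] vec.subspace_sum[OF Vs] vec.subspace_scale[OF Vs]) auto
  have uv: "B (u i) (v j) = (if i = j then 1 else 0)" if "i < p" for i j
    using that u(2) by (simp add: v_def bil_simps bil_sum_right y)
  have vu: "B (v j) (u i) = (if i = j then \<epsilon> else 0)" if "i < p" for i j
    using B_sym[of "v j" "u i"] uv[OF that, of j] by simp
  have vv: "B (v i) (v j) = 0" if ij: "i < p" "j < p" for i j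
  proof -
    have "B (v i) (v j) = B (v i) (y j) - (\<Sum>k<p. (\<epsilon> * B (y k) (y j) / 2) * B (v i) (u k))"
      unfolding v_def[of j] by (simp add: bil_simps bil_sum_right)
    also have "(\<Sum>k<p. (\<epsilon> * B (y k) (y j) / 2) * B (v i) (u k)) = (\<Sum>k<p. if k = i then B (y i) (y j) / 2 else 0)"
      by (intro sum.cong) (auto simp: vu)
    also have "\<dots> = B (y i) (y j) / 2" using ij by simp
    also have "B (v i) (y j) = B (y i) (y j) - (\<Sum>k<p. (\<epsilon> * B (y k) (y i) / 2) * B (u k) (y j))"
      unfolding v_def[of i] by (simp add: bil_simps bil_sum_left)
    also have "(\<Sum>k<p. (\<epsilon> * B (y k) (y i) / 2) * B (u k) (y j)) = (\<Sum>k<p. if k = j then \<epsilon> * B (y j) (y i) / 2 else 0)"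
      by (intro sum.cong) (auto simp: y)
    also have "\<dots> = B (y i) (y j) / 2" using ij B_sym[of "y i" "y j"] by simp
    finally show ?thesis by simp
  qed
  show ?thesis by (rule exI[of _ v]) (simp add: vV uv vv)
qed

lemma witt_frame:
  assumes u: "indep_seq u wi" "\<And>i j. i < wi \<Longrightarrow> j < wi \<Longrightarrow> B (u i) (u j) = 0"
    and ev: "\<epsilon> = - 1 \<Longrightarrow> CARD('n) = 2 * wi"
  shows "\<exists>f. frame f \<and> (\<forall>i<wi. f i = u i)"
proof -
  let ?p = wi and ?N = "CARD('n)"
  have p2: "2 * ?p \<le> ?N" using isotropic_le[OF u] by simp
  obtain v where v: "\<forall>i<?p. \<forall>j<?p. B (u i) (v j) = (if i = j then 1 else 0)" "\<forall>i<?p. \<forall>j<?p. B (v i) (v j) = 0"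
    using isotropic_duals[OF nd_UNIV UNIV_I u] by blast
  have "\<exists>f. frame f \<and> (\<forall>i<wi. f i = u i \<and> f (dl i) = v i)"
    by (rule hyperbolic_frame[OF _ _ _ p2]) (use u(2) v ev in auto)
  then obtain f where f: "frame f \<and> (\<forall>i<wi. f i = u i \<and> f (dl i) = v i)" ..
  show ?thesis by (rule exI[of _ f]) (use f in simp)
qed

end

section \<open>Triangular matrices with respect to a basis\<close>

text \<open>The relation \<open>r i j\<close> says that the matrix entry at (i, j) with respect to
  \<open>f\<close> may be nonzero. Triangular algebras, their strict parts and the pieces of a
  grading are all of this shape.\<close>

definition tri :: "(nat \<Rightarrow> complex^'n) \<Rightarrow> (nat \<Rightarrow> nat \<Rightarrow> bool) \<Rightarrow> (complex^'n^'n) set"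
  where "tri f r = {X. \<forall>j<CARD('n). X *v f j \<in> vec.span (f ` {i. i < CARD('n) \<and> r i j})}"

lemma triD: "X \<in> tri f r \<Longrightarrow> j < CARD('n) \<Longrightarrow> X *v f j \<in> vec.span (f ` {i. i < CARD('n) \<and> r i j})"
  for X :: "complex^'n^'n"
  by (simp add: tri_def)

lemma tri_mono: "(\<And>i j. i < CARD('n) \<Longrightarrow> j < CARD('n) \<Longrightarrow> r i j \<Longrightarrow> s i j) \<Longrightarrow> tri f r \<subseteq> tri f s"
  for f :: "nat \<Rightarrow> complex^'n"
proof
  fix X assume rs: "\<And>i j. i < CARD('n) \<Longrightarrow> j < CARD('n) \<Longrightarrow> r i j \<Longrightarrow> s i j" and X: "X \<in> tri f r"
  have "vec.span (f ` {i. i < CARD('n) \<and> r i j}) \<subseteq> vec.span (f ` {i. i < CARD('n) \<and> s i j})" if "j < CARD('n)" for j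
    using rs that by (intro vec.span_mono image_mono) auto
  then show "X \<in> tri f s" using X by (auto simp: tri_def)
qed

lemma tri_apply:
  fixes f :: "nat \<Rightarrow> complex^'n"
  assumes "X \<in> tri f r" "x \<in> vec.span (f ` {j. j < CARD('n) \<and> s j})"
    and "\<And>i j. i < CARD('n) \<Longrightarrow> j < CARD('n) \<Longrightarrow> r i j \<Longrightarrow> s j \<Longrightarrow> t i"
  shows "X *v x \<in> vec.span (f ` {i. i < CARD('n) \<and> t i})"
  using assms(2)
proof (induction rule: vec.span_induct_alt)
  case base then show ?case by (simp add: vec.span_zero)
next
  case (step c y z)
  then obtain j where j: "j < CARD('n)" "s j" "y = f j" by auto
  have "vec.span (f ` {i. i < CARD('n) \<and> r i j}) \<subseteq> vec.span (f ` {i. i < CARD('n) \<and> t i})"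
    using assms(3) j by (intro vec.span_mono image_mono) auto
  then have "X *v y \<in> vec.span (f ` {i. i < CARD('n) \<and> t i})" using triD[OF assms(1) j(1)] j(3) by blast
  then show ?case using step by (simp add: matrix_vector_right_distrib vec.span_add vec.span_scale)
qed

lemma tri_mult:
  fixes f :: "nat \<Rightarrow> complex^'n"
  assumes "X \<in> tri f r" "Y \<in> tri f s"
    and "\<And>l i j. l < CARD('n) \<Longrightarrow> i < CARD('n) \<Longrightarrow> j < CARD('n) \<Longrightarrow> r l i \<Longrightarrow> s i j \<Longrightarrow> t l j"
  shows "X ** Y \<in> tri f t"
  unfolding tri_def mem_Collect_eq
proof (intro allI impI)
  fix j assume j: "j < CARD('n)"
  have "X *v (Y *v f j) \<in> vec.span (f ` {i. i < CARD('n) \<and> t i j})"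
    by (rule tri_apply[OF assms(1) triD[OF assms(2) j]]) (use assms(3) j in blast)
  then show "(X ** Y) *v f j \<in> vec.span (f ` {i. i < CARD('n) \<and> t i j})"
    by (simp add: matrix_vector_mul_assoc)
qed

lemma subspace_tri: "cmat.subspace (tri f r)"
  by (auto simp: cmat.subspace_def tri_def matrix_vector_mult_add_rdistrib vec.span_add vec.span_scale vec.span_zero)

lemma tri_bracket:
  fixes f :: "nat \<Rightarrow> complex^'n"
  assumes "X \<in> tri f r" "Y \<in> tri f s"
    and "\<And>l i j. l < CARD('n) \<Longrightarrow> i < CARD('n) \<Longrightarrow> j < CARD('n) \<Longrightarrow> r l i \<Longrightarrow> s i j \<Longrightarrow> t l j"
    and "\<And>l i j. l < CARD('n) \<Longrightarrow> i < CARD('n) \<Longrightarrow> j < CARD('n) \<Longrightarrow> s l i \<Longrightarrow> r i j \<Longrightarrow> t l j"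
  shows "bracket X Y \<in> tri f t"
  unfolding bracket_def using tri_mult[OF assms(1,2,3)] tri_mult[OF assms(2,1,4)]
  by (intro cmat.subspace_diff[OF subspace_tri])

lemma coord_zero:
  fixes f :: "nat \<Rightarrow> complex^'n"
  assumes "invertible (fmat f)" "x \<in> vec.span (f ` I)" "I \<subseteq> {..<CARD('n)}" "idx i \<notin> I"
  shows "(matrix_inv (fmat f) *v x) $ i = 0"
  using assms(2)
proof (induction rule: vec.span_induct_alt)
  case (step c y z)
  then obtain j where j: "j \<in> I" "y = f j" by auto
  then obtain l :: 'n where l: "idx l = j" using assms(3) ex_idx by blast
  have "y = fmat f *v axis l 1" using l j(2) by (simp add: fmat_axis)
  then have "matrix_inv (fmat f) *v y = axis l 1" by (simp add: matrix_inv_mult(4)[OF assms(1)])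
  moreover have "l \<noteq> i" using l j assms(4) by auto
  ultimately show ?case using step by (simp add: matrix_vector_right_distrib axis_def)
qed simp

lemma trace_tri:
  fixes f :: "nat \<Rightarrow> complex^'n"
  assumes f: "fspan f CARD('n) = UNIV" and X: "X \<in> tri f r" and r: "\<And>j. j < CARD('n) \<Longrightarrow> \<not> r j j"
  shows "trace X = 0"
proof -
  let ?P = "fmat f"
  note P = invertible_fmat[OF f]
  have "trace X = trace (?P ** (matrix_inv ?P ** X))" by (simp add: matrix_inv_conj[OF P])
  also have "\<dots> = trace (matrix_inv ?P ** X ** ?P)" by (rule trace_mul_sym)
  also have "\<dots> = 0"
    unfolding trace_def
  proof (rule sum.neutral, rule ballI)
    fix i :: 'n
    have "(matrix_inv ?P *v (X *v f (idx i))) $ i = 0"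
      by (rule coord_zero[OF P triD[OF X]]) (use r in auto)
    then have "((matrix_inv ?P ** X ** ?P) *v axis i 1) $ i = 0"
      by (simp add: matrix_vector_mul_assoc[symmetric] fmat_axis)
    then show "(matrix_inv ?P ** X ** ?P) $ i $ i = 0"
      by (simp add: matrix_vector_mult_def axis_def if_distrib cong: if_cong)
  qed
  finally show ?thesis .
qed

lemma tri_le_eigen:
  fixes f :: "nat \<Rightarrow> complex^'n"
  assumes "X \<in> tri f (\<le>)" "j < CARD('n)"
  shows "\<exists>a. X *v f j - a *s f j \<in> vec.span (f ` {i. i < CARD('n) \<and> i < j})"
proof -
  have "{i. i < CARD('n) \<and> i \<le> j} = insert j {i. i < CARD('n) \<and> i < j}" using assms(2) by auto
  then show ?thesis using triD[OF assms] by (simp add: vec.span_insert)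
qed

lemma tri_le_lt:
  fixes f :: "nat \<Rightarrow> complex^'n"
  assumes "X \<in> tri f (\<le>)" "x \<in> vec.span (f ` {i. i < CARD('n) \<and> i < j})"
  shows "X *v x \<in> vec.span (f ` {i. i < CARD('n) \<and> i < j})"
  by (rule tri_apply[OF assms]) auto

text \<open>The diagonal entries \<open>a\<close> and \<open>b\<close> are scalars modulo the
  preceding member of the flag and drop out of the commutator.\<close>

lemma bracket_tri_le:
  fixes f :: "nat \<Rightarrow> complex^'n"
  assumes X: "X \<in> tri f (\<le>)" and Y: "Y \<in> tri f (\<le>)"
  shows "bracket X Y \<in> tri f (<)"
  unfolding tri_def mem_Collect_eq
proof (intro allI impI)
  fix j assume j: "j < CARD('n)"
  let ?S = "vec.span (f ` {i. i < CARD('n) \<and> i < j})"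
  obtain a b where ab: "X *v f j - a *s f j \<in> ?S" "Y *v f j - b *s f j \<in> ?S"
    using tri_le_eigen[OF X j] tri_le_eigen[OF Y j] by blast
  have "bracket X Y *v f j = (X *v (Y *v f j - b *s f j) - Y *v (X *v f j - a *s f j))
      + (b *s (X *v f j - a *s f j) - a *s (Y *v f j - b *s f j))"
    by (simp add: bracket_def matrix_vector_mult_diff_rdistrib matrix_vector_mult_diff_distrib
      matrix_vector_mul_assoc[symmetric] vec_eq_iff algebra_simps)
  also have "\<dots> \<in> ?S"
    by (intro vec.span_add vec.span_diff vec.span_scale tri_le_lt X Y ab)
  finally show "bracket X Y *v f j \<in> ?S" .
qed

text \<open>The first derived algebra has no diagonal, and each further step moves the possible
  entries at least one place away from it until none is left.\<close>

lemma solvable_tri: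
  fixes f :: "nat \<Rightarrow> complex^'n"
  assumes f: "fspan f CARD('n) = UNIV" and s: "s \<subseteq> tri f (\<le>)"
  shows "lie_solvable s"
proof -
  let ?D = "\<lambda>k. ((\<lambda>d. bracket_span d d) ^^ k) s"
  have "?D (Suc k) \<subseteq> tri f (\<lambda>i j. i + Suc k \<le> j)" for k
  proof (induction k)
    case 0
    have "bracket X Y \<in> tri f (\<lambda>i j. i + Suc 0 \<le> j)" if "X \<in> s" "Y \<in> s" for X Y
      using bracket_tri_le[of X f Y] s that by (auto simp: less_eq_Suc_le[symmetric] tri_def)
    then show ?case by (simp add: bracket_span_minimal[OF subspace_tri])
  next
    case (Suc k)
    have "bracket X Y \<in> tri f (\<lambda>i j. i + Suc (Suc k) \<le> j)" if "X \<in> ?D (Suc k)" "Y \<in> ?D (Suc k)" for X Y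
      by (rule tri_bracket[of X f "\<lambda>i j. i + Suc k \<le> j" Y "\<lambda>i j. i + Suc k \<le> j"]) (use that Suc in auto)
    then show ?case by (subst funpow.simps(2), subst o_apply) (intro bracket_span_minimal[OF subspace_tri])
  qed
  moreover have "tri f (\<lambda>i j. i + Suc CARD('n) \<le> j) \<subseteq> {0}"
  proof
    fix X assume X: "X \<in> tri f (\<lambda>i j. i + Suc CARD('n) \<le> j)"
    have "X = 0"
    proof (rule matrix_eq_on_basis[OF f])
      fix j assume j: "j < CARD('n)"
      then have e: "{i. i < CARD('n) \<and> i + Suc CARD('n) \<le> j} = {}" by auto
      show "X *v f j = 0 *v f j" using triD[OF X j] unfolding e by simp
    qed
    then show "X \<in> {0}" by simp
  qed
  ultimately have "?D (Suc CARD('n)) \<subseteq> {0}" by blast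
  moreover have "0 \<in> ?D (Suc CARD('n))"
    by (subst funpow.simps(2), subst o_apply) (rule cmat.subspace_0[OF subspace_bracket_span])
  ultimately show ?thesis unfolding lie_solvable_def by blast
qed

text \<open>A diagonal entry \<open>a\<close> of a triangular matrix satisfies a^k = 0 when the k-th
  power vanishes.\<close>

lemma tri_nilpotent:
  fixes f :: "nat \<Rightarrow> complex^'n"
  assumes f: "indep_seq f CARD('n)" and X: "X \<in> tri f (\<le>)" and nil: "nilpotent_matrix X"
  shows "X \<in> tri f (<)"
  unfolding tri_def mem_Collect_eq
proof (intro allI impI)
  fix j assume j: "j < CARD('n)"
  let ?S = "vec.span (f ` {i. i < CARD('n) \<and> i < j})"
  obtain a where a: "X *v f j - a *s f j \<in> ?S" using tri_le_eigen[OF X j] by blast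
  have e: "{i. i < CARD('n) \<and> i < j} = {..<j}" using j by auto
  have fj: "f j \<notin> ?S" using f j unfolding e indep_seq_def by blast
  have pw: "mpow X k *v f j - a ^ k *s f j \<in> ?S" for k
  proof (induction k)
    case (Suc k)
    have "mpow X (Suc k) *v f j - a ^ Suc k *s f j = X *v (mpow X k *v f j - a ^ k *s f j) + a ^ k *s (X *v f j - a *s f j)"
      by (simp add: mpow_mult_vec_Suc[symmetric] matrix_vector_mult_diff_distrib vec_eq_iff algebra_simps)
    also have "\<dots> \<in> ?S" by (intro vec.span_add vec.span_scale tri_le_lt X Suc a)
    finally show ?case .
  qed (simp add: vec.span_zero)
  obtain k where "mpow X k = 0" using nil by (auto simp: nilpotent_matrix_iff)
  with pw[of k] have "- (a ^ k *s f j) \<in> ?S" by simp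
  then have "a ^ k *s f j \<in> ?S" using vec.span_neg by fastforce
  then have "inverse (a ^ k) *s (a ^ k *s f j) \<in> ?S" by (rule vec.span_scale)
  then have "a ^ k = 0" using fj by (cases "a ^ k = 0") (simp_all add: vec.scale_scale)
  then have "a = 0" by simp
  then show "X *v f j \<in> ?S" using a by simp
qed

lemma tri_rev:
  fixes f :: "nat \<Rightarrow> complex^'n"
  shows "tri (\<lambda>i. f (CARD('n) - 1 - i)) r = tri f (\<lambda>i j. r (CARD('n) - 1 - i) (CARD('n) - 1 - j))"
proof -
  let ?d = "\<lambda>i. CARD('n) - 1 - i"
  have im: "(\<lambda>i. f (?d i)) ` {i. i < CARD('n) \<and> r i (?d j)} = f ` {i. i < CARD('n) \<and> r (?d i) (?d j)}" for j r
  proof (intro equalityI subsetI)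
    fix x assume "x \<in> (\<lambda>i. f (?d i)) ` {i. i < CARD('n) \<and> r i (?d j)}"
    then obtain i where "i < CARD('n)" "r i (?d j)" "x = f (?d i)" by auto
    then show "x \<in> f ` {i. i < CARD('n) \<and> r (?d i) (?d j)}" by (intro image_eqI[of _ _ "?d i"]) auto
  next
    fix x assume "x \<in> f ` {i. i < CARD('n) \<and> r (?d i) (?d j)}"
    then obtain i where "i < CARD('n)" "r (?d i) (?d j)" "x = f i" by auto
    then show "x \<in> (\<lambda>i. f (?d i)) ` {i. i < CARD('n) \<and> r i (?d j)}" by (intro image_eqI[of _ _ "?d i"]) auto
  qed
  have "(\<forall>j<CARD('n). P (?d j)) \<longleftrightarrow> (\<forall>j<CARD('n). P j)" for P
  proof (intro iffI allI impI)
    fix j assume P: "\<forall>j<CARD('n). P (?d j)" and j: "j < CARD('n)"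
    have "?d j < CARD('n)" using j by auto
    with P have "P (?d (?d j))" by blast
    moreover have "?d (?d j) = j" using j by auto
    ultimately show "P j" by (simp only:)
  qed auto
  note all = this
  show ?thesis
  proof (intro equalityI subsetI)
    fix X assume X: "X \<in> tri (\<lambda>i. f (?d i)) r"
    show "X \<in> tri f (\<lambda>i j. r (?d i) (?d j))" unfolding tri_def mem_Collect_eq im[symmetric]
    proof (intro allI impI)
      fix j assume j: "j < CARD('n)"
      then have "?d j < CARD('n)" "?d (?d j) = j" by auto
      then show "X *v f j \<in> vec.span ((\<lambda>i. f (?d i)) ` {i. i < CARD('n) \<and> r i (?d j)})"
        using triD[OF X, of "?d j"] by simp
    qed
  next
    fix X assume X: "X \<in> tri f (\<lambda>i j. r (?d i) (?d j))"
    show "X \<in> tri (\<lambda>i. f (?d i)) r" unfolding tri_def mem_Collect_eq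
    proof (intro allI impI)
      fix j assume j: "j < CARD('n)"
      then have d: "?d j < CARD('n)" "?d (?d j) = j" by auto
      show "X *v f (?d j) \<in> vec.span ((\<lambda>i. f (?d i)) ` {i. i < CARD('n) \<and> r i j})"
        using triD[OF X d(1)] im[of r "?d j"] unfolding d(2) by simp
    qed
  qed
qed

lemma indep_seq_rev:
  fixes f :: "nat \<Rightarrow> complex^'n"
  assumes "indep_seq f CARD('n)" shows "indep_seq (\<lambda>i. f (CARD('n) - 1 - i)) CARD('n)"
proof -
  have P: "invertible (fmat f)" by (intro invertible_fmat span_indep_seq assms)
  let ?g = "\<lambda>i. f (CARD('n) - 1 - i)"
  have "vec.dim (?g ` {..<i}) = i" if "i \<le> CARD('n)" for i
  proof -
    have inj: "inj_on (\<lambda>i. CARD('n) - 1 - i) {..<i}" using that by (auto simp: inj_on_def)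
    have "?g ` {..<i} = f ` ((\<lambda>i. CARD('n) - 1 - i) ` {..<i})" by (simp add: image_image)
    also have "vec.dim \<dots> = card ((\<lambda>i. CARD('n) - 1 - i) ` {..<i})"
      by (rule dim_span_of_invertible_fmat[OF P]) auto
    finally show ?thesis using card_image[OF inj] by simp
  qed
  note d = this
  show ?thesis unfolding indep_seq_def
  proof (intro allI impI notI)
    fix i assume i: "i < CARD('n)" "?g i \<in> fspan ?g i"
    then have "vec.dim (?g ` {..<Suc i}) = vec.dim (?g ` {..<i})" by (simp add: lessThan_Suc vec.dim_insert)
    then show False using d[of i] d[of "Suc i"] i(1) by simp
  qed
qed

lemma indep_seq_of_span:
  fixes f :: "nat \<Rightarrow> complex^'n"
  assumes "fspan f CARD('n) = UNIV" shows "indep_seq f CARD('n)"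
  unfolding indep_seq_def
proof (intro allI impI notI)
  fix i assume i: "i < CARD('n)" "f i \<in> fspan f i"
  then have "vec.dim (f ` {..<Suc i}) = vec.dim (f ` {..<i})" by (simp add: lessThan_Suc vec.dim_insert)
  then show False using dim_span_of_invertible_fmat[OF invertible_fmat[OF assms], of "{..<i}"]
    dim_span_of_invertible_fmat[OF invertible_fmat[OF assms], of "{..<Suc i}"] i(1) by simp
qed

lemma ex_basis_seq:
  fixes S :: "(complex^'n) set"
  assumes "vec.subspace S" shows "\<exists>u. indep_seq u (vec.dim S) \<and> fspan u (vec.dim S) = S"
proof -
  obtain f where f: "fspan f (vec.dim S) = S" "fspan f CARD('n) = UNIV"
    using ex_enumerated_basis[OF assms] by blast
  have "indep_seq f (vec.dim S)"
    using indep_seq_of_span[OF f(2)] dim_le_CARD[of S] by (auto simp: indep_seq_def)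
  then show ?thesis using f(1) by blast
qed

lemma nilradical_tri:
  fixes f :: "nat \<Rightarrow> complex^'n"
  assumes "indep_seq f CARD('n)" "b \<subseteq> tri f (\<le>)" shows "nilradical b \<subseteq> tri f (<)"
  unfolding nilradical_def
  by (rule cmat.span_minimal[OF _ subspace_tri]) (use assms tri_nilpotent[OF assms(1)] in \<open>auto simp: lie_ideal_def\<close>)

text \<open>Otherwise \<open>Y\<close> would lie in every term of the lower central series. This is
  how the nilpotency of a Cartan subalgebra excludes Borel subalgebras whose flags are not
  transversal.\<close>

lemma lie_nilpotent_no_eigenvector:
  assumes "lie_nilpotent h" "X \<in> h" "Y \<in> h" "bracket X Y = cscale a Y" "a \<noteq> 0" shows "Y = 0"
proof -
  obtain k where k: "((\<lambda>d. bracket_span h d) ^^ k) h = {0}" using assms(1) by (auto simp: lie_nilpotent_def)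
  have "Y \<in> ((\<lambda>d. bracket_span h d) ^^ k) h" for k
  proof (induction k)
    case (Suc k)
    have "cscale (inverse a) (bracket X Y) \<in> bracket_span h (((\<lambda>d. bracket_span h d) ^^ k) h)"
      by (intro cmat.subspace_scale[OF subspace_bracket_span] bracket_in_span assms Suc)
    moreover have "cscale (inverse a) (bracket X Y) = Y"
      unfolding assms(4) using assms(5) by (simp add: cmat.scale_scale)
    ultimately show ?case by simp
  qed (simp add: assms)
  then show ?thesis using k by blast
qed

section \<open>Isotropic flags\<close>

context form
begin

lemma subspace_so: "cmat.subspace (so M)"
  by (auto simp: cmat.subspace_def so_def matrix_vector_mult_add_rdistrib bil_simps)

lemma bracket_so: "X \<in> so M \<Longrightarrow> Y \<in> so M \<Longrightarrow> bracket X Y \<in> so M"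
  by (simp add: so_def bracket_def matrix_vector_mult_diff_rdistrib matrix_vector_mul_assoc[symmetric] bil_simps)

lemma lie_subalgebra_so_tri:
  assumes "r = (\<le>) \<or> r = (\<ge>)" shows "lie_subalgebra (so M \<inter> tri f r) (so M)"
  unfolding lie_subalgebra_def
proof (intro conjI ballI)
  show "cmat.subspace (so M \<inter> tri f r)" by (intro cmat.subspace_inter subspace_so subspace_tri)
  fix X Y assume XY: "X \<in> so M \<inter> tri f r" "Y \<in> so M \<inter> tri f r"
  have tr: "r l i \<Longrightarrow> r i j \<Longrightarrow> r l j" for l i j using assms by (elim disjE) auto
  have "bracket X Y \<in> tri f r"
    by (rule tri_bracket[of X f r Y r]) (use XY tr in blast)+
  then show "bracket X Y \<in> so M \<inter> tri f r" using bracket_so XY by blast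
qed auto

text \<open>Lie's theorem in the quotient of \<open>perp U\<close> by \<open>U\<close> gives a
  common eigenvector \<open>v\<close>. If \<open>v\<close> is not isotropic, the form is symmetric,
  all weights of \<open>v\<close> vanish, and the theorem applies once more to the vectors
  orthogonal to \<open>v\<close>. If the second eigenvector \<open>w\<close> is not isotropic
  either, both are killed modulo \<open>U\<close>, and so is an isotropic combination v + t w. The
  bound on \<open>p\<close> leaves enough room for \<open>w\<close>.\<close>

lemma isotropic_step:
  assumes L: "lie_solvable L" "cmat.subspace L" "\<And>X Y. X \<in> L \<Longrightarrow> Y \<in> L \<Longrightarrow> bracket X Y \<in> L" "L \<subseteq> so M"
    and u: "indep_seq u p" "\<And>i j. i < p \<Longrightarrow> j < p \<Longrightarrow> B (u i) (u j) = 0"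
    and st: "\<And>X i. X \<in> L \<Longrightarrow> i < p \<Longrightarrow> X *v u i \<in> fspan u (Suc i)"
    and p: "\<epsilon> = 1 \<Longrightarrow> 2 * p + 2 \<le> CARD('n)" "2 * p < CARD('n)"
  shows "\<exists>v. v \<notin> fspan u p \<and> v \<in> perp (u ` {..<p}) \<and> B v v = 0 \<and>
    (\<forall>X\<in>L. X *v v \<in> vec.span (insert v (u ` {..<p})))"
proof -
  obtain k where k: "((\<lambda>d. bracket_span d d) ^^ k) L = {0}" using L(1) by (auto simp: lie_solvable_def)
  define U where "U = fspan u p"
  have U: "vec.subspace U" by (simp add: U_def)
  have perpU: "perp U = perp (u ` {..<p})" unfolding U_def by (rule perp_span)
  have dU: "vec.dim U = p" using dim_indep_seq[OF u(1)] by (simp add: U_def)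
  have dP: "vec.dim (perp U) = CARD('n) - p" unfolding perpU by (rule dim_perp[OF u(1)])
  have LU: "X *v x \<in> U" if "X \<in> L" "x \<in> U" for X x
    using that(2) unfolding U_def
  proof (induction rule: vec.span_induct_alt)
    case (step c y z)
    then obtain i where i: "i < p" "y = u i" by auto
    have "fspan u (Suc i) \<subseteq> fspan u p" using i by (intro vec.span_mono image_mono) auto
    then show ?case using step st[OF that(1) i(1)] i
      by (auto simp: matrix_vector_right_distrib intro!: vec.span_add vec.span_scale)
  qed (simp add: vec.span_zero)
  have LP: "X *v x \<in> perp U" if "X \<in> L" "x \<in> perp U" for X x
    by (rule perp_stable[of X U]) (use that L(4) LU in auto)
  have "u ` {..<p} \<subseteq> perp (u ` {..<p})" using u(2) by (auto simp: perp_def)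
  then have UP: "U \<subseteq> perp U" unfolding perpU unfolding U_def by (rule vec.span_minimal[OF _ subspace_perp])
  have ins: "vec.span (insert v (u ` {..<p})) = {x. \<exists>c. x - c *s v \<in> U}" for v
    by (simp add: vec.span_insert U_def)
  have ortho: "B x y = 0" "B y x = 0" if "x \<in> U" "y \<in> perp U" for x y
    using that B_sym_0 by (auto simp: perp_def)
  have "\<not> perp U \<subseteq> U" using vec.dim_subset[of "perp U" U] dP dU p(2) by auto
  then obtain v where v: "v \<in> perp U" "v \<notin> U" "\<And>X. X \<in> L \<Longrightarrow> \<exists>c. X *v v - c *s v \<in> U"
    using lie_common_eigenvector[OF k L(2,3) U subspace_perp UP _ LU LP] by blast
  show ?thesis
  proof (cases "B v v = 0")
    case True
    then show ?thesis using v by (intro exI[of _ v]) (auto simp: ins U_def[symmetric] perpU[symmetric])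
  next
    case False
    then have e1: "\<epsilon> = 1" using B_sym[of v v] eps by auto
    \<comment> \<open>For a symmetric form B (X x) x vanishes by skewness, so an eigenvector modulo
      \<open>U\<close> with nonzero square has weight 0.\<close>
    have w0: "X *v x \<in> U" if x: "x \<in> perp U" "B x x \<noteq> 0" "\<exists>c. X *v x - c *s x \<in> U" "X \<in> L" for X x
    proof -
      obtain c where c: "X *v x - c *s x \<in> U" using x by blast
      have "B (X *v x) x = - B (X *v x) x"
        using soD[of X M x x] x(4) L(4) B_sym[of x "X *v x"] e1 by auto
      then have "B (X *v x) x = 0" by simp
      moreover have "B (X *v x - c *s x) x = 0" by (rule ortho[OF c x(1)])
      ultimately have "c = 0" using x(2) by (simp add: bil_simps)
      then show ?thesis using c by simp
    qed
    define W where "W = {w \<in> perp U. B v w = 0}"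
    have W: "vec.subspace W" using subspace_perp[of U] by (auto simp: W_def vec.subspace_def bil_simps)
    have UW: "U \<subseteq> W" using UP ortho v(1) by (auto simp: W_def)
    have "vec.dim (perp U) \<le> Suc (vec.dim W)" unfolding W_def
      by (rule hyperplane_dim[OF subspace_perp]) (auto simp: bil_simps)
    then have "\<not> W \<subseteq> U" using vec.dim_subset[of W U] dP dU p(1)[OF e1] by auto
    moreover have "X *v w \<in> W" if "X \<in> L" "w \<in> W" for X w
    proof -
      have "B v (X *v w) = - B (X *v v) w" using soD[of X M v w] that L(4) by auto
      also have "\<dots> = 0" using ortho(1)[of "X *v v" w] w0[OF v(1) False v(3)] that by (auto simp: W_def)
      finally show ?thesis using LP that by (auto simp: W_def)
    qed
    ultimately obtain w where w: "w \<in> W" "w \<notin> U" "\<And>X. X \<in> L \<Longrightarrow> \<exists>c. X *v w - c *s w \<in> U"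
      using lie_common_eigenvector[OF k L(2,3) U W UW _ LU] by blast
    have wP: "w \<in> perp U" "B v w = 0" "B w v = 0" using w(1) B_sym_0 by (auto simp: W_def)
    show ?thesis
    proof (cases "B w w = 0")
      case True
      then show ?thesis using w wP by (intro exI[of _ w]) (auto simp: ins U_def[symmetric] perpU[symmetric])
    next
      case wnz: False
      define t where "t = csqrt (- B v v / B w w)"
      have t: "t * t = - B v v / B w w" by (metis t_def power2_csqrt power2_eq_square)
      let ?x = "v + t *s w"
      have "B ?x ?x = B v v + (t * t) * B w w" using wP by (simp add: bil_simps)
      then have "B ?x ?x = 0" unfolding t using wnz by simp
      moreover have "?x \<in> perp U" using v(1) wP subspace_perp by (intro vec.subspace_add vec.subspace_scale)
      moreover have "?x \<notin> U"
      proof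
        assume "?x \<in> U"
        then have "B ?x v = 0" using ortho v(1) by blast
        then show False using wP False by (simp add: bil_simps)
      qed
      moreover have "X *v ?x - 0 *s ?x \<in> U" if "X \<in> L" for X
        using w0[OF v(1) False v(3)[OF that] that] w0[OF wP(1) wnz w(3)[OF that] that] U
        by (simp add: matrix_vector_right_distrib vec.subspace_add vec.subspace_scale)
      ultimately show ?thesis unfolding ins U_def[symmetric] perpU[symmetric] by blast
    qed
  qed
qed

lemma ex_isotropic_seq:
  assumes L: "lie_solvable L" "cmat.subspace L" "\<And>X Y. X \<in> L \<Longrightarrow> Y \<in> L \<Longrightarrow> bracket X Y \<in> L" "L \<subseteq> so M"
    and p: "2 * p \<le> CARD('n) + 1" "\<epsilon> = 1 \<Longrightarrow> 2 * p \<le> CARD('n)"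
  shows "\<exists>u. indep_seq u p \<and> (\<forall>i<p. \<forall>j<p. B (u i) (u j) = 0) \<and>
    (\<forall>X\<in>L. \<forall>i<p. X *v u i \<in> fspan u (Suc i))"
  using p
proof (induction p)
  case 0 then show ?case by (simp add: indep_seq_def)
next
  case (Suc p)
  then obtain u where u: "indep_seq u p" "\<And>i j. i < p \<Longrightarrow> j < p \<Longrightarrow> B (u i) (u j) = 0"
    "\<And>X i. X \<in> L \<Longrightarrow> i < p \<Longrightarrow> X *v u i \<in> fspan u (Suc i)" by auto
  obtain v where v: "v \<notin> fspan u p" "v \<in> perp (u ` {..<p})" "B v v = 0"
    "\<And>X. X \<in> L \<Longrightarrow> X *v v \<in> vec.span (insert v (u ` {..<p}))"
    using isotropic_step[OF L u] Suc.prems by auto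
  let ?w = "u(p := v)"
  have im: "?w ` {..<i} = u ` {..<i}" if "i \<le> p" for i using that by (intro image_cong) auto
  have ims: "?w ` {..<Suc p} = insert v (u ` {..<p})" using im[of p] by (simp add: lessThan_Suc del: fun_upd_apply, simp)
  show ?case
  proof (intro exI[of _ ?w] conjI allI impI ballI)
    show "indep_seq ?w (Suc p)" by (rule indep_seq_upd[OF u(1) v(1)])
    fix i assume i: "i < Suc p"
    {
      fix j assume j: "j < Suc p"
      have "B (u i) v = 0" "B v (u i) = 0" if "i < p" for i using v(2) that B_sym_0 by (auto simp: perp_def)
      then show "B (?w i) (?w j) = 0" using i j u(2) v(3) by (auto simp: less_Suc_eq)
    next
      fix X assume X: "X \<in> L"
      show "X *v ?w i \<in> fspan ?w (Suc i)"
      proof (cases "i = p")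
        case True
        show ?thesis unfolding True ims using v(4)[OF X] by simp
      next
        case False
        then have "Suc i \<le> p" using i by simp
        then show ?thesis using u(3)[OF X, of i] False im[of "Suc i"] by simp
      qed
    }
  qed
qed

text \<open>Applied to the zero algebra, \<open>ex_isotropic_seq\<close> gives an isotropic space of
  dimension (n + 1) div 2, which is more than half of the dimension when n is odd.\<close>

lemma even_if_alternating: "\<epsilon> = - 1 \<Longrightarrow> CARD('n) = 2 * wi"
proof -
  assume e: "\<epsilon> = - 1"
  have "((\<lambda>d. bracket_span d d) ^^ 0) {0} = {0}" by simp
  then have L: "lie_solvable {0}" unfolding lie_solvable_def by blast
  have "\<exists>u. indep_seq u ((CARD('n) + 1) div 2) \<and> (\<forall>i<(CARD('n) + 1) div 2. \<forall>j<(CARD('n) + 1) div 2. B (u i) (u j) = 0) \<and>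
    (\<forall>X\<in>{0}. \<forall>i<(CARD('n) + 1) div 2. X *v u i \<in> fspan u (Suc i))"
    by (rule ex_isotropic_seq[OF L]) (auto simp: e bracket_def so_def)
  then obtain u where "indep_seq u ((CARD('n) + 1) div 2)"
    "\<And>i j. i < (CARD('n) + 1) div 2 \<Longrightarrow> j < (CARD('n) + 1) div 2 \<Longrightarrow> B (u i) (u j) = 0" by blast
  then have "2 * ((CARD('n) + 1) div 2) \<le> CARD('n)" by (rule isotropic_le)
  moreover have "2 * ((N + 1) div 2) \<le> N \<Longrightarrow> N = 2 * (N div 2)" for N :: nat by presburger
  ultimately show ?thesis using e by (subst wi_def) auto
qed

lemma two_wi: "2 * wi \<le> CARD('n)" "\<epsilon> = 1 \<Longrightarrow> 2 * wi < CARD('n)" "\<epsilon> = 1 \<Longrightarrow> CARD('n) \<le> 2 * wi + 2"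
proof -
  have "0 < N \<Longrightarrow> 2 * ((N - 1) div 2) < N \<and> N \<le> 2 * ((N - 1) div 2) + 2 \<and> 2 * (N div 2) \<le> N" for N :: nat
    by presburger
  from this[OF zero_less_card_finite[where 'a='n]] show "2 * wi \<le> CARD('n)" "\<epsilon> = 1 \<Longrightarrow> 2 * wi < CARD('n)" "\<epsilon> = 1 \<Longrightarrow> CARD('n) \<le> 2 * wi + 2"
    unfolding wi_def by (auto split: if_splits)
qed

text \<open>The entries at (i, j) and at (\<open>dl j\<close>, \<open>dl i\<close>) agree up to
  sign, so one half of a skew matrix determines the other.\<close>

lemma entry_skew:
  assumes "X \<in> so M" "i < CARD('n)"
  shows "B (f (dl i)) (X *v f j) = - \<epsilon> * B (f j) (X *v f (dl i))"
  using soD[OF assms(1), of "f j" "f (dl i)"] B_sym[of "X *v f j" "f (dl i)"]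
  by (metis (no_types, opaque_lifting) B_sym minus_mult_right mult_minus_left soD[OF assms(1)])

lemma frame_tri_iff:
  assumes "frame f"
  shows "X \<in> tri f r \<longleftrightarrow> (\<forall>i<CARD('n). \<forall>j<CARD('n). \<not> r i j \<longrightarrow> B (f (dl i)) (X *v f j) = 0)"
proof -
  have "X *v f j \<in> vec.span (f ` {i. i < CARD('n) \<and> r i j}) \<longleftrightarrow>
      (\<forall>i<CARD('n). \<not> r i j \<longrightarrow> B (f (dl i)) (X *v f j) = 0)" for j
    by (subst frame_span_iff[OF assms]) auto
  then show ?thesis by (auto simp: tri_def)
qed

lemma dl_simps: "i < CARD('n) \<Longrightarrow> dl i < CARD('n)" "i < CARD('n) \<Longrightarrow> dl (dl i) = i"
  "i < CARD('n) \<Longrightarrow> j < CARD('n) \<Longrightarrow> dl i < dl j \<longleftrightarrow> j < i"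
  "i < CARD('n) \<Longrightarrow> j < CARD('n) \<Longrightarrow> dl i = dl j \<longleftrightarrow> j = i"
  by (auto simp: dl_def)

lemma entry_antidiagonal:
  assumes "X \<in> so M" "\<epsilon> = 1" shows "B x (X *v x) = 0"
proof -
  have "B x (X *v x) = - B x (X *v x)"
    using soD[OF assms(1), of x x] B_sym[of x "X *v x"] assms(2) by simp
  then show ?thesis by simp
qed

text \<open>By skewness the conditions on the isotropic half of the flag imply all the others; in even
  orthogonal groups the entry relating the two middle vectors vanishes by skewness as well.\<close>

lemma flag_tri_le:
  assumes f: "frame f" and X: "X \<in> so M" and st: "\<And>j. j < wi \<Longrightarrow> X *v f j \<in> fspan f (Suc j)"
  shows "X \<in> tri f (\<le>)"
  unfolding frame_tri_iff[OF f]
proof (intro allI impI)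
  fix i j assume ij: "i < CARD('n)" "j < CARD('n)" "\<not> i \<le> j"
  have low: "B (f (dl i)) (X *v f j) = 0" if "i < CARD('n)" "j < i" "j < wi" for i j
  proof -
    have "{..<Suc j} \<subseteq> {..<CARD('n)}" using that by auto
    then show ?thesis using st[OF that(3)] frame_span_iff[OF f, of "{..<Suc j}"] that by auto
  qed
  show "B (f (dl i)) (X *v f j) = 0"
  proof (cases "j < wi")
    case True then show ?thesis using low ij by simp
  next
    case j: False
    show ?thesis
    proof (cases "dl i < wi")
      case True
      have "B (f (dl (dl j))) (X *v f (dl i)) = 0" by (rule low) (use ij True dl_simps in auto)
      then show ?thesis using entry_skew[OF X ij(1)] ij dl_simps by simp
    next
      case False
      have "\<epsilon> = 1"
        using False j ij even_if_alternating eps by (auto simp: dl_def)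
      moreover have "dl i = j" using False j ij two_wi(3)[OF \<open>\<epsilon> = 1\<close>] by (auto simp: dl_def)
      ultimately show ?thesis using entry_antidiagonal[OF X] by simp
    qed
  qed
qed

lemma flag_tri_ge:
  assumes f: "frame f" and X: "X \<in> so M"
    and st: "\<And>j. j < wi \<Longrightarrow> X *v f (dl j) \<in> vec.span ((\<lambda>i. f (dl i)) ` {..<Suc j})"
  shows "X \<in> tri f (\<ge>)"
  unfolding frame_tri_iff[OF f]
proof (intro allI impI)
  fix i j assume ij: "i < CARD('n)" "j < CARD('n)" "\<not> i \<ge> j"
  have low: "B (f i) (X *v f (dl j)) = 0" if "i < CARD('n)" "j < i" "j < wi" for i j
  proof -
    have "{dl l | l. l < Suc j} \<subseteq> {..<CARD('n)}" by (auto simp: dl_def)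
    moreover have "(\<lambda>i. f (dl i)) ` {..<Suc j} = f ` {dl l | l. l < Suc j}" by auto
    moreover have "dl i \<notin> {dl l | l. l < Suc j}" using that by (auto simp: dl_def)
    ultimately have "B (f (dl (dl i))) (X *v f (dl j)) = 0"
      using st[OF that(3)] frame_span_iff[OF f, of "{dl l | l. l < Suc j}"] that dl_simps(1)[OF that(1)] by auto
    then show ?thesis using dl_simps that by simp
  qed
  show "B (f (dl i)) (X *v f j) = 0"
  proof (cases "dl j < wi")
    case True
    have "B (f (dl i)) (X *v f (dl (dl j))) = 0" by (rule low) (use ij True dl_simps in auto)
    then show ?thesis using dl_simps ij by simp
  next
    case j: False
    show ?thesis
    proof (cases "i < wi")
      case True
      have "B (f j) (X *v f (dl i)) = 0" by (rule low) (use ij True in auto)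
      then show ?thesis using entry_skew[OF X ij(1)] by simp
    next
      case False
      have "\<epsilon> = 1" using False j ij even_if_alternating eps by (auto simp: dl_def)
      moreover have "dl i = j" using False j ij two_wi(3)[OF \<open>\<epsilon> = 1\<close>] by (auto simp: dl_def)
      ultimately show ?thesis using entry_antidiagonal[OF X] by simp
    qed
  qed
qed

text \<open>The isotropic flag stabilized by \<open>b\<close> extends to a frame. The triangular
  elements of that frame form a solvable algebra containing \<open>b\<close>, which equals
  \<open>b\<close> by maximality.\<close>

lemma borel_frame:
  assumes "borel_subalgebra b (so M)"
  shows "\<exists>f. frame f \<and> b = so M \<inter> tri f (\<le>)"
proof -
  have b: "lie_solvable b" "cmat.subspace b" "\<And>X Y. X \<in> b \<Longrightarrow> Y \<in> b \<Longrightarrow> bracket X Y \<in> b" "b \<subseteq> so M"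
    and max: "\<And>s. lie_subalgebra s (so M) \<Longrightarrow> lie_solvable s \<Longrightarrow> b \<subseteq> s \<Longrightarrow> s = b"
    using assms by (auto simp: borel_subalgebra_def lie_subalgebra_def)
  obtain u where u: "indep_seq u wi" "\<And>i j. i < wi \<Longrightarrow> j < wi \<Longrightarrow> B (u i) (u j) = 0"
    "\<And>X i. X \<in> b \<Longrightarrow> i < wi \<Longrightarrow> X *v u i \<in> fspan u (Suc i)"
    using ex_isotropic_seq[OF b le_trans[OF two_wi(1) le_add1] two_wi(1)] by blast
  obtain f where f: "frame f" "\<And>i. i < wi \<Longrightarrow> f i = u i"
    using witt_frame[OF u(1,2) even_if_alternating] by blast
  have "X \<in> tri f (\<le>)" if "X \<in> b" for X
  proof (rule flag_tri_le[OF f(1)])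
    show "X \<in> so M" using b(4) that by blast
    fix j assume j: "j < wi"
    then have "f ` {..<Suc j} = u ` {..<Suc j}" by (intro image_cong) (auto simp: f(2))
    then show "X *v f j \<in> fspan f (Suc j)" using u(3)[OF that j] f(2)[OF j] by simp
  qed
  then have "b \<subseteq> so M \<inter> tri f (\<le>)" using b(4) by blast
  moreover have "lie_solvable (so M \<inter> tri f (\<le>))" by (rule solvable_tri[OF frame_span[OF f(1)]]) auto
  ultimately have "so M \<inter> tri f (\<le>) = b" by (intro max lie_subalgebra_so_tri) auto
  then show ?thesis using f(1) by blast
qed

end

section \<open>Opposite Borel subalgebras\<close>

lemma matrix_of_linear:
  fixes g :: "complex^'n \<Rightarrow> complex^'n"
  assumes "\<And>x y. g (x + y) = g x + g y" "\<And>c x. g (c *s x) = c *s g x"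
  shows "matrix g *v z = g z"
proof (rule matrix_works)
  show "Vector_Spaces.linear (*s) (*s) g" by unfold_locales (simp_all add: assms)
qed

lemma LeastM_flag:
  fixes F :: "nat \<Rightarrow> (complex^'n) set"
  assumes "x \<in> F k" "x \<notin> F 0"
  obtains j where "Suc j \<le> k" "x \<in> F (Suc j)" "x \<notin> F j"
proof -
  define l where "l = (LEAST l. x \<in> F l)"
  have l: "x \<in> F l" "l \<le> k" unfolding l_def using assms(1) by (auto intro: LeastI Least_le)
  then obtain j where j: "l = Suc j" using assms(2) by (cases l) auto
  have "x \<notin> F j" using not_less_Least[of j "\<lambda>l. x \<in> F l"] j by (simp add: l_def[symmetric])
  then show ?thesis using that l j by blast
qed

lemma span_initial_mono: "i \<le> j \<Longrightarrow> fspan f i \<subseteq> fspan f j" for i j :: nat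
  by (intro vec.span_mono image_mono) auto

lemma tri_le_initial:
  fixes f :: "nat \<Rightarrow> complex^'n"
  assumes "X \<in> tri f (\<le>)" "x \<in> fspan f i" "i \<le> CARD('n)" shows "X *v x \<in> fspan f i"
proof -
  have "{..<i} = {j. j < CARD('n) \<and> j < i}" using assms(3) by auto
  then show ?thesis using tri_le_lt[OF assms(1), of x i] assms(2) by simp
qed

context form
begin

lemma ex_separating:
  assumes "vec.subspace S" "x \<notin> S" shows "\<exists>y. (\<forall>s\<in>S. B y s = 0) \<and> B y x = 1"
proof -
  obtain u where u: "indep_seq u (vec.dim S)" "fspan u (vec.dim S) = S"
    using ex_basis_seq[OF assms(1)] by blast
  define d where "d = vec.dim S"
  have im: "(u(d := x)) ` {..<d} = u ` {..<d}" by (intro image_cong) auto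
  have "indep_seq (u(d := x)) (Suc d)"
    by (rule indep_seq_upd) (use u assms in \<open>simp_all add: d_def\<close>)
  from ex_dual_vector[OF this, of "\<lambda>i. if i = d then \<epsilon> else 0"]
  obtain y where y: "\<And>i. i < Suc d \<Longrightarrow> B ((u(d := x)) i) y = (if i = d then \<epsilon> else 0)" by blast
  have "B (u i) y = 0" if "i < d" for i using y[of i] that by simp
  then have "y \<in> perp (u ` {..<d})" by (auto simp: perp_def)
  then have "B s y = 0" if "s \<in> S" for s using that u(2) perp_span[of "u ` {..<d}"] by (auto simp: perp_def d_def)
  moreover have "B y x = 1" using y[of d] B_sym[of y x] by simp
  ultimately show ?thesis using B_sym_0 by blast
qed

lemma ex_common_perp:
  assumes "vec.subspace T" "i + j + vec.dim T < CARD('n)"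
  shows "\<exists>y. y \<notin> T \<and> (\<forall>s\<in>fspan u i. B y s = 0) \<and> (\<forall>s\<in>fspan v j. B y s = 0)"
proof -
  define w where "w l = (if l < i then u l else v (l - i))" for l
  let ?P = "perp (w ` {..<i + j})"
  have "CARD('n) \<le> (i + j) + vec.dim ?P" using dim_perp_ge[of UNIV "i + j" w] by (simp add: card_cart_basis)
  then have "\<not> ?P \<subseteq> T" using vec.dim_subset[of ?P T] assms(2) by linarith
  then obtain y where y: "y \<in> ?P" "y \<notin> T" by blast
  have "u ` {..<i} \<subseteq> w ` {..<i + j}" by (auto simp: w_def intro!: image_eqI)
  moreover have "v ` {..<j} \<subseteq> w ` {..<i + j}"
  proof
    fix x assume "x \<in> v ` {..<j}"
    then obtain l where "l < j" "x = v l" by auto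
    then show "x \<in> w ` {..<i + j}" by (intro image_eqI[of _ _ "i + l"]) (auto simp: w_def)
  qed
  ultimately have "y \<in> perp (u ` {..<i})" "y \<in> perp (v ` {..<j})" using y(1) perp_mono by blast+
  then have "y \<in> perp (fspan u i)" "y \<in> perp (fspan v j)" by (simp_all add: perp_span)
  then show ?thesis using y(2) B_sym_0 by (auto simp: perp_def)
qed

lemma frame_perp:
  assumes "frame f" "i \<le> CARD('n)"
  shows "y \<in> perp (fspan f i) \<longleftrightarrow> y \<in> fspan f (CARD('n) - i)"
proof -
  have "y \<in> fspan f (CARD('n) - i) \<longleftrightarrow> (\<forall>l<CARD('n). l \<notin> {..<CARD('n) - i} \<longrightarrow> B (f (dl l)) y = 0)"
    by (rule frame_span_iff[OF assms(1)]) auto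
  also have "\<dots> \<longleftrightarrow> (\<forall>l<i. B (f l) y = 0)"
  proof (intro iffI allI impI)
    fix l assume R: "\<forall>l<CARD('n). l \<notin> {..<CARD('n) - i} \<longrightarrow> B (f (dl l)) y = 0" and l: "l < i"
    have "dl l < CARD('n)" "dl l \<notin> {..<CARD('n) - i}" using l assms(2) by (auto simp: dl_def)
    with R have "B (f (dl (dl l))) y = 0" by blast
    then show "B (f l) y = 0" using dl_simps(2)[of l] l assms(2) by simp
  next
    fix l assume "\<forall>l<i. B (f l) y = 0" "l < CARD('n)" "l \<notin> {..<CARD('n) - i}"
    moreover have "dl l < i" using calculation(2,3) by (auto simp: dl_def)
    ultimately show "B (f (dl l)) y = 0" by blast
  qed
  finally show ?thesis unfolding perp_span by (auto simp: perp_def)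
qed

text \<open>The element of the Lie algebra that corresponds to the exterior product of
  \<open>x\<close> and \<open>y\<close> in the orthogonal case, and to their symmetric product in
  the symplectic case.\<close>

definition wedge :: "complex^'n \<Rightarrow> complex^'n \<Rightarrow> complex^'n^'n"
  where "wedge x y = matrix (\<lambda>z. B y z *s x - (\<epsilon> * B x z) *s y)"

lemma wedge: "wedge x y *v z = B y z *s x - (\<epsilon> * B x z) *s y"
  unfolding wedge_def by (rule matrix_of_linear) (simp_all add: bil_simps vec_eq_iff algebra_simps)

lemma wedge_so: "wedge x y \<in> so M"
proof -
  have "B (wedge x y *v z) w = - B z (wedge x y *v w)" for z w
    using B_sym[of z x] B_sym[of z y] by (simp add: wedge bil_simps algebra_simps)
  then show ?thesis by (simp add: so_def)
qed

lemma frame_isotropic: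
  assumes "frame f" "x \<in> fspan f i" "i + l \<le> CARD('n) - 1" "l < CARD('n)"
  shows "B x (f l) = 0"
  using assms(2)
proof (induction rule: vec.span_induct_alt)
  case (step c y z)
  then obtain a where "a < i" "y = f a" by auto
  then have "B y (f l) = 0" using assms(3,4) frameD[OF assms(1), of a l] by auto
  then show ?case using step by (simp add: bil_simps)
qed simp

lemma frame_isotropic':
  assumes "frame f" "x \<in> fspan f i" "y \<in> fspan f l" "i + l \<le> CARD('n)"
  shows "B x y = 0"
  using assms(3)
proof (induction rule: vec.span_induct_alt)
  case (step c w z)
  then obtain a where "a < l" "w = f a" by auto
  then have "B x w = 0" using assms(4) by (auto intro!: frame_isotropic[OF assms(1,2)])
  then show ?case using step by (simp add: bil_simps)
qed simp

text \<open>If the flags of two Borel subalgebras were not transversal, their intersection would contain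
  non-commuting semisimple and nilpotent elements of rank at most two.\<close>

lemma transversal_flags:
  assumes f: "frame f" and f': "frame f'"
    and h: "lie_nilpotent h" "cmat.subspace h" "\<And>X Y. X \<in> h \<Longrightarrow> Y \<in> h \<Longrightarrow> bracket X Y \<in> h"
      "so M \<inter> tri f (\<le>) \<inter> tri f' (\<le>) \<subseteq> h"
  shows "i \<le> wi \<Longrightarrow> x \<in> fspan f i \<Longrightarrow> x \<in> perp (fspan f' i) \<Longrightarrow> x = 0"
proof (induction i arbitrary: x)
  case 0 then show ?case by simp
next
  case (Suc i)
  let ?N = "CARD('n)"
  define F where "F l = fspan f l" for l
  define F' where "F' l = fspan f' l" for l
  have sub: "vec.subspace (F l)" "vec.subspace (F' l)" for l by (simp_all add: F_def F'_def)
  have mono: "l \<le> m \<Longrightarrow> F l \<subseteq> F m" "l \<le> m \<Longrightarrow> F' l \<subseteq> F' m" for l m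
    unfolding F_def F'_def by (intro span_initial_mono; assumption)+
  have iN: "Suc i \<le> ?N" using Suc.prems(1) two_wi(1) by simp
  have pF: "y \<in> perp (F l) \<longleftrightarrow> y \<in> F (?N - l)" "y \<in> perp (F' l) \<longleftrightarrow> y \<in> F' (?N - l)" if "l \<le> ?N" for l y
    unfolding F_def F'_def by (rule frame_perp[OF f that], rule frame_perp[OF f' that])
  have xF: "x \<in> F (Suc i)" "x \<in> F' (?N - Suc i)"
    using Suc.prems pF(2)[OF iN] by (simp_all add: F_def F'_def)
  have IH: "z = 0" if "z \<in> F i" "z \<in> F' (?N - i)" for z
    using Suc.IH[of z] Suc.prems(1) that pF(2)[of i z] iN by (simp add: F_def F'_def)
  show "x = 0"
  proof (rule ccontr)
    assume x0: "x \<noteq> 0"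
    then have "x \<notin> F' 0" by (simp add: F'_def)
    \<comment> \<open>The place where the second flag first reaches \<open>x\<close>.\<close>
    then obtain j where j: "Suc j \<le> ?N - Suc i" "x \<in> F' (Suc j)" "x \<notin> F' j"
      using LeastM_flag[of x F' "?N - Suc i"] xF(2) by blast
    have xx: "B x x = 0"
      by (rule frame_isotropic'[OF f xF(1)[unfolded F_def] xF(1)[unfolded F_def]]) (use Suc.prems(1) two_wi(1) in linarith)
    \<comment> \<open>A vector \<open>y\<close> orthogonal to \<open>F i\<close> and to
      \<open>F' j\<close> annihilates the basis vectors before the places where the flags reach
      \<open>x\<close>. This makes \<open>wedge x y\<close> triangular for both flags; the remaining
      term with \<open>y\<close> is harmless because \<open>y\<close> lies in the orthogonal
      complement of \<open>F' j\<close>.\<close>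
    have mem: "wedge x y \<in> h" if y: "\<forall>s\<in>F i. B y s = 0" "\<forall>s\<in>F' j. B y s = 0" for y
    proof -
      have 1: "wedge x y \<in> tri f (\<le>)"
      proof (rule flag_tri_le[OF f wedge_so])
        fix l assume l: "l < wi"
        have "B x (f l) = 0"
          by (rule frame_isotropic[OF f xF(1)[unfolded F_def]]) (use Suc.prems(1) two_wi(1) l in linarith)+
        moreover have "B y (f l) *s x \<in> F (Suc l)"
        proof (cases "l < i")
          case True
          then have "f l \<in> F i" unfolding F_def by (intro vec.span_base) auto
          then show ?thesis using y(1) sub by (simp add: vec.subspace_0)
        next
          case False
          then show ?thesis using xF(1) mono(1)[of "Suc i" "Suc l"] sub by (intro vec.subspace_scale) auto
        qed
        ultimately show "wedge x y *v f l \<in> fspan f (Suc l)" by (simp add: wedge F_def)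
      qed
      have 2: "wedge x y \<in> tri f' (\<le>)"
      proof (rule flag_tri_le[OF f' wedge_so])
        fix l assume l: "l < wi"
        then have lN: "l < ?N" using two_wi(1) by linarith
        have a: "B y (f' l) *s x \<in> F' (Suc l)"
        proof (cases "l < j")
          case True
          then have "f' l \<in> F' j" unfolding F'_def by (intro vec.span_base) auto
          then show ?thesis using y(2) sub by (simp add: vec.subspace_0)
        next
          case False
          then show ?thesis using j(2) mono(2)[of "Suc j" "Suc l"] sub by (intro vec.subspace_scale) auto
        qed
        have b: "B x (f' l) = 0 \<or> y \<in> F' (Suc l)"
        proof (cases "Suc j + l \<le> ?N - 1")
          case True
          then show ?thesis using frame_isotropic[OF f' j(2)[unfolded F'_def] True lN] by blast
        next
          case False
          have "y \<in> perp (F' (?N - Suc l))"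
          proof -
            have "F' (?N - Suc l) \<subseteq> F' j" using False lN by (intro mono) linarith
            then show ?thesis using y(2) B_sym_0 by (auto simp: perp_def)
          qed
          then have "y \<in> F' (?N - (?N - Suc l))" using pF(2)[of "?N - Suc l" y] by simp
          then show ?thesis using lN by simp
        qed
        have "wedge x y *v f' l \<in> F' (Suc l)" unfolding wedge
          using a b sub by (intro vec.subspace_diff) (auto simp: vec.subspace_scale vec.subspace_0)
        then show "wedge x y *v f' l \<in> fspan f' (Suc l)" by (simp add: F'_def)
      qed
      show ?thesis using 1 2 wedge_so h(4) by blast
    qed
    have "x \<notin> {a + b | a b. a \<in> F i \<and> b \<in> F' j}"
    proof
      assume "x \<in> {a + b | a b. a \<in> F i \<and> b \<in> F' j}"
      then obtain a c where ac: "a \<in> F i" "c \<in> F' j" "x = a + c" by auto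
      have "x - c \<in> F' (?N - Suc i)"
        using xF(2) ac(2) mono(2)[of j "?N - Suc i"] j(1) sub by (intro vec.subspace_diff) auto
      then have "a \<in> F' (?N - i)" using ac mono(2)[of "?N - Suc i" "?N - i"] by (auto simp: diff_le_mono2)
      then have "a = 0" using IH ac by blast
      then show False using ac j(3) by simp
    qed
    then obtain y where y: "\<forall>s\<in>{a + b | a b. a \<in> F i \<and> b \<in> F' j}. B y s = 0" "B y x = 1"
      using ex_separating[OF vec.subspace_sums[OF sub]] by blast
    have y1: "\<forall>s\<in>F i. B y s = 0"
    proof
      fix s assume "s \<in> F i"
      then have "s + 0 \<in> {a + b | a b. a \<in> F i \<and> b \<in> F' j}" using sub vec.subspace_0 by blast
      then show "B y s = 0" using y(1) by force
    qed
    have y2: "\<forall>s\<in>F' j. B y s = 0"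
    proof
      fix s assume "s \<in> F' j"
      then have "0 + s \<in> {a + b | a b. a \<in> F i \<and> b \<in> F' j}" using sub vec.subspace_0 by blast
      then show "B y s = 0" using y(1) by force
    qed
    \<comment> \<open>A second partner that is orthogonal to \<open>x\<close> as well. In the
      orthogonal case it must not be a multiple of \<open>x\<close>, since \<open>wedge x x\<close>
      is 0.\<close>
    have "\<exists>y'. y' \<noteq> 0 \<and> (\<epsilon> = 1 \<longrightarrow> y' \<notin> vec.span {x}) \<and> (\<forall>s\<in>F i. B y' s = 0) \<and> (\<forall>s\<in>F' (Suc j). B y' s = 0)"
    proof (cases "\<epsilon> = 1 \<and> Suc j < ?N - Suc i")
      case True
      have "vec.dim (vec.span {x}) = 1" using x0 by simp
      then have "i + Suc j + vec.dim (vec.span {x}) < ?N" using True by linarith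
      then obtain y' where "y' \<notin> vec.span {x}" "\<forall>s\<in>F i. B y' s = 0" "\<forall>s\<in>F' (Suc j). B y' s = 0"
        using ex_common_perp[OF vec.subspace_span, of i "Suc j" "{x}" f f'] unfolding F_def F'_def by blast
      then show ?thesis using vec.span_zero by metis
    next
      case False
      have "i + Suc j + vec.dim {0 :: complex^'n} < ?N" using j(1) iN by simp
      then obtain y' where y': "y' \<noteq> 0" "\<forall>s\<in>F i. B y' s = 0" "\<forall>s\<in>F' (Suc j). B y' s = 0"
        using ex_common_perp[of "{0}" i "Suc j" f f'] vec.subspace_single_0 unfolding F_def F'_def by blast
      have "y' \<notin> vec.span {x}" if e1: "\<epsilon> = 1"
      proof
        assume "y' \<in> vec.span {x}"
        then obtain c where c: "y' = c *s x" by (auto simp: vec.span_singleton)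
        have jj: "Suc j = ?N - Suc i" using False e1 j(1) by auto
        have "B s x = 0" if "s \<in> F' (?N - Suc i)" for s
          using y'(1,3) that B_sym_0 unfolding jj c by (auto simp: bil_simps)
        then have "x \<in> perp (F' (?N - Suc i))" by (auto simp: perp_def)
        then have "x \<in> F' (Suc i)" using pF(2)[of "?N - Suc i" x] iN by simp
        then have "\<not> Suc i \<le> j" using j(3) mono(2)[of "Suc i" j] by blast
        then show False using jj Suc.prems(1) two_wi(2)[OF e1] by linarith
      qed
      then show ?thesis using y' by blast
    qed
    then obtain y' where y': "y' \<noteq> 0" "\<epsilon> = 1 \<Longrightarrow> y' \<notin> vec.span {x}" "\<forall>s\<in>F i. B y' s = 0" "\<forall>s\<in>F' (Suc j). B y' s = 0"
      by blast
    let ?X = "wedge x y" and ?X' = "wedge x y'"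
    have X: "?X \<in> h" by (rule mem[OF y1 y2])
    have X': "?X' \<in> h" by (rule mem[OF y'(3)]) (use y'(4) mono(2)[of j "Suc j"] in auto)
    have vals: "B x y = \<epsilon>" "B y' x = 0" "B x y' = 0"
      using y(2) B_sym[of x y] y'(4) j(2) B_sym_0 by auto
    define c where "c = \<epsilon> * B y' y - \<epsilon> * B y y'"
    \<comment> \<open>With this error term [X, X'] = X' + W and [X, W] = 2 W. A nilpotent algebra
      admits no nonzero eigenvalue, so \<open>W\<close> and then X' must vanish.\<close>
    define W where "W = bracket ?X ?X' - ?X'"
    have W: "W *v z = (c * B x z) *s x" for z
      unfolding W_def bracket_def
      by (simp add: matrix_vector_mult_diff_rdistrib matrix_vector_mul_assoc[symmetric] wedge bil_simps vals xx y(2) c_def)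
        (simp add: vec_eq_iff algebra_simps)
    have Wh: "W \<in> h" unfolding W_def by (intro cmat.subspace_diff[OF h(2)] h(3) X X')
    have "bracket ?X W = cscale 2 W"
    proof (rule matrix_eqI)
      fix z
      show "bracket ?X W *v z = cscale 2 W *v z"
        unfolding bracket_def
        by (simp add: matrix_vector_mult_diff_rdistrib matrix_vector_mul_assoc[symmetric] wedge bil_simps vals xx y(2) W)
          (simp add: vec_eq_iff algebra_simps)
    qed
    then have "W = 0" using lie_nilpotent_no_eigenvector[OF h(1) X Wh, of 2] by simp
    then have "bracket ?X ?X' = cscale 1 ?X'" by (simp add: W_def)
    then have "?X' = 0" using lie_nilpotent_no_eigenvector[OF h(1) X X', of 1] by simp
    then have "?X' *v y = 0" by simp
    then have e: "B y' y *s x = y'" by (simp add: wedge vals)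
    then have "y' \<in> vec.span {x}" by (metis vec.span_base vec.span_scale singletonI)
    then have "\<epsilon> = - 1" using y'(2) eps by blast
    moreover have "B y' y = B y' y * \<epsilon>" using arg_cong[OF e, of "\<lambda>t. B t y"] vals by (simp add: bil_simps)
    ultimately have "B y' y = 0" by auto
    then show False using e y'(1) by simp
  qed
qed

text \<open>There are only \<open>i\<close> linear conditions on a space of dimension i + 1.\<close>

lemma ex_flag_vector:
  assumes f: "frame f" and f': "frame f'" and i: "i < CARD('n)"
  shows "\<exists>a. a \<noteq> 0 \<and> a \<in> fspan f (Suc i) \<and> a \<in> perp (fspan f' i)"
proof -
  have "indep_seq f (Suc i)" using frame_indep[OF f] i by (auto simp: indep_seq_def)
  then have "vec.dim (fspan f (Suc i)) = Suc i" by (simp add: dim_indep_seq del: vec.dim_span, simp add: dim_indep_seq)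
  then have "Suc i \<le> i + vec.dim (fspan f (Suc i) \<inter> perp (f' ` {..<i}))"
    using dim_perp_ge[of "fspan f (Suc i)" i f'] by simp
  then have "vec.dim (fspan f (Suc i) \<inter> perp (f' ` {..<i})) \<noteq> 0" by linarith
  then obtain a where "a \<noteq> 0" "a \<in> fspan f (Suc i) \<inter> perp (f' ` {..<i})"
    by (auto simp: vec.dim_eq_0)
  then show ?thesis by (auto simp: perp_span)
qed

lemma span_adapted:
  assumes f: "frame f" and c: "\<And>i. i < p \<Longrightarrow> c i \<in> fspan f (Suc i)"
    "\<And>i. i < p \<Longrightarrow> c i \<notin> fspan f i" and p: "p \<le> CARD('n)"
  shows "fspan c p = fspan f p"
proof -
  have sub: "c ` {..<q} \<subseteq> fspan f q" if "q \<le> p" for q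
  proof
    fix x assume "x \<in> c ` {..<q}"
    then obtain i where i: "i < q" "x = c i" by auto
    then show "x \<in> fspan f q" using c(1)[of i] that span_initial_mono[of "Suc i" q f] by auto
  qed
  have "indep_seq c p" unfolding indep_seq_def
  proof (intro allI impI notI)
    fix i assume i: "i < p" "c i \<in> fspan c i"
    have "fspan c i \<subseteq> fspan f i" using sub[of i] i by (intro vec.span_minimal) auto
    then show False using c(2) i by blast
  qed
  moreover have "indep_seq f p" using frame_indep[OF f] p by (auto simp: indep_seq_def)
  ultimately have "vec.dim (c ` {..<p}) = p" "vec.dim (f ` {..<p}) = p" by (simp_all add: dim_indep_seq)
  then show ?thesis using sub[of p] by (intro dim_psubset_subspace vec.span_minimal) auto
qed

text \<open>Each \<open>c i\<close> lies in the second flag and is orthogonal to the previous member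
  of the first, and \<open>a i\<close> is chosen with the roles exchanged. Hence B (c i) (a j) = 0
  for i different from j, and transversality makes the diagonal values nonzero. After scaling these
  are hyperbolic pairs. The quantification over \<open>e'\<close> leaves the middle vectors free,
  because both Borel subalgebras are controlled by the pairs alone.\<close>

lemma opposite_frames:
  assumes "opposite_borels (so M) h b b'"
  shows "\<exists>e. frame e \<and> (\<forall>e'. frame e' \<longrightarrow> (\<forall>i<wi. e' i = e i \<and> e' (dl i) = e (dl i)) \<longrightarrow>
    b' \<subseteq> tri e' (\<le>) \<and> b \<subseteq> tri e' (\<ge>))"
proof -
  obtain f where f: "frame f" "b = so M \<inter> tri f (\<le>)" using borel_frame assms by (auto simp: opposite_borels_def)
  obtain f' where f': "frame f'" "b' = so M \<inter> tri f' (\<le>)" using borel_frame assms by (auto simp: opposite_borels_def)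
  have h: "lie_nilpotent h" "cmat.subspace h" "\<And>X Y. X \<in> h \<Longrightarrow> Y \<in> h \<Longrightarrow> bracket X Y \<in> h" "b \<inter> b' = h"
    using assms by (auto simp: opposite_borels_def cartan_subalgebra_def lie_subalgebra_def)
  have tr: "x = 0" if "i \<le> wi" "x \<in> fspan f i" "x \<in> perp (fspan f' i)" for i x
    by (rule transversal_flags[OF f(1) f'(1) h(1,2,3) _ that]) (use h(4) f f' in auto)
  have tr': "x = 0" if "i \<le> wi" "x \<in> fspan f' i" "x \<in> perp (fspan f i)" for i x
    by (rule transversal_flags[OF f'(1) f(1) h(1,2,3) _ that]) (use h(4) f f' in auto)
  have iN: "i < CARD('n)" if "i < wi" for i using that two_wi(1) by linarith
  have "\<forall>i. \<exists>c. i < wi \<longrightarrow> c \<noteq> 0 \<and> c \<in> fspan f' (Suc i) \<and> c \<in> perp (fspan f i)"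
    using ex_flag_vector[OF f'(1) f(1) iN] by blast
  from choice[OF this] obtain c where c: "c i \<noteq> 0" "c i \<in> fspan f' (Suc i)" "c i \<in> perp (fspan f i)"
    if "i < wi" for i by blast
  have "\<forall>i. \<exists>a. i < wi \<longrightarrow> a \<noteq> 0 \<and> a \<in> fspan f (Suc i) \<and> a \<in> perp (fspan f' i)"
    using ex_flag_vector[OF f(1) f'(1) iN] by blast
  from choice[OF this] obtain a where a: "a i \<noteq> 0" "a i \<in> fspan f (Suc i)" "a i \<in> perp (fspan f' i)"
    if "i < wi" for i by blast
  have cn: "c i \<notin> fspan f' i" if "i < wi" for i using tr'[of i "c i"] c[OF that] that by auto
  have an: "a i \<notin> fspan f i" if "i < wi" for i using tr[of i "a i"] a[OF that] that by auto
  have spc: "fspan c p = fspan f' p" if "p \<le> wi" for p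
    by (rule span_adapted[OF f'(1)]) (use that c cn two_wi(1) in auto)
  have spa: "fspan a p = fspan f p" if "p \<le> wi" for p
    by (rule span_adapted[OF f(1)]) (use that a an two_wi(1) in auto)
  have cF: "c i \<in> fspan f' p" "a i \<in> fspan f p" if "i < p" "p \<le> wi" for i p
    using that by (auto simp: spc[symmetric] spa[symmetric] intro: vec.span_base)
  have cc: "B (c i) (c j) = 0" if "i < wi" "j < wi" for i j
    using cF(1)[OF that(1)] cF(1)[OF that(2)] two_wi(1) by (intro frame_isotropic'[OF f'(1), of _ wi _ wi]) auto
  have aa: "B (a i) (a j) = 0" if "i < wi" "j < wi" for i j
    using cF(2)[OF that(1)] cF(2)[OF that(2)] two_wi(1) by (intro frame_isotropic'[OF f(1), of _ wi _ wi]) auto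
  have ca0: "B (c i) (a j) = 0" if "i < wi" "j < wi" "i \<noteq> j" for i j
  proof (cases "i < j")
    case True
    then show ?thesis using cF(1)[of i j] a(3)[of j] that by (auto simp: perp_def)
  next
    case False
    then have "j < i" using that by simp
    then show ?thesis using cF(2)[of j i] c(3)[of i] that B_sym_0 by (auto simp: perp_def)
  qed
  have ca: "B (c i) (a i) \<noteq> 0" if i: "i < wi" for i
  proof
    assume 0: "B (c i) (a i) = 0"
    have "B (c j) (a i) = 0" if "j < Suc i" for j using that i 0 ca0[of j i] by (cases "j = i") auto
    then have "a i \<in> perp (fspan c (Suc i))" unfolding perp_span by (auto simp: perp_def)
    then have "a i = 0" using tr[of "Suc i" "a i"] a(2)[OF i] i by (simp add: spc)
    then show False using a(1)[OF i] by simp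
  qed
  define v where "v i = inverse (B (c i) (a i)) *s a i" for i
  have "\<exists>e. frame e \<and> (\<forall>i<wi. e i = c i \<and> e (dl i) = v i)"
  proof (rule hyperbolic_frame)
    show "B (c i) (v j) = (if i = j then 1 else 0)" if "i < wi" "j < wi" for i j
      using ca0[OF that] ca that by (auto simp: v_def bil_simps)
  qed (use cc aa two_wi(1) even_if_alternating in \<open>auto simp: v_def bil_simps\<close>)
  then obtain e where e: "frame e" "\<And>i. i < wi \<Longrightarrow> e i = c i" "\<And>i. i < wi \<Longrightarrow> e (dl i) = v i" by blast
  have vS: "fspan v p = fspan f p" if "p \<le> wi" for p
  proof -
    have "v i \<in> fspan f p" if "i < p" for i
      using cF(2)[of i p] that \<open>p \<le> wi\<close> by (auto simp: v_def vec.span_scale)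
    moreover have "a i \<in> fspan v p" if "i < p" for i
    proof -
      have "a i = B (c i) (a i) *s v i" using ca[of i] that \<open>p \<le> wi\<close> by (simp add: v_def vec.scale_scale)
      then show ?thesis using that by (metis imageI lessThan_iff vec.span_base vec.span_scale)
    qed
    ultimately show ?thesis unfolding spa[OF that, symmetric] using spa[OF that]
      by (intro vec.span_eq[THEN iffD2]) auto
  qed
  have "b' \<subseteq> tri e' (\<le>) \<and> b \<subseteq> tri e' (\<ge>)"
    if e': "frame e'" "\<And>i. i < wi \<Longrightarrow> e' i = e i \<and> e' (dl i) = e (dl i)" for e'
  proof (intro conjI subsetI)
    fix X assume X: "X \<in> b'"
    show "X \<in> tri e' (\<le>)"
    proof (rule flag_tri_le[OF e'(1)])
      show "X \<in> so M" using X f'(2) by blast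
      fix j assume j: "j < wi"
      have "e' ` {..<Suc j} = c ` {..<Suc j}" using j e'(2) e(2) by (intro image_cong) auto
      moreover have "X *v c j \<in> fspan f' (Suc j)"
        by (rule tri_le_initial[OF _ c(2)[OF j]]) (use X f'(2) iN[OF j] in auto)
      ultimately show "X *v e' j \<in> fspan e' (Suc j)" using j e'(2) e(2) spc[of "Suc j"] by simp
    qed
  next
    fix X assume X: "X \<in> b"
    show "X \<in> tri e' (\<ge>)"
    proof (rule flag_tri_ge[OF e'(1)])
      show "X \<in> so M" using X f(2) by blast
      fix j assume j: "j < wi"
      have "(\<lambda>i. e' (dl i)) ` {..<Suc j} = v ` {..<Suc j}" using j e'(2) e(3) by (intro image_cong) auto
      moreover have "v j \<in> fspan f (Suc j)" using a(2)[OF j] by (simp add: v_def vec.span_scale)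
      then have "X *v v j \<in> fspan f (Suc j)"
        by (rule tri_le_initial[rotated]) (use X f(2) iN[OF j] in auto)
      ultimately show "X *v e' (dl j) \<in> vec.span ((\<lambda>i. e' (dl i)) ` {..<Suc j})"
        using j e'(2) e(3) vS[of "Suc j"] by simp
    qed
  qed
  then show ?thesis using e(1) by blast
qed

end

section \<open>Characters of the nilradical\<close>

lemma trace_cscale: "trace (cscale c X) = c * trace X"
  by (simp add: trace_def cscale_def sum_distrib_left)

lemma trace_dual_in_dual:
  assumes "cmat.subspace q" shows "trace_dual q X \<in> dual q"
  using assms by (auto simp: dual_def trace_dual_def cmat.subspace_def matrix_add_ldistrib trace_add trace_cscale)

text \<open>Both conditions hold for reasons of degree. Elements of \<open>b'\<close> do not raise
  \<open>\<delta>\<close> and \<open>Z\<close> lowers it by one; elements of the derived algebra of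
  the nilradical raise it by at least two. In either case the product has no diagonal entry and its
  trace is 0.\<close>

lemma Psi_intro:
  fixes e :: "nat \<Rightarrow> complex^'n" and \<delta> :: "nat \<Rightarrow> nat"
  assumes e: "fspan e CARD('n) = UNIV"
    and q: "cmat.subspace q" "b' \<subseteq> q" "bracket_span (nilradical b) (nilradical b) \<subseteq> q"
    and b': "b' \<subseteq> tri e (\<lambda>i j. \<delta> i \<le> \<delta> j)" and n: "nilradical b \<subseteq> tri e (\<lambda>i j. \<delta> j < \<delta> i)"
    and Z: "Z \<in> tri e (\<lambda>i j. Suc (\<delta> i) = \<delta> j)"
  shows "trace_dual q Z \<in> Psi q b b'"
  unfolding Psi_def mem_Collect_eq
proof (intro conjI ballI)
  show "trace_dual q Z \<in> dual q" by (rule trace_dual_in_dual[OF q(1)])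
  fix X assume X: "X \<in> b'"
  have "Z ** X \<in> tri e (\<lambda>i j. \<delta> i < \<delta> j)"
    by (rule tri_mult[OF Z subsetD[OF b' X]]) auto
  then have "trace (Z ** X) = 0" by (rule trace_tri[OF e]) auto
  then show "trace_dual q Z X = 0" using X q(2) by (auto simp: trace_dual_def)
next
  fix X assume X: "X \<in> bracket_span (nilradical b) (nilradical b)"
  have "bracket_span (nilradical b) (nilradical b) \<subseteq> tri e (\<lambda>i j. Suc (\<delta> j) < \<delta> i)"
  proof (rule bracket_span_minimal[OF subspace_tri])
    fix Y Y' assume "Y \<in> nilradical b" "Y' \<in> nilradical b"
    then show "bracket Y Y' \<in> tri e (\<lambda>i j. Suc (\<delta> j) < \<delta> i)"
      using n by (intro tri_bracket[of Y e "\<lambda>i j. \<delta> j < \<delta> i" Y' "\<lambda>i j. \<delta> j < \<delta> i"]) auto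
  qed
  then have "Z ** X \<in> tri e (\<lambda>i j. \<delta> j < \<delta> i)"
    using X by (intro tri_mult[OF Z, of X "\<lambda>i j. Suc (\<delta> j) < \<delta> i"]) auto
  then have "trace (Z ** X) = 0" by (rule trace_tri[OF e]) auto
  then show "trace_dual q Z X = 0" using X q(3) by (auto simp: trace_dual_def)
qed

lemma nilradical_subset: "cmat.subspace b \<Longrightarrow> nilradical b \<subseteq> b"
  unfolding nilradical_def by (rule cmat.span_minimal) (auto simp: lie_ideal_def)

lemma nilradical_tri_ge:
  fixes e :: "nat \<Rightarrow> complex^'n"
  assumes "indep_seq e CARD('n)" "b \<subseteq> tri e (\<ge>)" shows "nilradical b \<subseteq> tri e (\<lambda>i j. j < i)"
proof -
  let ?g = "\<lambda>i. e (CARD('n) - 1 - i)"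
  have "tri e (\<ge>) \<subseteq> tri ?g (\<le>)" unfolding tri_rev by (rule tri_mono) auto
  then have "nilradical b \<subseteq> tri ?g (<)" using assms by (intro nilradical_tri indep_seq_rev) auto
  also have "\<dots> \<subseteq> tri e (\<lambda>i j. j < i)" unfolding tri_rev by (rule tri_mono) auto
  finally show ?thesis .
qed

text \<open>The degree may be constant on the two middle vectors of an even orthogonal frame,
  because the entry of a skew matrix relating them is 0 and hence the nilradical still raises the
  degree strictly.\<close>

lemma (in form) Psi_form:
  fixes \<delta> :: "nat \<Rightarrow> nat"
  assumes e: "frame e" and b: "lie_subalgebra b (so M)" "b' \<subseteq> so M" "b' \<subseteq> tri e (\<le>)" "b \<subseteq> tri e (\<ge>)"
    and \<delta>: "\<And>i j. i \<le> j \<Longrightarrow> j < CARD('n) \<Longrightarrow> \<delta> i \<le> \<delta> j"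
      "\<And>i j. i < j \<Longrightarrow> j < CARD('n) \<Longrightarrow> \<delta> i < \<delta> j \<or> \<epsilon> = 1 \<and> dl i = j"
    and Z: "Z \<in> tri e (\<lambda>i j. Suc (\<delta> i) = \<delta> j)"
  shows "trace_dual (so M) Z \<in> Psi (so M) b b'"
proof (rule Psi_intro[OF frame_span[OF e] subspace_so b(2) _ _ _ Z])
  have nb: "nilradical b \<subseteq> so M" using nilradical_subset b(1) by (auto simp: lie_subalgebra_def)
  then show "bracket_span (nilradical b) (nilradical b) \<subseteq> so M"
    using bracket_so by (intro bracket_span_minimal[OF subspace_so]) auto
  have "tri e (\<le>) \<subseteq> tri e (\<lambda>i j. \<delta> i \<le> \<delta> j)" by (rule tri_mono) (use \<delta>(1) in auto)
  then show "b' \<subseteq> tri e (\<lambda>i j. \<delta> i \<le> \<delta> j)" using b(3) by blast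
  show "nilradical b \<subseteq> tri e (\<lambda>i j. \<delta> j < \<delta> i)"
  proof
    fix Y assume Y: "Y \<in> nilradical b"
    have Yt: "Y \<in> tri e (\<lambda>i j. j < i)" using nilradical_tri_ge[OF frame_indep[OF e] b(4)] Y by blast
    have Yso: "Y \<in> so M" using nb Y by blast
    show "Y \<in> tri e (\<lambda>i j. \<delta> j < \<delta> i)" unfolding frame_tri_iff[OF e]
    proof (intro allI impI)
      fix i j assume ij: "i < CARD('n)" "j < CARD('n)" "\<not> \<delta> j < \<delta> i"
      show "B (e (dl i)) (Y *v e j) = 0"
      proof (cases "j < i")
        case True
        then have "\<epsilon> = 1" "dl j = i" using \<delta>(2)[OF True ij(1)] ij by auto
        then show ?thesis using entry_antidiagonal[OF Yso] dl_simps(2)[OF ij(2)] by auto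
      next
        case False
        then show ?thesis using Yt ij unfolding frame_tri_iff[OF e] by blast
      qed
    qed
  qed
qed

section \<open>Borel subalgebras of the general and special linear algebras\<close>

lemma ex_full_flag:
  fixes L :: "(complex^'n^'n) set"
  assumes L: "lie_solvable L" "cmat.subspace L" "\<And>X Y. X \<in> L \<Longrightarrow> Y \<in> L \<Longrightarrow> bracket X Y \<in> L"
  shows "\<exists>f. indep_seq f CARD('n) \<and> L \<subseteq> tri f (\<le>)"
proof -
  obtain k where k: "((\<lambda>d. bracket_span d d) ^^ k) L = {0}" using L(1) by (auto simp: lie_solvable_def)
  have "p \<le> CARD('n) \<Longrightarrow> \<exists>u. indep_seq u p \<and> (\<forall>X\<in>L. \<forall>i<p. X *v u i \<in> fspan u (Suc i))" for p
  proof (induction p)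
    case 0 then show ?case by (simp add: indep_seq_def)
  next
    case (Suc p)
    then obtain u where u: "indep_seq u p" "\<And>X i. X \<in> L \<Longrightarrow> i < p \<Longrightarrow> X *v u i \<in> fspan u (Suc i)" by auto
    define U where "U = fspan u p"
    have dU: "vec.dim U = p" using dim_indep_seq[OF u(1)] by (simp add: U_def)
    have LU: "X *v x \<in> U" if "X \<in> L" "x \<in> U" for X x
      using that(2) unfolding U_def
    proof (induction rule: vec.span_induct_alt)
      case (step c y z)
      then obtain i where i: "i < p" "y = u i" by auto
      have "fspan u (Suc i) \<subseteq> fspan u p" using i by (intro vec.span_mono image_mono) auto
      then show ?case using step u(2)[OF that(1) i(1)] i
        by (auto simp: matrix_vector_right_distrib intro!: vec.span_add vec.span_scale)
    qed (simp add: vec.span_zero)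
    have "U \<noteq> UNIV"
    proof
      assume "U = UNIV"
      then have "p = CARD('n)" using dU by (simp add: card_cart_basis)
      then show False using Suc.prems by simp
    qed
    then have nU: "\<not> UNIV \<subseteq> U" by auto
    have "vec.subspace U" by (simp add: U_def)
    from lie_common_eigenvector[OF k L(2,3) this vec.subspace_UNIV subset_UNIV nU] LU
    have "\<exists>v\<in>UNIV. v \<notin> U \<and> (\<forall>X\<in>L. \<exists>c. X *v v - c *s v \<in> U)" by blast
    then obtain v where v: "v \<notin> U" "\<And>X. X \<in> L \<Longrightarrow> \<exists>c. X *v v - c *s v \<in> U" by blast
    let ?w = "u(p := v)"
    have im: "?w ` {..<i} = u ` {..<i}" if "i \<le> p" for i using that by (intro image_cong) auto
    have ims: "?w ` {..<Suc p} = insert v (u ` {..<p})" using im[of p] by (simp add: lessThan_Suc del: fun_upd_apply, simp)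
    show ?case
    proof (intro exI[of _ ?w] conjI allI impI ballI)
      show "indep_seq ?w (Suc p)" by (rule indep_seq_upd[OF u(1)]) (use v(1) in \<open>simp add: U_def\<close>)
      fix X i assume X: "X \<in> L" and i: "i < Suc p"
      show "X *v ?w i \<in> fspan ?w (Suc i)"
      proof (cases "i = p")
        case True
        show ?thesis unfolding True ims using v(2)[OF X] by (simp add: vec.span_insert U_def)
      next
        case False
        then have "Suc i \<le> p" using i by simp
        then show ?thesis using u(2)[OF X, of i] False im[of "Suc i"] by simp
      qed
    qed
  qed
  from this[OF order_refl] obtain u where u: "indep_seq u CARD('n)"
    "\<And>X i. X \<in> L \<Longrightarrow> i < CARD('n) \<Longrightarrow> X *v u i \<in> fspan u (Suc i)" by blast
  have "L \<subseteq> tri u (\<le>)"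
  proof
    fix X assume X: "X \<in> L"
    have "{i. i < CARD('n) \<and> i \<le> j} = {..<Suc j}" if "j < CARD('n)" for j using that by auto
    then show "X \<in> tri u (\<le>)" using u(2)[OF X] by (auto simp: tri_def)
  qed
  then show ?thesis using u(1) by blast
qed

lemma form_mat_1: "form (mat 1 :: complex^'n^'n) 1"
  by unfold_locales (auto simp: transpose_mat invertible_def intro: exI[of _ "mat 1"])

lemma borel_basis:
  fixes q :: "(complex^'n^'n) set"
  assumes q: "q = UNIV \<or> q = {X. trace X = 0}" and b: "borel_subalgebra b q"
  shows "\<exists>f. indep_seq f CARD('n) \<and> b = q \<inter> tri f (\<le>)"
proof -
  have b: "lie_solvable b" "cmat.subspace b" "\<And>X Y. X \<in> b \<Longrightarrow> Y \<in> b \<Longrightarrow> bracket X Y \<in> b" "b \<subseteq> q"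
    and max: "\<And>s. lie_subalgebra s q \<Longrightarrow> lie_solvable s \<Longrightarrow> b \<subseteq> s \<Longrightarrow> s = b"
    using b by (auto simp: borel_subalgebra_def lie_subalgebra_def)
  obtain f where f: "indep_seq f CARD('n)" "b \<subseteq> tri f (\<le>)" using ex_full_flag[OF b(1-3)] by blast
  have "q \<inter> tri f (\<le>) = b"
  proof (rule max)
    show "lie_subalgebra (q \<inter> tri f (\<le>)) q" unfolding lie_subalgebra_def
    proof (intro conjI ballI)
      have "cmat.subspace q" using q by (auto simp: cmat.subspace_def trace_add trace_cscale) (simp add: trace_def)
      then show "cmat.subspace (q \<inter> tri f (\<le>))" by (intro cmat.subspace_inter subspace_tri)
      fix X Y assume XY: "X \<in> q \<inter> tri f (\<le>)" "Y \<in> q \<inter> tri f (\<le>)"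
      have "trace (bracket X Y) = 0" using trace_mul_sym[of X Y] by (simp add: bracket_def trace_sub)
      then have "bracket X Y \<in> q" using q by auto
      moreover have "bracket X Y \<in> tri f (\<le>)"
        by (rule tri_bracket[of X f "(\<le>)" Y "(\<le>)"]) (use XY in auto)
      ultimately show "bracket X Y \<in> q \<inter> tri f (\<le>)" by blast
    qed auto
    show "lie_solvable (q \<inter> tri f (\<le>))" by (rule solvable_tri[OF span_indep_seq[OF f(1)]]) auto
  qed (use f(2) b(4) in blast)
  then show ?thesis using f(1) by blast
qed

definition outer :: "complex^'n \<Rightarrow> complex^'n \<Rightarrow> complex^'n^'n"
  where "outer x y = (\<chi> i j. x $ i * y $ j)"

lemma bil_mat_1: "bil (mat 1) x y = (\<Sum>i\<in>UNIV. x $ i * y $ i)"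
  by (simp add: bil_def)

lemma outer: "outer x y *v z = bil (mat 1) y z *s x"
  by (simp add: outer_def bil_mat_1 vec_eq_iff matrix_vector_mult_def sum_distrib_left sum_distrib_right mult_ac)

lemma trace_outer: "trace (outer x y) = bil (mat 1) y x"
  by (simp add: outer_def trace_def bil_mat_1 mult.commute)

text \<open>The argument of \<open>transversal_flags\<close> with matrices of rank one:
  \<open>outer x y\<close> with B y x = 1 acts on \<open>outer x y'\<close> with B y' x = 0 by the
  eigenvalue 1. Subtracting a scalar matrix makes the trace zero without changing the bracket. The
  standard symmetric form only serves to represent functionals by vectors.\<close>

lemma transversal_full_flags:
  fixes q :: "(complex^'n^'n) set"
  assumes q: "q = UNIV \<or> q = {X. trace X = 0}"
    and h: "lie_nilpotent h" "q \<inter> tri f (\<le>) \<inter> tri f' (\<le>) \<subseteq> h"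
  shows "i \<le> CARD('n) \<Longrightarrow> x \<in> fspan f i \<Longrightarrow> x \<in> fspan f' (CARD('n) - i) \<Longrightarrow> x = 0"
proof (induction i arbitrary: x)
  case 0 then show ?case by simp
next
  case (Suc i)
  interpret form "mat 1 :: complex^'n^'n" 1 by (rule form_mat_1)
  let ?N = "CARD('n)"
  define F where "F l = fspan f l" for l
  define F' where "F' l = fspan f' l" for l
  have sub: "vec.subspace (F l)" "vec.subspace (F' l)" for l by (simp_all add: F_def F'_def)
  have mono: "l \<le> m \<Longrightarrow> F l \<subseteq> F m" "l \<le> m \<Longrightarrow> F' l \<subseteq> F' m" for l m
    unfolding F_def F'_def by (intro span_initial_mono; assumption)+
  have iN: "Suc i \<le> ?N" by fact
  have xF: "x \<in> F (Suc i)" "x \<in> F' (?N - Suc i)" using Suc.prems by (simp_all add: F_def F'_def)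
  have IH: "z = 0" if "z \<in> F i" "z \<in> F' (?N - i)" for z
    using Suc.IH[of z] iN that by (simp add: F_def F'_def)
  show "x = 0"
  proof (rule ccontr)
    assume x0: "x \<noteq> 0"
    then have "x \<notin> F' 0" by (simp add: F'_def)
    then obtain j where j: "Suc j \<le> ?N - Suc i" "x \<in> F' (Suc j)" "x \<notin> F' j"
      using LeastM_flag[of x F' "?N - Suc i"] xF(2) by blast
    have stable: "outer x y \<in> tri g (\<le>)"
      if "\<And>l. B y (g l) = 0 \<or> x \<in> fspan g (Suc l)" for y and g :: "nat \<Rightarrow> complex^'n"
      unfolding tri_def mem_Collect_eq
    proof (intro allI impI)
      fix l assume l: "l < ?N"
      then have "{i. i < ?N \<and> i \<le> l} = {..<Suc l}" by auto
      moreover have "outer x y *v g l \<in> fspan g (Suc l)" unfolding outer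
        using that[of l] by (elim disjE) (simp_all add: vec.span_scale vec.span_zero del: lessThan_Suc image_insert)
      ultimately show "outer x y *v g l \<in> vec.span (g ` {i. i < ?N \<and> i \<le> l})" by simp
    qed
    have mem: "outer x y \<in> tri f (\<le>)" "outer x y \<in> tri f' (\<le>)"
      if y: "\<forall>s\<in>F i. B y s = 0" "\<forall>s\<in>F' j. B y s = 0" for y
    proof -
      show "outer x y \<in> tri f (\<le>)"
      proof (rule stable)
        fix l
        show "B y (f l) = 0 \<or> x \<in> fspan f (Suc l)"
        proof (cases "l < i")
          case True
          then have "f l \<in> F i" unfolding F_def by (intro vec.span_base) auto
          then show ?thesis using y(1) by blast
        next
          case False
          then show ?thesis using xF(1) mono(1)[of "Suc i" "Suc l"] by (auto simp: F_def)
        qed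
      qed
      show "outer x y \<in> tri f' (\<le>)"
      proof (rule stable)
        fix l
        show "B y (f' l) = 0 \<or> x \<in> fspan f' (Suc l)"
        proof (cases "l < j")
          case True
          then have "f' l \<in> F' j" unfolding F'_def by (intro vec.span_base) auto
          then show ?thesis using y(2) by blast
        next
          case False
          then show ?thesis using j(2) mono(2)[of "Suc j" "Suc l"] by (auto simp: F'_def)
        qed
      qed
    qed
    have "x \<notin> {a + b | a b. a \<in> F i \<and> b \<in> F' j}"
    proof
      assume "x \<in> {a + b | a b. a \<in> F i \<and> b \<in> F' j}"
      then obtain a c where ac: "a \<in> F i" "c \<in> F' j" "x = a + c" by auto
      have "x - c \<in> F' (?N - Suc i)"
        using xF(2) ac(2) mono(2)[of j "?N - Suc i"] j(1) sub by (intro vec.subspace_diff) auto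
      then have "a \<in> F' (?N - i)" using ac mono(2)[of "?N - Suc i" "?N - i"] by (auto simp: diff_le_mono2)
      then have "a = 0" using IH ac by blast
      then show False using ac j(3) by simp
    qed
    then obtain y where y: "\<forall>s\<in>{a + b | a b. a \<in> F i \<and> b \<in> F' j}. B y s = 0" "B y x = 1"
      using ex_separating[OF vec.subspace_sums[OF sub]] by blast
    have y1: "\<forall>s\<in>F i. B y s = 0"
    proof
      fix s assume "s \<in> F i"
      then have "s + 0 \<in> {a + b | a b. a \<in> F i \<and> b \<in> F' j}" using sub vec.subspace_0 by blast
      then show "B y s = 0" using y(1) by force
    qed
    have y2: "\<forall>s\<in>F' j. B y s = 0"
    proof
      fix s assume "s \<in> F' j"
      then have "0 + s \<in> {a + b | a b. a \<in> F i \<and> b \<in> F' j}" using sub vec.subspace_0 by blast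
      then show "B y s = 0" using y(1) by force
    qed
    have "i + Suc j + vec.dim {0 :: complex^'n} < ?N" using j(1) iN by simp
    then obtain y' where y': "y' \<noteq> 0" "\<forall>s\<in>F i. B y' s = 0" "\<forall>s\<in>F' (Suc j). B y' s = 0"
      using ex_common_perp[of "{0}" i "Suc j" f f'] vec.subspace_single_0 unfolding F_def F'_def by blast
    have yx: "B y' x = 0" using y'(3) j(2) by blast
    define X where "X = outer x y - cscale (1 / of_nat ?N) (mat 1)"
    have "mat 1 \<in> tri g (\<le>)" for g :: "nat \<Rightarrow> complex^'n"
      by (auto simp: tri_def intro: vec.span_base)
    then have "X \<in> tri f (\<le>)" "X \<in> tri f' (\<le>)" unfolding X_def using mem[OF y1 y2]
      by (auto intro!: cmat.subspace_diff[OF subspace_tri] cmat.subspace_scale[OF subspace_tri])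
    moreover have "trace X = 0"
      by (simp add: X_def trace_sub trace_outer y(2) trace_cscale trace_I)
    ultimately have Xh: "X \<in> h" using h(2) q by blast
    have "trace (outer x y') = 0" by (simp add: trace_outer yx)
    moreover have "\<forall>s\<in>F' j. B y' s = 0" using y'(3) mono(2)[of j "Suc j"] by auto
    ultimately have X'h: "outer x y' \<in> h" using mem[OF y'(2)] h(2) q by blast
    have "bracket X (outer x y') = cscale 1 (outer x y')"
      by (rule matrix_eqI)
        (simp add: bracket_def X_def matrix_vector_mult_diff_rdistrib matrix_vector_mult_diff_distrib
          matrix_vector_mul_assoc[symmetric] outer y(2) yx bil_simps)
    then have "outer x y' = 0" using lie_nilpotent_no_eigenvector[OF h(1) Xh X'h, of 1] by simp
    then have "B y' z *s x = 0" for z by (metis outer matrix_vector_mult_0)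
    then have "B z y' = 0" for z using x0 B_sym_0 by simp
    then show False using nondeg y'(1) by blast
  qed
qed

text \<open>By dimension, the member of index i + 1 of one flag meets the member of index n - i of
  the other. Transversality makes the chosen vectors independent; they span the second flag, and in
  reverse order the first.\<close>

lemma opposite_bases:
  fixes q :: "(complex^'n^'n) set"
  assumes q: "q = UNIV \<or> q = {X. trace X = 0}" and op: "opposite_borels q h b b'"
  shows "\<exists>e. indep_seq e CARD('n) \<and> b' \<subseteq> tri e (\<le>) \<and> b \<subseteq> tri e (\<ge>)"
proof -
  interpret form "mat 1 :: complex^'n^'n" 1 by (rule form_mat_1)
  let ?N = "CARD('n)"
  obtain f where f: "indep_seq f ?N" "b = q \<inter> tri f (\<le>)"
    using borel_basis[OF q] op by (auto simp: opposite_borels_def)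
  obtain f' where f': "indep_seq f' ?N" "b' = q \<inter> tri f' (\<le>)"
    using borel_basis[OF q] op by (auto simp: opposite_borels_def)
  have h: "lie_nilpotent h" "q \<inter> tri f (\<le>) \<inter> tri f' (\<le>) \<subseteq> h"
    using op f(2) f'(2) by (auto simp: opposite_borels_def cartan_subalgebra_def)
  note tr = transversal_full_flags[OF q h]
  define F where "F l = fspan f l" for l
  define F' where "F' l = fspan f' l" for l
  have sub: "vec.subspace (F l)" "vec.subspace (F' l)" for l by (simp_all add: F_def F'_def)
  have dim: "vec.dim (F l) = l" "vec.dim (F' l) = l" if "l \<le> ?N" for l
  proof -
    have "indep_seq f l" "indep_seq f' l" using f(1) f'(1) that by (auto simp: indep_seq_def)
    then show "vec.dim (F l) = l" "vec.dim (F' l) = l" by (simp_all add: F_def F'_def dim_indep_seq)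
  qed
  have "\<exists>c. c \<noteq> 0 \<and> c \<in> F' (Suc i) \<and> c \<in> F (?N - i)" if i: "i < ?N" for i
  proof (rule ccontr)
    assume "\<not> ?thesis"
    then have "F' (Suc i) \<inter> F (?N - i) \<subseteq> {0}" by blast
    then have "vec.dim {x + y | x y. x \<in> F' (Suc i) \<and> y \<in> F (?N - i)} = Suc i + (?N - i)"
      using dim_direct_sum[OF sub(2) sub(1)] dim i by simp
    then show False using dim_le_CARD[of "{x + y | x y. x \<in> F' (Suc i) \<and> y \<in> F (?N - i)}"] i by simp
  qed
  then have "\<forall>i. \<exists>c. i < ?N \<longrightarrow> c \<noteq> 0 \<and> c \<in> F' (Suc i) \<and> c \<in> F (?N - i)" by blast
  from choice[OF this] obtain c where c: "c i \<noteq> 0" "c i \<in> F' (Suc i)" "c i \<in> F (?N - i)" if "i < ?N" for i by blast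
  have mono: "l \<le> m \<Longrightarrow> F l \<subseteq> F m" "l \<le> m \<Longrightarrow> F' l \<subseteq> F' m" for l m
    unfolding F_def F'_def by (intro span_initial_mono; assumption)+
  have cF': "fspan c i \<subseteq> F' i" if "i \<le> ?N" for i
  proof (rule vec.span_minimal[OF _ sub(2)])
    show "c ` {..<i} \<subseteq> F' i"
    proof (rule image_subsetI)
      fix l assume "l \<in> {..<i}"
      then have "c l \<in> F' (Suc l)" "Suc l \<le> i" using c(2) that by auto
      then show "c l \<in> F' i" using mono(2) by blast
    qed
  qed
  have ind: "indep_seq c ?N" unfolding indep_seq_def
  proof (intro allI impI notI)
    fix i assume i: "i < ?N" "c i \<in> fspan c i"
    then have "c i \<in> F' i" using cF'[of i] by auto
    then have "c i = 0" using tr[of "?N - i" "c i"] c(3)[OF i(1)] i(1) by (simp add: F_def F'_def)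
    then show False using c(1) i(1) by blast
  qed
  let ?g = "\<lambda>i. c (?N - 1 - i)"
  have indg: "indep_seq ?g ?N" by (rule indep_seq_rev[OF ind])
  have gF: "fspan ?g i \<subseteq> F i" if "i \<le> ?N" for i
  proof (rule vec.span_minimal[OF _ sub(1)], rule image_subsetI)
    fix l assume l: "l \<in> {..<i}"
    then have "?g l \<in> F (?N - (?N - 1 - l))" using that by (intro c(3)) auto
    then show "?g l \<in> F i" using mono(1)[of "?N - (?N - 1 - l)" i] l that by auto
  qed
  have eqs: "fspan c i = F' i" "fspan ?g i = F i" if "i \<le> ?N" for i
  proof -
    have "indep_seq c i" "indep_seq ?g i" using ind indg that by (auto simp: indep_seq_def)
    then have "vec.dim (fspan c i) = i" "vec.dim (fspan ?g i) = i"
      by (simp_all add: dim_indep_seq)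
    then show "fspan c i = F' i" "fspan ?g i = F i"
      using that dim[OF that] cF'[OF that] gF[OF that] sub by (intro dim_psubset_subspace; simp)+
  qed
  have tri_iff: "X \<in> tri g (\<le>) \<longleftrightarrow> (\<forall>j<?N. X *v g j \<in> fspan g (Suc j))" for X and g :: "nat \<Rightarrow> complex^'n"
  proof -
    have "{i. i < ?N \<and> i \<le> j} = {..<Suc j}" if "j < ?N" for j using that by auto
    then show ?thesis by (auto simp: tri_def)
  qed
  have "b' \<subseteq> tri c (\<le>)"
  proof
    fix X assume X: "X \<in> b'"
    have "X *v c j \<in> F' (Suc j)" if "j < ?N" for j
      using tri_le_initial[of X f' "c j" "Suc j"] X f'(2) c(2)[OF that] that by (auto simp: F'_def)
    then show "X \<in> tri c (\<le>)" unfolding tri_iff using eqs(1) by auto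
  qed
  moreover have "b \<subseteq> tri c (\<ge>)"
  proof
    fix X assume X: "X \<in> b"
    have "X *v ?g j \<in> F (Suc j)" if "j < ?N" for j
    proof -
      have "?g j \<in> F (Suc j)" using eqs(2)[of "Suc j"] that by (metis Suc_leI imageI lessI lessThan_iff vec.span_base)
      then show ?thesis using tri_le_initial[of X f "?g j" "Suc j"] X f(2) that by (auto simp: F_def)
    qed
    then have "X \<in> tri ?g (\<le>)" unfolding tri_iff using eqs(2) by auto
    moreover have "tri ?g (\<le>) \<subseteq> tri c (\<ge>)" unfolding tri_rev by (rule tri_mono) auto
    ultimately show "X \<in> tri c (\<ge>)" by blast
  qed
  ultimately show ?thesis using ind by blast
qed

section \<open>Decomposition of a nilpotent element\<close>

lemma dim_sums_le:
  fixes S T :: "(complex^'n) set"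
  assumes "vec.subspace S" "vec.subspace T" shows "vec.dim {x + y | x y. x \<in> S \<and> y \<in> T} \<le> vec.dim S + vec.dim T"
  using vec.dim_sums_Int[OF assms] by simp

lemma image_sums: "(*v) A ` {x + y | x y. x \<in> S \<and> y \<in> T} = {x + y | x y. x \<in> (*v) A ` S \<and> y \<in> (*v) A ` T}"
  for A :: "complex^'n^'n"
proof (intro equalityI subsetI)
  fix z assume "z \<in> (*v) A ` {x + y | x y. x \<in> S \<and> y \<in> T}"
  then obtain x y where "x \<in> S" "y \<in> T" "z = A *v (x + y)" by auto
  then have "z = A *v x + A *v y" "A *v x \<in> (*v) A ` S" "A *v y \<in> (*v) A ` T"
    by (auto simp: matrix_vector_right_distrib)
  then show "z \<in> {x + y | x y. x \<in> (*v) A ` S \<and> y \<in> (*v) A ` T}" by blast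
next
  fix z assume "z \<in> {x + y | x y. x \<in> (*v) A ` S \<and> y \<in> (*v) A ` T}"
  then obtain x y where "x \<in> S" "y \<in> T" "z = A *v x + A *v y" by auto
  then have "z = A *v (x + y)" "x + y \<in> {x + y | x y. x \<in> S \<and> y \<in> T}"
    by (auto simp: matrix_vector_right_distrib)
  then show "z \<in> (*v) A ` {x + y | x y. x \<in> S \<and> y \<in> T}" by blast
qed

lemma subset_sums:
  assumes "vec.subspace S" "vec.subspace T"
  shows "S \<subseteq> {x + y | x y. x \<in> S \<and> y \<in> T}" "T \<subseteq> {x + y | x y. x \<in> S \<and> y \<in> T}"
proof
  fix x assume "x \<in> S"
  then have "x = x + 0" "x \<in> S \<and> 0 \<in> T" using vec.subspace_0[OF assms(2)] by auto
  then show "x \<in> {x + y | x y. x \<in> S \<and> y \<in> T}" by blast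
next
  show "T \<subseteq> {x + y | x y. x \<in> S \<and> y \<in> T}"
  proof
    fix x assume "x \<in> T"
    then have "x = 0 + x" "0 \<in> S \<and> x \<in> T" using vec.subspace_0[OF assms(1)] by auto
    then show "x \<in> {x + y | x y. x \<in> S \<and> y \<in> T}" by blast
  qed
qed

definition stable :: "complex^'n^'n \<Rightarrow> (complex^'n) set \<Rightarrow> bool"
  where "stable X V \<longleftrightarrow> (\<forall>x\<in>V. X *v x \<in> V)"

lemma stable_mpow: "stable X V \<Longrightarrow> x \<in> V \<Longrightarrow> mpow X k *v x \<in> V"
  using mpow_stable[of V X x k] by (simp add: stable_def)

definition cyc :: "complex^'n^'n \<Rightarrow> complex^'n \<Rightarrow> nat \<Rightarrow> (complex^'n) set"
  where "cyc X v c = fspan (\<lambda>i. mpow X i *v v) c"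

lemma subspace_cyc: "vec.subspace (cyc X v c)"
  by (simp add: cyc_def)

lemma stable_cyc: "mpow X c *v v = 0 \<Longrightarrow> stable X (cyc X v c)"
  using cyclic_stable[of X c v] by (auto simp: stable_def cyc_def)

lemma mpow_in_cyc: assumes "mpow X c *v v = 0" shows "mpow X i *v v \<in> cyc X v c"
proof (cases "i < c")
  case True then show ?thesis unfolding cyc_def by (intro vec.span_base) auto
next
  case False
  then have "mpow X i *v v = 0" using mpow_eq_0_mono[OF assms, of i] by simp
  then show ?thesis by (simp add: cyc_def vec.span_zero)
qed

lemma dim_image_cyc:
  assumes "mpow X c *v v = 0" "mpow X (c - 1) *v v \<noteq> 0"
  shows "rk (mpow X k) (cyc X v c) = c - k"
  unfolding cyc_def image_cyclic[OF assms(1)] by (rule dim_cyclic[OF assms])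

lemma dim_cyc:
  assumes "mpow X c *v v = 0" "mpow X (c - 1) *v v \<noteq> 0" shows "vec.dim (cyc X v c) = c"
  using dim_image_cyc[OF assms, of 0] by simp

lemma sums_stable:
  assumes "stable X S" "stable X T" shows "stable X {x + y | x y. x \<in> S \<and> y \<in> T}"
  using assms unfolding stable_def by (auto simp: matrix_vector_right_distrib) blast

lemma cyc_subset:
  assumes "vec.subspace V" "stable X V" "v \<in> V" shows "cyc X v c \<subseteq> V"
  unfolding cyc_def
  by (rule vec.span_minimal[OF image_subsetI assms(1)]) (rule stable_mpow[OF assms(2,3)])

lemma cyc_induct:
  assumes "x \<in> cyc X v c" "P 0" "\<And>x y. P x \<Longrightarrow> P y \<Longrightarrow> P (x + y)" "\<And>a x. P x \<Longrightarrow> P (a *s x)"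
    "\<And>i. i < c \<Longrightarrow> P (mpow X i *v v)"
  shows "P x"
  using assms(1) unfolding cyc_def
  by (induction rule: vec.span_induct_alt) (use assms(2-) in auto)

context form
begin

lemma B_mpow: "X \<in> so M \<Longrightarrow> B (mpow X i *v x) (mpow X j *v y) = (- 1) ^ i * B x (mpow X (i + j) *v y)"
  by (simp add: mpow_so mpow_mult_vec_add)

text \<open>So B x (X^j x) can be nonzero only if \<epsilon> (-1)^j = 1. This parity rule decides
  which block sizes can occur singly.\<close>

lemma B_mpow_sym: "X \<in> so M \<Longrightarrow> B x (mpow X j *v x) = \<epsilon> * (- 1) ^ j * B x (mpow X j *v x)"
  using B_sym[of x "mpow X j *v x"] mpow_so[of X M j x x] by (simp add: mult.assoc)

lemma nd_subspace: "nd V \<Longrightarrow> vec.subspace V"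
  by (simp add: nd_def)

lemma nd_D: "nd V \<Longrightarrow> x \<in> V \<Longrightarrow> (\<And>y. y \<in> V \<Longrightarrow> B x y = 0) \<Longrightarrow> x = 0"
  by (simp add: nd_def)

lemma nd_split:
  assumes V: "nd V" and V1: "nd V1" "V1 \<subseteq> V"
  defines "V2 \<equiv> V \<inter> perp V1"
  shows "nd V2" "V = {x + y | x y. x \<in> V1 \<and> y \<in> V2}" "vec.dim V = vec.dim V1 + vec.dim V2"
    "\<And>x y. x \<in> V1 \<Longrightarrow> y \<in> V2 \<Longrightarrow> B x y = 0" "\<And>x y. x \<in> V1 \<Longrightarrow> y \<in> V2 \<Longrightarrow> B y x = 0"
proof -
  note sV = nd_subspace[OF V] and sV1 = nd_subspace[OF V1(1)]
  have sV2: "vec.subspace V2" unfolding V2_def by (intro vec.subspace_inter sV subspace_perp)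
  show o: "B x y = 0" if "x \<in> V1" "y \<in> V2" for x y using that by (auto simp: V2_def perp_def)
  then show o': "B y x = 0" if "x \<in> V1" "y \<in> V2" for x y using that B_sym_0 by blast
  show eq: "V = {x + y | x y. x \<in> V1 \<and> y \<in> V2}"
  proof (intro equalityI subsetI)
    fix x assume x: "x \<in> V"
    obtain y where y: "y \<in> V1" "x - y \<in> perp V1" using nd_project[OF V1(1)] by blast
    then have "x - y \<in> V2" using x V1(2) sV by (auto simp: V2_def vec.subspace_diff)
    moreover have "x = y + (x - y)" by simp
    ultimately show "x \<in> {x + y | x y. x \<in> V1 \<and> y \<in> V2}" using y(1) by blast
  next
    fix x assume "x \<in> {x + y | x y. x \<in> V1 \<and> y \<in> V2}"
    then show "x \<in> V" using V1(2) sV by (auto simp: V2_def vec.subspace_add)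
  qed
  have "V1 \<inter> V2 \<subseteq> {0}" using nd_D[OF V1(1)] o' by blast
  then show "vec.dim V = vec.dim V1 + vec.dim V2" by (rule dim_direct_sum[OF sV1 sV2 _ eq])
  show "nd V2" unfolding nd_def
  proof (intro conjI ballI impI sV2)
    fix x assume x: "x \<in> V2" "\<forall>y\<in>V2. B x y = 0"
    show "x = 0"
    proof (rule nd_D[OF V])
      show "x \<in> V" using x by (simp add: V2_def)
      fix y assume "y \<in> V"
      then obtain a b where "a \<in> V1" "b \<in> V2" "y = a + b" using eq by blast
      then show "B x y = 0" using x o' by (simp add: bil_simps)
    qed
  qed
qed

lemma stable_complement:
  assumes "X \<in> so M" "stable X V" "stable X V1" shows "stable X (V \<inter> perp V1)"
  using assms perp_stable[OF assms(1), of V1] by (auto simp: stable_def)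

lemma nd_sum:
  assumes "nd S" "nd T" "\<And>x y. x \<in> S \<Longrightarrow> y \<in> T \<Longrightarrow> B x y = 0"
  shows "nd {x + y | x y. x \<in> S \<and> y \<in> T}"
  unfolding nd_def
proof (intro conjI ballI impI)
  show "vec.subspace {x + y | x y. x \<in> S \<and> y \<in> T}" by (intro vec.subspace_sums nd_subspace assms)
  fix x assume x: "x \<in> {x + y | x y. x \<in> S \<and> y \<in> T}" "\<forall>y\<in>{x + y | x y. x \<in> S \<and> y \<in> T}. B x y = 0"
  then obtain s t where st: "s \<in> S" "t \<in> T" "x = s + t" by blast
  have 0: "0 \<in> S" "0 \<in> T" using assms(1,2) nd_subspace vec.subspace_0 by blast+
  have "B x y = 0" if "y \<in> S" for y
  proof -
    have "y + 0 \<in> {x + y | x y. x \<in> S \<and> y \<in> T}" using that 0 by blast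
    then show ?thesis using x(2) by force
  qed
  then have "B s y + B t y = 0" if "y \<in> S" for y using that st(3) by (simp add: bil_simps)
  moreover have "B t y = 0" if "y \<in> S" for y using assms(3)[OF that st(2)] B_sym_0 by blast
  ultimately have "B s y = 0" if "y \<in> S" for y using that by force
  then have "s = 0" using nd_D[OF assms(1) st(1)] by blast
  have "B x y = 0" if "y \<in> T" for y
  proof -
    have "0 + y \<in> {x + y | x y. x \<in> S \<and> y \<in> T}" using that 0 by blast
    then show ?thesis using x(2) by force
  qed
  then have "B s y + B t y = 0" if "y \<in> T" for y using that st(3) by (simp add: bil_simps)
  then have "B t y = 0" if "y \<in> T" for y using that assms(3)[OF st(1) that] by force
  then have "t = 0" using nd_D[OF assms(2) st(2)] by blast
  then show "x = 0" using st \<open>s = 0\<close> by simp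
qed

section \<open>Jordan blocks in the presence of a form\<close>

lemma functional_B:
  assumes "mpow X c *v v = 0" "B w (mpow X (c - 1) *v v) \<noteq> 0" shows "cyclic_functional X v c (B w)"
  by unfold_locales (use assms in \<open>simp_all add: bil_simps\<close>)

text \<open>A single Jordan block on which the form is nondegenerate, with a generator normalized such that
  the Gram matrix is antidiagonal, and an even-dimensional nondegenerate subspace with a cyclic Lagrangian.\<close>

definition single_block :: "complex^'n^'n \<Rightarrow> complex^'n \<Rightarrow> nat \<Rightarrow> bool"
  where "single_block X v c \<longleftrightarrow> c > 0 \<and> \<epsilon> * (- 1) ^ (c - 1) = 1 \<and> mpow X c *v v = 0 \<and>
    B v (mpow X (c - 1) *v v) \<noteq> 0 \<and> (\<forall>j<c - 1. B v (mpow X j *v v) = 0)"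

definition siegel :: "complex^'n^'n \<Rightarrow> (complex^'n) set \<Rightarrow> complex^'n \<Rightarrow> nat \<Rightarrow> bool"
  where "siegel X V u a \<longleftrightarrow> nd V \<and> stable X V \<and> vec.dim V = 2 * a \<and> a > 0 \<and> u \<in> V \<and>
    mpow X a *v u = 0 \<and> mpow X (a - 1) *v u \<noteq> 0 \<and> (\<forall>j. B u (mpow X j *v u) = 0)"

lemma single_block_B:
  assumes "X \<in> so M" "single_block X v c"
  shows "B (mpow X i *v v) (mpow X j *v v) = 0 \<longleftrightarrow> i + j \<noteq> c - 1"
proof -
  have "B v (mpow X (i + j) *v v) = 0 \<longleftrightarrow> i + j \<noteq> c - 1"
  proof (cases "i + j < c - 1")
    case True then show ?thesis using assms(2) by (auto simp: single_block_def)
  next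
    case False
    show ?thesis
    proof (cases "i + j = c - 1")
      case True then show ?thesis using assms(2) by (auto simp: single_block_def)
    next
      case F: False
      then have "c \<le> i + j" "mpow X c *v v = 0" using assms(2) False by (auto simp: single_block_def)
      then have "mpow X (i + j) *v v = 0" using mpow_eq_0_mono by blast
      then show ?thesis using F by simp
    qed
  qed
  then show ?thesis by (simp add: B_mpow[OF assms(1)])
qed

lemma single_block_nd:
  assumes X: "X \<in> so M" and s: "single_block X v c"
  shows "nd (cyc X v c)" "stable X (cyc X v c)" "vec.dim (cyc X v c) = c"
    "rk (mpow X k) (cyc X v c) = c - k" "v \<in> cyc X v c"
proof -
  have z: "mpow X c *v v = 0" and t: "B v (mpow X (c - 1) *v v) \<noteq> 0" and c: "c > 0" using s by (auto simp: single_block_def)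
  interpret cyclic_functional X v c "B v" by (rule functional_B[OF z t])
  show "stable X (cyc X v c)" by (rule stable_cyc[OF z])
  show "vec.dim (cyc X v c) = c" by (rule dim_cyc[OF z top_nz])
  show "rk (mpow X k) (cyc X v c) = c - k" by (rule dim_image_cyc[OF z top_nz])
  show "v \<in> cyc X v c" using mpow_in_cyc[OF z, of 0] by simp
  show "nd (cyc X v c)" unfolding nd_def
  proof (intro conjI ballI impI subspace_cyc)
    fix x assume x: "x \<in> cyc X v c" "\<forall>y\<in>cyc X v c. B x y = 0"
    show "x = 0"
    proof (rule indep)
      show "x \<in> fspan (\<lambda>i. mpow X i *v v) c" using x(1) by (simp add: cyc_def)
      fix j assume "j < c"
      have "B (mpow X j *v v) x = 0" using x(2) mpow_in_cyc[OF z, of j] B_sym_0 by blast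
      then show "B v (mpow X j *v x) = 0" by (simp add: mpow_so[OF X])
    qed
  qed
qed

text \<open>The values B v (X^j v) are cleared downwards from j = c - 2. At odd distance from c - 1
  they vanish by parity. At even distance L, adding s X^L v changes the value by 2 s B v (X^(c - 1)
  v) and leaves the values at larger j alone.\<close>

lemma normalize_single:
  assumes X: "X \<in> so M" and V: "nd V" "stable X V" and c: "c > 0" "\<And>x. x \<in> V \<Longrightarrow> mpow X c *v x = 0"
    and e: "\<epsilon> * (- 1) ^ (c - 1) = 1" and v: "v \<in> V" "B v (mpow X (c - 1) *v v) \<noteq> 0"
  shows "\<exists>v\<in>V. single_block X v c"
proof -
  note sV = nd_subspace[OF V(1)]
  have "l \<le> c - 1 \<Longrightarrow> \<exists>v\<in>V. B v (mpow X (c - 1) *v v) \<noteq> 0 \<and> (\<forall>j. c - 1 - l \<le> j \<longrightarrow> j < c - 1 \<longrightarrow> B v (mpow X j *v v) = 0)" for l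
  proof (induction l)
    case 0 then show ?case using v by auto
  next
    case (Suc l)
    then obtain v where v: "v \<in> V" "B v (mpow X (c - 1) *v v) \<noteq> 0"
      "\<And>j. c - 1 - l \<le> j \<Longrightarrow> j < c - 1 \<Longrightarrow> B v (mpow X j *v v) = 0" by auto
    have z: "mpow X j *v v = 0" if "c \<le> j" for j using mpow_eq_0_mono[OF c(2)[OF v(1)] that] .
    let ?j = "c - 1 - Suc l"
    show ?case
    proof (cases "even (Suc l)")
      case False
      have "even (c - 1) \<noteq> even ?j" using False Suc.prems by auto
      then have "\<epsilon> * (- 1) ^ ?j = - (\<epsilon> * (- 1) ^ (c - 1))" by (auto simp: minus_one_power_iff)
      then have "B v (mpow X ?j *v v) = - B v (mpow X ?j *v v)" using B_mpow_sym[OF X, of v ?j] e by simp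
      then have "B v (mpow X ?j *v v) = 0" by simp
      moreover have "c - 1 - l \<le> j" if "c - 1 - Suc l \<le> j" "j \<noteq> ?j" for j using that by simp
      ultimately show ?thesis using v by metis
    next
      case True
      define L where "L = Suc l"
      have L: "(- 1 :: complex) ^ L = 1" unfolding L_def using True by (rule neg_one_even_power)
      define s where "s = - B v (mpow X ?j *v v) / (2 * B v (mpow X (c - 1) *v v))"
      let ?v = "v + s *s (mpow X L *v v)"
      have e: "B ?v (mpow X j *v ?v) = B v (mpow X j *v v) + 2 * s * B v (mpow X (j + L) *v v)
          + s * s * B v (mpow X (L + (j + L)) *v v)" for j
        by (simp only: matrix_vector_right_distrib bil_simps mult_vec_scale mpow_mult_vec_add B_mpow[OF X] L)
          (simp add: algebra_simps)
      have 1: "B ?v (mpow X j *v ?v) = B v (mpow X j *v v)" if "c - 1 - l \<le> j" for j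
      proof -
        have "c \<le> j + L" "c \<le> L + (j + L)" using that Suc.prems by (auto simp: L_def)
        then show ?thesis unfolding e by (simp add: z)
      qed
      have "B ?v (mpow X ?j *v ?v) = 0"
      proof -
        have a: "?j + L = c - 1" "c \<le> L + (?j + L)" using Suc.prems by (simp_all add: L_def)
        show ?thesis unfolding e z[OF a(2)] unfolding a(1) using v(2) by (simp add: s_def)
      qed
      moreover have "c - 1 - l \<le> j" if "c - 1 - Suc l \<le> j" "j \<noteq> ?j" for j using that by simp
      moreover have "?v \<in> V" using v(1) stable_mpow[OF V(2)] sV by (simp add: vec.subspace_add vec.subspace_scale)
      moreover have "B ?v (mpow X (c - 1) *v ?v) \<noteq> 0" using 1[of "c - 1"] v(2) by simp
      ultimately show ?thesis using 1 v(3) by metis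
    qed
  qed
  from this[of "c - 1"] obtain v where "v \<in> V" "B v (mpow X (c - 1) *v v) \<noteq> 0" "\<And>j. j < c - 1 \<Longrightarrow> B v (mpow X j *v v) = 0"
    by auto
  then show ?thesis using c e by (auto simp: single_block_def)
qed

text \<open>For the opposite parity the values at even distance from c - 1 vanish automatically.
  Those at odd distance L are cleared by adding a multiple of X^L w, which does not affect the
  pairing of \<open>v\<close> with X^(c - 1) w.\<close>

lemma normalize_pair:
  assumes X: "X \<in> so M" and V: "nd V" "stable X V" and c: "c > 0" "\<And>x. x \<in> V \<Longrightarrow> mpow X c *v x = 0"
    and e: "\<epsilon> * (- 1) ^ (c - 1) = - 1" and v: "v \<in> V" "w \<in> V" "B v (mpow X (c - 1) *v w) \<noteq> 0"
  shows "\<exists>v\<in>V. B v (mpow X (c - 1) *v w) \<noteq> 0 \<and> (\<forall>j. B v (mpow X j *v v) = 0)"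
proof -
  note sV = nd_subspace[OF V(1)]
  have zz: "mpow X j *v x = 0" if "c \<le> j" "x \<in> V" for j x using mpow_eq_0_mono[OF c(2)[OF that(2)] that(1)] .
  have "l \<le> c - 1 \<Longrightarrow> \<exists>v\<in>V. B v (mpow X (c - 1) *v w) \<noteq> 0 \<and> (\<forall>j. c - 1 - l \<le> j \<longrightarrow> B v (mpow X j *v v) = 0)" for l
  proof (induction l)
    case 0
    have "B v (mpow X (c - 1) *v v) = - B v (mpow X (c - 1) *v v)" using B_mpow_sym[OF X, of v "c - 1"] e by simp
    then have "B v (mpow X (c - 1) *v v) = 0" by simp
    then have "B v (mpow X j *v v) = 0" if "c - 1 \<le> j" for j
      using that zz[OF _ v(1), of j] c(1) by (cases "j = c - 1") auto
    then show ?case using v by auto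
  next
    case (Suc l)
    then obtain v where v': "v \<in> V" "B v (mpow X (c - 1) *v w) \<noteq> 0"
      "\<And>j. c - 1 - l \<le> j \<Longrightarrow> B v (mpow X j *v v) = 0" by auto
    let ?j = "c - 1 - Suc l"
    show ?case
    proof (cases "even (Suc l)")
      case True
      have "even (c - 1) = even ?j" using True Suc.prems by auto
      then have "\<epsilon> * (- 1) ^ ?j = \<epsilon> * (- 1) ^ (c - 1)" by (auto simp: minus_one_power_iff)
      then have "B v (mpow X ?j *v v) = - B v (mpow X ?j *v v)" using B_mpow_sym[OF X, of v ?j] e by simp
      then have "B v (mpow X ?j *v v) = 0" by simp
      moreover have "c - 1 - l \<le> j" if "c - 1 - Suc l \<le> j" "j \<noteq> ?j" for j using that by simp
      ultimately show ?thesis using v' by metis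
    next
      case False
      define L where "L = Suc l"
      define s where "s = - B v (mpow X ?j *v v) / (2 * B v (mpow X (c - 1) *v w))"
      let ?v = "v + s *s (mpow X L *v w)"
      have sw: "B (mpow X L *v w) (mpow X j *v v) = \<epsilon> * (- 1) ^ j * B v (mpow X (j + L) *v w)" for j
        by (subst B_sym) (simp only: B_mpow[OF X] mult.assoc)
      have tw: "B (mpow X L *v w) (mpow X (j + L) *v w) = (- 1) ^ L * B w (mpow X (L + (j + L)) *v w)" for j
        by (rule B_mpow[OF X])
      have e': "B ?v (mpow X j *v ?v) = B v (mpow X j *v v) + s * ((1 + \<epsilon> * (- 1) ^ j) * B v (mpow X (j + L) *v w))
          + s * s * (- 1) ^ L * B w (mpow X (L + (j + L)) *v w)" for j
        by (simp only: matrix_vector_right_distrib bil_simps mult_vec_scale mpow_mult_vec_add sw tw) (simp add: algebra_simps)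
      have 1: "B ?v (mpow X j *v ?v) = 0" if "c - 1 - l \<le> j" for j
      proof -
        have "c \<le> j + L" "c \<le> L + (j + L)" using that Suc.prems c(1) by (auto simp: L_def)
        then show ?thesis unfolding e' using zz[OF _ v(2)] v'(3)[OF that] by simp
      qed
      have "B ?v (mpow X ?j *v ?v) = 0"
      proof -
        have a: "?j + L = c - 1" "c \<le> L + (?j + L)" using Suc.prems c(1) by (simp_all add: L_def)
        have "even (c - 1) \<noteq> even ?j" using False Suc.prems by auto
        then have "\<epsilon> * (- 1) ^ ?j = - (\<epsilon> * (- 1) ^ (c - 1))" by (auto simp: minus_one_power_iff)
        then have p: "\<epsilon> * (- 1) ^ ?j = 1" using e by simp
        show ?thesis unfolding e' zz[OF a(2) v(2)] unfolding a(1) p using v'(2) by (simp add: s_def)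
      qed
      moreover have "c - 1 - l \<le> j" if "c - 1 - Suc l \<le> j" "j \<noteq> ?j" for j using that by simp
      moreover have "?v \<in> V" using v'(1) v(2) stable_mpow[OF V(2)] sV by (simp add: vec.subspace_add vec.subspace_scale)
      moreover have "c \<le> L + (c - 1)" using c(1) by (simp add: L_def)
      then have "B ?v (mpow X (c - 1) *v w) \<noteq> 0"
        using v'(2) by (simp only: bil_simps B_mpow[OF X] zz[OF _ v(2)]) simp
      ultimately show ?thesis using 1 by metis
    qed
  qed
  from this[of "c - 1"] show ?thesis by auto
qed

text \<open>The chain of \<open>v\<close> is isotropic and perfectly paired with the chain of
  \<open>w\<close>, so the two are independent and their sum is nondegenerate with the first as a
  Lagrangian.\<close>

lemma siegel_of_pair:
  assumes X: "X \<in> so M" and c: "c > 0" "mpow X c *v v = 0" "mpow X c *v w = 0"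
    and vw: "B v (mpow X (c - 1) *v w) \<noteq> 0" "\<And>j. B v (mpow X j *v v) = 0"
  defines "V1 \<equiv> {x + y | x y. x \<in> cyc X v c \<and> y \<in> cyc X w c}"
  shows "siegel X V1 v c" "\<And>k. rk (mpow X k) V1 \<le> 2 * (c - k)"
proof -
  have wv: "B w (mpow X (c - 1) *v v) \<noteq> 0"
  proof -
    have "B (mpow X (c - 1) *v v) w \<noteq> 0" using vw(1) by (simp add: mpow_so[OF X])
    then show ?thesis using B_sym_0 by blast
  qed
  interpret w: cyclic_functional X w c "B v" by (rule functional_B[OF c(3) vw(1)])
  interpret v: cyclic_functional X v c "B w" by (rule functional_B[OF c(2) wv])
  have vv: "B v (mpow X j *v s) = 0" if "s \<in> cyc X v c" for s j
    using that by (rule cyc_induct) (simp_all add: matrix_vector_right_distrib bil_simps mpow_mult_vec_add vw(2))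
  have w0: "t = 0" if "t \<in> cyc X w c" "\<And>j. j < c \<Longrightarrow> B v (mpow X j *v t) = 0" for t
    using w.indep[of t] that by (simp add: cyc_def)
  have v0: "t = 0" if "t \<in> cyc X v c" "\<And>j. j < c \<Longrightarrow> B w (mpow X j *v t) = 0" for t
    using v.indep[of t] that by (simp add: cyc_def)
  have sub: "vec.subspace V1" unfolding V1_def by (intro vec.subspace_sums subspace_cyc)
  have in1: "cyc X v c \<subseteq> V1" "cyc X w c \<subseteq> V1"
    unfolding V1_def by (rule subset_sums[OF subspace_cyc subspace_cyc])+
  have "cyc X v c \<inter> cyc X w c \<subseteq> {0}" using w0 vv by blast
  then have "vec.dim V1 = vec.dim (cyc X v c) + vec.dim (cyc X w c)"
    by (rule dim_direct_sum[OF subspace_cyc subspace_cyc]) (simp add: V1_def)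
  then have d: "vec.dim V1 = 2 * c"
    by (simp add: dim_cyc[OF c(2) v.top_nz] dim_cyc[OF c(3) w.top_nz])
  have nd: "nd V1" unfolding nd_def
  proof (intro conjI ballI impI sub)
    fix x assume x: "x \<in> V1" "\<forall>y\<in>V1. B x y = 0"
    then obtain s t where st: "s \<in> cyc X v c" "t \<in> cyc X w c" "x = s + t" by (auto simp: V1_def)
    have xv: "B v (mpow X j *v x) = 0" for j
    proof -
      have "B (mpow X j *v v) x = 0" using x(2) in1 mpow_in_cyc[OF c(2), of j] B_sym_0 by blast
      then show ?thesis by (simp add: mpow_so[OF X])
    qed
    have xw: "B w (mpow X j *v x) = 0" for j
    proof -
      have "B (mpow X j *v w) x = 0" using x(2) in1 mpow_in_cyc[OF c(3), of j] B_sym_0 by blast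
      then show ?thesis by (simp add: mpow_so[OF X])
    qed
    have "B v (mpow X j *v t) = 0" for j
      using xv[of j] vv[OF st(1), of j] by (simp add: st(3) matrix_vector_right_distrib bil_simps)
    then have "t = 0" using w0[OF st(2)] by blast
    then have "s = 0" using v0[OF st(1)] xw st(3) by simp
    then show "x = 0" using \<open>t = 0\<close> st by simp
  qed
  show "siegel X V1 v c" unfolding siegel_def
    using nd d c vw(2) v.top_nz in1 mpow_in_cyc[OF c(2), of 0] sums_stable[OF stable_cyc stable_cyc, OF c(2,3)]
    by (auto simp: V1_def)
  fix k
  have "rk (mpow X k) V1 \<le> rk (mpow X k) (cyc X v c) + rk (mpow X k) (cyc X w c)"
    unfolding V1_def image_sums by (intro dim_sums_le subspace_image subspace_cyc)
  then show "rk (mpow X k) V1 \<le> 2 * (c - k)"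
    by (simp add: dim_image_cyc[OF c(2) v.top_nz] dim_image_cyc[OF c(3) w.top_nz])
qed

text \<open>The form B x (X^(c - 1) y) on \<open>V\<close> is symmetric or alternating according to
  the parity of \<open>c\<close>. In the symmetric case polarization gives a vector generating a
  single block; in the alternating case two vectors are needed and a pair of blocks splits
  off.\<close>

lemma peel_form:
  assumes X: "X \<in> so M" and V: "nd V" "stable X V" and c: "c > 0" "\<And>x. x \<in> V \<Longrightarrow> mpow X c *v x = 0"
    and y: "y \<in> V" "mpow X (c - 1) *v y \<noteq> 0"
  shows "(\<exists>u V1. siegel X V1 u c \<and> V1 \<subseteq> V \<and> (\<forall>k. rk (mpow X k) V1 \<le> 2 * (c - k))) \<or>
    (\<exists>v\<in>V. single_block X v c)"
proof -
  note sV = nd_subspace[OF V(1)]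
  obtain x where x: "x \<in> V" "B x (mpow X (c - 1) *v y) \<noteq> 0"
    using nd_D[OF V(1) stable_mpow[OF V(2) y(1)]] y(2) B_sym_0 by blast
  have "\<epsilon> * (- 1) ^ (c - 1) = 1 \<or> \<epsilon> * (- 1) ^ (c - 1) = - 1" using eps by (auto simp: minus_one_power_iff)
  then show ?thesis
  proof
    assume e: "\<epsilon> * (- 1) ^ (c - 1) = 1"
    have "\<exists>v\<in>V. B v (mpow X (c - 1) *v v) \<noteq> 0"
    proof (rule ccontr)
      assume "\<not> ?thesis"
      then have z: "B v (mpow X (c - 1) *v v) = 0" if "v \<in> V" for v using that by blast
      have "B y (mpow X (c - 1) *v x) = B x (mpow X (c - 1) *v y)"
      proof -
        have "B y (mpow X (c - 1) *v x) = \<epsilon> * ((- 1) ^ (c - 1) * B x (mpow X (c - 1) *v y))"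
          by (subst B_sym) (simp only: mpow_so[OF X])
        then show ?thesis using e by (simp add: mult.assoc[symmetric])
      qed
      moreover have "B (x + y) (mpow X (c - 1) *v (x + y)) = 0" using x(1) y(1) sV by (intro z vec.subspace_add)
      ultimately have "2 * B x (mpow X (c - 1) *v y) = 0"
        using z[OF x(1)] z[OF y(1)] by (simp add: matrix_vector_right_distrib bil_simps)
      then show False using x(2) by simp
    qed
    then show ?thesis using normalize_single[OF X V c e] by blast
  next
    assume e: "\<epsilon> * (- 1) ^ (c - 1) = - 1"
    obtain v where v: "v \<in> V" "B v (mpow X (c - 1) *v y) \<noteq> 0" "\<And>j. B v (mpow X j *v v) = 0"
      using normalize_pair[OF X V c e x(1) y(1) x(2)] by blast
    let ?V = "{p + q | p q. p \<in> cyc X v c \<and> q \<in> cyc X y c}"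
    have "cyc X v c \<subseteq> V" "cyc X y c \<subseteq> V" using cyc_subset[OF sV V(2)] v(1) y(1) by blast+
    then have "?V \<subseteq> V" using sV by (auto intro!: vec.subspace_add)
    then show ?thesis using siegel_of_pair[OF X c(1) c(2)[OF v(1)] c(2)[OF y(1)] v(2,3)] by blast
  qed
qed

text \<open>Two blocks of sizes \<open>c > c2\<close> of the same parity contain a cyclic Lagrangian, generated by
  a combination of \<open>X\<^sup>a v\<close> with \<open>2 a = c - c2\<close> and \<open>w\<close>.\<close>

lemma siegel_of_singles:
  assumes X: "X \<in> so M" and v: "single_block X v c" and w: "single_block X w c2" and le: "c2 \<le> c"
    and o: "\<And>x y. x \<in> cyc X v c \<Longrightarrow> y \<in> cyc X w c2 \<Longrightarrow> B x y = 0"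
  defines "V1 \<equiv> {x + y | x y. x \<in> cyc X v c \<and> y \<in> cyc X w c2}"
  shows "\<exists>u a. siegel X V1 u a \<and> (\<forall>k. k \<le> c2 \<longrightarrow> rk (mpow X k) V1 \<le> 2 * (a - k))"
proof -
  have c: "c > 0" "c2 > 0" and z: "mpow X c *v v = 0" "mpow X c2 *v w = 0" using v w by (auto simp: single_block_def)
  have "(- 1 :: complex) ^ (c - 1) = (- 1) ^ (c2 - 1)"
  proof -
    have "\<epsilon> * (- 1) ^ (c - 1) = \<epsilon> * (- 1) ^ (c2 - 1)" using v w by (simp add: single_block_def)
    then show ?thesis by simp
  qed
  then have "even (c - 1) = even (c2 - 1)" by (auto simp: minus_one_power_iff split: if_splits)
  then have "even (c - c2)" using c le by (auto simp: even_diff_nat)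
  then obtain a0 where a0: "c = c2 + 2 * a0" using le by (metis dvdE le_add_diff_inverse)
  define a where "a = c2 + a0"
  let ?bv = "B v (mpow X (c - 1) *v v)" and ?bw = "B w (mpow X (c2 - 1) *v w)"
  have b: "?bv \<noteq> 0" "?bw \<noteq> 0" using v w by (auto simp: single_block_def)
  \<comment> \<open>Chosen so that the contributions of both blocks to B u (X^(c2 - 1) u) cancel;
    all other values B u (X^j u) vanish block by block.\<close>
  define \<iota> where "\<iota> = csqrt (- ((- 1) ^ a0 * ?bv) / ?bw)"
  have i2: "\<iota> * \<iota> = - ((- 1) ^ a0 * ?bv) / ?bw" by (metis \<iota>_def power2_csqrt power2_eq_square)
  define u where "u = mpow X a0 *v v + \<iota> *s w"
  have vc: "mpow X i *v v \<in> cyc X v c" "mpow X i *v w \<in> cyc X w c2" for i using mpow_in_cyc z by blast+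
  have wc: "w \<in> cyc X w c2" "v \<in> cyc X v c" using vc[of 0] by simp_all
  have o': "B y x = 0" if "x \<in> cyc X v c" "y \<in> cyc X w c2" for x y using o[OF that] B_sym_0 by blast
  have Xu: "mpow X j *v u = mpow X (j + a0) *v v + \<iota> *s (mpow X j *v w)" for j
    by (simp add: u_def matrix_vector_right_distrib mpow_mult_vec_add)
  have uu: "B u (mpow X j *v u) = 0" for j
  proof -
    have "B u (mpow X j *v u) = B (mpow X a0 *v v) (mpow X (j + a0) *v v) + \<iota> * \<iota> * B w (mpow X j *v w)"
      unfolding Xu by (simp add: u_def bil_simps o[OF vc(1) vc(2)] o'[OF vc(1) wc(1)])
    also have "\<dots> = 0"
    proof (cases "j = c2 - 1")
      case True
      then have "a0 + (j + a0) = c - 1" using a0 c by simp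
      then show ?thesis using b True by (simp add: B_mpow[OF X] i2)
    next
      case False
      then have "a0 + (j + a0) \<noteq> c - 1" using a0 c by auto
      then have "B (mpow X a0 *v v) (mpow X (j + a0) *v v) = 0" using single_block_B[OF X v] by blast
      moreover have "B (mpow X 0 *v w) (mpow X j *v w) = 0" using single_block_B[OF X w, of 0 j] False by simp
      ultimately show ?thesis by simp
    qed
    finally show ?thesis .
  qed
  have in1: "cyc X v c \<subseteq> V1" "cyc X w c2 \<subseteq> V1"
    unfolding V1_def by (rule subset_sums[OF subspace_cyc subspace_cyc])+
  have nd1: "nd (cyc X v c)" "nd (cyc X w c2)" using single_block_nd(1) X v w by blast+
  have nd: "nd V1" unfolding V1_def by (rule nd_sum[OF nd1 o])
  have st: "stable X V1" unfolding V1_def by (intro sums_stable stable_cyc z)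
  have int: "cyc X v c \<inter> cyc X w c2 \<subseteq> {0}" using nd_D[OF nd1(1)] o' by blast
  have d: "vec.dim V1 = c + c2"
    using dim_direct_sum[OF subspace_cyc subspace_cyc int] single_block_nd(3)[OF X v] single_block_nd(3)[OF X w]
    by (simp add: V1_def)
  have "u \<in> V1" unfolding u_def
    using vc(1)[of a0] wc(1) in1 nd_subspace[OF nd] by (intro vec.subspace_add vec.subspace_scale) auto
  moreover have "mpow X a *v u = 0"
    unfolding Xu using mpow_eq_0_mono[OF z(1), of "a + a0"] mpow_eq_0_mono[OF z(2), of a] a0 by (simp add: a_def)
  moreover have "mpow X (a - 1) *v u \<noteq> 0"
  proof
    assume "mpow X (a - 1) *v u = 0"
    then have "B v (mpow X (a - 1) *v u) = 0" by simp
    moreover have "a - 1 + a0 = c - 1" using a0 c by (simp add: a_def)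
    ultimately have "?bv = 0" unfolding Xu by (simp add: bil_simps o[OF wc(2) vc(2)])
    then show False using b by simp
  qed
  ultimately have s: "siegel X V1 u a" unfolding siegel_def
    using nd st d uu c a0 by (simp add: a_def)
  have "rk (mpow X k) V1 \<le> 2 * (a - k)" if "k \<le> c2" for k
  proof -
    have "rk (mpow X k) V1 \<le> rk (mpow X k) (cyc X v c) + rk (mpow X k) (cyc X w c2)"
      unfolding V1_def image_sums by (intro dim_sums_le subspace_image subspace_cyc)
    also have "\<dots> = (c - k) + (c2 - k)" using single_block_nd(4)[OF X v] single_block_nd(4)[OF X w] by simp
    also have "\<dots> = 2 * (a - k)" using that a0 by (simp add: a_def)
    finally show ?thesis .
  qed
  with s show ?thesis by blast
qed

end

section \<open>Frames adapted to a nilpotent element\<close>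

text \<open>The degrees of the basis vectors for the principal grading; in even orthogonal algebras the two
  middle vectors may be given the same degree.\<close>

definition deg :: "bool \<Rightarrow> nat \<Rightarrow> nat \<Rightarrow> nat"
  where "deg t m i = (if t \<and> m div 2 \<le> i then i - 1 else i)"

lemma deg_False [simp]: "deg False m i = i"
  by (simp add: deg_def)

context form
begin

text \<open>The position described in the introduction, up to scaling of the frame, on a stable subspace \<open>V\<close>
  and for the powers of \<open>X\<close> with exponents in \<open>K\<close>; \<open>B (f (m - 1 - i)) (X *v f j)\<close> is, up to a nonzero
  factor, the matrix entry of \<open>X\<close> at \<open>(i, j)\<close>.\<close>

definition good_frame ::
    "complex^'n^'n \<Rightarrow> nat set \<Rightarrow> bool \<Rightarrow> (complex^'n) set \<Rightarrow> nat \<Rightarrow> (nat \<Rightarrow> complex^'n) \<Rightarrow> bool"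
  where "good_frame X K t V m f \<longleftrightarrow> vec.dim V = m \<and> (t \<longrightarrow> \<epsilon> = 1 \<and> even m \<and> m \<ge> 2) \<and>
    (\<forall>i<m. f i \<in> V) \<and>
    (\<forall>i<m. \<forall>j<m. B (f i) (f j) = 0 \<longleftrightarrow> i + j \<noteq> m - 1) \<and>
    (\<forall>i<m. \<forall>j<m. B (f (m - 1 - i)) (X *v f j) \<noteq> 0 \<longrightarrow> deg t m i < deg t m j) \<and>
    (\<forall>k\<in>K. \<exists>J\<subseteq>{..<m}. inj_on (deg t m) J \<and> rk (mpow X k) V \<le> card J \<and>
      (\<forall>j\<in>J. \<exists>i<m. deg t m i + k = deg t m j \<and> B (f (m - 1 - i)) (mpow X k *v f j) \<noteq> 0))"

text \<open>The Lagrangian chain is listed from the kernel upwards, so that powers of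
  \<open>X\<close> shift the index down.\<close>

lemma siegel_string:
  assumes X: "X \<in> so M" and s: "siegel X V u a"
  defines "ws \<equiv> \<lambda>j. mpow X (a - 1 - j) *v u"
  shows "ws j \<in> V" "B (ws i) (ws j) = 0"
    "j < a \<Longrightarrow> mpow X k *v ws j = (if k \<le> j then ws (j - k) else 0)"
    "\<exists>wd. (\<forall>j<a. wd j \<in> V) \<and> (\<forall>i<a. \<forall>j<a. B (ws i) (wd j) = (if i = j then 1 else 0)) \<and>
      (\<forall>i<a. \<forall>j<a. B (wd i) (wd j) = 0)"
proof -
  have V: "nd V" "stable X V" "u \<in> V" "mpow X a *v u = 0" "mpow X (a - 1) *v u \<noteq> 0" "\<And>j. B u (mpow X j *v u) = 0" "a > 0"
    using s by (auto simp: siegel_def)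
  show wV: "ws j \<in> V" for j unfolding ws_def by (rule stable_mpow[OF V(2,3)])
  show ww: "B (ws i) (ws j) = 0" for i j unfolding ws_def by (simp add: B_mpow[OF X] V(6))
  show Xw: "mpow X k *v ws j = (if k \<le> j then ws (j - k) else 0)" if "j < a" for j k
  proof (cases "k \<le> j")
    case True
    then have "k + (a - 1 - j) = a - 1 - (j - k)" using that by simp
    then show ?thesis using True by (simp add: ws_def mpow_mult_vec_add)
  next
    case False
    then have "a \<le> k + (a - 1 - j)" using that by simp
    then show ?thesis using False mpow_eq_0_mono[OF V(4)] by (simp add: ws_def mpow_mult_vec_add)
  qed
  have ind: "indep_seq ws a" unfolding indep_seq_def
  proof (intro allI impI notI)
    fix i assume i: "i < a" "ws i \<in> fspan ws i"
    have "mpow X i *v x = 0" if "x \<in> fspan ws i" for x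
      using that
    proof (induction rule: vec.span_induct_alt)
      case (step c y z)
      then obtain j where "j < i" "y = ws j" by auto
      then have "mpow X i *v y = 0" using Xw[of j i] i(1) by simp
      with step show ?case by (simp add: matrix_vector_right_distrib)
    qed simp
    from this[OF i(2)] have "ws 0 = 0" using Xw[OF i(1), of i] by simp
    then show False using V(5) by (simp add: ws_def)
  qed
  show "\<exists>wd. (\<forall>j<a. wd j \<in> V) \<and> (\<forall>i<a. \<forall>j<a. B (ws i) (wd j) = (if i = j then 1 else 0)) \<and>
      (\<forall>i<a. \<forall>j<a. B (wd i) (wd j) = 0)"
    by (rule isotropic_duals[OF V(1) wV ind ww])
qed

text \<open>Adding \<open>a\<close> vectors at either end of a frame shifts the degrees of the inner
  frame by \<open>a\<close>.\<close>

lemma deg_shift: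
  assumes "t \<longrightarrow> even m2 \<and> m2 \<ge> 2" "m = m2 + 2 * a"
  shows "i < a \<Longrightarrow> deg t m i = i" "a \<le> i \<Longrightarrow> i < a + m2 \<Longrightarrow> deg t m i = a + deg t m2 (i - a)"
    "a + m2 \<le> i \<Longrightarrow> deg t m i = (if t then i - 1 else i)"
proof -
  have "t \<Longrightarrow> m div 2 = m2 div 2 + a \<and> m2 div 2 \<ge> 1 \<and> m2 div 2 \<le> m2" using assms by auto
  then show "i < a \<Longrightarrow> deg t m i = i" "a \<le> i \<Longrightarrow> i < a + m2 \<Longrightarrow> deg t m i = a + deg t m2 (i - a)"
    "a + m2 \<le> i \<Longrightarrow> deg t m i = (if t then i - 1 else i)"
    by (auto simp: deg_def)
qed

lemma deg_lt: "t \<longrightarrow> m2 \<ge> 2 \<Longrightarrow> i < m2 \<Longrightarrow> deg t m2 i < (if t then m2 - 1 else m2)"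
  by (auto simp: deg_def)

text \<open>The Lagrangian chain is put in front, its dual system in reverse order behind, and the
  frame of the complement in between. On the dual system \<open>X\<close> acts by the negative
  transpose of the chain, which is again a shift, plus terms in the Lagrangian, whose degrees are
  smaller.\<close>

lemma good_frame_siegel:
  assumes X: "X \<in> so M" and V: "nd V" and stV: "stable X V" and s: "siegel X V1 u a" "V1 \<subseteq> V"
    and r: "\<And>k. k \<in> K \<Longrightarrow> rk (mpow X k) V1 \<le> 2 * (a - k)"
    and f2: "good_frame X K t (V \<inter> perp V1) m2 f2"
  shows "\<exists>f. good_frame X K t V (m2 + 2 * a) f"
proof -
  define V2 where "V2 = V \<inter> perp V1"
  have V1: "nd V1" "stable X V1" "vec.dim V1 = 2 * a" "a > 0" using s(1) by (auto simp: siegel_def)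
  note sp = nd_split[OF V V1(1) s(2), folded V2_def]
  define ws where "ws j = mpow X (a - 1 - j) *v u" for j
  note str = siegel_string[OF X s(1), folded ws_def]
  obtain wd where wd: "(\<forall>j<a. wd j \<in> V1) \<and> (\<forall>i<a. \<forall>j<a. B (ws i) (wd j) = (if i = j then 1 else 0)) \<and>
      (\<forall>i<a. \<forall>j<a. B (wd i) (wd j) = 0)"
    using str(4) by (elim exE)
  have w: "j < a \<Longrightarrow> wd j \<in> V1" "ws j \<in> V1" "B (ws i) (ws j) = 0"
    "i < a \<Longrightarrow> j < a \<Longrightarrow> B (ws i) (wd j) = (if i = j then 1 else 0)"
    "i < a \<Longrightarrow> j < a \<Longrightarrow> B (wd i) (wd j) = 0"
    "j < a \<Longrightarrow> mpow X k *v ws j = (if k \<le> j then ws (j - k) else 0)" for i j k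
    using wd str(1-3) by auto
  have wdws: "B (wd j) (ws i) = (if i = j then \<epsilon> else 0)" if "i < a" "j < a" for i j
    using B_sym[of "wd j" "ws i"] w(4)[OF that] by simp
  have g: "vec.dim V2 = m2" "t \<longrightarrow> \<epsilon> = 1 \<and> even m2 \<and> m2 \<ge> 2" "\<And>i. i < m2 \<Longrightarrow> f2 i \<in> V2"
    "\<And>i j. i < m2 \<Longrightarrow> j < m2 \<Longrightarrow> B (f2 i) (f2 j) = 0 \<longleftrightarrow> i + j \<noteq> m2 - 1"
    "\<And>i j. i < m2 \<Longrightarrow> j < m2 \<Longrightarrow> B (f2 (m2 - 1 - i)) (X *v f2 j) \<noteq> 0 \<Longrightarrow> deg t m2 i < deg t m2 j"
    "\<And>k. k \<in> K \<Longrightarrow> \<exists>J\<subseteq>{..<m2}. inj_on (deg t m2) J \<and> rk (mpow X k) V2 \<le> card J \<and>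
      (\<forall>j\<in>J. \<exists>i<m2. deg t m2 i + k = deg t m2 j \<and> B (f2 (m2 - 1 - i)) (mpow X k *v f2 j) \<noteq> 0)"
    using f2 unfolding good_frame_def V2_def by blast+
  define m where "m = m2 + 2 * a"
  have dg: "i < a \<Longrightarrow> deg t m i = i" "a \<le> i \<Longrightarrow> i < a + m2 \<Longrightarrow> deg t m i = a + deg t m2 (i - a)"
    "a + m2 \<le> i \<Longrightarrow> deg t m i = (if t then i - 1 else i)" for i
    using deg_shift[of t m2 m a i] g(2) by (auto simp: m_def)
  define f where "f j = (if j < a then ws j else if j < a + m2 then f2 (j - a) else wd (m - 1 - j))" for j
  have fL: "f j = ws j" if "j < a" for j using that by (simp add: f_def)
  have fM: "f j = f2 (j - a)" if "a \<le> j" "j < a + m2" for j using that by (simp add: f_def)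
  have fT: "f j = wd (m - 1 - j)" "m - 1 - j < a" if "a + m2 \<le> j" "j < m" for j
    using that by (auto simp: f_def m_def)
  have o: "B x y = 0" "B y x = 0" if "x \<in> V1" "y \<in> V2" for x y using that sp(4,5) by blast+
  have st2: "mpow X k *v f2 j \<in> V2" if "j < m2" for j k
    using stable_mpow[OF stable_complement[OF X stV V1(2)]] g(3)[OF that] by (simp add: V2_def)
  have st1: "mpow X k *v wd j \<in> V1" if "j < a" for j k
    by (rule stable_mpow[OF V1(2) w(1)[OF that]])
  have Xp: "X *v x = mpow X 1 *v x" for x by simp
  have cases: thesis if "j < m" "j < a \<Longrightarrow> thesis" "a \<le> j \<Longrightarrow> j < a + m2 \<Longrightarrow> thesis" "a + m2 \<le> j \<Longrightarrow> thesis" for j thesis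
    using that by linarith
  have dual: "i < a \<Longrightarrow> f (m - 1 - i) = wd i" "a \<le> i \<Longrightarrow> i < a + m2 \<Longrightarrow> f (m - 1 - i) = f2 (m2 - 1 - (i - a))"
    "a + m2 \<le> i \<Longrightarrow> i < m \<Longrightarrow> f (m - 1 - i) = ws (m - 1 - i)" for i
  proof -
    show "f (m - 1 - i) = wd i" if "i < a"
    proof -
      have "a + m2 \<le> m - 1 - i" "m - 1 - i < m" "m - 1 - (m - 1 - i) = i" using that by (auto simp: m_def)
      then show ?thesis using fT(1) by simp
    qed
    show "f (m - 1 - i) = f2 (m2 - 1 - (i - a))" if "a \<le> i" "i < a + m2"
    proof -
      have "a \<le> m - 1 - i" "m - 1 - i < a + m2" "m - 1 - i - a = m2 - 1 - (i - a)" using that by (auto simp: m_def)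
      then show ?thesis using fM by simp
    qed
    show "f (m - 1 - i) = ws (m - 1 - i)" if "a + m2 \<le> i" "i < m" using fL fT(2)[OF that] by simp
  qed
  have fV1: "f j \<in> V1" if "j < m" "\<not> (a \<le> j \<and> j < a + m2)" for j
    using that w(1,2) fT fL by (cases "j < a") auto
  have gram: "B (f i) (f j) = 0 \<longleftrightarrow> i + j \<noteq> m - 1" if ij: "i < m" "j < m" for i j
  proof (rule cases[OF ij(1)]; rule cases[OF ij(2)])
    assume "i < a" "j < a"
    then show ?thesis using w(3) by (simp add: fL m_def)
  next
    assume "i < a" "a \<le> j" "j < a + m2"
    then show ?thesis using o(1)[OF w(2) g(3)] by (simp add: fL fM m_def)
  next
    assume c: "i < a" "a + m2 \<le> j"
    then have "i = m - 1 - j \<longleftrightarrow> i + j = m - 1" using ij by auto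
    then show ?thesis using c w(4) fT[OF c(2) ij(2)] by (simp add: fL)
  next
    assume "a \<le> i" "i < a + m2" "j < a"
    then show ?thesis using o(2)[OF w(2) g(3)] by (simp add: fL fM m_def)
  next
    assume c: "a \<le> i" "i < a + m2" "a \<le> j" "j < a + m2"
    then have "i - a + (j - a) = m2 - 1 \<longleftrightarrow> i + j = m - 1" by (auto simp: m_def)
    then show ?thesis using c g(4)[of "i - a" "j - a"] by (simp add: fM)
  next
    assume c: "a \<le> i" "i < a + m2" "a + m2 \<le> j"
    then show ?thesis using o(2)[OF w(1) g(3)] fT[OF c(3) ij(2)] by (simp add: fM m_def)
  next
    assume c: "a + m2 \<le> i" "j < a"
    then have "j = m - 1 - i \<longleftrightarrow> i + j = m - 1" using ij by auto
    then show ?thesis using c wdws fT[OF c(1) ij(1)] by (simp add: fL)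
  next
    assume c: "a + m2 \<le> i" "a \<le> j" "j < a + m2"
    then show ?thesis using o(1)[OF w(1) g(3)] fT[OF c(1) ij(1)] by (simp add: fM m_def)
  next
    assume c: "a + m2 \<le> i" "a + m2 \<le> j"
    then show ?thesis using w(5) fT[OF c(1) ij(1)] fT[OF c(2) ij(2)] ij by (simp add: m_def)
  qed
  have tri: "deg t m i < deg t m j" if ij: "i < m" "j < m" and nz: "B (f (m - 1 - i)) (X *v f j) \<noteq> 0" for i j
    using nz
  proof (rule_tac contrapos_np)
    assume nd: "\<not> deg t m i < deg t m j"
    show "B (f (m - 1 - i)) (X *v f j) = 0"
    proof (rule cases[OF ij(2)])
      assume j: "j < a"
      have Xj: "X *v f j = (if 1 \<le> j then ws (j - 1) else 0)" unfolding Xp fL[OF j] by (rule w(6)[OF j])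
      show ?thesis
      proof (rule cases[OF ij(1)])
        assume "i < a"
        moreover have "i \<noteq> j - 1 \<or> j = 0" using nd dg(1) j \<open>i < a\<close> by auto
        ultimately show ?thesis unfolding Xj dual(1)[OF \<open>i < a\<close>] using j wdws by auto
      next
        assume i: "a \<le> i" "i < a + m2"
        then have "m2 - 1 - (i - a) < m2" by simp
        then show ?thesis unfolding Xj dual(2)[OF i] using o(2)[OF w(2) g(3)] by auto
      next
        assume i: "a + m2 \<le> i"
        show ?thesis unfolding Xj dual(3)[OF i ij(1)] using w(3) by auto
      qed
    next
      assume j: "a \<le> j" "j < a + m2"
      then have jm: "j - a < m2" by simp
      have Xj: "X *v f j \<in> V2" unfolding Xp fM[OF j] by (rule st2) (use j in simp)
      show ?thesis
      proof (rule cases[OF ij(1)])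
        assume i: "i < a"
        show ?thesis unfolding dual(1)[OF i] by (rule o(1)[OF w(1)[OF i] Xj])
      next
        assume i: "a \<le> i" "i < a + m2"
        then have "\<not> deg t m2 (i - a) < deg t m2 (j - a)" using nd dg(2) j by simp
        moreover have "i - a < m2" "j - a < m2" using i j by auto
        ultimately show ?thesis unfolding dual(2)[OF i] fM[OF j] using g(5)[of "i - a" "j - a"] by blast
      next
        assume i: "a + m2 \<le> i"
        show ?thesis unfolding dual(3)[OF i ij(1)] by (rule o(1)[OF w(2) Xj])
      qed
    next
      assume j: "a + m2 \<le> j"
      have Xj: "X *v f j \<in> V1" unfolding Xp fT(1)[OF j ij(2)] by (rule st1[OF fT(2)[OF j ij(2)]])
      show ?thesis
      proof (rule cases[OF ij(1)])
        assume "i < a"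
        then show ?thesis using nd dg(1)[of i] dg(3)[OF j] g(2) j by (auto split: if_splits)
      next
        assume i: "a \<le> i" "i < a + m2"
        then have "m2 - 1 - (i - a) < m2" by simp
        then show ?thesis unfolding dual(2)[OF i] by (rule o(2)[OF Xj g(3)])
      next
        assume i: "a + m2 \<le> i"
        have ia: "m - 1 - i < a" "m - 1 - j < a" using fT(2) i j ij by auto
        have "\<not> i < j" using nd dg(3)[OF i] dg(3)[OF j] V1(4) i by (auto split: if_splits)
        then have ne: "m - 1 - i - 1 \<noteq> m - 1 - j \<or> m - 1 - i = 0" using ij by auto
        have "B (ws (m - 1 - i)) (X *v wd (m - 1 - j)) = - B (X *v ws (m - 1 - i)) (wd (m - 1 - j))"
          using soD[OF X, of "ws (m - 1 - i)" "wd (m - 1 - j)"] by simp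
        also have "\<dots> = 0" unfolding Xp w(6)[OF ia(1)] using ne ia w(4) by auto
        finally show ?thesis unfolding dual(3)[OF i ij(1)] fT(1)[OF j ij(2)] .
      qed
    qed
  qed
  have count: "\<exists>J\<subseteq>{..<m}. inj_on (deg t m) J \<and> rk (mpow X k) V \<le> card J \<and>
      (\<forall>j\<in>J. \<exists>i<m. deg t m i + k = deg t m j \<and> B (f (m - 1 - i)) (mpow X k *v f j) \<noteq> 0)" if k: "k \<in> K" for k
  proof -
    obtain J2 where J2: "J2 \<subseteq> {..<m2}" "inj_on (deg t m2) J2" "rk (mpow X k) V2 \<le> card J2"
      "\<And>j. j \<in> J2 \<Longrightarrow> \<exists>i<m2. deg t m2 i + k = deg t m2 j \<and> B (f2 (m2 - 1 - i)) (mpow X k *v f2 j) \<noteq> 0"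
      using g(6)[OF k] by blast
    \<comment> \<open>Each of the two strings contributes a - k columns; together they account for
      the bound 2 (a - k) on the rank over \<open>V1\<close>.\<close>
    define J where "J = {k..<a} \<union> (\<lambda>j. a + j) ` J2 \<union> (\<lambda>j. m - 1 - j) ` {..<a - k}"
    have JT: "a + m2 \<le> m - 1 - j" "m - 1 - j < m" if "j < a - k" for j using that by (auto simp: m_def)
    have Jm: "J \<subseteq> {..<m}" using J2(1) JT by (auto simp: J_def m_def)
    have "finite J2" using J2(1) finite_subset by blast
    have cJ: "card J = (a - k) + card J2 + (a - k)"
    proof -
      have "card ((\<lambda>j. m - 1 - j) ` {..<a - k}) = a - k" by (subst card_image) (auto simp: inj_on_def m_def)
      moreover have "card ((\<lambda>j. a + j) ` J2) = card J2" by (subst card_image) auto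
      moreover have "{k..<a} \<inter> (\<lambda>j. a + j) ` J2 = {}" by auto
      moreover have "({k..<a} \<union> (\<lambda>j. a + j) ` J2) \<inter> (\<lambda>j. m - 1 - j) ` {..<a - k} = {}"
        using J2(1) JT(1) by fastforce
      ultimately show ?thesis unfolding J_def using \<open>finite J2\<close> by (simp add: card_Un_disjoint)
    qed
    \<comment> \<open>The degree already decides in which of the three regions an index lies, so
      coincidences can only happen inside the inner frame, where \<open>J2\<close> avoids
      them.\<close>
    have reg: "(x < a \<longleftrightarrow> y < a) \<and> (a + m2 \<le> x \<longleftrightarrow> a + m2 \<le> y)" if xy: "x < m" "y < m" "deg t m x = deg t m y" for x y
    proof -
      have "(x < a \<longleftrightarrow> deg t m x < a) \<and> (a + m2 \<le> x \<longleftrightarrow> a + (if t then m2 - 1 else m2) \<le> deg t m x)" if "x < m" for x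
        using that
      proof (rule cases)
        assume "x < a" then show ?thesis using dg(1) by auto
      next
        assume x: "a \<le> x" "x < a + m2"
        then have "x - a < m2" by simp
        then show ?thesis using x dg(2)[OF x] deg_lt[of t m2 "x - a"] g(2) by auto
      next
        assume x: "a + m2 \<le> x"
        then show ?thesis using dg(3)[OF x] g(2) by auto
      qed
      from this[OF xy(1)] this[OF xy(2)] show ?thesis using xy(3) by simp
    qed
    have "inj_on (deg t m) J"
    proof (rule inj_onI)
      fix x y assume xy: "x \<in> J" "y \<in> J" "deg t m x = deg t m y"
      have xm: "x < m" "y < m" using xy Jm by auto
      note R = reg[OF xm xy(3)]
      show "x = y"
      proof (rule cases[OF xm(1)])
        assume "x < a" then show ?thesis using R xy(3) dg(1) by auto
      next
        assume x: "a \<le> x" "x < a + m2"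
        then have y: "a \<le> y" "y < a + m2" using R by auto
        have in2: "z - a \<in> J2" if "z \<in> J" "a \<le> z" "z < a + m2" for z
        proof -
          have "z \<notin> (\<lambda>j. m - 1 - j) ` {..<a - k}" using JT(1) that(3) by fastforce
          then show ?thesis using that by (auto simp: J_def)
        qed
        have "deg t m2 (x - a) = deg t m2 (y - a)" using xy(3) dg(2)[OF x] dg(2)[OF y] by simp
        then have "x - a = y - a" using J2(2) in2 x y xy by (auto simp: inj_on_def)
        then show ?thesis using x y by simp
      next
        assume x: "a + m2 \<le> x"
        then have "a + m2 \<le> y" using R by simp
        then show ?thesis using xy(3) dg(3) x V1(4) by (auto split: if_splits)
      qed
    qed
    moreover have "rk (mpow X k) V \<le> card J"
    proof -
      have "rk (mpow X k) V \<le> rk (mpow X k) V1 + rk (mpow X k) V2"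
        by (subst sp(2), subst image_sums) (intro dim_sums_le subspace_image nd_subspace V1(1) sp(1))
      then show ?thesis using r[OF k] J2(3) cJ by simp
    qed
    moreover have "\<exists>i<m. deg t m i + k = deg t m j \<and> B (f (m - 1 - i)) (mpow X k *v f j) \<noteq> 0" if "j \<in> J" for j
    proof -
      from that consider "k \<le> j" "j < a" | l where "l \<in> J2" "j = a + l" | l where "l < a - k" "j = m - 1 - l"
        by (auto simp: J_def)
      then show ?thesis
      proof cases
        case 1
        then have "B (f (m - 1 - (j - k))) (mpow X k *v f j) \<noteq> 0"
          unfolding fL[OF 1(2)] w(6)[OF 1(2)] using wdws[of "j - k" "j - k"] 1 dual(1)[of "j - k"] by simp
        moreover have "j - k < m" "deg t m (j - k) + k = deg t m j" using 1 dg(1) by (auto simp: m_def)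
        ultimately show ?thesis by blast
      next
        case 2
        then have lm: "l < m2" using J2(1) by auto
        obtain i where i: "i < m2" "deg t m2 i + k = deg t m2 l" "B (f2 (m2 - 1 - i)) (mpow X k *v f2 l) \<noteq> 0"
          using J2(4)[OF 2(1)] by blast
        have "B (f (m - 1 - (a + i))) (mpow X k *v f j) \<noteq> 0"
          unfolding 2(2) using i lm dual(2)[of "a + i"] fM[of "a + l"] by simp
        moreover have "a + i < m" "deg t m (a + i) + k = deg t m j"
          using i lm dg(2)[of "a + i"] dg(2)[of "a + l"] by (auto simp: 2(2) m_def)
        ultimately show ?thesis by blast
      next
        case 3
        let ?i = "m - 1 - (l + k)"
        have i: "a + m2 \<le> ?i" "?i < m" "m - 1 - ?i = l + k" "?i + k = j" "m - 1 - j = l" using 3 by (auto simp: m_def)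
        have j: "a + m2 \<le> j" "j < m" using JT 3 by auto
        have lk: "l + k < a" "l < a" using 3 by auto
        have "B (ws (l + k)) (mpow X k *v wd l) = (- 1) ^ k * B (mpow X k *v ws (l + k)) (wd l)"
        proof -
          have "(- 1) ^ k * ((- 1) ^ k * B (ws (l + k)) (mpow X k *v wd l)) = B (ws (l + k)) (mpow X k *v wd l)"
            by (simp add: mult.assoc[symmetric] power_mult_distrib[symmetric])
          then show ?thesis by (simp add: mpow_so[OF X])
        qed
        also have "\<dots> \<noteq> 0" using w(6)[OF lk(1), of k] w(4)[OF lk(2) lk(2)] by simp
        finally have "B (f (m - 1 - ?i)) (mpow X k *v f j) \<noteq> 0"
          using fT(1)[OF j] i lk by (simp add: fL)
        moreover have "deg t m ?i + k = deg t m j" using dg(3)[OF i(1)] dg(3)[OF j(1)] i(4) V1(4) i(1) by (auto split: if_splits)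
        ultimately show ?thesis using i(2) by blast
      qed
    qed
    ultimately show ?thesis using Jm by blast
  qed
  have "good_frame X K t V m f" unfolding good_frame_def
  proof (intro conjI allI impI ballI)
    show "vec.dim V = m" using sp(3) V1(3) g(1) by (simp add: m_def)
    show "\<epsilon> = 1" "even m" "m \<ge> 2" if t using g(2) that by (auto simp: m_def)
    show "f i \<in> V" if "i < m" for i
      using that
    proof (rule cases)
      assume "a \<le> i" "i < a + m2"
      then show ?thesis using g(3)[of "i - a"] by (simp add: fM V2_def)
    qed (use fV1[OF that] s(2) in auto)
  qed (use gram tri count in blast)+
  then show ?thesis by (auto simp: m_def)
qed

end

section \<open>Inserting a single block into a frame\<close>

context form
begin

lemma single_block_string:
  assumes X: "X \<in> so M" and v: "single_block X v c"
  defines "S \<equiv> \<lambda>j. mpow X (c - 1 - j) *v v"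
  shows "S j \<in> cyc X v c" "i < c \<Longrightarrow> j < c \<Longrightarrow> B (S i) (S j) = 0 \<longleftrightarrow> i + j \<noteq> c - 1"
    "j < c \<Longrightarrow> mpow X k *v S j = (if k \<le> j then S (j - k) else 0)"
proof -
  have z: "mpow X c *v v = 0" using v by (simp add: single_block_def)
  show "S j \<in> cyc X v c" unfolding S_def by (rule mpow_in_cyc[OF z])
  show "B (S i) (S j) = 0 \<longleftrightarrow> i + j \<noteq> c - 1" if "i < c" "j < c"
    unfolding S_def single_block_B[OF X v] using that by auto
  show "mpow X k *v S j = (if k \<le> j then S (j - k) else 0)" if "j < c"
  proof (cases "k \<le> j")
    case True
    then have "k + (c - 1 - j) = c - 1 - (j - k)" using that by simp
    then show ?thesis using True by (simp add: S_def mpow_mult_vec_add)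
  next
    case False
    then have "c \<le> k + (c - 1 - j)" using that by simp
    then show ?thesis using False mpow_eq_0_mono[OF z] by (simp add: S_def mpow_mult_vec_add)
  qed
qed

lemma good_frameD:
  assumes "good_frame X K t V m f"
  shows "vec.dim V = m" "\<And>i. i < m \<Longrightarrow> f i \<in> V"
    "\<And>i j. i < m \<Longrightarrow> j < m \<Longrightarrow> B (f i) (f j) = 0 \<longleftrightarrow> i + j \<noteq> m - 1"
    "\<And>i j. i < m \<Longrightarrow> j < m \<Longrightarrow> B (f (m - 1 - i)) (X *v f j) \<noteq> 0 \<Longrightarrow> deg t m i < deg t m j"
proof -
  have "vec.dim V = m \<and> (\<forall>i<m. f i \<in> V) \<and> (\<forall>i<m. \<forall>j<m. B (f i) (f j) = 0 \<longleftrightarrow> i + j \<noteq> m - 1) \<and>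
    (\<forall>i<m. \<forall>j<m. B (f (m - 1 - i)) (X *v f j) \<noteq> 0 \<longrightarrow> deg t m i < deg t m j)"
    using assms unfolding good_frame_def by (intro conjI; elim conjE)
  then show "vec.dim V = m" "\<And>i. i < m \<Longrightarrow> f i \<in> V"
    "\<And>i j. i < m \<Longrightarrow> j < m \<Longrightarrow> B (f i) (f j) = 0 \<longleftrightarrow> i + j \<noteq> m - 1"
    "\<And>i j. i < m \<Longrightarrow> j < m \<Longrightarrow> B (f (m - 1 - i)) (X *v f j) \<noteq> 0 \<Longrightarrow> deg t m i < deg t m j"
    by simp_all
qed

lemma sum_zero_iff:
  fixes x y :: complex
  assumes "x = 0 \<longleftrightarrow> \<not> P" "y = 0 \<longleftrightarrow> \<not> Q" "(P \<or> Q \<longleftrightarrow> R) \<and> \<not> (P \<and> Q)"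
  shows "x + y = 0 \<longleftrightarrow> \<not> R"
  using assms by (cases P; cases Q) simp_all

text \<open>The index bookkeeping for the Gram matrix in \<open>good_frame_insert_odd\<close>.
  \<open>Ai\<close> and \<open>Bi\<close> say whether the i-th vector has a component in the block
  and in the frame of the complement; \<open>bi\<close> and \<open>ai\<close> are the positions of
  these components.\<close>

lemma insert_odd_arith:
  fixes p s i j ai aj bi bj m :: nat
  assumes "\<not> Ai \<and> Bi \<and> ai = i \<and> i < p \<or> Ai \<and> \<not> Bi \<and> bi + p = i \<and> p \<le> i \<and> i < p + s \<or>
        i \<in> {p + s, p + s + 1} \<and> Ai \<and> Bi \<and> bi = s \<and> ai = p \<or>
        Ai \<and> \<not> Bi \<and> bi + 1 + p = i \<and> p + s + 1 < i \<and> i \<le> p + 2 * s + 1 \<or>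
        \<not> Ai \<and> Bi \<and> ai + 2 * s + 1 = i \<and> p + 2 * s + 1 < i"
   and "\<not> Aj \<and> Bj \<and> aj = j \<and> j < p \<or> Aj \<and> \<not> Bj \<and> bj + p = j \<and> p \<le> j \<and> j < p + s \<or>
        j \<in> {p + s, p + s + 1} \<and> Aj \<and> Bj \<and> bj = s \<and> aj = p \<or>
        Aj \<and> \<not> Bj \<and> bj + 1 + p = j \<and> p + s + 1 < j \<and> j \<le> p + 2 * s + 1 \<or>
        \<not> Aj \<and> Bj \<and> aj + 2 * s + 1 = j \<and> p + 2 * s + 1 < j"
   and "i \<notin> {p + s, p + s + 1} \<or> j \<notin> {p + s, p + s + 1}" "i < 2 * (p + s + 1)" "j < 2 * (p + s + 1)" "m = 2 * (p + s + 1)"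
  shows "(Ai \<and> Aj \<and> bi + bj = 2 * s \<or> Bi \<and> Bj \<and> ai + aj = 2 * p \<longleftrightarrow> i + j = m - 1) \<and>
    \<not> ((Ai \<and> Aj \<and> bi + bj = 2 * s) \<and> (Bi \<and> Bj \<and> ai + aj = 2 * p))"
proof -
  have m1: "m - 1 = 2 * p + 2 * s + 1" using assms(6) by simp
  show ?thesis using assms(1-5) unfolding m1
    by (elim disjE conjE; simp; arith?)
qed

text \<open>The frame of the complement has even length, so the block fits between its halves
  without mixing. The exponents in \<open>K\<close> kill the complement, hence the columns of the
  block alone account for the rank.\<close>

lemma good_frame_insert_even:
  assumes X: "X \<in> so M" and V: "nd V" and stV: "stable X V" and v: "single_block X v c" "v \<in> V"
    and f2: "good_frame X {} False (V \<inter> perp (cyc X v c)) m2 f2" "even m2"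
    and K: "\<And>k x. k \<in> K \<Longrightarrow> x \<in> V \<inter> perp (cyc X v c) \<Longrightarrow> mpow X k *v x = 0"
  shows "\<exists>f. good_frame X K False V (m2 + c) f"
proof -
  define V1 where "V1 = cyc X v c"
  define V2 where "V2 = V \<inter> perp V1"
  note V1 = single_block_nd[OF X v(1), folded V1_def]
  have V1V: "V1 \<subseteq> V" unfolding V1_def by (rule cyc_subset[OF nd_subspace[OF V] stV v(2)])
  note sp = nd_split[OF V V1(1) V1V, folded V2_def]
  define S where "S j = mpow X (c - 1 - j) *v v" for j
  note S = single_block_string[OF X v(1), folded S_def V1_def]
  note g = good_frameD[OF f2(1), folded V1_def, folded V2_def, unfolded deg_False]
  obtain p where p: "m2 = 2 * p" using f2(2) by (elim evenE)
  define m where "m = m2 + c"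
  have c0: "c > 0" using v(1) by (simp add: single_block_def)
  define \<phi> where "\<phi> j = (if j < p then j else j - c)" for j
  define f where "f j = (if p \<le> j \<and> j < p + c then S (j - p) else f2 (\<phi> j))" for j
  have mid: "f j = S (j - p)" "j - p < c" if "p \<le> j" "j < p + c" for j using that by (auto simp: f_def)
  have out: "f j = f2 (\<phi> j)" "\<phi> j < m2" if "\<not> (p \<le> j \<and> j < p + c)" "j < m" for j
    using that by (auto simp: f_def \<phi>_def m_def p)
  have dmid: "f (m - 1 - i) = S (c - 1 - (i - p))" if "p \<le> i" "i < p + c" for i
  proof -
    have "p \<le> m - 1 - i" "m - 1 - i < p + c" "m - 1 - i - p = c - 1 - (i - p)" using that by (auto simp: m_def p)
    then show ?thesis using mid by simp
  qed
  have dout: "f (m - 1 - i) = f2 (m2 - 1 - \<phi> i)" if "\<not> (p \<le> i \<and> i < p + c)" "i < m" for i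
  proof -
    have "\<not> (p \<le> m - 1 - i \<and> m - 1 - i < p + c)" "m - 1 - i < m" "\<phi> (m - 1 - i) = m2 - 1 - \<phi> i"
      using that by (auto simp: m_def p \<phi>_def)
    then show ?thesis using out by simp
  qed
  have o: "B x y = 0" "B y x = 0" if "x \<in> V1" "y \<in> V2" for x y using that sp(4,5) by blast+
  have st2: "mpow X k *v f2 j \<in> V2" if "j < m2" for j k
    using stable_mpow[OF stable_complement[OF X stV V1(2)]] g(2)[OF that] by (simp add: V2_def)
  have st1: "mpow X k *v S j \<in> V1" for j k
    by (rule stable_mpow[OF V1(2) S(1)])
  have Xp: "X *v x = mpow X 1 *v x" for x by simp
  have gram: "B (f i) (f j) = 0 \<longleftrightarrow> i + j \<noteq> m - 1" if ij: "i < m" "j < m" for i j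
  proof (cases "p \<le> i \<and> i < p + c"; cases "p \<le> j \<and> j < p + c")
    assume i: "p \<le> i \<and> i < p + c" and j: "p \<le> j \<and> j < p + c"
    then have "i - p + (j - p) = c - 1 \<longleftrightarrow> i + j = m - 1" using c0 by (auto simp: m_def p)
    then show ?thesis using i j mid S(2)[of "i - p" "j - p"] by simp
  next
    assume i: "p \<le> i \<and> i < p + c" and j: "\<not> (p \<le> j \<and> j < p + c)"
    then have "i + j \<noteq> m - 1" using ij by (auto simp: m_def p)
    then show ?thesis using i out[OF j ij(2)] mid o(1)[OF S(1) g(2)] by simp
  next
    assume i: "\<not> (p \<le> i \<and> i < p + c)" and j: "p \<le> j \<and> j < p + c"
    then have "i + j \<noteq> m - 1" using ij by (auto simp: m_def p)
    then show ?thesis using j out[OF i ij(1)] mid o(2)[OF S(1) g(2)] by simp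
  next
    assume i: "\<not> (p \<le> i \<and> i < p + c)" and j: "\<not> (p \<le> j \<and> j < p + c)"
    then have "\<phi> i + \<phi> j = m2 - 1 \<longleftrightarrow> i + j = m - 1" using ij c0 by (auto simp: m_def p \<phi>_def)
    then show ?thesis using out[OF i ij(1)] out[OF j ij(2)] g(3)[of "\<phi> i" "\<phi> j"] by simp
  qed
  have tri: "i < j" if ij: "i < m" "j < m" and nz: "B (f (m - 1 - i)) (X *v f j) \<noteq> 0" for i j
  proof (cases "p \<le> i \<and> i < p + c"; cases "p \<le> j \<and> j < p + c")
    assume i: "p \<le> i \<and> i < p + c" and j: "p \<le> j \<and> j < p + c"
    have jp: "j - p < c" using j by auto
    have Xf: "X *v f j = (if 1 \<le> j - p then S (j - p - 1) else 0)" using j mid S(3)[OF jp, of 1] by simp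
    have "1 \<le> j - p" using nz unfolding Xf by (auto split: if_splits)
    then have "B (S (c - 1 - (i - p))) (S (j - p - 1)) \<noteq> 0" using nz dmid[of i] i unfolding Xf by auto
    then have "c - 1 - (i - p) + (j - p - 1) = c - 1" using S(2)[of "c - 1 - (i - p)" "j - p - 1"] i j by auto
    then show ?thesis using i j \<open>1 \<le> j - p\<close> by linarith
  next
    assume i: "p \<le> i \<and> i < p + c" and j: "\<not> (p \<le> j \<and> j < p + c)"
    have "X *v f j \<in> V2" unfolding Xp out(1)[OF j ij(2)] by (rule st2[OF out(2)[OF j ij(2)]])
    then show ?thesis using nz dmid[of i] i o(1)[OF S(1)] by auto
  next
    assume i: "\<not> (p \<le> i \<and> i < p + c)" and j: "p \<le> j \<and> j < p + c"
    have "X *v f j \<in> V1" unfolding Xp using mid j st1[of 1] by simp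
    moreover have "m2 - 1 - \<phi> i < m2" using out(2)[OF i ij(1)] by simp
    ultimately show ?thesis using nz dout[OF i ij(1)] o(2)[OF _ g(2)] by auto
  next
    assume i: "\<not> (p \<le> i \<and> i < p + c)" and j: "\<not> (p \<le> j \<and> j < p + c)"
    have "\<phi> i < \<phi> j"
      by (rule g(4)[OF out(2)[OF i ij(1)] out(2)[OF j ij(2)]]) (use nz in \<open>simp only: dout[OF i ij(1)] out(1)[OF j ij(2)]\<close>, simp)
    then show ?thesis using i j ij by (auto simp: \<phi>_def p m_def split: if_splits)
  qed
  have count: "\<exists>J\<subseteq>{..<m}. inj_on (deg False m) J \<and> rk (mpow X k) V \<le> card J \<and>
      (\<forall>j\<in>J. \<exists>i<m. deg False m i + k = deg False m j \<and> B (f (m - 1 - i)) (mpow X k *v f j) \<noteq> 0)" if k: "k \<in> K" for k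
  proof (intro exI[of _ "{p + k..<p + c}"] conjI ballI)
    show "{p + k..<p + c} \<subseteq> {..<m}" by (auto simp: m_def p)
    show "inj_on (deg False m) {p + k..<p + c}" by (simp add: inj_on_def)
    have "(*v) (mpow X k) ` V2 \<subseteq> {0}" using K[OF k] by (auto simp: V2_def V1_def)
    then have d0: "rk (mpow X k) V2 = 0" by (simp only: vec.dim_eq_0)
    have "rk (mpow X k) V \<le> rk (mpow X k) V1 + rk (mpow X k) V2"
      by (subst sp(2), subst image_sums) (intro dim_sums_le subspace_image nd_subspace V1(1) sp(1))
    then show "rk (mpow X k) V \<le> card {p + k..<p + c}" unfolding d0 using V1(4)[of k] by simp
    fix j assume j: "j \<in> {p + k..<p + c}"
    then have jp: "j - p < c" "k \<le> j - p" "p \<le> j" "j < p + c" by auto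
    have ip: "p \<le> j - k" "j - k < p + c" "j - k - p = j - p - k" using j by auto
    have "mpow X k *v f j = S (j - p - k)" using mid(1)[OF jp(3,4)] S(3)[OF jp(1), of k] jp(2) by simp
    moreover have "f (m - 1 - (j - k)) = S (c - 1 - (j - p - k))" using dmid[OF ip(1,2)] ip(3) by simp
    moreover have "B (S (c - 1 - (j - p - k))) (S (j - p - k)) \<noteq> 0"
      using S(2)[of "c - 1 - (j - p - k)" "j - p - k"] jp by auto
    ultimately show "\<exists>i<m. deg False m i + k = deg False m j \<and> B (f (m - 1 - i)) (mpow X k *v f j) \<noteq> 0"
      using ip jp by (intro exI[of _ "j - k"]) (simp add: m_def p)
  qed
  have "good_frame X K False V m f" unfolding good_frame_def
  proof (intro conjI allI impI ballI)
    show "vec.dim V = m" using sp(3) V1(3) g(1) by (simp add: m_def)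
    show "f i \<in> V" if "i < m" for i
    proof (cases "p \<le> i \<and> i < p + c")
      case True then show ?thesis using mid S(1) V1V by auto
    next
      case False then show ?thesis using out[OF False that] g(2) by (auto simp: V2_def)
    qed
  qed (use gram tri count in auto)
  then show ?thesis by (auto simp: m_def)
qed

text \<open>Each vector is a combination of one vector of the block and one of the frame of the complement;
  both occur only in the two middle vectors, the isotropic combinations of the two middle vectors.\<close>

lemma good_frame_insert_odd:
  assumes X: "X \<in> so M" and V: "nd V" and stV: "stable X V" and v: "single_block X v c" "v \<in> V"
    and f2: "good_frame X {} False (V \<inter> perp (cyc X v c)) m2 f2" and m2: "m2 = 2 * p + 1" and c: "c = 2 * s + 1"
    and e: "\<epsilon> = 1"
    and K: "\<And>x. x \<in> V \<inter> perp (cyc X v c) \<Longrightarrow> mpow X k *v x = 0"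
  shows "\<exists>f. good_frame X {k} True V (m2 + c) f"
proof -
  define V1 where "V1 = cyc X v c"
  define V2 where "V2 = V \<inter> perp V1"
  note V1 = single_block_nd[OF X v(1), folded V1_def]
  have V1V: "V1 \<subseteq> V" unfolding V1_def by (rule cyc_subset[OF nd_subspace[OF V] stV v(2)])
  note sp = nd_split[OF V V1(1) V1V, folded V2_def]
  define S where "S j = mpow X (c - 1 - j) *v v" for j
  note S = single_block_string[OF X v(1), folded S_def V1_def]
  note g = good_frameD[OF f2, folded V1_def, folded V2_def, unfolded deg_False]
  define m where "m = m2 + c"
  have m: "m = 2 * (p + s + 1)" by (simp add: m_def m2 c)
  have o: "B x y = 0" "B y x = 0" if "x \<in> V1" "y \<in> V2" for x y using that sp(4,5) by blast+
  let ?b = "B (S s) (S s)" and ?x = "f2 p"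
  have b: "?b \<noteq> 0" "B ?x ?x \<noteq> 0" using S(2)[of s s] g(3)[of p p] by (auto simp: c m2)
  \<comment> \<open>With this factor both S s + \<theta> f2 p and S s - \<theta> f2 p are isotropic;
    their mutual pairing is 2 B (S s) (S s).\<close>
  define \<theta> where "\<theta> = csqrt (- ?b / B ?x ?x)"
  have th: "\<theta> * \<theta> = - ?b / B ?x ?x" by (metis \<theta>_def power2_csqrt power2_eq_square)
  \<comment> \<open>Coefficient \<open>a1\<close> and position \<open>\<beta>\<close> describe the
    component in the block, \<open>b1\<close> and \<open>\<alpha>\<close> the component in the frame
    of the complement. The latter occupies the two ends, the block the middle, and both share the
    positions p + s and p + s + 1.\<close>
  define a1 :: "nat \<Rightarrow> complex" where "a1 j = (if p \<le> j \<and> j \<le> p + c then 1 else 0)" for j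
  define b1 where "b1 j = (if j = p + s then \<theta> else if j = p + s + 1 then - \<theta> else if p \<le> j \<and> j \<le> p + c then 0 else 1)" for j
  define \<beta> where "\<beta> j = (if j \<le> p + s then j - p else j - 1 - p)" for j
  define \<alpha> where "\<alpha> j = (if j < p then j else if j \<le> p + c then p else j - c)" for j
  define f where "f j = a1 j *s S (\<beta> j) + b1 j *s f2 (\<alpha> j)" for j
  have idx: "\<alpha> j < m2" "a1 j \<noteq> 0 \<Longrightarrow> \<beta> j < c" if "j < m" for j
    using that by (auto simp: \<alpha>_def \<beta>_def a1_def m m2 c split: if_splits)
  have du: "a1 (m - 1 - i) = a1 i" "a1 i \<noteq> 0 \<Longrightarrow> \<beta> (m - 1 - i) = c - 1 - \<beta> i" "\<alpha> (m - 1 - i) = m2 - 1 - \<alpha> i"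
    "b1 (m - 1 - i) \<noteq> 0 \<Longrightarrow> b1 i \<noteq> 0" "m - 1 - i < m" if "i < m" for i
    using that by (auto simp: \<alpha>_def \<beta>_def a1_def b1_def m m2 c split: if_splits)
  have dgb: "deg True m j = p + \<beta> j" if "a1 j \<noteq> 0" "j < m" for j
    using that by (auto simp: deg_def \<beta>_def a1_def m c split: if_splits)
  have dga: "deg True m j = (if \<alpha> j < p then \<alpha> j else if \<alpha> j = p then p + s else \<alpha> j + 2 * s)"
    if "b1 j \<noteq> 0" "j < m" for j
    using that by (auto simp: deg_def \<alpha>_def b1_def m c split: if_splits)
  have Bf: "B (f i) (mpow X k *v f j) = a1 i * a1 j * B (S (\<beta> i)) (mpow X k *v S (\<beta> j))
      + b1 i * b1 j * B (f2 (\<alpha> i)) (mpow X k *v f2 (\<alpha> j))" if ij: "i < m" "j < m" for i j k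
  proof -
    have "mpow X k *v f2 (\<alpha> j) \<in> V2"
      using stable_mpow[OF stable_complement[OF X stV V1(2)]] g(2)[OF idx(1)[OF ij(2)]] by (simp add: V2_def)
    moreover have "mpow X k *v S (\<beta> j) \<in> V1" by (rule stable_mpow[OF V1(2) S(1)])
    ultimately show ?thesis unfolding f_def
      using o(1)[OF S(1)] o(2)[OF _ g(2)[OF idx(1)[OF ij(1)]]]
      by (simp add: matrix_vector_right_distrib bil_simps algebra_simps)
  qed
  have gram: "B (f i) (f j) = 0 \<longleftrightarrow> i + j \<noteq> m - 1" if ij: "i < m" "j < m" for i j
  proof -
    have e: "B (f i) (f j) = a1 i * a1 j * B (S (\<beta> i)) (S (\<beta> j)) + b1 i * b1 j * B (f2 (\<alpha> i)) (f2 (\<alpha> j))"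
      using Bf[OF ij, of 0] by simp
    have SS: "a1 i * a1 j * B (S (\<beta> i)) (S (\<beta> j)) = 0 \<longleftrightarrow> \<not> (a1 i \<noteq> 0 \<and> a1 j \<noteq> 0 \<and> \<beta> i + \<beta> j = 2 * s)"
      using S(2)[of "\<beta> i" "\<beta> j"] idx ij by (auto simp: c)
    have FF: "b1 i * b1 j * B (f2 (\<alpha> i)) (f2 (\<alpha> j)) = 0 \<longleftrightarrow> \<not> (b1 i \<noteq> 0 \<and> b1 j \<noteq> 0 \<and> \<alpha> i + \<alpha> j = 2 * p)"
      using g(3)[of "\<alpha> i" "\<alpha> j"] idx ij by (auto simp: m2)
    have th0: "\<theta> \<noteq> 0" using th b by auto
    consider "i \<in> {p + s, p + s + 1}" "j \<in> {p + s, p + s + 1}"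
      | "i \<notin> {p + s, p + s + 1} \<or> j \<notin> {p + s, p + s + 1}" by blast
    then show ?thesis
    proof cases
      case 1
      have "a1 i = 1" "a1 j = 1" "\<beta> i = s" "\<beta> j = s" "\<alpha> i = p" "\<alpha> j = p"
        using 1 by (auto simp: a1_def \<beta>_def \<alpha>_def c)
      then have e': "B (f i) (f j) = ?b + b1 i * b1 j * B ?x ?x" using e by simp
      show ?thesis
      proof (cases "i = j")
        case True
        then have "b1 i * b1 j = \<theta> * \<theta>" using 1 by (auto simp: b1_def)
        then have "B (f i) (f j) = 0" using e' th b by simp
        moreover have "i + i \<noteq> m - 1" unfolding m by presburger
        ultimately show ?thesis using True by simp
      next
        case False
        then have "b1 i * b1 j = - (\<theta> * \<theta>)" using 1 by (auto simp: b1_def)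
        then have "B (f i) (f j) = 2 * ?b" using e' th b by simp
        moreover have "i + j = m - 1" using 1 False by (auto simp: m)
        ultimately show ?thesis using b by simp
      qed
    next
      case 2
      have reg: "\<not> a1 l \<noteq> 0 \<and> b1 l \<noteq> 0 \<and> \<alpha> l = l \<and> l < p \<or> a1 l \<noteq> 0 \<and> \<not> b1 l \<noteq> 0 \<and> \<beta> l + p = l \<and> p \<le> l \<and> l < p + s \<or>
        l \<in> {p + s, p + s + 1} \<and> a1 l \<noteq> 0 \<and> b1 l \<noteq> 0 \<and> \<beta> l = s \<and> \<alpha> l = p \<or>
        a1 l \<noteq> 0 \<and> \<not> b1 l \<noteq> 0 \<and> \<beta> l + 1 + p = l \<and> p + s + 1 < l \<and> l \<le> p + 2 * s + 1 \<or>
        \<not> a1 l \<noteq> 0 \<and> b1 l \<noteq> 0 \<and> \<alpha> l + 2 * s + 1 = l \<and> p + 2 * s + 1 < l" for l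
      proof -
        consider "l < p" | "p \<le> l" "l < p + s" | "l = p + s" | "l = p + s + 1" | "p + s + 1 < l" "l \<le> p + 2 * s + 1" | "p + 2 * s + 1 < l"
          by linarith
        then show ?thesis by cases (simp_all add: a1_def b1_def \<alpha>_def \<beta>_def c th0)
      qed
      have ar: "(a1 i \<noteq> 0 \<and> a1 j \<noteq> 0 \<and> \<beta> i + \<beta> j = 2 * s \<or> b1 i \<noteq> 0 \<and> b1 j \<noteq> 0 \<and> \<alpha> i + \<alpha> j = 2 * p \<longleftrightarrow> i + j = m - 1) \<and>
        \<not> ((a1 i \<noteq> 0 \<and> a1 j \<noteq> 0 \<and> \<beta> i + \<beta> j = 2 * s) \<and> (b1 i \<noteq> 0 \<and> b1 j \<noteq> 0 \<and> \<alpha> i + \<alpha> j = 2 * p))"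
        by (rule insert_odd_arith[OF reg[of i] reg[of j] 2 ij[unfolded m] m])
      show ?thesis unfolding e by (rule sum_zero_iff[OF SS FF ar])
    qed
  qed
  have tri: "deg True m i < deg True m j" if ij: "i < m" "j < m" and nz: "B (f (m - 1 - i)) (X *v f j) \<noteq> 0" for i j
  proof -
    have e: "B (f (m - 1 - i)) (X *v f j) = a1 i * a1 j * B (S (\<beta> (m - 1 - i))) (X *v S (\<beta> j))
      + b1 (m - 1 - i) * b1 j * B (f2 (m2 - 1 - \<alpha> i)) (X *v f2 (\<alpha> j))"
      using Bf[OF du(5)[OF ij(1)] ij(2), of 1] du(1,3)[OF ij(1)] by simp
    consider "a1 i * a1 j * B (S (\<beta> (m - 1 - i))) (X *v S (\<beta> j)) \<noteq> 0"
      | "b1 (m - 1 - i) * b1 j * B (f2 (m2 - 1 - \<alpha> i)) (X *v f2 (\<alpha> j)) \<noteq> 0"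
      using nz unfolding e by (metis add.right_neutral)
    then show ?thesis
    proof cases
      case 1
      then have a: "a1 i \<noteq> 0" "a1 j \<noteq> 0" by auto
      have bc: "\<beta> i < c" "\<beta> j < c" using idx(2) ij a by blast+
      have XS: "X *v S (\<beta> j) = (if 1 \<le> \<beta> j then S (\<beta> j - 1) else 0)" using S(3)[OF bc(2), of 1] by simp
      have j1: "1 \<le> \<beta> j" using 1 unfolding XS by (auto split: if_splits)
      have "B (S (c - 1 - \<beta> i)) (S (\<beta> j - 1)) \<noteq> 0" using 1 du(2)[OF ij(1) a(1)] j1 unfolding XS by auto
      then have "c - 1 - \<beta> i + (\<beta> j - 1) = c - 1" using S(2)[of "c - 1 - \<beta> i" "\<beta> j - 1"] bc by auto
      then have "\<beta> i < \<beta> j" using bc j1 by linarith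
      then show ?thesis using dgb[OF a(1) ij(1)] dgb[OF a(2) ij(2)] by simp
    next
      case 2
      then have bb: "b1 i \<noteq> 0" "b1 j \<noteq> 0" using du(4)[OF ij(1)] by auto
      have "\<alpha> i < \<alpha> j" by (rule g(4)[OF idx(1)[OF ij(1)] idx(1)[OF ij(2)]]) (use 2 in auto)
      then show ?thesis using dga[OF bb(1) ij(1)] dga[OF bb(2) ij(2)] by auto
    qed
  qed
  have k0: "k \<noteq> 0"
  proof
    assume "k = 0"
    then have "?x = 0" using K[of ?x] g(2)[of p] by (simp add: V2_def V1_def m2)
    then show False using b by simp
  qed
  have count: "\<exists>J\<subseteq>{..<m}. inj_on (deg True m) J \<and> rk (mpow X k) V \<le> card J \<and>
      (\<forall>j\<in>J. \<exists>i<m. deg True m i + k = deg True m j \<and> B (f (m - 1 - i)) (mpow X k *v f j) \<noteq> 0)"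
  proof -
    \<comment> \<open>The position p + s + 1 is left out: the two middle vectors have the same
      degree and only one of them may be counted.\<close>
    define \<sigma> where "\<sigma> l = (if l \<le> s then p + l else p + l + 1)" for l
    have sg: "\<sigma> l < m" "a1 (\<sigma> l) = 1" "\<beta> (\<sigma> l) = l" if "l < c" for l
      using that by (auto simp: \<sigma>_def a1_def \<beta>_def m c)
    have dsg: "deg True m (\<sigma> l) = p + l" if "l < c" for l using dgb[of "\<sigma> l"] sg[OF that] by simp
    show ?thesis
    proof (intro exI[of _ "\<sigma> ` {k..<c}"] conjI ballI)
      show "\<sigma> ` {k..<c} \<subseteq> {..<m}" using sg(1) by auto
      show "inj_on (deg True m) (\<sigma> ` {k..<c})" by (auto simp: inj_on_def dsg)
      have cs: "card (\<sigma> ` {k..<c}) = c - k" by (subst card_image) (auto simp: inj_on_def \<sigma>_def split: if_splits)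
      have "(*v) (mpow X k) ` V2 \<subseteq> {0}" using K by (auto simp: V2_def V1_def)
      then have d0: "rk (mpow X k) V2 = 0" by (simp only: vec.dim_eq_0)
      have "rk (mpow X k) V \<le> rk (mpow X k) V1 + rk (mpow X k) V2"
        by (subst sp(2), subst image_sums) (intro dim_sums_le subspace_image nd_subspace V1(1) sp(1))
      then show "rk (mpow X k) V \<le> card (\<sigma> ` {k..<c})" unfolding d0 cs using V1(4)[of k] by simp
      fix j assume "j \<in> \<sigma> ` {k..<c}"
      then obtain l where l: "k \<le> l" "l < c" "j = \<sigma> l" by auto
      have lk: "l - k < c" using l by simp
      have "mpow X k *v f2 (\<alpha> j) = 0" using K g(2)[OF idx(1)[OF sg(1)[OF l(2)]]] l(3) by (simp add: V2_def V1_def)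
      then have "B (f (m - 1 - \<sigma> (l - k))) (mpow X k *v f j) = B (S (c - 1 - (l - k))) (S (l - k))"
        using Bf[OF du(5)[OF sg(1)[OF lk]] sg(1)[OF l(2)], of k] du(1,2)[OF sg(1)[OF lk]] sg[OF lk] sg[OF l(2)]
          S(3)[OF l(2), of k] l by simp
      also have "\<dots> \<noteq> 0" using S(2)[of "c - 1 - (l - k)" "l - k"] lk by auto
      finally show "\<exists>i<m. deg True m i + k = deg True m j \<and> B (f (m - 1 - i)) (mpow X k *v f j) \<noteq> 0"
        using sg(1)[OF lk] dsg[OF lk] dsg[OF l(2)] l by (intro exI[of _ "\<sigma> (l - k)"]) simp
    qed
  qed
  have "good_frame X {k} True V m f" unfolding good_frame_def
  proof (intro conjI allI impI ballI)
    show "vec.dim V = m" using sp(3) V1(3) g(1) by (simp add: m_def)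
    show "\<epsilon> = 1" "even m" "m \<ge> 2" using e by (auto simp: m)
    show "f i \<in> V" if "i < m" for i
      unfolding f_def using S(1)[of "\<beta> i"] g(2)[OF idx(1)[OF that]] V1V nd_subspace[OF V]
      by (auto simp: V2_def intro!: vec.subspace_add vec.subspace_scale)
  qed (use gram tri count in auto)
  then show ?thesis by (auto simp: m_def)
qed

section \<open>Existence of good frames\<close>

lemma good_frame_0: "V \<subseteq> {0} \<Longrightarrow> good_frame X K False V 0 f"
proof -
  assume V: "V \<subseteq> {0}"
  have "(*v) (mpow X k) ` V \<subseteq> {0}" for k using V by auto
  then show ?thesis using V by (auto simp: good_frame_def intro!: exI[of _ "{}"])
qed

lemma complement_smaller:
  assumes X: "X \<in> so M" and V: "nd V" "stable X V" and V1: "nd V1" "stable X V1" "V1 \<subseteq> V" "vec.dim V1 > 0"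
  shows "nd (V \<inter> perp V1)" "stable X (V \<inter> perp V1)" "vec.dim (V \<inter> perp V1) < vec.dim V"
    "vec.dim V = vec.dim (V \<inter> perp V1) + vec.dim V1"
  using nd_split(1,3)[OF V(1) V1(1,3)] stable_complement[OF X V(2) V1(2)] V1(4) by auto

lemma peel_cases:
  assumes X: "X \<in> so M" "mpow X n0 = 0" and V: "nd V" "stable X V" "\<not> V \<subseteq> {0}"
  obtains (siegel) c u V1 where "siegel X V1 u c" "V1 \<subseteq> V" "\<And>k. rk (mpow X k) V1 \<le> 2 * (c - k)"
  | (single) c v where "v \<in> V" "single_block X v c" "\<And>x. x \<in> V \<Longrightarrow> mpow X c *v x = 0" "\<exists>y\<in>V. mpow X (c - 1) *v y \<noteq> 0"
proof -
  have "mpow X n0 *v w = 0" for w using X(2) by simp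
  then obtain c where c: "c > 0" "\<And>w. w \<in> V \<Longrightarrow> mpow X c *v w = 0" "\<exists>v\<in>V. mpow X (c - 1) *v v \<noteq> 0"
    using nilpotent_order[of V X n0] V(3) by metis
  then obtain y where "y \<in> V" "mpow X (c - 1) *v y \<noteq> 0" by blast
  from peel_form[OF X(1) V(1,2) c(1,2) this] c show thesis using siegel single by blast
qed

text \<open>Without a condition on ranks, any two single blocks may be merged into a summand with a
  cyclic Lagrangian. At most one single block is left over; it is then the whole remaining space and
  is inserted into the empty frame.\<close>

lemma ex_good_frame_empty:
  assumes X: "X \<in> so M" "mpow X n0 = 0"
  shows "nd V \<Longrightarrow> stable X V \<Longrightarrow> \<exists>f. good_frame X {} False V (vec.dim V) f"
proof (induction "vec.dim V" arbitrary: V rule: less_induct)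
  case less
  note V = less.prems
  have sieg: ?case if s: "siegel X V1 u a" "V1 \<subseteq> V" for V1 u a
  proof -
    have V1: "nd V1" "stable X V1" "vec.dim V1 = 2 * a" "vec.dim V1 > 0" using s(1) by (auto simp: siegel_def)
    note cs = complement_smaller[OF X(1) V V1(1,2) s(2) V1(4)]
    obtain f2 where "good_frame X {} False (V \<inter> perp V1) (vec.dim (V \<inter> perp V1)) f2"
      using less.hyps[OF cs(3,1,2)] by blast
    from good_frame_siegel[OF X(1) V s _ this] show ?thesis using cs(4) V1(3) by simp
  qed
  show ?case
  proof (cases "V \<subseteq> {0}")
    case True
    then have d0: "vec.dim V = 0" by (simp only: vec.dim_eq_0)
    show ?thesis unfolding d0 by (intro exI good_frame_0[OF True])
  next
    case False
    show ?thesis using X V False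
    proof (cases rule: peel_cases)
      case (siegel c u V1)
      then show ?thesis using sieg by blast
    next
      case (single c v)
      note V1 = single_block_nd[OF X(1) single(2)]
      have c0: "c > 0" using single(2) by (simp add: single_block_def)
      have V1V: "cyc X v c \<subseteq> V" by (rule cyc_subset[OF nd_subspace[OF V(1)] V(2) single(1)])
      have d1: "vec.dim (cyc X v c) > 0" using V1(3) c0 by simp
      note cs = complement_smaller[OF X(1) V V1(1,2) V1V d1]
      let ?V2 = "V \<inter> perp (cyc X v c)"
      show ?thesis
      proof (cases "?V2 \<subseteq> {0}")
        case True
        then have "vec.dim ?V2 = 0" by (simp only: vec.dim_eq_0)
        then have "vec.dim V = 0 + c" using cs(4) V1(3) by simp
        then show ?thesis using good_frame_insert_even[OF X(1) V single(2,1) good_frame_0[OF True], of "{}"] by auto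
      next
        case F: False
        show ?thesis using X cs(1,2) F
        proof (cases rule: peel_cases)
          case (siegel c2 u V1)
          then show ?thesis using sieg by blast
        next
          case (single c2 w)
          have "c2 \<le> c"
          proof (rule ccontr)
            assume "\<not> c2 \<le> c"
            moreover obtain y where "y \<in> ?V2" "mpow X (c2 - 1) *v y \<noteq> 0" using single(4) by blast
            moreover have "mpow X c *v y = 0" using \<open>y \<in> ?V2\<close> \<open>\<And>x. x \<in> V \<Longrightarrow> mpow X c *v x = 0\<close> by blast
            moreover have "c \<le> c2 - 1" using \<open>\<not> c2 \<le> c\<close> by simp
            ultimately show False using mpow_eq_0_mono[of X c y "c2 - 1"] by blast
          qed
          moreover have "cyc X w c2 \<subseteq> ?V2" by (rule cyc_subset[OF nd_subspace[OF cs(1)] cs(2) single(1)])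
          moreover have "B x y = 0" if "x \<in> cyc X v c" "y \<in> cyc X w c2" for x y
            using that \<open>cyc X w c2 \<subseteq> ?V2\<close> by (auto simp: perp_def)
          ultimately obtain u a where "siegel X {x + y | x y. x \<in> cyc X v c \<and> y \<in> cyc X w c2} u a"
            using siegel_of_singles[OF X(1) \<open>single_block X v c\<close> single(2)] by blast
          moreover have "{x + y | x y. x \<in> cyc X v c \<and> y \<in> cyc X w c2} \<subseteq> V"
            using V1V \<open>cyc X w c2 \<subseteq> ?V2\<close> nd_subspace[OF V(1)] by (auto intro!: vec.subspace_add)
          ultimately show ?thesis using sieg by blast
        qed
      qed
    qed
  qed
qed

text \<open>In odd dimension the middle vector of a good frame for the zero element is not
  orthogonal to itself, which an alternating form excludes.\<close>

lemma odd_dim_orthogonal: "nd V \<Longrightarrow> odd (vec.dim V) \<Longrightarrow> \<epsilon> = 1"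
proof (rule ccontr)
  assume V: "nd V" "odd (vec.dim V)" and "\<epsilon> \<noteq> 1"
  then have e: "\<epsilon> = - 1" using eps by simp
  have "0 \<in> so M" "mpow (0 :: complex^'n^'n) 1 = 0" "stable 0 V"
    using vec.subspace_0[OF nd_subspace[OF V(1)]] by (auto simp: so_def stable_def)
  then obtain f where f: "good_frame 0 {} False V (vec.dim V) f" using ex_good_frame_empty[of 0 1 V] V(1) by blast
  define l where "l = (vec.dim V - 1) div 2"
  have "l < vec.dim V" "l + l = vec.dim V - 1" using V(2) by (auto simp: l_def elim!: oddE)
  then have "B (f l) (f l) \<noteq> 0" using f by (simp add: good_frame_def)
  then show False using B_sym[of "f l" "f l"] e by simp
qed

text \<open>If X^k kills the complement of the largest single block, that block carries the whole
  rank and is inserted into an arbitrary good frame of the complement. Otherwise the next single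
  block has size at least \<open>k\<close>, and merging the two costs no rank of X^k.\<close>

lemma ex_good_frame:
  assumes X: "X \<in> so M" "mpow X n0 = 0"
  shows "nd V \<Longrightarrow> stable X V \<Longrightarrow> \<exists>t f. good_frame X {k} t V (vec.dim V) f"
proof (induction "vec.dim V" arbitrary: V rule: less_induct)
  case less
  note V = less.prems
  have sieg: ?case if s: "siegel X V1 u a" "V1 \<subseteq> V" and r: "rk (mpow X k) V1 \<le> 2 * (a - k)" for V1 u a
  proof -
    have V1: "nd V1" "stable X V1" "vec.dim V1 = 2 * a" "vec.dim V1 > 0" using s(1) by (auto simp: siegel_def)
    note cs = complement_smaller[OF X(1) V V1(1,2) s(2) V1(4)]
    obtain t f2 where "good_frame X {k} t (V \<inter> perp V1) (vec.dim (V \<inter> perp V1)) f2"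
      using less.hyps[OF cs(3,1,2)] by blast
    from good_frame_siegel[OF X(1) V s _ this] r show ?thesis using cs(4) V1(3) by auto
  qed
  show ?case
  proof (cases "\<forall>x\<in>V. mpow X k *v x = 0")
    case True
    obtain f where f: "good_frame X {} False V (vec.dim V) f" using ex_good_frame_empty[OF X V] by blast
    have "(*v) (mpow X k) ` V \<subseteq> {0}" using True by auto
    then have "good_frame X {k} False V (vec.dim V) f" using f unfolding good_frame_def
      by (auto intro!: exI[of _ "{}"])
    then show ?thesis by blast
  next
    case nz: False
    have "\<not> V \<subseteq> {0}" using nz by auto
    show ?thesis using X V \<open>\<not> V \<subseteq> {0}\<close>
    proof (cases rule: peel_cases)
      case (siegel c u V1)
      then show ?thesis using sieg by blast
    next
      case (single c v)
      note V1 = single_block_nd[OF X(1) single(2)]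
      have c0: "c > 0" using single(2) by (simp add: single_block_def)
      have V1V: "cyc X v c \<subseteq> V" by (rule cyc_subset[OF nd_subspace[OF V(1)] V(2) single(1)])
      have d1: "vec.dim (cyc X v c) > 0" using V1(3) c0 by simp
      note cs = complement_smaller[OF X(1) V V1(1,2) V1V d1]
      let ?V2 = "V \<inter> perp (cyc X v c)"
      show ?thesis
      proof (cases "\<forall>x\<in>?V2. mpow X k *v x = 0")
        case True
        obtain f2 where f2: "good_frame X {} False ?V2 (vec.dim ?V2) f2" using ex_good_frame_empty[OF X cs(1,2)] by blast
        have d: "vec.dim V = vec.dim ?V2 + c" using cs(4) V1(3) by simp
        show ?thesis
        proof (cases "even (vec.dim ?V2)")
          case ev: True
          have "\<exists>f. good_frame X {k} False V (vec.dim ?V2 + c) f"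
            by (rule good_frame_insert_even[OF X(1) V single(2,1) f2 ev]) (use True in auto)
          then show ?thesis using d by auto
        next
          case od: False
          have e: "\<epsilon> = 1" by (rule odd_dim_orthogonal[OF cs(1) od])
          have "\<epsilon> * (- 1 :: complex) ^ (c - 1) = 1" using single(2) unfolding single_block_def by blast
          then have "(- 1 :: complex) ^ (c - 1) = 1" unfolding e by simp
          then have "even (c - 1)" by (auto simp: minus_one_power_iff split: if_splits)
          then obtain s where s: "c = 2 * s + 1" using c0 by (metis Suc_diff_1 Suc_eq_plus1 evenE)
          obtain p where p: "vec.dim ?V2 = 2 * p + 1" using od by (elim oddE)
          have "\<exists>f. good_frame X {k} True V (vec.dim ?V2 + c) f"
            by (rule good_frame_insert_odd[OF X(1) V single(2,1) f2 p s e]) (use True in auto)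
          then show ?thesis using d by auto
        qed
      next
        case F: False
        then have "\<not> ?V2 \<subseteq> {0}" by auto
        show ?thesis using X cs(1,2) \<open>\<not> ?V2 \<subseteq> {0}\<close>
        proof (cases rule: peel_cases)
          case (siegel c2 u V1)
          then show ?thesis using sieg[of V1 u c2] by blast
        next
          case (single c2 w)
          have "c2 \<le> c"
          proof (rule ccontr)
            assume "\<not> c2 \<le> c"
            moreover obtain y where "y \<in> ?V2" "mpow X (c2 - 1) *v y \<noteq> 0" using single(4) by blast
            moreover have "mpow X c *v y = 0" using \<open>y \<in> ?V2\<close> \<open>\<And>x. x \<in> V \<Longrightarrow> mpow X c *v x = 0\<close> by blast
            moreover have "c \<le> c2 - 1" using \<open>\<not> c2 \<le> c\<close> by simp
            ultimately show False using mpow_eq_0_mono[of X c y "c2 - 1"] by blast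
          qed
          moreover have "k \<le> c2"
          proof (rule ccontr)
            assume "\<not> k \<le> c2"
            then have "mpow X k *v x = 0" if "x \<in> ?V2" for x using mpow_eq_0_mono[OF single(3)[OF that], of k] by simp
            then show False using F by blast
          qed
          moreover have "cyc X w c2 \<subseteq> ?V2" by (rule cyc_subset[OF nd_subspace[OF cs(1)] cs(2) single(1)])
          moreover have "B x y = 0" if "x \<in> cyc X v c" "y \<in> cyc X w c2" for x y
            using that \<open>cyc X w c2 \<subseteq> ?V2\<close> by (auto simp: perp_def)
          ultimately obtain u a where "siegel X {x + y | x y. x \<in> cyc X v c \<and> y \<in> cyc X w c2} u a"
            "rk (mpow X k) {x + y | x y. x \<in> cyc X v c \<and> y \<in> cyc X w c2} \<le> 2 * (a - k)"
            using siegel_of_singles[OF X(1) \<open>single_block X v c\<close> single(2)] by blast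
          moreover have "{x + y | x y. x \<in> cyc X v c \<and> y \<in> cyc X w c2} \<subseteq> V"
            using V1V \<open>cyc X w c2 \<subseteq> ?V2\<close> nd_subspace[OF V(1)] by (auto intro!: vec.subspace_add)
          ultimately show ?thesis using sieg by blast
        qed
      qed
    qed
  qed
qed

text \<open>Every summand that is peeled off has a cyclic Lagrangian, and
  \<open>good_frame_siegel\<close> keeps the ranks of all powers for such summands.\<close>

lemma ex_good_frame_all:
  assumes X: "X \<in> so M" "mpow X n0 = 0" and ns: "\<And>v c. \<not> single_block X v c"
  shows "nd V \<Longrightarrow> stable X V \<Longrightarrow> \<exists>f. good_frame X UNIV False V (vec.dim V) f"
proof (induction "vec.dim V" arbitrary: V rule: less_induct)
  case less
  note V = less.prems
  show ?case
  proof (cases "V \<subseteq> {0}")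
    case True
    then have d0: "vec.dim V = 0" by (simp only: vec.dim_eq_0)
    show ?thesis unfolding d0 by (intro exI good_frame_0[OF True])
  next
    case False
    show ?thesis using X V False
    proof (cases rule: peel_cases)
      case (siegel c u V1)
      have V1: "nd V1" "stable X V1" "vec.dim V1 = 2 * c" "vec.dim V1 > 0" using siegel(1) by (auto simp: siegel_def)
      note cs = complement_smaller[OF X(1) V V1(1,2) siegel(2) V1(4)]
      obtain f2 where "good_frame X UNIV False (V \<inter> perp V1) (vec.dim (V \<inter> perp V1)) f2"
        using less.hyps[OF cs(3,1,2)] by blast
      from good_frame_siegel[OF X(1) V siegel(1,2,3) this] show ?thesis using cs(4) V1(3) by simp
    next
      case (single c v)
      then show ?thesis using ns by blast
    qed
  qed
qed

end

section \<open>Contraction to the principal grading\<close>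

lemma fmat_mult: "fmat (\<lambda>j. A *v f j) = A ** fmat f" for A :: "complex^'n^'n"
  by (simp add: fmat_def matrix_matrix_mult_def matrix_vector_mult_def vec_eq_iff)

lemma ex_matrix_on_basis:
  fixes f g :: "nat \<Rightarrow> complex^'n"
  assumes "fspan f CARD('n) = UNIV" shows "\<exists>T :: complex^'n^'n. \<forall>j<CARD('n). T *v f j = g j"
proof (intro exI allI impI)
  fix j assume "j < CARD('n)"
  then obtain i :: 'n where i: "idx i = j" using ex_idx by blast
  have "(fmat g ** matrix_inv (fmat f)) *v f (idx i) = g (idx i)"
    using matrix_inv_mult(4)[OF invertible_fmat[OF assms], of "axis i 1"]
    by (simp add: fmat_axis matrix_vector_mul_assoc[symmetric])
  then show "(fmat g ** matrix_inv (fmat f)) *v f j = g j" by (simp add: i)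
qed

lemma tendsto_matrix_on_basis:
  fixes Zm :: "nat \<Rightarrow> complex^'n^'n"
  assumes f: "fspan f CARD('n) = UNIV"
    and lim: "\<And>j. j < CARD('n) \<Longrightarrow> (\<lambda>m. Zm m *v f j) \<longlonglongrightarrow> Z *v f j"
  shows "Zm \<longlonglongrightarrow> Z"
proof -
  have "(\<lambda>m. fmat (\<lambda>j. Zm m *v f j)) \<longlonglongrightarrow> fmat (\<lambda>j. Z *v f j)"
  proof (intro vec_tendstoI)
    fix r i :: 'n
    show "(\<lambda>m. fmat (\<lambda>j. Zm m *v f j) $ r $ i) \<longlonglongrightarrow> fmat (\<lambda>j. Z *v f j) $ r $ i"
      unfolding fmat_def vec_lambda_beta by (intro tendsto_vec_nth lim) simp
  qed
  then have "(\<lambda>m. fmat (\<lambda>j. Zm m *v f j) ** matrix_inv (fmat f)) \<longlonglongrightarrow> fmat (\<lambda>j. Z *v f j) ** matrix_inv (fmat f)"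
    by (intro tendsto_matrix_mult tendsto_const)
  then show ?thesis
    unfolding fmat_mult by (simp add: matrix_inv_conj(3)[OF invertible_fmat[OF f]])
qed

lemma range_mult_invertible:
  fixes T :: "complex^'n^'n"
  assumes "invertible T" shows "range ((*v) (A ** T)) = range ((*v) A)"
proof -
  have "A *v x = (A ** T) *v (matrix_inv T *v x)" for x
    using matrix_inv_mult(3)[OF assms, of x] by (simp add: matrix_vector_mul_assoc[symmetric])
  then show ?thesis by (auto simp: matrix_vector_mul_assoc[symmetric])
qed

lemma dim_range_mult_left:
  fixes T :: "complex^'n^'n"
  assumes "invertible T" shows "rk (T ** A) UNIV = rk A UNIV"
proof (rule antisym)
  have "range ((*v) (T ** A)) = (*v) T ` range ((*v) A)" by (auto simp: matrix_vector_mul_assoc[symmetric])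
  then show "rk (T ** A) UNIV \<le> rk A UNIV" by (simp only: dim_image_matrix_le)
  have "range ((*v) A) = (*v) (matrix_inv T) ` range ((*v) (T ** A))"
  proof -
    have "A *v x = matrix_inv T *v ((T ** A) *v x)" for x
      using matrix_inv_mult(4)[OF assms, of "A *v x"] by (simp add: matrix_vector_mul_assoc[symmetric])
    then show ?thesis by (auto simp: image_iff)
  qed
  then show "rk A UNIV \<le> rk (T ** A) UNIV" by (simp only: dim_image_matrix_le)
qed

lemma rank_conj:
  fixes T :: "complex^'n^'n"
  assumes "invertible T" "T ** X = Y ** T"
  shows "rk (mpow X k) UNIV = rk (mpow Y k) UNIV"
  using dim_range_mult_left[OF assms(1), of "mpow X k"] range_mult_invertible[OF assms(1), of "mpow Y k"]
    mpow_conj[OF assms(2), of k] by simp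

lemma rank_cscale:
  fixes A :: "complex^'n^'n"
  assumes "c \<noteq> 0" shows "range ((*v) (cscale c A)) = range ((*v) A)"
proof -
  have 1: "A *v x = cscale c A *v (inverse c *s x)" for x using assms by simp
  have 2: "cscale c A *v x = A *v (c *s x)" for x by simp
  show ?thesis
  proof (intro equalityI subsetI; elim rangeE)
    show "y \<in> range ((*v) A)" if "y = cscale c A *v x" for x y unfolding that 2 by (rule rangeI)
    show "y \<in> range ((*v) (cscale c A))" if "y = A *v x" for x y unfolding that by (subst 1) (rule rangeI)
  qed
qed

text \<open>Degrees of paired vectors have a constant sum. This symmetry is what makes the
  one-parameter group of the grading preserve the form.\<close>

lemma deg_dual:
  assumes "t \<longrightarrow> even m \<and> m \<ge> 2" "i < m"
  shows "deg t m i + deg t m (m - 1 - i) = (if t then m - 2 else m - 1)"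
proof (cases t)
  case True
  then obtain l where "m = 2 * l" "l > 0" using assms by (auto elim!: evenE)
  then show ?thesis using assms(2) True by (auto simp: deg_def)
qed (use assms in auto)

lemma deg_mono: "i \<le> j \<Longrightarrow> deg t m i \<le> deg t m j"
  by (auto simp: deg_def)

lemma deg_strict:
  assumes "t \<longrightarrow> even m \<and> m \<ge> 2" "i < j" "j < m"
  shows "deg t m i < deg t m j \<or> t \<and> m - 1 - i = j"
proof (cases t)
  case True
  then obtain l where "m = 2 * l" "l > 0" using assms by (auto elim!: evenE)
  then show ?thesis using assms(2,3) True by (auto simp: deg_def)
qed (use assms in auto)

section \<open>Transport of frames and the contraction\<close>

context form
begin

lemma good_frame_twist: "good_frame X K t V m f \<Longrightarrow> t \<longrightarrow> \<epsilon> = 1 \<and> even m \<and> m \<ge> 2"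
  unfolding good_frame_def by (elim conjE)

lemma good_frame_count:
  "good_frame X K t V m f \<Longrightarrow> k \<in> K \<Longrightarrow> \<exists>J\<subseteq>{..<m}. inj_on (deg t m) J \<and> rk (mpow X k) V \<le> card J \<and>
      (\<forall>j\<in>J. \<exists>i<m. deg t m i + k = deg t m j \<and> B (f (m - 1 - i)) (mpow X k *v f j) \<noteq> 0)"
  unfolding good_frame_def by (elim conjE) blast

lemma good_frame_cong:
  assumes gf: "good_frame X K t UNIV m f"
    and e: "\<And>i j. i < m \<Longrightarrow> j < m \<Longrightarrow> B (e i) (e j) = 0 \<longleftrightarrow> B (f i) (f j) = 0"
      "\<And>i j k. i < m \<Longrightarrow> j < m \<Longrightarrow> B (e i) (mpow A k *v e j) = 0 \<longleftrightarrow> B (f i) (mpow X k *v f j) = 0"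
    and r: "\<And>k. rk (mpow A k) UNIV = rk (mpow X k) UNIV"
  shows "good_frame A K t UNIV m e"
proof -
  have e': "B (e (m - 1 - i)) (mpow A k *v e j) = 0 \<longleftrightarrow> B (f (m - 1 - i)) (mpow X k *v f j) = 0" if "i < m" "j < m" for i j k
    using e(2)[of "m - 1 - i" j k] that by simp
  show ?thesis unfolding good_frame_def
  proof (intro conjI allI impI ballI)
    show "vec.dim (UNIV :: (complex^'n) set) = m" using good_frameD(1)[OF gf] .
    show "\<epsilon> = 1" "even m" "2 \<le> m" if t using good_frame_twist[OF gf] that by auto
    show "B (e i) (e j) = 0 \<longleftrightarrow> i + j \<noteq> m - 1" if "i < m" "j < m" for i j
      using e(1)[OF that] good_frameD(3)[OF gf that] by simp
    show "deg t m i < deg t m j" if "i < m" "j < m" "B (e (m - 1 - i)) (A *v e j) \<noteq> 0" for i j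
      using e'[OF that(1,2), of 1] good_frameD(4)[OF gf that(1,2)] that(3) by simp
    fix k assume "k \<in> K"
    then obtain J where J: "J \<subseteq> {..<m}" "inj_on (deg t m) J" "rk (mpow X k) UNIV \<le> card J"
      "\<And>j. j \<in> J \<Longrightarrow> \<exists>i<m. deg t m i + k = deg t m j \<and> B (f (m - 1 - i)) (mpow X k *v f j) \<noteq> 0"
      using good_frame_count[OF gf, of k] by blast
    show "\<exists>J\<subseteq>{..<m}. inj_on (deg t m) J \<and> rk (mpow A k) UNIV \<le> card J \<and>
      (\<forall>j\<in>J. \<exists>i<m. deg t m i + k = deg t m j \<and> B (e (m - 1 - i)) (mpow A k *v e j) \<noteq> 0)"
    proof (intro exI[of _ J] conjI ballI)
      fix j assume j: "j \<in> J"
      then obtain i where i: "i < m" "deg t m i + k = deg t m j" "B (f (m - 1 - i)) (mpow X k *v f j) \<noteq> 0" using J(4) by blast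
      moreover have "j < m" using j J(1) by auto
      ultimately show "\<exists>i<m. deg t m i + k = deg t m j \<and> B (e (m - 1 - i)) (mpow A k *v e j) \<noteq> 0" using e' by blast
    qed (use J r in auto)
  qed auto
qed

lemma good_frame_to_frame:
  assumes gf: "good_frame X K t UNIV CARD('n) f" and X: "X \<in> so M" and e: "frame e"
  shows "\<exists>g\<in>Iso M. good_frame (Ad g X) K t UNIV CARD('n) e"
proof -
  let ?N = "CARD('n)"
  have nz: "B (f i) (f j) = 0 \<longleftrightarrow> i + j \<noteq> ?N - 1" if "i < ?N" "j < ?N" for i j using good_frameD(3)[OF gf that] .
  \<comment> \<open>Of each pair only one vector is scaled, to make the pairing 1; a vector paired
    with itself needs a square root.\<close>
  define c where "c i = (if i < dl i then inverse (B (f i) (f (dl i))) else if i = dl i then inverse (csqrt (B (f i) (f i))) else 1)" for i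
  define f' where "f' i = c i *s f i" for i
  have c: "c i \<noteq> 0" if "i < ?N" for i using nz[of i "dl i"] dl_simps(1)[OF that] that by (auto simp: c_def dl_def)
  have fr: "frame f'" unfolding frame_def
  proof (intro allI impI)
    fix i j assume ij: "i < ?N" "j < ?N"
    have p: "B (f' i) (f' j) = 1" if s: "i + j = ?N - 1" and l: "i \<le> j" and ij: "i < ?N" "j < ?N" for i j
    proof (cases "i = j")
      case True
      then have d: "dl i = i" "dl j = j" "B (f i) (f i) \<noteq> 0" using s nz[OF ij] by (auto simp: dl_def)
      have "inverse (csqrt (B (f i) (f i))) * inverse (csqrt (B (f i) (f i))) = inverse (B (f i) (f i))"
        by (metis inverse_mult_distrib power2_csqrt power2_eq_square)
      then show ?thesis using d True by (simp add: f'_def c_def bil_simps mult.assoc[symmetric])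
    next
      case False
      then have d: "dl i = j" "dl j = i" "B (f i) (f j) \<noteq> 0" using s nz[OF ij] by (auto simp: dl_def)
      then show ?thesis using False l by (simp add: f'_def c_def bil_simps)
    qed
    show "B (f' i) (f' j) = (if i + j = ?N - 1 then if i \<le> j then 1 else \<epsilon> else 0)"
    proof (cases "i + j = ?N - 1")
      case True
      show ?thesis using p[OF True _ ij] p[of j i] True ij B_sym[of "f' i" "f' j"] by (auto simp: add.commute)
    next
      case False
      then show ?thesis using nz[OF ij] by (simp add: f'_def bil_simps)
    qed
  qed
  obtain g where g: "g \<in> Iso M" "\<And>j. j < ?N \<Longrightarrow> g *v f' j = e j" using frame_iso[OF fr e] by blast
  have inv: "invertible g" by (rule invertible_Iso[OF g(1)])
  let ?A = "Ad g X"
  have gX: "g ** X = ?A ** g" by (simp add: matrix_inv_conj(4)[OF inv])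
  have Ae: "B (e i) (mpow ?A k *v e j) = c i * c j * B (f i) (mpow X k *v f j)" if "i < ?N" "j < ?N" for i j k
  proof -
    have "mpow ?A k *v (g *v f' j) = g *v (mpow X k *v f' j)"
      using mpow_conj[OF gX, of k] by (simp add: matrix_vector_mul_assoc)
    then have "B (e i) (mpow ?A k *v e j) = B (g *v f' i) (g *v (mpow X k *v f' j))" using g(2) that by simp
    also have "\<dots> = B (f' i) (mpow X k *v f' j)" by (rule IsoD[OF g(1)])
    finally show ?thesis by (simp add: f'_def bil_simps)
  qed
  have "good_frame ?A K t UNIV ?N e"
    by (rule good_frame_cong[OF gf])
      (use Ae Ae[where k=0] c rank_conj[OF inv gX] in auto)
  then show ?thesis using g(1) by blast
qed

lemma so_conj:
  assumes "X \<in> so M" "g \<in> Iso M" shows "Ad g X \<in> so M"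
  unfolding so_def
proof (intro CollectI allI)
  fix x y
  have gi: "g *v (matrix_inv g *v z) = z" for z by (rule matrix_inv_mult(3)[OF invertible_Iso[OF assms(2)]])
  have "B ((Ad g X) *v x) y = B (g *v (X *v (matrix_inv g *v x))) (g *v (matrix_inv g *v y))"
    by (simp add: gi matrix_vector_mul_assoc[symmetric])
  also have "\<dots> = - B (matrix_inv g *v x) (X *v (matrix_inv g *v y))" by (simp add: IsoD[OF assms(2)] soD[OF assms(1)])
  also have "\<dots> = - B (g *v (matrix_inv g *v x)) (g *v (X *v (matrix_inv g *v y)))" by (simp add: IsoD[OF assms(2)])
  finally show "B ((Ad g X) *v x) y = - B x ((Ad g X) *v y)"
    by (simp add: gi matrix_vector_mul_assoc[symmetric])
qed

lemma so_cscale: "X \<in> so M \<Longrightarrow> cscale c X \<in> so M"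
  by (simp add: so_def bil_simps)

lemma so_limit:
  assumes "Zm \<longlonglongrightarrow> Z" "\<And>m. Zm m \<in> so M" shows "Z \<in> so M"
  unfolding so_def
proof (intro CollectI allI)
  fix x y
  have "(\<lambda>m. B (Zm m *v x) y) \<longlonglongrightarrow> B (Z *v x) y" by (intro tendsto_intros assms(1))
  moreover have "(\<lambda>m. - B x (Zm m *v y)) \<longlonglongrightarrow> - B x (Z *v y)" by (intro tendsto_intros assms(1))
  moreover have "(\<lambda>m. B (Zm m *v x) y) = (\<lambda>m. - B x (Zm m *v y))" using assms(2) by (auto simp: so_def)
  ultimately show "B (Z *v x) y = - B x (Z *v y)" using LIMSEQ_unique by metis
qed

text \<open>The elements X and u X have powers of equal rank, so an isometry intertwines them. Its
  square scales by u^2 and has determinant 1.\<close>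

lemma ex_square_scaling:
  assumes X: "X \<in> so M" "nilpotent_matrix X" and u: "u \<noteq> 0"
  shows "\<exists>g\<in>Iso M. det g = 1 \<and> g ** X = cscale (u ^ 2) X ** g"
proof -
  have m: "mpow (cscale u X) k = cscale (u ^ k) (mpow X k)" for k by (rule mpow_cscale)
  have "nilpotent_matrix (cscale u X)" using X(2) by (auto simp: nilpotent_matrix_iff m)
  then obtain T where "invertible T" "T ** X = cscale u X ** T"
    using conj_of_same_ranks[OF X(2)] rank_cscale[of "u ^ _"] u m by (metis power_not_zero)
  then obtain g where g: "g \<in> Iso M" "g ** X = cscale u X ** g" using iso_conj[OF X(1) so_cscale[OF X(1)]] by blast
  have "(g ** g) ** X = g ** (cscale u X ** g)" by (simp add: g(2) matrix_mul_assoc[symmetric])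
  also have "\<dots> = cscale u (g ** X ** g)" by (simp add: matrix_mul_assoc)
  also have "\<dots> = cscale (u ^ 2) X ** (g ** g)" by (simp add: g(2) power2_eq_square matrix_mul_assoc)
  finally have "(g ** g) ** X = cscale (u ^ 2) X ** (g ** g)" .
  moreover have "det (g ** g) = 1" using det_Iso[OF g(1)] by (auto simp: det_mul)
  ultimately show ?thesis using Iso_mult[OF g(1,1)] by blast
qed

lemma iso_of_frame_images:
  assumes e: "frame e" and T: "\<And>i j. i < CARD('n) \<Longrightarrow> j < CARD('n) \<Longrightarrow> B (T *v e i) (T *v e j) = B (e i) (e j)"
  shows "T \<in> Iso M"
  unfolding Iso_def
proof (intro CollectI allI)
  fix x y
  have "x \<in> fspan e CARD('n)" "y \<in> fspan e CARD('n)" using frame_span[OF e] by auto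
  then obtain c d where x: "x = (\<Sum>j<CARD('n). c j *s e j)" and y: "y = (\<Sum>j<CARD('n). d j *s e j)"
    by (auto simp: in_span_image_iff)
  have s: "T *v (\<Sum>j<CARD('n). a j *s e j) = (\<Sum>j<CARD('n). a j *s (T *v e j))" for a
    by (simp add: vec.linear_sum[OF matrix_vector_mul_linear_gen])
  show "B (T *v x) (T *v y) = B x y" unfolding x y s
    by (simp add: bil_sum_left bil_sum_right bil_simps T)
qed

lemma frame_expand:
  assumes e: "frame e"
  shows "x = (\<Sum>i<CARD('n). (B (e (dl i)) x / B (e (dl i)) (e i)) *s e i)"
proof -
  have "x \<in> fspan e CARD('n)" using frame_span[OF e] by auto
  then obtain c where x: "x = (\<Sum>i<CARD('n). c i *s e i)" by (auto simp: in_span_image_iff)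
  have "B (e (dl i)) x = c i * B (e (dl i)) (e i)" if i: "i < CARD('n)" for i
  proof -
    have "B (e (dl i)) x = (\<Sum>j<CARD('n). c j * B (e (dl i)) (e j))" by (simp add: x bil_sum_right bil_simps)
    also have "\<dots> = (\<Sum>j<CARD('n). if j = i then c i * B (e (dl i)) (e i) else 0)"
      by (intro sum.cong refl) (use frame_dual_0[OF e i] in auto)
    finally show ?thesis using i by simp
  qed
  then have "(\<Sum>i<CARD('n). (B (e (dl i)) x / B (e (dl i)) (e i)) *s e i) = (\<Sum>i<CARD('n). c i *s e i)"
    using frame_dual_nz[OF e] by (intro sum.cong refl) simp
  then show ?thesis using x by simp
qed

text \<open>Vectors with a dual system of functionals are independent.\<close>

lemma dual_system_card_le:
  assumes J: "finite J" and y: "\<And>j l. j \<in> J \<Longrightarrow> l \<in> J \<Longrightarrow> B (w j) (y l) = 0 \<longleftrightarrow> j \<noteq> l" and S: "y ` J \<subseteq> S"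
  shows "card J \<le> vec.dim S"
proof -
  have "inj_on y J" using y by (metis inj_onI)
  then have "card J = card (y ` J)" by (simp add: card_image)
  moreover have "vec.independent (y ` J)" unfolding vec.dependent_def
  proof
    assume "\<exists>a\<in>y ` J. a \<in> vec.span (y ` J - {a})"
    then obtain j where j: "j \<in> J" "y j \<in> vec.span (y ` J - {y j})" by auto
    have "y ` J - {y j} \<subseteq> perp {w j}" using y[OF j(1)] by (auto simp: perp_def)
    then have "vec.span (y ` J - {y j}) \<subseteq> perp {w j}" by (intro vec.span_minimal subspace_perp)
    then have "B (w j) (y j) = 0" using j(2) by (auto simp: perp_def)
    then show False using y[OF j(1,1)] by simp
  qed
  ultimately show ?thesis using vec.independent_card_le_dim[OF S] by simp
qed

text \<open>A diagonal isometry combined with a scaling multiplies the entry at (i, j) of the k-th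
  power by u^(2 (\<delta> i + k - \<delta> j)). For k = 1 the entries of degree -1 stay fixed and
  those of lower degree tend to 0. The limit is the part of degree -1, and its k-th power has the
  same entries of degree -k as A^k, which is what the counting condition of
  \<open>good_frame\<close> refers to.\<close>

lemma degeneration:
  assumes A: "A \<in> so M" "nilpotent_matrix A" and e: "frame e" and gf: "good_frame A K t UNIV CARD('n) e"
  defines "\<delta> \<equiv> deg t CARD('n)"
  shows "\<exists>Z h. Z \<in> so M \<and> Z \<in> tri e (\<lambda>i j. Suc (\<delta> i) = \<delta> j) \<and>
    (\<forall>m. h m \<in> Iso M \<and> det (h m) = 1) \<and> (\<lambda>m. Ad (h m) A) \<longlonglongrightarrow> Z \<and>
    (\<forall>k\<in>K. rk (mpow A k) UNIV \<le> rk (mpow Z k) UNIV)"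
proof -
  let ?N = "CARD('n)"
  note sp = frame_span[OF e]
  define D where "D = (if t then ?N - 2 else ?N - 1)"
  have \<delta>D: "\<delta> i + \<delta> (dl i) = D" if "i < ?N" for i
    using deg_dual[of t ?N i] good_frame_twist[OF gf] that by (simp add: \<delta>_def D_def dl_def)
  define r where "r m = complex_of_real (of_nat (Suc m))" for m
  have r0: "r m \<noteq> 0" for m unfolding r_def of_real_eq_0_iff by simp
  \<comment> \<open>The exponent 2 \<delta> j - D changes sign under \<open>dl\<close>, so the
    factors of paired vectors are inverse to each other and the diagonal map is an isometry.\<close>
  define c where "c m j = r m ^ (2 * \<delta> j) * inverse (r m ^ D)" for m j
  have cc: "c m j * c m (dl j) = 1" if "j < ?N" for m j
  proof -
    have "c m j * c m (dl j) = r m ^ (2 * (\<delta> j + \<delta> (dl j))) * (inverse (r m ^ D) * inverse (r m ^ D))"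
      by (simp add: c_def power_add algebra_simps)
    also have "\<dots> = (r m ^ D * inverse (r m ^ D)) * (r m ^ D * inverse (r m ^ D))"
      unfolding \<delta>D[OF that] mult_2 power_add by (simp only: mult_ac)
    also have "\<dots> = 1" using r0[of m] by simp
    finally show ?thesis .
  qed
  have "\<exists>T. \<forall>j<?N. T *v e j = c m j *s e j" for m by (rule ex_matrix_on_basis[OF sp])
  then obtain T1 where T1: "\<forall>m. \<forall>j<?N. T1 m *v e j = c m j *s e j" using choice by metis
  have T1I: "T1 m \<in> Iso M" for m
  proof (rule iso_of_frame_images[OF e])
    fix i j assume ij: "i < ?N" "j < ?N"
    have "B (T1 m *v e i) (T1 m *v e j) = c m i * c m j * B (e i) (e j)" using T1 ij by (simp add: bil_simps)
    also have "\<dots> = B (e i) (e j)"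
    proof (cases "i + j = ?N - 1")
      case True
      then have "j = dl i" by (simp add: dl_def)
      then show ?thesis using cc[OF ij(1)] by simp
    qed (use frameD[OF e ij] in simp)
    finally show "B (T1 m *v e i) (T1 m *v e j) = B (e i) (e j)" .
  qed
  \<comment> \<open>Squaring makes the determinant 1.\<close>
  define T where "T m = T1 m ** T1 m" for m
  have TI: "T m \<in> Iso M" for m unfolding T_def by (rule Iso_mult[OF T1I T1I])
  have Td: "det (T m) = 1" for m using det_Iso[OF T1I[of m]] by (auto simp: T_def det_mul)
  have Te: "T m *v e j = c m j ^ 2 *s e j" if "j < ?N" for m j
    using T1 that by (simp add: T_def matrix_vector_mul_assoc[symmetric] power2_eq_square)
  \<comment> \<open>Conjugation by \<open>T m\<close> multiplies an entry by r^4 for each unit of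
    degree. Scaling by u^2 = r^4 compensates exactly in degree -1.\<close>
  define u where "u m = r m ^ 2" for m
  have u0: "u m \<noteq> 0" for m using r0 by (simp add: u_def)
  have "\<forall>m. \<exists>g. g \<in> Iso M \<and> det g = 1 \<and> g ** A = cscale (u m ^ 2) A ** g"
    using ex_square_scaling[OF A u0] by blast
  then obtain g where g: "\<forall>m. g m \<in> Iso M \<and> det (g m) = 1 \<and> g m ** A = cscale (u m ^ 2) A ** g m"
    by (rule choice[THEN exE])
  define h where "h m = T m ** g m" for m
  have hI: "h m \<in> Iso M" "det (h m) = 1" for m
    using g TI Td Iso_mult by (auto simp: h_def det_mul)
  define Zm where "Zm m = Ad (h m) A" for m
  have Zso: "Zm m \<in> so M" for m unfolding Zm_def by (rule so_conj[OF A(1) hI(1)])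
  have ZT: "Zm m ** T m = T m ** cscale (u m ^ 2) A" for m
  proof -
    note gi = invertible_Iso[of "g m"] and hi = invertible_Iso[OF hI(1), of m]
    have "Zm m ** T m ** g m = Zm m ** h m" by (simp add: h_def matrix_mul_assoc)
    also have "\<dots> = T m ** (g m ** A)" unfolding Zm_def matrix_inv_conj(4)[OF hi] by (simp add: h_def matrix_mul_assoc)
    also have "\<dots> = T m ** cscale (u m ^ 2) A ** g m" using g by (simp add: matrix_mul_assoc)
    finally have "(Zm m ** T m ** g m) ** matrix_inv (g m) = (T m ** cscale (u m ^ 2) A ** g m) ** matrix_inv (g m)" by simp
    then show ?thesis using matrix_inv_conj(3) gi g by metis
  qed
  have entry: "c m j ^ 2 * B (e (dl i)) (mpow (Zm m) k *v e j) = c m i ^ 2 * u m ^ (2 * k) * B (e (dl i)) (mpow A k *v e j)"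
    if ij: "i < ?N" "j < ?N" for m i j k
  proof -
    have dc: "c m i ^ 2 * c m (dl i) ^ 2 = 1" using cc[OF ij(1), of m] by (simp add: power_mult_distrib[symmetric])
    have "c m j ^ 2 * B (e (dl i)) (mpow (Zm m) k *v e j) = B (e (dl i)) (mpow (Zm m) k *v (T m *v e j))"
      using Te[OF ij(2)] by (simp add: bil_simps)
    also have "mpow (Zm m) k *v (T m *v e j) = T m *v (u m ^ (2 * k) *s (mpow A k *v e j))"
    proof -
      have "mpow (Zm m) k ** T m = T m ** cscale (u m ^ (2 * k)) (mpow A k)"
        using mpow_conj[OF ZT[of m, symmetric], of k] by (simp add: mpow_cscale power_mult[symmetric])
      then have "(mpow (Zm m) k ** T m) *v e j = (T m ** cscale (u m ^ (2 * k)) (mpow A k)) *v e j" by simp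
      then show ?thesis by (simp only: matrix_vector_mul_assoc[symmetric] cscale_mult_vec)
    qed
    also have "B (e (dl i)) (T m *v (u m ^ (2 * k) *s (mpow A k *v e j))) =
      c m i ^ 2 * B (c m (dl i) ^ 2 *s e (dl i)) (T m *v (u m ^ (2 * k) *s (mpow A k *v e j)))"
      using dc by (simp add: bil_simps mult.assoc[symmetric])
    also have "c m (dl i) ^ 2 *s e (dl i) = T m *v e (dl i)" using Te dl_simps(1)[OF ij(1)] by simp
    also have "B (T m *v e (dl i)) (T m *v (u m ^ (2 * k) *s (mpow A k *v e j))) = u m ^ (2 * k) * B (e (dl i)) (mpow A k *v e j)"
      by (simp add: IsoD[OF TI] bil_simps)
    finally show ?thesis by (simp add: mult.assoc)
  qed
  have ratio: "c m i ^ 2 * u m ^ (2 * k) * u m ^ (2 * \<delta> j) = u m ^ (2 * (\<delta> i + k)) * c m j ^ 2" for m i j k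
    by (simp add: c_def u_def power_mult[symmetric] power_mult_distrib power_add[symmetric] algebra_simps power_inverse)
  have entry': "u m ^ (2 * \<delta> j) * B (e (dl i)) (mpow (Zm m) k *v e j) = u m ^ (2 * (\<delta> i + k)) * B (e (dl i)) (mpow A k *v e j)"
    if ij: "i < ?N" "j < ?N" for m i j k
  proof -
    have c0: "c m j ^ 2 \<noteq> 0" using cc[OF ij(2), of m] by auto
    have "c m j ^ 2 * (u m ^ (2 * \<delta> j) * B (e (dl i)) (mpow (Zm m) k *v e j)) =
      u m ^ (2 * \<delta> j) * (c m i ^ 2 * u m ^ (2 * k) * B (e (dl i)) (mpow A k *v e j))"
      unfolding mult.left_commute[of "c m j ^ 2" "u m ^ (2 * \<delta> j)"] entry[OF ij] ..
    also have "\<dots> = (c m i ^ 2 * u m ^ (2 * k) * u m ^ (2 * \<delta> j)) * B (e (dl i)) (mpow A k *v e j)"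
      by (simp only: mult_ac)
    also have "\<dots> = c m j ^ 2 * (u m ^ (2 * (\<delta> i + k)) * B (e (dl i)) (mpow A k *v e j))"
      unfolding ratio by (simp only: mult_ac)
    finally show ?thesis using c0 by simp
  qed
  define a where "a i j = (if Suc (\<delta> i) = \<delta> j then B (e (dl i)) (A *v e j) else 0)" for i j
  obtain Z :: "complex^'n^'n" where Z: "\<forall>j<?N. Z *v e j = (\<Sum>i<?N. (a i j / B (e (dl i)) (e i)) *s e i)"
    using ex_matrix_on_basis[OF sp, of "\<lambda>j. \<Sum>i<?N. (a i j / B (e (dl i)) (e i)) *s e i"] ..
  have "(\<lambda>m. B (e (dl i)) (Zm m *v e j)) \<longlonglongrightarrow> a i j" if ij: "i < ?N" "j < ?N" for i j
  proof (cases "B (e (dl i)) (A *v e j) = 0")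
    case True
    then have "B (e (dl i)) (Zm m *v e j) = 0" for m using entry'[OF ij, of m 1] u0[of m] by simp
    then show ?thesis using True by (simp add: a_def)
  next
    case False
    then have lt: "\<delta> i < \<delta> j" using good_frameD(4)[OF gf ij] by (simp add: \<delta>_def dl_def)
    then obtain d where d: "\<delta> j = \<delta> i + 1 + d" using less_imp_Suc_add by fastforce
    have eq: "B (e (dl i)) (Zm m *v e j) = inverse (u m) ^ (2 * d) * B (e (dl i)) (A *v e j)" for m
    proof -
      have "u m ^ (2 * (\<delta> i + 1)) * (u m ^ (2 * d) * B (e (dl i)) (Zm m *v e j)) =
          u m ^ (2 * (\<delta> i + 1)) * B (e (dl i)) (A *v e j)"
        using entry'[OF ij, of m 1] by (simp add: d power_add algebra_simps)
      then have "u m ^ (2 * d) * B (e (dl i)) (Zm m *v e j) = B (e (dl i)) (A *v e j)" using u0[of m] by simp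
      then show ?thesis using u0[of m] by (simp add: field_simps)
    qed
    show ?thesis
    proof (cases d)
      case 0
      then show ?thesis using d by (simp add: eq a_def)
    next
      case (Suc d')
      have "(\<lambda>m. inverse (real (Suc m))) \<longlonglongrightarrow> 0" by (rule LIMSEQ_inverse_real_of_nat)
      then have "(\<lambda>m. complex_of_real (inverse (real (Suc m)))) \<longlonglongrightarrow> complex_of_real 0" by (rule tendsto_of_real)
      then have "(\<lambda>m. inverse (r m)) \<longlonglongrightarrow> 0" by (simp add: r_def)
      then have "(\<lambda>m. (inverse (r m) ^ 2) ^ (2 * d) * B (e (dl i)) (A *v e j)) \<longlonglongrightarrow> (0 ^ 2) ^ (2 * d) * B (e (dl i)) (A *v e j)"
        by (intro tendsto_mult tendsto_power tendsto_const)
      then show ?thesis using d Suc unfolding eq u_def a_def by (simp add: power_inverse)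
    qed
  qed note lim = this
  have "(\<lambda>m. Zm m *v e j) \<longlonglongrightarrow> Z *v e j" if j: "j < ?N" for j
  proof -
    have "(\<lambda>m. \<Sum>i<?N. (B (e (dl i)) (Zm m *v e j) / B (e (dl i)) (e i)) *s e i) \<longlonglongrightarrow>
      (\<Sum>i<?N. (a i j / B (e (dl i)) (e i)) *s e i)"
    proof (intro tendsto_sum vec_tendstoI)
      fix i and q :: 'n assume "i \<in> {..<?N}"
      then show "(\<lambda>m. ((B (e (dl i)) (Zm m *v e j) / B (e (dl i)) (e i)) *s e i) $ q) \<longlonglongrightarrow>
        ((a i j / B (e (dl i)) (e i)) *s e i) $ q"
        unfolding vector_smult_component
        by (intro tendsto_mult tendsto_divide lim tendsto_const frame_dual_nz[OF e]) (use j in auto)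
    qed
    then show ?thesis using Z j by (simp add: frame_expand[OF e, symmetric])
  qed
  then have ZZ: "Zm \<longlonglongrightarrow> Z" by (rule tendsto_matrix_on_basis[OF sp])
  \<comment> \<open>In degree -k the factor in \<open>entry'\<close> is 1, so these entries are
    constant along the sequence.\<close>
  have Zk: "B (e (dl i)) (mpow Z k *v e j) = B (e (dl i)) (mpow A k *v e j)" if ij: "i < ?N" "j < ?N" "\<delta> i + k = \<delta> j" for i j k
  proof -
    have "(\<lambda>m. B (e (dl i)) (mpow (Zm m) k *v e j)) \<longlonglongrightarrow> B (e (dl i)) (mpow Z k *v e j)"
      by (intro tendsto_intros ZZ)
    moreover have "B (e (dl i)) (mpow (Zm m) k *v e j) = B (e (dl i)) (mpow A k *v e j)" for m
      using entry'[OF ij(1,2), of m k] u0[of m] ij(3) by simp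
    ultimately show ?thesis by (simp add: LIMSEQ_const_iff)
  qed
  have Zso: "Z \<in> so M" by (rule so_limit[OF ZZ Zso])
  have "Z *v e j \<in> vec.span (e ` {i. i < ?N \<and> Suc (\<delta> i) = \<delta> j})" if "j < ?N" for j
  proof -
    have "(a i j / B (e (dl i)) (e i)) *s e i \<in> vec.span (e ` {i. i < ?N \<and> Suc (\<delta> i) = \<delta> j})" if "i < ?N" for i
    proof (cases "Suc (\<delta> i) = \<delta> j")
      case True
      then have "e i \<in> vec.span (e ` {i. i < ?N \<and> Suc (\<delta> i) = \<delta> j})" using that by (intro vec.span_base) blast
      then show ?thesis by (rule vec.span_scale)
    qed (simp add: a_def vec.span_zero)
    then show ?thesis using Z that by (auto intro!: vec.span_sum)
  qed
  then have Zt: "Z \<in> tri e (\<lambda>i j. Suc (\<delta> i) = \<delta> j)" by (simp add: tri_def)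
  have Zkt: "mpow Z k \<in> tri e (\<lambda>i j. \<delta> i + k = \<delta> j)" for k
  proof (induction k)
    case 0
    show ?case by (auto simp: tri_def intro!: vec.span_base)
  next
    case (Suc k)
    show ?case unfolding mpow_Suc by (rule tri_mult[OF Zt Suc.IH]) simp
  qed
  \<comment> \<open>The columns in \<open>J\<close> have distinct degrees and the k-th power of
    \<open>Z\<close> is homogeneous, so the nonzero entries selected for them form a diagonal
    pairing.\<close>
  have rank: "rk (mpow A k) UNIV \<le> rk (mpow Z k) UNIV" if k: "k \<in> K" for k
  proof -
    obtain J where J: "J \<subseteq> {..<?N}" "inj_on \<delta> J" "rk (mpow A k) UNIV \<le> card J"
      "\<forall>j\<in>J. \<exists>i. i < ?N \<and> \<delta> i + k = \<delta> j \<and> B (e (dl i)) (mpow A k *v e j) \<noteq> 0"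
      using good_frame_count[OF gf k] unfolding \<delta>_def dl_def by blast
    obtain l where l: "\<forall>j\<in>J. l j < ?N \<and> \<delta> (l j) + k = \<delta> j \<and> B (e (dl (l j))) (mpow A k *v e j) \<noteq> 0"
      using bchoice[OF J(4)] by blast
    have "card J \<le> rk (mpow Z k) UNIV"
    proof (rule dual_system_card_le[where w="\<lambda>j. e (dl (l j))" and y="\<lambda>j. mpow Z k *v e j"])
      show "finite J" using J(1) finite_subset by blast
      fix i j assume ij: "i \<in> J" "j \<in> J"
      show "B (e (dl (l i))) (mpow Z k *v e j) = 0 \<longleftrightarrow> i \<noteq> j"
      proof (cases "i = j")
        case True
        then show ?thesis using Zk[of "l i" j k] l ij J(1) by auto
      next
        case False
        then have "\<delta> (l i) + k \<noteq> \<delta> j" using l ij J(2) by (auto simp: inj_on_def)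
        then show ?thesis using Zkt[of k] False l ij J(1) unfolding frame_tri_iff[OF e] by auto
      qed
    qed auto
    then show ?thesis using J(3) by simp
  qed
  show ?thesis using Zso Zt hI ZZ rank unfolding Zm_def by blast
qed

end

section \<open>Positions compatible with the Borel subalgebras, and determinants\<close>

lemma det_cscale: "det (cscale c A) = c ^ CARD('n) * det A" for A :: "complex^'n^'n"
  by (simp add: det_def cscale_def prod.distrib sum_distrib_left mult_ac)

text \<open>In a basis adapted to the two eigenspaces the matrix is diagonal.\<close>

lemma det_two_eigenspaces:
  fixes T :: "complex^'n^'n"
  assumes V: "vec.subspace V1" "vec.subspace V2" "vec.dim V1 + vec.dim V2 = CARD('n)"
    and s: "UNIV = {x + y | x y. x \<in> V1 \<and> y \<in> V2}"
    and T: "\<And>x. x \<in> V1 \<Longrightarrow> T *v x = - x" "\<And>x. x \<in> V2 \<Longrightarrow> T *v x = x"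
  shows "det T = (- 1) ^ vec.dim V1"
proof -
  let ?c = "vec.dim V1"
  obtain u1 where u1: "fspan u1 ?c = V1" using ex_basis_seq[OF V(1)] by blast
  obtain u2 where u2: "fspan u2 (vec.dim V2) = V2" using ex_basis_seq[OF V(2)] by blast
  define f where "f j = (if j < ?c then u1 j else u2 (j - ?c))" for j
  have b1: "u1 j \<in> V1" if "j < ?c" for j
    using that by (subst u1[symmetric], intro vec.span_base imageI) simp
  have b2: "u2 j \<in> V2" if "j < vec.dim V2" for j
    using that by (subst u2[symmetric], intro vec.span_base imageI) simp
  have f1: "f j \<in> V1" if "j < ?c" for j using b1[OF that] that by (simp add: f_def)
  have f2: "f j \<in> V2" if "\<not> j < ?c" "j < CARD('n)" for j
    using b2[of "j - ?c"] that V(3) by (simp add: f_def)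
  have sp: "fspan f CARD('n) = UNIV"
  proof -
    have "u1 ` {..<?c} \<subseteq> f ` {..<CARD('n)}"
    proof
      fix x assume "x \<in> u1 ` {..<?c}"
      then obtain j where "j < ?c" "x = u1 j" by auto
      then show "x \<in> f ` {..<CARD('n)}" using V(3) by (intro image_eqI[of _ _ j]) (auto simp: f_def)
    qed
    from vec.span_mono[OF this] have "V1 \<subseteq> fspan f CARD('n)" by (simp only: u1)
    moreover have "u2 ` {..<vec.dim V2} \<subseteq> f ` {..<CARD('n)}"
    proof
      fix x assume "x \<in> u2 ` {..<vec.dim V2}"
      then obtain j where "j < vec.dim V2" "x = u2 j" by auto
      then show "x \<in> f ` {..<CARD('n)}" using V(3) by (intro image_eqI[of _ _ "?c + j"]) (auto simp: f_def)
    qed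
    from vec.span_mono[OF this] have "V2 \<subseteq> fspan f CARD('n)" by (simp only: u2)
    ultimately have "{x + y | x y. x \<in> V1 \<and> y \<in> V2} \<subseteq> fspan f CARD('n)"
      by (auto intro!: vec.span_add)
    then show ?thesis using s by auto
  qed
  define D :: "complex^'n^'n" where "D = (\<chi> i j. if i = j then if idx i < ?c then - 1 else 1 else 0)"
  have Tf: "T *v f (idx i) = (if idx i < ?c then - 1 else 1) *s f (idx i)" for i :: 'n
    using T(1)[OF f1[of "idx i"]] T(2)[OF f2[of "idx i"]] by (cases "idx i < ?c") (simp_all add: vec_eq_iff)
  have "(fmat f ** D) $ r $ i = f (idx i) $ r * (if idx i < ?c then - 1 else 1)" for r i :: 'n
  proof -
    have "(fmat f ** D) $ r $ i = (\<Sum>k\<in>UNIV. if k = i then f (idx i) $ r * (if idx i < ?c then - 1 else 1) else 0)"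
      unfolding matrix_matrix_mult_def D_def fmat_def vec_lambda_beta by (intro sum.cong refl) auto
    then show ?thesis by simp
  qed
  then have "T ** fmat f = fmat f ** D"
    unfolding fmat_mult[symmetric] by (simp only: vec_eq_iff fmat_def vec_lambda_beta Tf) (simp add: mult.commute)
  then have "det T * det (fmat f) = det (fmat f) * det D" by (metis det_mul)
  moreover have "det (fmat f) \<noteq> 0" using invertible_fmat[OF sp] by (simp add: invertible_det_nz)
  moreover have "det D = (- 1) ^ ?c"
  proof -
    have "det D = (\<Prod>i\<in>UNIV. if idx (i::'n) < ?c then - 1 else 1)"
      by (subst det_diagonal) (auto simp: D_def)
    also have "\<dots> = (\<Prod>j<CARD('n). if j < ?c then - 1 else 1)"
      by (rule prod.reindex_bij_betw[OF bij_idx, of "\<lambda>j. if j < ?c then - 1 else 1"])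
    also have "\<dots> = (\<Prod>j\<in>{..<CARD('n)} \<inter> {j. j < ?c}. - 1)" by (simp add: prod.If_cases)
    also have "{..<CARD('n)} \<inter> {j. j < ?c} = {..<?c}" using V(3) by auto
    finally show ?thesis by simp
  qed
  ultimately show ?thesis by simp
qed

lemma conj_conj:
  fixes s g X :: "complex^'n^'n"
  assumes "invertible s" "invertible g"
  shows "Ad s (Ad g X) = Ad (s ** g) X"
proof -
  have sg: "invertible (s ** g)" using assms by (rule invertible_mult)
  have "Ad s (Ad g X) ** (s ** g) = s ** (Ad g X) ** g"
    by (simp only: matrix_mul_assoc matrix_inv_conj(4)[OF assms(1)])
  also have "\<dots> = s ** g ** X" by (simp only: matrix_mul_assoc matrix_inv_conj(4)[OF assms(2)])
  finally have "(Ad s (Ad g X) ** (s ** g)) ** matrix_inv (s ** g) =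
    s ** g ** X ** matrix_inv (s ** g)" by simp
  then show ?thesis by (simp only: matrix_inv_conj(3)[OF sg])
qed

lemma nilpotent_conj:
  fixes g :: "complex^'n^'n"
  assumes "invertible g" "nilpotent_matrix X" shows "nilpotent_matrix (Ad g X)"
proof -
  have "g ** X = Ad g X ** g" by (simp only: matrix_inv_conj(4)[OF assms(1)])
  note m = mpow_conj[OF this]
  obtain k where "mpow X k = 0" using assms(2) by (auto simp: nilpotent_matrix_iff)
  then have "mpow (Ad g X) k ** g = 0" using m[of k] by simp
  then have "mpow (Ad g X) k ** g ** matrix_inv g = 0" by simp
  then have "mpow (Ad g X) k = 0" by (simp only: matrix_inv_conj(3)[OF assms(1)])
  then show ?thesis by (auto simp: nilpotent_matrix_iff)
qed

context form
begin

lemma good_frame_iso: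
  assumes gf: "good_frame A K t UNIV CARD('n) e" and s: "s \<in> Iso M" "\<And>j. j < CARD('n) \<Longrightarrow> s *v e j = e' j"
  shows "good_frame (Ad s A) K t UNIV CARD('n) e'"
proof -
  let ?A = "Ad s A"
  note inv = invertible_Iso[OF s(1)]
  have sA: "s ** A = ?A ** s" by (simp add: matrix_inv_conj(4)[OF inv])
  have Ae: "B (e' i) (mpow ?A k *v e' j) = B (e i) (mpow A k *v e j)" if "i < CARD('n)" "j < CARD('n)" for i j k
  proof -
    have "mpow ?A k *v (s *v e j) = s *v (mpow A k *v e j)"
      using mpow_conj[OF sA, of k] by (simp add: matrix_vector_mul_assoc)
    then have "B (e' i) (mpow ?A k *v e' j) = B (s *v e i) (s *v (mpow A k *v e j))" using s(2) that by simp
    then show ?thesis by (simp add: IsoD[OF s(1)])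
  qed
  show ?thesis
    by (rule good_frame_cong[OF gf]) (use Ae Ae[where k=0] rank_conj[OF inv sA] in auto)
qed

text \<open>Exchanging the two middle vectors preserves the Gram matrix of an even orthogonal frame.
  It changes the determinant without touching the pairs that tie the frame to the Borel
  subalgebras.\<close>

lemma swap_middle:
  assumes e: "frame e" and e1: "\<epsilon> = 1" and ev: "even CARD('n)"
  shows "\<exists>e'. \<exists>s\<in>Iso M. det s = - 1 \<and> frame e' \<and> (\<forall>j<CARD('n). s *v e j = e' j) \<and>
    (\<forall>i<wi. e' i = e i \<and> e' (dl i) = e (dl i))"
proof -
  let ?N = "CARD('n)"
  obtain l where l: "?N = 2 * l" using ev by (elim evenE)
  have l0: "l > 0" using l zero_less_card_finite[where 'a='n] by simp
  have wi: "wi = l - 1" unfolding wi_def l using e1 l0 by simp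
  have pq: "dl (l - 1) = l" "l - 1 < ?N" "l < ?N" "l - 1 \<noteq> l" using l l0 by (auto simp: dl_def)
  obtain a b :: 'n where ab: "idx a = l - 1" "idx b = l" using ex_idx pq by metis
  define \<pi> where "\<pi> j = (if j = l - 1 then l else if j = l then l - 1 else j)" for j
  define e' where "e' j = e (\<pi> j)" for j
  have \<pi>: "\<pi> i < ?N" "\<pi> i + \<pi> j = ?N - 1 \<longleftrightarrow> i + j = ?N - 1" if "i < ?N" "j < ?N" for i j
  proof -
    obtain q where q: "l = Suc q" using l0 gr0_implies_Suc by blast
    have "i < 2 * l" "j < 2 * l" using that l by auto
    then show "\<pi> i < ?N" "\<pi> i + \<pi> j = ?N - 1 \<longleftrightarrow> i + j = ?N - 1"
      unfolding l q \<pi>_def by (auto split: if_splits)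
  qed
  have fr: "frame e'" unfolding frame_def
  proof (intro allI impI)
    fix i j assume ij: "i < ?N" "j < ?N"
    show "B (e' i) (e' j) = (if i + j = ?N - 1 then if i \<le> j then 1 else \<epsilon> else 0)"
      using frameD[OF e \<pi>(1)[OF ij] \<pi>(1)[OF ij(2,1)]] \<pi>(2)[OF ij] by (simp add: e'_def e1)
  qed
  obtain s where s: "s \<in> Iso M" "\<And>j. j < ?N \<Longrightarrow> s *v e j = e' j" using frame_iso[OF e fr] by blast
  have "s ** fmat e = (\<chi> r i. fmat e $ r $ Transposition.transpose a b i)"
  proof -
    have "\<pi> (idx i) = idx (Transposition.transpose a b i)" for i
    proof -
      have "idx i = l - 1 \<longleftrightarrow> i = a" "idx i = l \<longleftrightarrow> i = b" using ab idx_eq_iff by metis+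
      then show ?thesis using ab by (simp add: \<pi>_def Transposition.transpose_def)
    qed
    then have "s *v e (idx i) = e (idx (Transposition.transpose a b i))" for i
      by (simp add: s(2) e'_def)
    then show ?thesis unfolding fmat_mult[symmetric] by (simp add: fmat_def vec_eq_iff)
  qed
  then have "det s * det (fmat e) = det (\<chi> r i. fmat e $ r $ Transposition.transpose a b i)" by (metis det_mul)
  also have "\<dots> = of_int (sign (Transposition.transpose a b)) * det (fmat e)"
    by (rule det_permute_columns) (rule permutes_swap_id, auto)
  also have "sign (Transposition.transpose a b) = - 1" using ab pq by (auto simp: sign_swap_id)
  finally have "(det s + 1) * det (fmat e) = 0" by (simp add: algebra_simps)
  then have "det s = - 1" using invertible_fmat[OF frame_span[OF e]] by (simp add: invertible_det_nz eq_neg_iff_add_eq_0)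
  moreover have "e' i = e i \<and> e' (dl i) = e (dl i)" if "i < wi" for i
  proof -
    have "\<pi> i = i" "\<pi> (dl i) = dl i" using that unfolding wi by (auto simp: \<pi>_def dl_def l)
    then show ?thesis by (simp add: e'_def)
  qed
  ultimately show ?thesis using s fr by blast
qed

text \<open>An orthogonal \<open>g\<close> of determinant -1 is corrected by
  \<open>swap_middle\<close> in even dimension. In odd dimension it is replaced by its negative,
  which gives the same conjugate of \<open>X\<close>.\<close>

lemma ex_good_position:
  assumes op: "opposite_borels (so M) h b b'" and X: "X \<in> so M"
    and gf: "good_frame X K t UNIV CARD('n) f"
  shows "\<exists>e. \<exists>g\<in>Iso M. (\<epsilon> = 1 \<longrightarrow> det g = 1) \<and> frame e \<and> b' \<subseteq> tri e (\<le>) \<and> b \<subseteq> tri e (\<ge>) \<and>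
    good_frame (Ad g X) K t UNIV CARD('n) e"
proof -
  obtain e where e: "frame e" "\<forall>e'. frame e' \<longrightarrow> (\<forall>i<wi. e' i = e i \<and> e' (dl i) = e (dl i)) \<longrightarrow>
    b' \<subseteq> tri e' (\<le>) \<and> b \<subseteq> tri e' (\<ge>)"
    using opposite_frames[OF op] by (elim exE conjE)
  obtain g where g: "g \<in> Iso M" "good_frame (Ad g X) K t UNIV CARD('n) e"
    using good_frame_to_frame[OF gf X e(1)] by (elim bexE)
  have be: "b' \<subseteq> tri e (\<le>) \<and> b \<subseteq> tri e (\<ge>)" using e by simp
  show ?thesis
  proof (cases "\<epsilon> = 1 \<longrightarrow> det g = 1")
    case True
    then show ?thesis using be g e(1) by blast
  next
    case False
    then have e1: "\<epsilon> = 1" and dg: "det g = - 1" using det_Iso[OF g(1)] by auto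
    show ?thesis
    proof (cases "even CARD('n)")
      case True
      obtain e' s where s: "s \<in> Iso M" "det s = - 1" "frame e'" "\<forall>j<CARD('n). s *v e j = e' j"
        "\<forall>i<wi. e' i = e i \<and> e' (dl i) = e (dl i)"
        using swap_middle[OF e(1) e1 True] by (elim exE bexE conjE)
      have "good_frame (Ad (s ** g) X) K t UNIV CARD('n) e'"
        using good_frame_iso[OF g(2) s(1)] s(4) conj_conj[OF invertible_Iso[OF s(1)] invertible_Iso[OF g(1)]] by simp
      moreover have "s ** g \<in> Iso M" "det (s ** g) = 1" using Iso_mult[OF s(1) g(1)] s(2) dg by (auto simp: det_mul)
      moreover have "b' \<subseteq> tri e' (\<le>) \<and> b \<subseteq> tri e' (\<ge>)" using e(2) s(3,5) by blast
      ultimately show ?thesis using s(3) by blast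
    next
      case False
      have inv: "invertible g" by (rule invertible_Iso[OF g(1)])
      define g' where "g' = cscale (- 1) g"
      have "g' *v x = (- 1) *s (g *v x)" for x unfolding g'_def by (rule cscale_mult_vec)
      then have gI: "g' \<in> Iso M" using IsoD[OF g(1)] by (simp add: Iso_def bil_simps)
      have "Ad g X ** g' = g' ** X"
        unfolding g'_def cscale_matrix_mult_right cscale_matrix_mult_left matrix_inv_conj(4)[OF inv] ..
      then have "Ad g X = Ad g' X"
        using matrix_inv_conj(3)[OF invertible_Iso[OF gI]] by metis
      moreover have "det g' = 1" unfolding g'_def det_cscale dg using False by simp
      ultimately show ?thesis using be g(2) gI e(1) by metis
    qed
  qed
qed

lemma ex_Psi_limit:
  assumes op: "opposite_borels (so M) h b b'" and X: "X \<in> so M" "nilpotent_matrix X"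
    and gf: "good_frame X K t UNIV CARD('n) f"
  shows "\<exists>Z hs. Z \<in> so M \<and> trace_dual (so M) Z \<in> Psi (so M) b b' \<and>
    (\<forall>m. hs m \<in> Iso M \<and> (\<epsilon> = 1 \<longrightarrow> det (hs m) = 1)) \<and> (\<lambda>m. Ad (hs m) X) \<longlonglongrightarrow> Z \<and>
    (\<forall>k\<in>K. rk (mpow X k) UNIV \<le> rk (mpow Z k) UNIV)"
proof -
  obtain e g where g: "g \<in> Iso M" "\<epsilon> = 1 \<longrightarrow> det g = 1" and e: "frame e" "b' \<subseteq> tri e (\<le>)" "b \<subseteq> tri e (\<ge>)"
    and gf': "good_frame (Ad g X) K t UNIV CARD('n) e"
    using ex_good_position[OF op X(1) gf] by (elim exE bexE conjE)
  let ?A = "Ad g X"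
  note inv = invertible_Iso[OF g(1)]
  have gX: "g ** X = ?A ** g" by (simp add: matrix_inv_conj(4)[OF inv])
  note nA = nilpotent_conj[OF inv X(2)]
  obtain Z hs where Z: "Z \<in> so M" "Z \<in> tri e (\<lambda>i j. Suc (deg t CARD('n) i) = deg t CARD('n) j)"
    "\<forall>m. hs m \<in> Iso M \<and> det (hs m) = 1" "(\<lambda>m. Ad (hs m) ?A) \<longlonglongrightarrow> Z"
    "\<forall>k\<in>K. rk (mpow ?A k) UNIV \<le> rk (mpow Z k) UNIV"
    using degeneration[OF so_conj[OF X(1) g(1)] nA e(1) gf'] by (elim exE conjE)
  have sub: "lie_subalgebra b (so M)" "b' \<subseteq> so M"
    using op by (auto simp: opposite_borels_def borel_subalgebra_def lie_subalgebra_def)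
  have tw: "t \<longrightarrow> even CARD('n) \<and> CARD('n) \<ge> 2" "t \<longrightarrow> \<epsilon> = 1" using good_frame_twist[OF gf] by auto
  have "trace_dual (so M) Z \<in> Psi (so M) b b'"
  proof (rule Psi_form[where \<delta> = "deg t CARD('n)", OF e(1) sub e(2,3) deg_mono _ Z(2)])
    show "deg t CARD('n) i < deg t CARD('n) j \<or> \<epsilon> = 1 \<and> dl i = j" if "i < j" "j < CARD('n)" for i j
      using deg_strict[OF tw(1) that] tw(2) by (auto simp: dl_def)
  qed
  moreover have "Ad (hs m) ?A = Ad (hs m ** g) X" for m
    using conj_conj[OF _ inv] invertible_Iso Z(3) by blast
  moreover have "\<forall>m. hs m ** g \<in> Iso M \<and> (\<epsilon> = 1 \<longrightarrow> det (hs m ** g) = 1)"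
    using Z(3) g Iso_mult by (auto simp: det_mul)
  moreover have "\<forall>k\<in>K. rk (mpow X k) UNIV \<le> rk (mpow Z k) UNIV"
    using Z(5) rank_conj[OF inv gX] by simp
  ultimately show ?thesis using Z(1,4) by (intro exI[of _ Z] exI[of _ "\<lambda>m. hs m ** g"]) simp
qed

text \<open>Reflecting in a block of odd size centralizes \<open>X\<close>.\<close>

lemma ex_centralizer_det:
  assumes X: "X \<in> so M" and e1: "\<epsilon> = 1" and s: "single_block X v c"
  shows "\<exists>s\<in>Iso M. det s = - 1 \<and> s ** X = X ** s"
proof -
  define V1 where "V1 = cyc X v c"
  note V1 = single_block_nd[OF X s, folded V1_def]
  define V2 where "V2 = UNIV \<inter> perp V1"
  note sp = nd_split[OF nd_UNIV V1(1) subset_UNIV, folded V2_def]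
  have c: "odd c"
  proof -
    have "c > 0" "\<epsilon> * (- 1 :: complex) ^ (c - 1) = 1" using s unfolding single_block_def by blast+
    then have "(- 1 :: complex) ^ (c - 1) = 1" unfolding e1 by simp
    then have "even (c - 1)" by (auto simp: minus_one_power_iff split: if_splits)
    then show ?thesis using \<open>c > 0\<close> by simp
  qed
  note sub = nd_subspace[OF V1(1)] nd_subspace[OF sp(1)]
  have st2: "stable X V2" unfolding V2_def by (rule stable_complement[OF X _ V1(2)]) (simp add: stable_def)
  have "\<forall>x. \<exists>y\<in>V1. x - y \<in> perp V1" using nd_project[OF V1(1)] by blast
  then have "\<forall>x. \<exists>y. y \<in> V1 \<and> x - y \<in> V2" by (auto simp: V2_def)
  then obtain p where p: "\<forall>x. p x \<in> V1 \<and> x - p x \<in> V2" using choice by metis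
  have uniq: "p x = y" if "y \<in> V1" "x - y \<in> V2" for x y
  proof -
    have "p x - y \<in> V1" using p that(1) by (blast intro: vec.subspace_diff[OF sub(1)])
    moreover have "p x - y \<in> V2"
    proof -
      have "(x - y) - (x - p x) \<in> V2" using p that(2) by (blast intro: vec.subspace_diff[OF sub(2)])
      then show ?thesis by simp
    qed
    ultimately have "p x - y = 0" using nd_D[OF V1(1)] sp(5) by blast
    then show ?thesis by simp
  qed
  have add: "p (x + y) = p x + p y" for x y
  proof (rule uniq)
    show "p x + p y \<in> V1" using p by (intro vec.subspace_add[OF sub(1)]) blast+
    have "(x - p x) + (y - p y) \<in> V2" using p by (intro vec.subspace_add[OF sub(2)]) blast+
    then show "x + y - (p x + p y) \<in> V2" by (simp only: add_diff_add)
  qed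
  have scale: "p (a *s x) = a *s p x" for a x
  proof (rule uniq)
    show "a *s p x \<in> V1" using p by (intro vec.subspace_scale[OF sub(1)]) blast
    have "a *s (x - p x) \<in> V2" using p by (intro vec.subspace_scale[OF sub(2)]) blast
    then show "a *s x - a *s p x \<in> V2" by (simp only: vec.scale_right_diff_distrib)
  qed
  define s where "s = matrix (\<lambda>x. x - 2 *s p x)"
  have sx: "s *v x = x - 2 *s p x" for x unfolding s_def
    by (rule matrix_of_linear) (simp_all add: add scale vec_eq_iff algebra_simps)
  have s1: "s *v x = - x" if "x \<in> V1" for x
    using uniq[of x x] that vec.subspace_0[OF sub(2)] by (simp add: sx vec_eq_iff)
  have s2: "s *v x = x" if "x \<in> V2" for x
    using uniq[of 0 x] that vec.subspace_0[OF sub(1)] by (simp add: sx vec_eq_iff)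
  have dec: "\<exists>y z. x = y + z \<and> y \<in> V1 \<and> z \<in> V2" for x using sp(2) by blast
  have "s \<in> Iso M" unfolding Iso_def
  proof (intro CollectI allI)
    fix x x'
    obtain y z where x: "x = y + z" "y \<in> V1" "z \<in> V2" using dec by blast
    obtain y' z' where x': "x' = y' + z'" "y' \<in> V1" "z' \<in> V2" using dec by blast
    show "B (s *v x) (s *v x') = B x x'"
      unfolding x(1) x'(1) using x(2,3) x'(2,3) sp(4,5)
      by (simp add: matrix_vector_right_distrib s1 s2 bil_simps)
  qed
  moreover have "det s = - 1"
  proof -
    have "vec.dim V1 + vec.dim V2 = CARD('n)" using sp(3) vec_dim_card[where 'a=complex and 'n='n] by linarith
    then have "det s = (- 1) ^ vec.dim V1" using det_two_eigenspaces[OF sub _ sp(2) s1 s2] by simp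
    then show ?thesis using c V1(3) by simp
  qed
  moreover have "s ** X = X ** s"
  proof (rule matrix_eqI)
    fix x
    obtain y z where x: "x = y + z" "y \<in> V1" "z \<in> V2" using dec by blast
    have "X *v y \<in> V1" "X *v z \<in> V2" using x V1(2) st2 by (auto simp: stable_def)
    then show "(s ** X) *v x = (X ** s) *v x"
      unfolding x(1) using x(2,3)
      by (simp add: matrix_vector_mul_assoc[symmetric] matrix_vector_right_distrib s1 s2 vec.neg)
  qed
  ultimately show ?thesis by blast
qed

end

section \<open>Orbits and their closures\<close>

definition orb :: "(complex^'n^'n) set \<Rightarrow> complex^'n^'n \<Rightarrow> (complex^'n^'n) set"
  where "orb G X = {Ad g X | g. g \<in> G}"

lemma matrix_inv_matrix_inv: "invertible g \<Longrightarrow> matrix_inv (matrix_inv g) = g" for g :: "complex^'n^'n"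
  by (metis invertible_matrix_inv matrix_inv_conj(1) matrix_inv_mult(1) matrix_mul_rid)

lemma trace_mult_axis: "trace (A ** (\<chi> k l. if k = j \<and> l = i then 1 else 0)) = A $ i $ j" for A :: "complex^'n^'n"
proof -
  have "(A ** (\<chi> k l. if k = j \<and> l = i then 1 else 0)) $ r $ r = (if r = i then A $ i $ j else 0)" for r
  proof -
    have "(A ** (\<chi> k l. if k = j \<and> l = i then 1 else 0)) $ r $ r = (\<Sum>k\<in>UNIV. if k = j then if r = i then A $ r $ j else 0 else 0)"
      unfolding matrix_matrix_mult_def vec_lambda_beta by (intro sum.cong refl) auto
    then show ?thesis by simp
  qed
  then show ?thesis by (simp add: trace_def)
qed

text \<open>On \<open>q\<close> the matrices \<open>E\<close> and \<open>P E\<close> define the same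
  trace functional. This expresses that the trace form is nondegenerate on \<open>q\<close>, in a
  form that allows the entries of an element to be recovered continuously from its
  functional.\<close>

locale matrix_group =
  fixes G q :: "(complex^'n^'n) set" and P :: "complex^'n^'n \<Rightarrow> complex^'n^'n"
  assumes inv: "g \<in> G \<Longrightarrow> invertible g"
    and mult: "g \<in> G \<Longrightarrow> k \<in> G \<Longrightarrow> g ** k \<in> G"
    and inverse: "g \<in> G \<Longrightarrow> matrix_inv g \<in> G"
    and conj: "X \<in> q \<Longrightarrow> g \<in> G \<Longrightarrow> Ad g X \<in> q"
    and proj: "P E \<in> q" "Y \<in> q \<Longrightarrow> trace (Y ** P E) = trace (Y ** E)"
begin

lemma coadjoint_trace_dual:
  assumes "g \<in> G" shows "coadjoint q g (trace_dual q X) = trace_dual q (Ad g X)"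
proof
  fix Y
  show "coadjoint q g (trace_dual q X) Y = trace_dual q (Ad g X) Y"
  proof (cases "Y \<in> q")
    case True
    note mm = matrix_inv_matrix_inv[OF inv[OF assms]]
    have "matrix_inv g ** Y ** g \<in> q" using conj[OF True inverse[OF assms]] by (simp only: mm)
    moreover have "trace (X ** (matrix_inv g ** Y ** g)) = trace (g ** (X ** (matrix_inv g ** Y)))"
      by (subst trace_mul_sym) (simp add: matrix_mul_assoc)
    ultimately show ?thesis using True by (simp add: coadjoint_def trace_dual_def matrix_mul_assoc)
  qed (simp add: coadjoint_def trace_dual_def)
qed

lemma orbit_trace_dual: "(\<lambda>g. coadjoint q g (trace_dual q X)) ` G = trace_dual q ` orb G X"
  by (auto simp: orb_def image_iff coadjoint_trace_dual)

lemma orb_subset: "X \<in> q \<Longrightarrow> orb G X \<subseteq> q"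
  using conj by (auto simp: orb_def)

lemma continuous_trace_dual: "continuous_on UNIV (trace_dual q)"
proof (rule continuous_on_coordinatewise_then_product)
  fix Y
  show "continuous_on UNIV (\<lambda>X. trace_dual q X Y)"
    by (cases "Y \<in> q") (auto simp: trace_dual_def trace_def intro!: continuous_intros)
qed

definition recover :: "(complex^'n^'n \<Rightarrow> complex) \<Rightarrow> complex^'n^'n"
  where "recover \<phi> = (\<chi> i j. \<phi> (P (\<chi> k l. if k = j \<and> l = i then 1 else 0)))"

lemma recover: "X \<in> q \<Longrightarrow> recover (trace_dual q X) = X"
  by (simp add: recover_def trace_dual_def proj trace_mult_axis vec_eq_iff)

lemma continuous_recover: "continuous_on UNIV recover"
  unfolding recover_def
  by (intro continuous_on_vec_lambda continuous_on_product_coordinates)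

text \<open>The identification of \<open>q\<close> with its dual is continuous and
  \<open>recover\<close> is a continuous left inverse, so closures may be computed among
  matrices.\<close>

lemma closure_orbit_iff:
  assumes X: "X \<in> q" and Z: "Z \<in> q"
  shows "trace_dual q Z \<in> closure (trace_dual q ` orb G X) \<longleftrightarrow> Z \<in> closure (orb G X)"
proof
  assume "Z \<in> closure (orb G X)"
  then show "trace_dual q Z \<in> closure (trace_dual q ` orb G X)"
    using continuous_image_closure_subset[OF continuous_trace_dual subset_UNIV] by blast
next
  assume "trace_dual q Z \<in> closure (trace_dual q ` orb G X)"
  then have "recover (trace_dual q Z) \<in> closure (recover ` trace_dual q ` orb G X)"
    using continuous_image_closure_subset[OF continuous_recover subset_UNIV] by blast
  moreover have "recover ` trace_dual q ` orb G X = orb G X"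
    using orb_subset[OF X] recover by (force simp: image_iff)
  ultimately show "Z \<in> closure (orb G X)" using recover[OF Z] by simp
qed

lemma rank_closure_orb:
  assumes "Z \<in> closure (orb G X)"
  shows "rk (mpow Z k) UNIV \<le> rk (mpow X k) UNIV"
proof -
  obtain Zm where Zm: "\<And>m. Zm m \<in> orb G X" "Zm \<longlonglongrightarrow> Z" using assms closure_sequential by blast
  have "rk (mpow (Zm m) k) UNIV = rk (mpow X k) UNIV" for m
  proof -
    obtain g where g: "g \<in> G" "Zm m = Ad g X" using Zm(1)[of m] by (auto simp: orb_def)
    have "g ** X = Zm m ** g" unfolding g(2) by (simp only: matrix_inv_conj(4)[OF inv[OF g(1)]])
    then show ?thesis using rank_conj[OF inv[OF g(1)]] by metis
  qed
  then show ?thesis using rank_limit[OF tendsto_mpow[OF Zm(2)]] by (metis order_refl)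
qed

lemma orb_eq:
  assumes s: "s \<in> G" "s ** X = X' ** s" shows "orb G X' = orb G X"
proof -
  have X': "X' = Ad s X"
    using s(2) matrix_inv_conj(3)[OF inv[OF s(1)]] by metis
  have i: "invertible s" by (rule inv[OF s(1)])
  show ?thesis
  proof
    show "orb G X' \<subseteq> orb G X"
    proof
      fix Y assume "Y \<in> orb G X'"
      then obtain g where g: "g \<in> G" "Y = Ad g X'" by (auto simp: orb_def)
      have "Y = Ad (g ** s) X" unfolding g(2) X' by (rule conj_conj[OF inv[OF g(1)] i])
      then show "Y \<in> orb G X" using mult[OF g(1) s(1)] by (auto simp: orb_def)
    qed
    show "orb G X \<subseteq> orb G X'"
    proof
      fix Y assume "Y \<in> orb G X"
      then obtain g where g: "g \<in> G" "Y = Ad g X" by (auto simp: orb_def)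
      let ?h = "g ** matrix_inv s"
      have "g = ?h ** s" by (simp only: matrix_inv_conj(4)[OF i])
      moreover have h: "?h \<in> G" by (rule mult[OF g(1) inverse[OF s(1)]])
      ultimately have "Y = Ad ?h X'"
        unfolding X' conj_conj[OF inv[OF h] i] using g(2) by simp
      then show "Y \<in> orb G X'" using h by (auto simp: orb_def)
    qed
  qed
qed

text \<open>The assumptions \<open>limit\<close> and \<open>conj\<close> isolate what depends on the
  group. The last premise of \<open>conj\<close> passes on the inclusion of closures inside \<Psi>,
  because ranks alone do not determine the orbits of the special orthogonal group.\<close>

theorem orbit_determined:
  assumes O: "(\<lambda>g. coadjoint q g \<phi>) ` G = Orb" "nilpotent_functional q \<phi>"
    and O': "(\<lambda>g. coadjoint q g \<phi>') ` G = Orb'" "nilpotent_functional q \<phi>'"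
    and eq: "closure Orb \<inter> \<Psi> = closure Orb' \<inter> \<Psi>"
    and limit: "\<And>X k. X \<in> q \<Longrightarrow> nilpotent_matrix X \<Longrightarrow> \<exists>Z\<in>q. trace_dual q Z \<in> \<Psi> \<and> Z \<in> closure (orb G X) \<and>
      rk (mpow X k) UNIV \<le> rk (mpow Z k) UNIV"
    and conj: "\<And>X X'. X \<in> q \<Longrightarrow> nilpotent_matrix X \<Longrightarrow> X' \<in> q \<Longrightarrow> nilpotent_matrix X' \<Longrightarrow>
      (\<And>k. rk (mpow X k) UNIV = rk (mpow X' k) UNIV) \<Longrightarrow>
      (\<And>Z. Z \<in> q \<Longrightarrow> trace_dual q Z \<in> \<Psi> \<Longrightarrow> Z \<in> closure (orb G X) \<Longrightarrow> Z \<in> closure (orb G X')) \<Longrightarrow>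
      \<exists>g\<in>G. g ** X = X' ** g"
  shows "Orb = Orb'"
proof -
  obtain X where X: "X \<in> q" "nilpotent_matrix X" "\<phi> = trace_dual q X"
    using O(2) by (auto simp: nilpotent_functional_def)
  obtain X' where X': "X' \<in> q" "nilpotent_matrix X'" "\<phi>' = trace_dual q X'"
    using O'(2) by (auto simp: nilpotent_functional_def)
  have Orb: "Orb = trace_dual q ` orb G X" "Orb' = trace_dual q ` orb G X'"
    using O(1) O'(1) orbit_trace_dual by (simp_all add: X(3) X'(3))
  have tr: "Z \<in> closure (orb G X) \<longleftrightarrow> Z \<in> closure (orb G X')" if "Z \<in> q" "trace_dual q Z \<in> \<Psi>" for Z
    using closure_orbit_iff[OF X(1) that(1)] closure_orbit_iff[OF X'(1) that(1)] eq that(2) unfolding Orb by blast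
  have "rk (mpow X k) UNIV = rk (mpow X' k) UNIV" for k
  proof (rule antisym)
    obtain Z where "Z \<in> q" "trace_dual q Z \<in> \<Psi>" "Z \<in> closure (orb G X)"
      "rk (mpow X k) UNIV \<le> rk (mpow Z k) UNIV" using limit[OF X(1,2)] by blast
    then show "rk (mpow X k) UNIV \<le> rk (mpow X' k) UNIV"
      using tr rank_closure_orb[of Z X' k] by auto
    obtain Z where "Z \<in> q" "trace_dual q Z \<in> \<Psi>" "Z \<in> closure (orb G X')"
      "rk (mpow X' k) UNIV \<le> rk (mpow Z k) UNIV" using limit[OF X'(1,2)] by blast
    then show "rk (mpow X' k) UNIV \<le> rk (mpow X k) UNIV"
      using tr rank_closure_orb[of Z X k] by auto
  qed
  then obtain g where "g \<in> G" "g ** X = X' ** g" using conj[OF X(1,2) X'(1,2)] tr by blast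
  then show ?thesis unfolding Orb using orb_eq by simp
qed

end

text \<open>In type \<open>A\<close> the conjugate of \<open>X\<close> in Jordan form with respect to a basis defining the two flags
  already lies in \<open>\<Psi>\<close>.\<close>

lemma ex_conj_in_Psi:
  fixes q :: "(complex^'n^'n) set"
  assumes q: "q = UNIV \<or> q = {X. trace X = 0}" and op: "opposite_borels q h b b'" and X: "nilpotent_matrix X"
  shows "\<exists>T. det T = 1 \<and> trace_dual q (Ad T X) \<in> Psi q b b'"
proof -
  let ?N = "CARD('n)"
  obtain e where e: "indep_seq e ?N" "b' \<subseteq> tri e (\<le>)" "b \<subseteq> tri e (\<ge>)" using opposite_bases[OF q op] by blast
  obtain f \<eta> where f0: "fspan f ?N = UNIV \<and> (\<forall>j. \<eta> j \<longrightarrow> j > (0::nat)) \<and>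
    (\<forall>j<?N. X *v f j = (if \<eta> j then f (j - 1) else 0))" using jordan_basis[OF X] by (elim exE)
  then have f: "fspan f ?N = UNIV" "\<And>j. \<eta> j \<Longrightarrow> j > 0"
    "\<And>j. j < ?N \<Longrightarrow> X *v f j = (if \<eta> j then f (j - 1) else 0)" by simp_all
  note se = span_indep_seq[OF e(1)]
  obtain T0 where T0: "invertible T0" "\<And>j. j < ?N \<Longrightarrow> T0 *v f j = e j" using ex_basis_map[OF f(1) se] by blast
  have d0: "det T0 \<noteq> 0" using T0(1) by (simp add: invertible_det_nz)
  obtain z where z: "z ^ ?N = inverse (det T0)"
    using exists_complex_root[of ?N "inverse (det T0)"] by (metis zero_less_card_finite less_irrefl)
  define T where "T = cscale z T0"
  have dT: "det T = 1" using d0 by (simp add: T_def det_cscale z)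
  have iT: "invertible T" using dT by (simp add: invertible_det_nz)
  let ?Z = "Ad T X"
  have z0: "z \<noteq> 0" using z d0 zero_less_card_finite[where 'a='n] by (metis inverse_nonzero_iff_nonzero zero_power)
  have Te: "T *v f j = z *s e j" if "j < ?N" for j using T0(2)[OF that] unfolding T_def cscale_mult_vec by simp
  have Ze: "?Z *v e j = (if \<eta> j then e (j - 1) else 0)" if j: "j < ?N" for j
  proof -
    have "?Z *v (T *v f j) = T *v (X *v f j)"
      using matrix_inv_mult(4)[OF iT, of "f j"] by (simp add: matrix_vector_mul_assoc[symmetric])
    then have "z *s (?Z *v e j) = z *s (if \<eta> j then e (j - 1) else 0)"
      using Te[OF j] Te[of "j - 1"] f(3)[OF j] j by (auto split: if_splits)
    then show ?thesis using z0 by (simp only: vec.scale_left_imp_eq)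
  qed
  have Zt: "?Z \<in> tri e (\<lambda>i j. Suc i = j)" unfolding tri_def
  proof (intro CollectI allI impI)
    fix j assume j: "j < ?N"
    have "e (j - 1) \<in> vec.span (e ` {i. i < ?N \<and> Suc i = j})" if "\<eta> j"
      using f(2)[OF that] j by (intro vec.span_base imageI) simp
    then show "?Z *v e j \<in> vec.span (e ` {i. i < ?N \<and> Suc i = j})" using Ze[OF j] by (simp add: vec.span_zero)
  qed
  have sq: "cmat.subspace q"
    using q by (elim disjE) (auto simp: cmat.subspace_def trace_add trace_cscale trace_def[of 0])
  have b: "lie_subalgebra b q" "b' \<subseteq> q"
    using op by (auto simp: opposite_borels_def borel_subalgebra_def lie_subalgebra_def)
  then have bs: "cmat.subspace b" "b \<subseteq> q" "\<And>X Y. X \<in> b \<Longrightarrow> Y \<in> b \<Longrightarrow> bracket X Y \<in> b" by (auto simp: lie_subalgebra_def)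
  have n: "nilradical b \<subseteq> b" by (rule nilradical_subset[OF bs(1)])
  have "bracket_span (nilradical b) (nilradical b) \<subseteq> q"
    by (rule bracket_span_minimal[OF sq]) (use bs n in blast)
  then have "trace_dual q ?Z \<in> Psi q b b'"
    using Psi_intro[where \<delta>="\<lambda>i. i", OF se sq b(2) _ e(2) nilradical_tri_ge[OF e(1,3)] Zt] by blast
  then show ?thesis using dT by blast
qed

section \<open>Lie algebras of the classical groups\<close>

text \<open>A tangent vector needs a curve on the whole real line; one given near 0 is continued by
  the constant 1.\<close>

lemma lie_algebraI:
  assumes "mat 1 \<in> G" "\<epsilon> > 0" "\<And>t. \<bar>t\<bar> < \<epsilon> \<Longrightarrow> \<gamma> t \<in> G" "\<gamma> 0 = mat 1" "(\<gamma> has_vector_derivative X) (at 0)"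
  shows "X \<in> lie_algebra G"
proof -
  define \<gamma>' where "\<gamma>' t = (if \<bar>t\<bar> < \<epsilon> then \<gamma> t else mat 1)" for t
  have "(\<gamma>' has_vector_derivative X) (at 0)"
    by (rule has_vector_derivative_transform_within[OF assms(5,2)]) (auto simp: \<gamma>'_def dist_real_def)
  moreover have "\<gamma>' t \<in> G" for t using assms(1,3) by (simp add: \<gamma>'_def)
  moreover have "\<gamma>' 0 = mat 1" using assms(2,4) by (simp add: \<gamma>'_def)
  ultimately show ?thesis unfolding lie_algebra_def by blast
qed

lemma has_vector_derivative_line: "((\<lambda>t. A + t *\<^sub>R X) has_vector_derivative X) (at t0)"
  by (auto intro!: derivative_eq_intros)

lemma invertible_near_one:
  fixes X :: "complex^'n^'n"
  shows "\<exists>d>0. \<forall>t. \<bar>t\<bar> < d \<longrightarrow> invertible (mat 1 + t *\<^sub>R X)"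
proof -
  have "((\<lambda>t. det (mat 1 + t *\<^sub>R X)) \<longlongrightarrow> det (mat 1 + 0 *\<^sub>R X)) (at 0)"
    by (intro tendsto_det tendsto_intros)
  then have "\<forall>\<^sub>F t in at 0. det (mat 1 + t *\<^sub>R X) \<noteq> 0"
    by (rule tendsto_imp_eventually_ne) simp
  then obtain d where d: "d > 0" "\<And>t. t \<noteq> 0 \<Longrightarrow> dist t 0 < d \<Longrightarrow> det (mat 1 + t *\<^sub>R X) \<noteq> 0"
    unfolding eventually_at by blast
  have "invertible (mat 1 + t *\<^sub>R X)" if "\<bar>t\<bar> < d" for t
    using d(2)[of t] that by (cases "t = 0") (auto simp: invertible_det_nz dist_real_def)
  then show ?thesis using d(1) by blast
qed

lemma lie_algebra_GL: "lie_algebra GL = (UNIV :: (complex^'n^'n) set)"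
proof -
  have "X \<in> lie_algebra GL" for X :: "complex^'n^'n"
  proof -
    obtain d where d: "d > 0" "\<forall>t. \<bar>t\<bar> < d \<longrightarrow> invertible (mat 1 + t *\<^sub>R X)" using invertible_near_one by blast
    show ?thesis
      by (rule lie_algebraI[OF _ d(1), where \<gamma>="\<lambda>t. mat 1 + t *\<^sub>R X"])
        (use d(2) has_vector_derivative_line in \<open>auto simp: GL_def invertible_det_nz\<close>)
  qed
  then show ?thesis by blast
qed

lemma permutation_fixing_all_but_one:
  assumes "p permutes UNIV" "\<And>j. j \<noteq> i \<Longrightarrow> p j = j" shows "p = id"
proof -
  have "p i = i"
  proof (rule ccontr)
    assume "p i \<noteq> i"
    then have "p (p i) = p i" using assms(2) by simp
    then show False using \<open>p i \<noteq> i\<close> permutes_inj[OF assms(1)] by (metis injD)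
  qed
  then show ?thesis using assms(2) by (metis eq_id_iff)
qed

text \<open>In the Leibniz expansion only the identity permutation contributes: any other one moves
  at least two points, and its product keeps a vanishing factor after one differentiation at the
  identity matrix.\<close>

lemma det_has_vector_derivative:
  fixes \<gamma> :: "real \<Rightarrow> complex^'n^'n"
  assumes g: "(\<gamma> has_vector_derivative X) (at 0)" and g0: "\<gamma> 0 = mat 1"
  shows "((\<lambda>t. det (\<gamma> t)) has_vector_derivative trace X) (at 0)"
proof -
  have c: "((\<lambda>t. \<gamma> t $ i $ j) has_derivative (\<lambda>y. y *\<^sub>R X $ i $ j)) (at 0)" for i j
    using bounded_linear.has_vector_derivative[OF bounded_linear_vec_nth
        bounded_linear.has_vector_derivative[OF bounded_linear_vec_nth g]]
    by (simp add: has_vector_derivative_def)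
  let ?P = "{p. p permutes (UNIV :: 'n set)}"
  have "((\<lambda>t. \<Sum>p\<in>?P. of_int (sign p) * (\<Prod>i\<in>UNIV. \<gamma> t $ i $ p i)) has_derivative
    (\<lambda>y. \<Sum>p\<in>?P. of_int (sign p) * (\<Sum>i\<in>UNIV. (y *\<^sub>R X $ i $ p i) * (\<Prod>j\<in>UNIV - {i}. \<gamma> 0 $ j $ p j)))) (at 0)"
    by (intro has_derivative_sum has_derivative_mult_right has_derivative_prod c)
  moreover have "(\<Sum>p\<in>?P. of_int (sign p) * (\<Sum>i\<in>UNIV. (y *\<^sub>R X $ i $ p i) * (\<Prod>j\<in>UNIV - {i}. \<gamma> 0 $ j $ p j))) =
    y *\<^sub>R trace X" for y
  proof -
    have "(\<Prod>j\<in>UNIV - {i}. \<gamma> 0 $ j $ p j) = (if p = id then 1 else 0)" if "p \<in> ?P" for p i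
    proof (cases "p = id")
      case True
      then show ?thesis by (auto simp: g0 mat_def intro!: prod.neutral)
    next
      case False
      then have "\<exists>j. j \<noteq> i \<and> p j \<noteq> j" using permutation_fixing_all_but_one[of p i] that by blast
      then obtain j where "j \<noteq> i" "p j \<noteq> j" by blast
      then have "\<exists>j\<in>UNIV - {i}. \<gamma> 0 $ j $ p j = 0" by (intro bexI[of _ j]) (auto simp: g0 mat_def)
      then show ?thesis using False by (simp add: prod_zero)
    qed
    then have "(\<Sum>p\<in>?P. of_int (sign p) * (\<Sum>i\<in>UNIV. (y *\<^sub>R X $ i $ p i) * (\<Prod>j\<in>UNIV - {i}. \<gamma> 0 $ j $ p j))) =
      (\<Sum>p\<in>?P. if p = id then \<Sum>i\<in>UNIV. y *\<^sub>R X $ i $ i else 0)"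
      by (intro sum.cong refl) (auto simp: sign_id)
    also have "\<dots> = (\<Sum>i\<in>UNIV. y *\<^sub>R X $ i $ i)"
      by (subst sum.delta) (auto simp: permutes_id finite_permutations)
    finally show ?thesis by (simp add: trace_def scaleR_sum_right)
  qed
  ultimately show ?thesis unfolding has_vector_derivative_def det_def by simp
qed

lemma lie_algebra_SL: "lie_algebra SL = {X :: complex^'n^'n. trace X = 0}"
proof (intro equalityI subsetI CollectI)
  fix X :: "complex^'n^'n" assume "X \<in> lie_algebra SL"
  then obtain \<gamma> where g: "\<And>t. \<gamma> t \<in> SL" "\<gamma> 0 = mat 1" "(\<gamma> has_vector_derivative X) (at 0)"
    by (auto simp: lie_algebra_def)
  have "((\<lambda>t. det (\<gamma> t)) has_vector_derivative trace X) (at 0)" by (rule det_has_vector_derivative[OF g(3,2)])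
  moreover have "(\<lambda>t. det (\<gamma> t)) = (\<lambda>t. 1)" using g(1) by (auto simp: SL_def)
  ultimately show "trace X = 0" using vector_derivative_unique_at[OF _ has_vector_derivative_const] by metis
next
  fix X :: "complex^'n^'n" assume "X \<in> {X. trace X = 0}"
  then have tX: "trace X = 0" by simp
  let ?N = "CARD('n)"
  define d where "d t = det (mat 1 + t *\<^sub>R X)" for t
  \<comment> \<open>An n-th root of the inverse determinant of 1 + t X. Its derivative at 0 vanishes
    with the trace of \<open>X\<close>, so the normalization does not change the tangent
    vector.\<close>
  define c where "c t = exp (- Ln (d t) / of_nat ?N)" for t
  have dd: "(d has_vector_derivative 0) (at 0)"
    using det_has_vector_derivative[OF has_vector_derivative_line[of "mat 1" X]] tX by (simp add: d_def[abs_def])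
  have d0: "d 0 = 1" by (simp add: d_def)
  have N: "of_nat ?N \<noteq> (0 :: complex)" using zero_less_card_finite[where 'a='n] by simp
  have "((\<lambda>z. exp (- Ln z / of_nat ?N)) has_field_derivative exp (- Ln 1 / of_nat ?N) * (- inverse 1 / of_nat ?N)) (at 1)"
    by (auto intro!: derivative_eq_intros simp: N)
  then have "((\<lambda>z. exp (- Ln z / of_nat ?N)) \<circ> d has_vector_derivative 0 * (exp (- Ln 1 / of_nat ?N) * (- inverse 1 / of_nat ?N))) (at 0)"
    by (intro field_vector_diff_chain_at dd) (simp add: d0)
  then have dc: "(c has_vector_derivative 0) (at 0)" by (simp add: c_def[abs_def] o_def)
  have c0: "c 0 = 1" by (simp add: c_def d0)
  have bb: "bounded_bilinear (cscale :: complex \<Rightarrow> complex^'n^'n \<Rightarrow> complex^'n^'n)"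
  proof
    show "\<exists>K. \<forall>a (b :: complex^'n^'n). norm (cscale a b) \<le> norm a * norm b * K"
    proof (intro exI allI)
      fix a and b :: "complex^'n^'n"
      have "norm (cscale a b $ i) = norm a * norm (b $ i)" for i
        by (simp add: cscale_def norm_vec_def norm_mult L2_set_right_distrib)
      then have "norm (cscale a b) = norm a * norm b"
        by (simp add: norm_vec_def[of "cscale a b"] norm_vec_def[of b] L2_set_right_distrib)
      then show "norm (cscale a b) \<le> norm a * norm b * 1" by simp
    qed
  qed (simp_all add: cscale_def vec_eq_iff algebra_simps)
  have "((\<lambda>t. cscale (c t) (mat 1 + t *\<^sub>R X)) has_vector_derivative (cscale (c 0) X + cscale 0 (mat 1 + 0 *\<^sub>R X))) (at 0)"
    by (rule bounded_bilinear.has_vector_derivative[OF bb dc has_vector_derivative_line])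
  then have der: "((\<lambda>t. cscale (c t) (mat 1 + t *\<^sub>R X)) has_vector_derivative X) (at 0)" by (simp add: c0)
  obtain e where e: "e > 0" "\<forall>t. \<bar>t\<bar> < e \<longrightarrow> invertible (mat 1 + t *\<^sub>R X)" using invertible_near_one by blast
  show "X \<in> lie_algebra SL"
  proof (rule lie_algebraI[OF _ e(1) _ _ der])
    fix t :: real assume "\<bar>t\<bar> < e"
    then have "d t \<noteq> 0" using e(2) by (simp add: d_def invertible_det_nz)
    have "c t ^ ?N = exp (of_nat ?N * (- Ln (d t) / of_nat ?N))" unfolding c_def exp_of_nat_mult ..
    also have "\<dots> = inverse (d t)" using N \<open>d t \<noteq> 0\<close> by (simp add: exp_minus)
    finally show "cscale (c t) (mat 1 + t *\<^sub>R X) \<in> SL" using \<open>d t \<noteq> 0\<close>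
      by (simp add: SL_def det_cscale d_def)
  qed (simp_all add: SL_def c0)
qed

section \<open>The Lie algebra of an isometry group\<close>

context form
begin

lemma so_of_curve:
  assumes g: "\<And>t. \<gamma> t \<in> Iso M" "\<gamma> 0 = mat 1" "(\<gamma> has_vector_derivative X) (at (0 :: real))"
  shows "X \<in> so M"
proof -
  note mm = bounded_bilinear.has_vector_derivative[OF bounded_bilinear_matrix_mult]
  have bl: "bounded_linear (transpose :: complex^'n^'n \<Rightarrow> complex^'n^'n)"
  proof (rule bounded_linear_intro[where K=1])
    fix A :: "complex^'n^'n"
    have "norm A ^ 2 = (\<Sum>i\<in>UNIV. \<Sum>j\<in>UNIV. norm (A $ i $ j) ^ 2)" for A :: "complex^'n^'n"
      by (simp add: norm_vec_def L2_set_def sum_nonneg)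
    from this[of A] this[of "transpose A"] have "norm (transpose A) ^ 2 = norm A ^ 2"
      by (simp add: transpose_def) (rule sum.swap)
    then show "norm (transpose A) \<le> norm A * 1" by (simp add: power2_eq_iff_nonneg)
  qed (simp_all add: transpose_def vec_eq_iff)
  have d: "((\<lambda>t. transpose (\<gamma> t) ** M ** \<gamma> t) has_vector_derivative
    (transpose (\<gamma> 0) ** M ** X + (transpose (\<gamma> 0) ** 0 + transpose X ** M) ** \<gamma> 0)) (at 0)"
    by (intro mm g(3) has_vector_derivative_const bounded_linear.has_vector_derivative[OF bl])
  have e: "(\<lambda>t. transpose (\<gamma> t) ** M ** \<gamma> t) = (\<lambda>t. M)" using g(1) by (auto simp: Iso_iff)
  have "transpose (\<gamma> 0) ** M ** X + (transpose (\<gamma> 0) ** 0 + transpose X ** M) ** \<gamma> 0 = 0"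
    by (rule vector_derivative_unique_at[OF d[unfolded e] has_vector_derivative_const])
  then have "M ** X + transpose X ** M = 0"
    unfolding g(2) transpose_mat matrix_mul_lid matrix_mul_rid times0_right add_0 .
  then show ?thesis unfolding so_iff by (subst add.commute)
qed

lemma det_adj: "det (adj T) = det T"
proof -
  have "det (matrix_inv M) * det M = 1" using matrix_inv_mult(2)[OF inv] by (metis det_I det_mul)
  then have "det T * (det (matrix_inv M) * det M) = det T" by simp
  then show ?thesis by (simp add: adj_def det_mul algebra_simps)
qed

text \<open>The curve is the Cayley transform (1 + Y) (1 - Y)^(-1) of Y = t X / 2. It is isometric
  because \<open>Y\<close> is skew, and has determinant 1 because 1 + Y is the adjoint of 1 - Y. A
  bound on the inverse gives a quadratic error term and hence the derivative.\<close>

lemma curve_of_so: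
  assumes X: "X \<in> so M"
  shows "X \<in> lie_algebra (Iso M \<inter> {g. det g = 1})"
proof -
  obtain K where K: "K > 0" "\<And>(A :: complex^'n^'n) (C :: complex^'n^'n). norm (A ** C) \<le> norm A * norm C * K"
    using bounded_bilinear.pos_bounded[OF bounded_bilinear_matrix_mult] by blast
  define Y where "Y t = (t / 2) *\<^sub>R X" for t
  have Yso: "B (Y t *v x) y = - B x (Y t *v y)" for t x y
    using soD[OF so_cscale[OF X]] by (simp add: Y_def scaleR_eq_cscale)
  obtain d where d: "d > 0" "\<forall>t. \<bar>t\<bar> < d \<longrightarrow> invertible (mat 1 + t *\<^sub>R X)" using invertible_near_one by blast
  \<comment> \<open>The second bound gives |t| K |X| \<le> 1; together with R = 1 + Y R this bounds
    the norm of \<open>R t\<close> by twice the norm of the identity.\<close>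
  define e where "e = min d (1 / (K * norm X + 1))"
  have KX: "K * norm X + 1 > 0" using K(1) by (simp add: add_nonneg_pos)
  have e0: "e > 0" using d(1) KX by (simp add: e_def)
  define R where "R t = matrix_inv (mat 1 - Y t)" for t
  define \<gamma> where "\<gamma> t = (mat 1 + Y t) ** R t" for t
  have i: "invertible (mat 1 - Y t)" if "\<bar>t\<bar> < e" for t
  proof -
    have "\<bar>- t / 2\<bar> < d" using that d(1) by (simp add: e_def)
    then have "invertible (mat 1 + (- t / 2) *\<^sub>R X)" using d(2) by blast
    then show ?thesis by (simp add: Y_def)
  qed
  have gR: "\<gamma> t ** (mat 1 - Y t) = mat 1 + Y t" if "\<bar>t\<bar> < e" for t
    unfolding \<gamma>_def R_def by (rule matrix_inv_conj(4)[OF i[OF that]])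
  have gI: "\<gamma> t \<in> Iso M" if t: "\<bar>t\<bar> < e" for t
    unfolding Iso_def
  proof (intro CollectI allI)
    fix x y
    have s: "z = (mat 1 - Y t) *v (R t *v z)" for z unfolding R_def using matrix_inv_mult(3)[OF i[OF t]] by simp
    have g: "\<gamma> t *v z = (mat 1 + Y t) *v (R t *v z)" for z by (simp add: \<gamma>_def matrix_vector_mul_assoc)
    have "B (\<gamma> t *v x) (\<gamma> t *v y) = B ((mat 1 - Y t) *v (R t *v x)) ((mat 1 - Y t) *v (R t *v y))"
      unfolding g by (simp add: matrix_vector_mult_add_rdistrib matrix_vector_mult_diff_rdistrib bil_simps Yso)
    then show "B (\<gamma> t *v x) (\<gamma> t *v y) = B x y" using s by simp
  qed
  have gd: "det (\<gamma> t) = 1" if t: "\<bar>t\<bar> < e" for t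
  proof -
    have "adj (mat 1 - Y t) = mat 1 + Y t"
    proof (rule matrix_eqI, rule B_eqI)
      fix y x
      show "B x (adj (mat 1 - Y t) *v y) = B x ((mat 1 + Y t) *v y)"
        unfolding adj[symmetric]
        by (simp add: matrix_vector_mult_add_rdistrib matrix_vector_mult_diff_rdistrib bil_simps Yso)
    qed
    then have "det (\<gamma> t) * det (mat 1 - Y t) = det (mat 1 - Y t)"
      using gR[OF t] det_adj[of "mat 1 - Y t"] by (metis det_mul)
    then show ?thesis using i[OF t] by (simp add: invertible_det_nz)
  qed
  have R: "R t = mat 1 + Y t ** R t" if t: "\<bar>t\<bar> < e" for t
  proof -
    have "(mat 1 - Y t) ** R t = mat 1" unfolding R_def by (rule matrix_inv_mult(1)[OF i[OF t]])
    then show ?thesis by (simp add: matrix_diff_distrib algebra_simps)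
  qed
  have Rb: "norm (R t) \<le> 2 * norm (mat 1 :: complex^'n^'n)" if t: "\<bar>t\<bar> < e" for t
  proof -
    have "\<bar>t\<bar> * (K * norm X + 1) \<le> 1" using t KX by (simp add: e_def pos_le_divide_eq less_imp_le field_simps)
    then have tk: "\<bar>t\<bar> * (K * norm X) \<le> 1" by (simp add: algebra_simps)
    have "norm (R t) \<le> norm (mat 1 :: complex^'n^'n) + norm (Y t ** R t)"
      using norm_triangle_ineq[of "mat 1" "Y t ** R t"] R[OF t] by simp
    also have "norm (Y t ** R t) \<le> \<bar>t\<bar> / 2 * norm X * norm (R t) * K" using K(2)[of "Y t" "R t"] by (simp add: Y_def)
    also have "\<dots> = (\<bar>t\<bar> * (K * norm X)) * (norm (R t) / 2)" by (simp add: algebra_simps)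
    also have "\<dots> \<le> 1 * (norm (R t) / 2)" by (rule mult_right_mono[OF tk]) simp
    finally show ?thesis by simp
  qed
  define C where "C = norm (X ** X) * (2 * norm (mat 1 :: complex^'n^'n)) * K"
  have quad: "norm (\<gamma> t - mat 1 - t *\<^sub>R X) \<le> t ^ 2 * C" if t: "\<bar>t\<bar> < e" for t
  proof -
    have "\<gamma> t = R t + Y t ** R t" by (simp add: \<gamma>_def matrix_add_rdistrib)
    also have "\<dots> = mat 1 + (Y t + Y t) ** R t" by (subst R[OF t]) (simp only: matrix_add_rdistrib add.assoc)
    also have "Y t + Y t = t *\<^sub>R X" by (simp add: Y_def flip: scaleR_add_left)
    also have "t *\<^sub>R X ** R t = t *\<^sub>R X + t *\<^sub>R (X ** (Y t ** R t))"
      by (subst R[OF t]) (simp add: matrix_add_ldistrib scaleR_matrix_mult scaleR_add_right)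
    also have "t *\<^sub>R (X ** (Y t ** R t)) = (t * (t / 2)) *\<^sub>R (X ** X ** R t)"
      by (simp add: Y_def scaleR_matrix_mult matrix_mul_assoc)
    finally have "norm (\<gamma> t - mat 1 - t *\<^sub>R X) = t ^ 2 / 2 * norm (X ** X ** R t)" by (simp add: power2_eq_square)
    also have "\<dots> \<le> t ^ 2 / 2 * (norm (X ** X) * norm (R t) * K)" by (intro mult_left_mono K(2)) simp
    also have "\<dots> \<le> t ^ 2 / 2 * C" unfolding C_def using Rb[OF t] K(1) by (intro mult_left_mono mult_right_mono) auto
    also have "\<dots> \<le> t ^ 2 * C" using K(1) by (intro mult_right_mono) (auto simp: C_def)
    finally show ?thesis .
  qed
  have g0: "\<gamma> 0 = mat 1"
    using R[OF abs_zero[THEN eq_refl, THEN order_le_less_trans, OF e0]] by (simp add: \<gamma>_def Y_def)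
  have "(\<gamma> has_derivative (\<lambda>t. t *\<^sub>R X)) (at 0)"
  proof (rule has_derivativeI_sandwich[OF e0])
    show "bounded_linear (\<lambda>t. t *\<^sub>R X)" by (rule bounded_linear_scaleR_left)
    show "norm (\<gamma> t - \<gamma> 0 - (t - 0) *\<^sub>R X) / norm (t - 0) \<le> \<bar>t\<bar> * C" if "t \<noteq> 0" "dist t 0 < e" for t
    proof -
      have "norm (\<gamma> t - \<gamma> 0 - (t - 0) *\<^sub>R X) \<le> t ^ 2 * C" using quad[of t] that(2) by (simp add: g0)
      also have "t ^ 2 = \<bar>t\<bar> * \<bar>t\<bar>" by (simp add: power2_eq_square)
      finally show ?thesis using that(1) by (simp add: divide_le_eq algebra_simps)
    qed
    have "((\<lambda>t. \<bar>t\<bar> * C) \<longlongrightarrow> \<bar>0\<bar> * C) (at 0)" by (intro tendsto_intros)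
    then show "((\<lambda>t. \<bar>t\<bar> * C) \<longlongrightarrow> 0) (at 0)" by simp
  qed
  then have "(\<gamma> has_vector_derivative X) (at 0)" by (simp add: has_vector_derivative_def)
  moreover have "mat 1 \<in> Iso M \<inter> {g. det g = 1}" by (simp add: Iso_def)
  ultimately show ?thesis using gI gd g0 by (intro lie_algebraI[OF _ e0, where \<gamma>=\<gamma>]) auto
qed

lemma lie_algebra_Iso:
  assumes "Iso M \<inter> {g. det g = 1} \<subseteq> G" "G \<subseteq> Iso M"
  shows "lie_algebra G = so M"
proof
  show "lie_algebra G \<subseteq> so M" using so_of_curve assms(2) by (auto simp: lie_algebra_def)
  show "so M \<subseteq> lie_algebra G" using curve_of_so assms(1) by (fastforce simp: lie_algebra_def)
qed

end

section \<open>Orbits of the classical groups\<close>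

lemma type_A_orbit_determined:
  fixes G h b b' :: "(complex^'n^'n) set"
  assumes G: "G = GL \<or> G = SL" and op: "opposite_borels (lie_algebra G) h b b'"
    and O: "nilpotent_coadjoint_orbit G Orb" "nilpotent_coadjoint_orbit G Orb'"
    and eq: "closure Orb \<inter> Psi (lie_algebra G) b b' = closure Orb' \<inter> Psi (lie_algebra G) b b'"
  shows "Orb = Orb'"
proof -
  define q where "q = lie_algebra G"
  have q: "q = UNIV \<or> q = {X. trace X = 0}" using G lie_algebra_GL lie_algebra_SL by (auto simp: q_def)
  \<comment> \<open>Removing a scalar matrix makes the trace zero and is invisible when paired with
    trace-free matrices.\<close>
  define P :: "complex^'n^'n \<Rightarrow> complex^'n^'n"
    where "P E = (if q = UNIV then E else E - cscale (trace E / of_nat CARD('n)) (mat 1))" for E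
  have N: "of_nat CARD('n) \<noteq> (0 :: complex)" using zero_less_card_finite[where 'a='n] by simp
  have t1: "trace (mat 1 :: complex^'n^'n) = of_nat CARD('n)" by (simp add: trace_def mat_def)
  have inv: "invertible g" if "g \<in> G" for g using G that by (auto simp: GL_def SL_def invertible_det_nz)
  have tc: "trace (Ad g X) = trace X" if "g \<in> G" for g X :: "complex^'n^'n"
    by (subst trace_mul_sym) (simp add: matrix_mul_assoc matrix_inv_mult(2)[OF inv[OF that]])
  have di: "det (matrix_inv g) = inverse (det g)" if "g \<in> G" for g :: "complex^'n^'n"
    using matrix_inv_mult(2)[OF inv[OF that]] inv[OF that] by (metis det_I det_mul inverse_unique mult.commute)
  interpret matrix_group G q P
  proof
    show "invertible g" if "g \<in> G" for g by (rule inv[OF that])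
    show "g ** k \<in> G" if "g \<in> G" "k \<in> G" for g k
      using G that by (auto simp: GL_def SL_def det_mul invertible_mult)
    show "matrix_inv g \<in> G" if "g \<in> G" for g
      using G that di[OF that] invertible_matrix_inv by (auto simp: GL_def SL_def)
    show "Ad g X \<in> q" if "X \<in> q" "g \<in> G" for X g using q tc that by auto
    show "P E \<in> q" for E using q N by (auto simp: P_def trace_sub trace_cscale t1)
    show "trace (Y ** P E) = trace (Y ** E)" if "Y \<in> q" for Y E
      using q that by (auto simp: P_def matrix_diff_distrib trace_sub trace_cscale)
  qed
  have SL: "T \<in> G" if "det T = 1" for T using G that by (auto simp: GL_def SL_def invertible_det_nz)
  obtain \<phi> where \<phi>: "nilpotent_functional q \<phi>" "Orb = (\<lambda>g. coadjoint q g \<phi>) ` G"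
    using O(1) by (auto simp: nilpotent_coadjoint_orbit_def q_def)
  obtain \<phi>' where \<phi>': "nilpotent_functional q \<phi>'" "Orb' = (\<lambda>g. coadjoint q g \<phi>') ` G"
    using O(2) by (auto simp: nilpotent_coadjoint_orbit_def q_def)
  show ?thesis
  proof (rule orbit_determined[OF \<phi>(2)[symmetric] \<phi>(1) \<phi>'(2)[symmetric] \<phi>'(1) eq[folded q_def]])
    fix X k assume X: "X \<in> q" "nilpotent_matrix X"
    obtain T where T: "det T = 1" "trace_dual q (Ad T X) \<in> Psi q b b'"
      using ex_conj_in_Psi[OF q op[folded q_def] X(2)] by blast
    have iT: "invertible T" by (rule inv[OF SL[OF T(1)]])
    have "Ad T X \<in> orb G X" using SL[OF T(1)] by (auto simp: orb_def)
    moreover have "rk (mpow X k) UNIV = rk (mpow (Ad T X) k) UNIV"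
      by (rule rank_conj[OF iT]) (simp only: matrix_inv_conj(4)[OF iT])
    ultimately show "\<exists>Z\<in>q. trace_dual q Z \<in> Psi q b b' \<and> Z \<in> closure (orb G X) \<and>
        rk (mpow X k) UNIV \<le> rk (mpow Z k) UNIV"
      using T(2) conj[OF X(1) SL[OF T(1)]] closure_subset by (intro bexI[of _ "Ad T X"]) auto
  next
    fix X and X' :: "complex^'n^'n" assume "X \<in> q" and X: "nilpotent_matrix X" "nilpotent_matrix X'"
      and r: "\<And>k. rk (mpow X k) UNIV = rk (mpow X' k) UNIV"
    obtain T where T: "invertible T" "T ** X = X' ** T" using conj_of_same_ranks[OF X r] by blast
    \<comment> \<open>Rescaling an intertwiner by an n-th root makes its determinant 1, so conjugacy
      under the general linear group already implies it under the special one.\<close>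
    obtain z where z: "z ^ CARD('n) = inverse (det T)"
      using exists_complex_root[of "CARD('n)" "inverse (det T)"] by (metis zero_less_card_finite less_irrefl)
    have "det (cscale z T) = 1" using T(1) by (simp add: det_cscale z invertible_det_nz)
    moreover have "cscale z T ** X = X' ** cscale z T"
      unfolding cscale_matrix_mult_left cscale_matrix_mult_right T(2) ..
    ultimately show "\<exists>g\<in>G. g ** X = X' ** g" using SL by blast
  qed
qed

lemma minus_mult_vec: "(- A) *v x = - (A *v x)" for A :: "complex^'n^'n"
  by (simp add: matrix_vector_mult_def vec_eq_iff sum_negf)

section \<open>Orbits of isometry groups\<close>

context form
begin

lemma nd_stable_UNIV: "nd UNIV" "stable X UNIV" "vec.dim (UNIV :: (complex^'n) set) = CARD('n)"
  using nd_UNIV vec_dim_card[where 'a=complex and 'n='n] by (auto simp: stable_def)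

lemma adj_simps: "adj (A ** C) = adj C ** adj A" "adj (adj A) = A" "adj (A - C) = adj A - adj C"
proof -
  have a: "B x (adj T *v y) = B (T *v x) y" for T x y by (simp add: adj)
  show "adj (A ** C) = adj C ** adj A"
    by (rule matrix_eqI, rule B_eqI) (simp add: a matrix_vector_mul_assoc[symmetric])
  show "adj (adj A) = A"
  proof (rule matrix_eqI, rule B_eqI)
    fix y x
    have "B x (adj (adj A) *v y) = \<epsilon> * B y (adj A *v x)" by (subst B_sym) (simp add: a B_sym[of "adj A *v x" y])
    then show "B x (adj (adj A) *v y) = B x (A *v y)" unfolding a by (subst B_sym[of x]) simp
  qed
  show "adj (A - C) = adj A - adj C"
    by (rule matrix_eqI, rule B_eqI) (simp add: a matrix_vector_mult_diff_rdistrib bil_simps)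
qed

lemma so_iff_adj: "X \<in> so M \<longleftrightarrow> adj X = - X"
proof
  assume "X \<in> so M"
  then show "adj X = - X"
    by (intro matrix_eqI B_eqI) (simp add: adj[symmetric] soD bil_simps minus_mult_vec)
next
  assume "adj X = - X"
  then show "X \<in> so M" unfolding so_def adj by (simp add: bil_simps minus_mult_vec)
qed

lemma trace_adj: "trace (adj A) = trace A"
proof -
  have "trace (adj A) = trace (transpose A ** M ** matrix_inv M)"
    unfolding adj_def by (subst trace_mul_sym) simp
  also have "transpose A ** M ** matrix_inv M = transpose A" by (rule matrix_inv_conj(3)[OF inv])
  finally show ?thesis by (simp add: trace_def transpose_def)
qed

text \<open>The projection takes the skew part. The self-adjoint part of a matrix is orthogonal to
  the skew matrices, since the trace is invariant under the adjoint.\<close>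

lemma matrix_group_form:
  assumes G: "G = Iso M \<or> G = Iso M \<inter> {g. det g = 1}"
  shows "matrix_group G (so M) (\<lambda>E. cscale (1 / 2) (E - adj E))"
proof
  show "invertible g" if "g \<in> G" for g using G that invertible_Iso by blast
  show "g ** k \<in> G" if "g \<in> G" "k \<in> G" for g k using G that Iso_mult by (auto simp: det_mul)
  show "matrix_inv g \<in> G" if g: "g \<in> G" for g
  proof -
    have i: "g \<in> Iso M" using G g by blast
    have "det (matrix_inv g) * det g = 1" using matrix_inv_mult(2)[OF invertible_Iso[OF i]] by (metis det_I det_mul)
    then show ?thesis using G g Iso_inv[OF i] by auto
  qed
  show "Ad g X \<in> so M" if "X \<in> so M" "g \<in> G" for X g using so_conj that G by blast
  show "cscale (1 / 2) (E - adj E) \<in> so M" for E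
    by (rule so_cscale) (simp add: so_iff_adj adj_simps)
  show "trace (Y ** cscale (1 / 2) (E - adj E)) = trace (Y ** E)" if Y: "Y \<in> so M" for Y E
  proof -
    have "trace (Y ** adj E) = trace (adj (Y ** adj E))" by (simp add: trace_adj)
    also have "\<dots> = trace (E ** (- Y))" using Y by (simp add: adj_simps so_iff_adj)
    also have "E ** (- Y) = - (E ** Y)" by (simp add: matrix_matrix_mult_def vec_eq_iff sum_negf)
    also have "trace (- (E ** Y)) = - trace (E ** Y)" by (simp add: trace_def sum_negf)
    also have "trace (E ** Y) = trace (Y ** E)" by (rule trace_mul_sym)
    finally show ?thesis by (simp add: matrix_diff_distrib trace_cscale trace_sub)
  qed
qed

text \<open>The elements of the orbit of \<open>Y\<close> converging to \<open>Z\<close> are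
  conjugate to \<open>Z\<close> by equality of ranks. By \<open>iso_conj_near\<close> one of them is
  conjugate to it by an isometry of determinant 1, and this is carried back to \<open>Y\<close>
  inside the group.\<close>

lemma ex_conj_of_closure:
  assumes G: "G = Iso M \<inter> {g. det g = 1}" and Y: "Y \<in> so M" "nilpotent_matrix Y"
    and Z: "Z \<in> so M" "nilpotent_matrix Z" "Z \<in> closure (orb G Y)"
    and r: "\<And>k. rk (mpow Z k) UNIV = rk (mpow Y k) UNIV"
  shows "\<exists>g\<in>G. g ** Z = Y ** g"
proof -
  interpret matrix_group G "so M" "\<lambda>E. cscale (1 / 2) (E - adj E)" by (rule matrix_group_form) (simp add: G)
  obtain Zm where Zm: "\<forall>m. Zm m \<in> orb G Y" "Zm \<longlonglongrightarrow> Z" using Z(3) unfolding closure_sequential by blast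
  have "\<forall>m. \<exists>h. h \<in> G \<and> Zm m = Ad h Y" using Zm(1) by (auto simp: orb_def)
  then obtain h where h: "\<forall>m. h m \<in> G \<and> Zm m = Ad (h m) Y" by (rule choice[THEN exE])
  have hY: "Zm m ** h m = h m ** Y" for m
    using h matrix_inv_conj(4)[OF inv] by metis
  obtain T0 where T0: "invertible T0" "T0 ** Z = Y ** T0" using conj_of_same_ranks[OF Z(2) Y(2) r] by blast
  have "\<exists>T. invertible T \<and> T ** Z = Zm m ** T" for m
  proof (intro exI conjI)
    show "invertible (h m ** T0)" using h inv T0(1) by (intro invertible_mult) auto
    have "h m ** T0 ** Z = h m ** Y ** T0" by (simp add: T0(2) matrix_mul_assoc[symmetric])
    then show "(h m ** T0) ** Z = Zm m ** (h m ** T0)" by (simp add: hY matrix_mul_assoc)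
  qed
  moreover have "Zm m \<in> so M" for m using Zm(1) orb_subset[OF Y(1)] by blast
  ultimately obtain m g where g: "g \<in> Iso M" "det g = 1" "g ** Z = Zm m ** g"
    using iso_conj_near[OF Z(1) _ Zm(2)] by blast
  have hi: "matrix_inv (h m) \<in> G" using h inverse by blast
  have ih: "invertible (h m)" using h inv by blast
  have "(matrix_inv (h m) ** g) ** Z = matrix_inv (h m) ** (Zm m ** g)" by (simp add: g(3) matrix_mul_assoc[symmetric])
  also have "Zm m = h m ** (Y ** matrix_inv (h m))" using h by (simp add: matrix_mul_assoc)
  also have "matrix_inv (h m) ** (h m ** (Y ** matrix_inv (h m)) ** g) = Y ** (matrix_inv (h m) ** g)"
    using matrix_inv_conj(2)[OF ih] by (simp add: matrix_mul_assoc[symmetric])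
  finally have "(matrix_inv (h m) ** g) ** Z = Y ** (matrix_inv (h m) ** g)" .
  moreover have "matrix_inv (h m) ** g \<in> G" using mult[OF hi, of g] g by (simp add: G)
  ultimately show ?thesis by blast
qed

lemma special_conj:
  assumes e1: "\<epsilon> = 1" and G: "G = Iso M \<inter> {g. det g = 1}" and op: "opposite_borels (so M) h b b'"
    and X: "X \<in> so M" "nilpotent_matrix X" and X': "X' \<in> so M" "nilpotent_matrix X'"
    and r: "\<And>k. rk (mpow X k) UNIV = rk (mpow X' k) UNIV"
    and cl: "\<And>Z. Z \<in> so M \<Longrightarrow> trace_dual (so M) Z \<in> Psi (so M) b b' \<Longrightarrow> Z \<in> closure (orb G X) \<Longrightarrow> Z \<in> closure (orb G X')"
  shows "\<exists>g\<in>G. g ** X = X' ** g"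
proof -
  interpret matrix_group G "so M" "\<lambda>E. cscale (1 / 2) (E - adj E)" by (rule matrix_group_form) (simp add: G)
  obtain T where "invertible T" "T ** X = X' ** T" using conj_of_same_ranks[OF X(2) X'(2) r] by blast
  then obtain s where s: "s \<in> Iso M" "s ** X = X' ** s" using iso_conj[OF X(1) X'(1)] by blast
  show ?thesis
  proof (cases "\<exists>v c. single_block X v c")
    case True
    then obtain z where z: "z \<in> Iso M" "det z = - 1" "z ** X = X ** z" using ex_centralizer_det[OF X(1) e1] by blast
    have "(s ** z) ** X = s ** X ** z" by (simp add: z(3) matrix_mul_assoc[symmetric])
    then have "(s ** z) ** X = X' ** (s ** z)" by (simp add: s(2) matrix_mul_assoc)
    moreover have "s ** z \<in> Iso M" "det (s ** z) = - det s" using Iso_mult[OF s(1) z(1)] z(2) by (auto simp: det_mul)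
    ultimately show ?thesis using det_Iso[OF s(1)] s unfolding G by (metis (mono_tags, lifting) Int_iff mem_Collect_eq minus_minus)
  next
    case False
    obtain n0 where n0: "mpow X n0 = 0" using X(2) by (auto simp: nilpotent_matrix_iff)
    obtain f where "good_frame X UNIV False UNIV CARD('n) f"
      using ex_good_frame_all[OF X(1) n0 _ nd_stable_UNIV(1,2)] False unfolding nd_stable_UNIV(3) by blast
    from ex_Psi_limit[OF op X this] obtain Z hs where Z: "Z \<in> so M" "trace_dual (so M) Z \<in> Psi (so M) b b'"
      "\<forall>m. hs m \<in> Iso M \<and> (\<epsilon> = 1 \<longrightarrow> det (hs m) = 1)" "(\<lambda>m. Ad (hs m) X) \<longlonglongrightarrow> Z"
      "\<forall>k\<in>UNIV. rk (mpow X k) UNIV \<le> rk (mpow Z k) UNIV"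
      by (elim exE conjE)
    have "\<forall>m. Ad (hs m) X \<in> orb G X" using Z(3) e1 by (auto simp: orb_def G)
    then have ZX: "Z \<in> closure (orb G X)" unfolding closure_sequential
      using Z(4) by (intro exI[of _ "\<lambda>m. Ad (hs m) X"]) simp
    have ZX': "Z \<in> closure (orb G X')" by (rule cl[OF Z(1,2) ZX])
    have rZ: "rk (mpow Z k) UNIV = rk (mpow X k) UNIV" for k
      using rank_closure_orb[OF ZX] Z(5) by (simp add: antisym)
    have "mpow Z n0 = 0"
    proof -
      have "rk (mpow Z n0) UNIV = 0" unfolding rZ n0 by (simp only: vec.dim_eq_0) auto
      then have "range ((*v) (mpow Z n0)) \<subseteq> {0}" by (simp only: vec.dim_eq_0)
      then show ?thesis by (intro matrix_eqI) auto
    qed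
    then have nZ: "nilpotent_matrix Z" by (auto simp: nilpotent_matrix_iff)
    obtain g where g: "g \<in> G" "g ** Z = X ** g" using ex_conj_of_closure[OF G X Z(1) nZ ZX rZ] by blast
    obtain g' where g': "g' \<in> G" "g' ** Z = X' ** g'" using ex_conj_of_closure[OF G X' Z(1) nZ ZX'] rZ r by auto
    have ig: "invertible g" by (rule inv[OF g(1)])
    have "matrix_inv g ** X = Z ** matrix_inv g"
    proof -
      have "Z ** matrix_inv g = matrix_inv g ** (g ** Z) ** matrix_inv g" by (simp only: matrix_inv_conj(2)[OF ig])
      also have "\<dots> = matrix_inv g ** X ** g ** matrix_inv g" unfolding g(2) by (simp only: matrix_mul_assoc)
      finally show ?thesis by (simp only: matrix_inv_conj(3)[OF ig])
    qed
    then have "(g' ** matrix_inv g) ** X = g' ** Z ** matrix_inv g" by (simp add: matrix_mul_assoc[symmetric])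
    then have "(g' ** matrix_inv g) ** X = X' ** (g' ** matrix_inv g)" by (simp add: g'(2) matrix_mul_assoc)
    then show ?thesis using mult[OF g'(1) inverse[OF g(1)]] by blast
  qed
qed

lemma form_orbit_determined:
  assumes G: "G = Iso M \<or> \<epsilon> = 1 \<and> G = Iso M \<inter> {g. det g = 1}" and op: "opposite_borels (lie_algebra G) h b b'"
    and O: "nilpotent_coadjoint_orbit G Orb" "nilpotent_coadjoint_orbit G Orb'"
    and eq: "closure Orb \<inter> Psi (lie_algebra G) b b' = closure Orb' \<inter> Psi (lie_algebra G) b b'"
  shows "Orb = Orb'"
proof -
  have q: "lie_algebra G = so M" by (rule lie_algebra_Iso) (use G in auto)
  interpret matrix_group G "so M" "\<lambda>E. cscale (1 / 2) (E - adj E)" by (rule matrix_group_form) (use G in auto)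
  obtain \<phi> where \<phi>: "nilpotent_functional (so M) \<phi>" "Orb = (\<lambda>g. coadjoint (so M) g \<phi>) ` G"
    using O(1) by (auto simp: nilpotent_coadjoint_orbit_def q)
  obtain \<phi>' where \<phi>': "nilpotent_functional (so M) \<phi>'" "Orb' = (\<lambda>g. coadjoint (so M) g \<phi>') ` G"
    using O(2) by (auto simp: nilpotent_coadjoint_orbit_def q)
  note op = op[unfolded q]
  show ?thesis
  proof (rule orbit_determined[OF \<phi>(2)[symmetric] \<phi>(1) \<phi>'(2)[symmetric] \<phi>'(1) eq[unfolded q]])
    fix X k assume X: "X \<in> so M" "nilpotent_matrix X"
    obtain n0 where n0: "mpow X n0 = 0" using X(2) by (auto simp: nilpotent_matrix_iff)
    obtain t f where "good_frame X {k} t UNIV CARD('n) f"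
      using ex_good_frame[OF X(1) n0 nd_stable_UNIV(1,2), of k] unfolding nd_stable_UNIV(3) by blast
    from ex_Psi_limit[OF op X this] obtain Z hs where Z: "Z \<in> so M" "trace_dual (so M) Z \<in> Psi (so M) b b'"
      "\<forall>m. hs m \<in> Iso M \<and> (\<epsilon> = 1 \<longrightarrow> det (hs m) = 1)" "(\<lambda>m. Ad (hs m) X) \<longlonglongrightarrow> Z"
      "\<forall>k\<in>{k}. rk (mpow X k) UNIV \<le> rk (mpow Z k) UNIV"
      by (elim exE conjE)
    have "\<forall>m. Ad (hs m) X \<in> orb G X" using Z(3) G by (auto simp: orb_def)
    then have "Z \<in> closure (orb G X)" unfolding closure_sequential
      using Z(4) by (intro exI[of _ "\<lambda>m. Ad (hs m) X"]) simp
    then show "\<exists>Z\<in>so M. trace_dual (so M) Z \<in> Psi (so M) b b' \<and> Z \<in> closure (orb G X) \<and>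
        rk (mpow X k) UNIV \<le> rk (mpow Z k) UNIV"
      using Z(1,2,5) by blast
  next
    fix X X' assume X: "X \<in> so M" "nilpotent_matrix X" and X': "X' \<in> so M" "nilpotent_matrix X'"
      and r: "\<And>k. rk (mpow X k) UNIV = rk (mpow X' k) UNIV"
      and cl: "\<And>Z. Z \<in> so M \<Longrightarrow> trace_dual (so M) Z \<in> Psi (so M) b b' \<Longrightarrow> Z \<in> closure (orb G X) \<Longrightarrow> Z \<in> closure (orb G X')"
    show "\<exists>g\<in>G. g ** X = X' ** g"
      using G
    proof (elim disjE conjE)
      assume "G = Iso M"
      then show ?thesis using conj_of_same_ranks[OF X(2) X'(2) r] iso_conj[OF X(1) X'(1)] by blast
    next
      assume e: "\<epsilon> = 1" "G = Iso M \<inter> {g. det g = 1}"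
      show ?thesis by (rule special_conj[OF e op X X' r cl])
    qed
  qed
qed

end

lemma OC_eq_Iso: "OC = Iso (mat 1 :: complex^'n^'n)"
  by (auto simp: OC_def Iso_iff orthogonal_matrix_def matrix_left_right_inverse)

lemma Sp_eq_Iso: "Sp J = Iso J"
  by (simp add: Sp_def Iso_iff set_eq_iff)

lemma form_symplectic: "symplectic_form J \<Longrightarrow> form J (- 1)"
  by unfold_locales (auto simp: symplectic_form_def cscale_def vec_eq_iff)

theorem theorem4:
  fixes G h b b' :: "(complex^'n^'n) set"
    and Orb Orb' :: "(complex^'n^'n \<Rightarrow> complex) set"
  assumes "classical_group G"
    and "opposite_borels (lie_algebra G) h b b'"
    and "nilpotent_coadjoint_orbit G Orb"
    and "nilpotent_coadjoint_orbit G Orb'"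
    and "closure Orb \<inter> Psi (lie_algebra G) b b' = closure Orb' \<inter> Psi (lie_algebra G) b b'"
  shows "Orb = Orb'"
proof -
  interpret form "mat 1 :: complex^'n^'n" 1 by (rule form_mat_1)
  consider "G = GL \<or> G = SL" | "G = OC \<or> G = SOC" | J where "symplectic_form J" "G = Sp J"
    using assms(1) by (auto simp: classical_group_def)
  then show ?thesis
  proof cases
    case 1
    then show ?thesis using type_A_orbit_determined assms(2-5) by blast
  next
    case 2
    moreover have "SOC = Iso (mat 1 :: complex^'n^'n) \<inter> {g. det g = 1}"
      unfolding OC_eq_Iso[symmetric] by (auto simp: SOC_def OC_def)
    ultimately have "G = Iso (mat 1) \<or> (1 :: complex) = 1 \<and> G = Iso (mat 1) \<inter> {g. det g = 1}"
      by (auto simp: OC_eq_Iso)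
    then show ?thesis by (rule form_orbit_determined) (rule assms(2-5))+
  next
    case 3
    interpret sp: form J "- 1" by (rule form_symplectic[OF 3(1)])
    show ?thesis by (rule sp.form_orbit_determined[OF _ assms(2-5)]) (simp add: 3(2) Sp_eq_Iso)
  qed
qed

end
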